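(* Let $X$ be a complete separable metric space, let $k>0$ be an integer, and let $T\in \mathbf M_k(X)\setminus\{0\}$ be a nonzero $k$-dimensional metric current in $X$ with mass measure $\|T\|$. Then there are (countably many) disjoint Borel sets $\{V_j\}_j$ in $X$ and functions $\pi^j:X\to\mathbb R^k$ that are $1$-Lipschitz with respect to the $l^\infty$-norm on $\mathbb R^k$ such that: (1) $\|T\|\bigl(X\setminus\bigcup_j V_j\bigr)=0$; (2) for every $\varepsilon>0$ and every $k$-dimensional cone field $\mathcal C$ on $X$, the measure $\|T\|$ admits a $(1,1+\varepsilon)$-biLipschitz Alberti representation $\mathcal A$ such that, for each $j$, the restriction $\mathcal A\llcorner V_j$ is in the $\pi^j$-direction of $\mathcal C$. In particular, the $L^\infty(\|T\|)$-module $\mathscr X(\|T\|)$ of Weaver derivations contains $k$ independent derivations.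
   Context: METRIC CURRENTS. $\mathrm{Lip}(X)$ is the set of real-valued Lipschitz functions on $X$, $\mathbf L(f)$ is the global Lipschitz constant of $f$, and $\mathrm{Lip}_b(X)$ is the set of bounded Lipschitz functions. $\mathscr D^k(X)=\mathrm{Lip}_b(X)\times \mathrm{Lip}(X)^k$. For $f_n,f\in\mathrm{Lip}(X)$ write $f_n\xrightarrow{w*}f$ if $f_n\to f$ pointwise and $\sup_n\mathbf L(f_n)<\infty$. A $k$-dimensional metric functional is a map $T:\mathscr D^k(X)\to\mathbb R$ which in each argument is subadditive ($|T(v_1+v_2)|\le|T(v_1)|+|T(v_2)|$) and positively $1$-homogeneous ($|T(\lambda v)|=\lambda|T(v)|$ for $\lambda\ge0$). It has finite mass if there is a finite Radon measure $\mu$ with $|T(f,\pi_1,\dots,\pi_k)|\le\prod_{i}\mathbf L(\pi_i)\int_X|f|\,d\mu$ for all $(f,\pi_1,\dots,\pi_k)$; the minimal such $\mu$ is the mass $\|T\|$. Such $T$ extends uniquely to bounded Borel first arguments $f$. A $k$-dimensional metric current is a metric functional of finite mass which is (1) multilinear; (2) alternating in $\pi_1,\dots,\pi_k$; (3) local: $T(f,\pi_1,\dots,\pi_k)=0$ if some $\pi_i$ is constant on $\{f\ne0\}$; (4) continuous: $T(f_n,\pi_{1,n},\dots,\pi_{k,n})\to T(f,\pi_1,\dots,\pi_k)$ whenever $f_n\xrightarrow{w*}f$ with $\sup_n\|f_n\|_\infty<\infty$, $\|f\|_\infty<\infty$, and $\pi_{i,n}\xrightarrow{w*}\pi_i$ for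 each $i$. $\mathbf M_k(X)$ is the set of $k$-dimensional metric currents. ALBERTI REPRESENTATIONS. A fragment in $X$ is a Lipschitz map $\gamma:K\to X$ with $K=\mathrm{dom}\,\gamma\subset\mathbb R$ nonempty compact; $\mathrm{Frag}(X)$ is the set of fragments, topologized by the Hausdorff distance between graphs. An Alberti representation of a Radon measure $\mu$ on $X$ is a pair $\mathcal A=(P,\nu)$ where: $P$ is a regular Borel probability measure on $\mathrm{Frag}(X)$; $\nu:\mathrm{Frag}(X)\to M(X)$ (finite Radon measures with the weak* topology) is Borel and $\nu_\gamma\ll\mathscr H^1_\gamma$, the $1$-dimensional Hausdorff measure on the image of $\gamma$; $\mu=\int_{\mathrm{Frag}(X)}\nu_\gamma\,dP(\gamma)$; and for each Borel $A\subset X$ and reals $a\le b$ the map $\gamma\mapsto\nu_\gamma(A\cap\gamma(\mathrm{dom}\,\gamma\cap[a,b]))$ is Borel. For Borel $U$, $\mathcal A\llcorner U=(P,\nu\llcorner U)$, an Alberti representation of $\mu\llcorner U$. $\mathcal A$ is $(C,D)$-biLipschitz if $P$-a.e. $\gamma$ satisfies $C|s-t|\le d(\gamma(s),\gamma(t))\le D|s-t|$ on $\mathrm{dom}\,\gamma$. For a unit vector $w\in\mathbb R^n$ and $\alpha\in(0,\pi/2)$ the open cone is $\mathcal C(w,\alpha)=\{u\in\mathbb R^n:\tan\alpha\,\langle w,u\rangle>\|\pi_w^\perp u\|_2\}$, $\pi_w^\perp$ being the orthogonal projection onto $w^\perp$. An $n$-dimensional cone field is a map $\mathcal C(x)=\mathcal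 C(w(x),\alpha(x))$ with $w:X\to\mathbb S^{n-1}$ and $\alpha:X\to(0,\pi/2)$ Borel. Given a Lipschitz map $f:X\to\mathbb R^n$, $\mathcal A=(P,\nu)$ is in the $f$-direction of $\mathcal C$ if for $P$-a.e. $\gamma$ and Lebesgue-a.e. $t\in\mathrm{dom}\,\gamma$ one has $(f\circ\gamma)'(t)\in\mathcal C(\gamma(t))$. For a restriction $\mathcal A\llcorner U$ this condition is required for $P$-a.e. $\gamma$ and Lebesgue-a.e. $t\in\mathrm{dom}\,\gamma$ with $\gamma(t)\in U$. DERIVATIONS. $\mathrm{Lip}_b(X)$ with norm $\max(\|f\|_\infty,\mathbf L(f))$ is a dual Banach space (with predual the closed linear span of the point evaluations); on bounded sets its weak* topology is that of pointwise convergence. For a Radon measure $\mu$, a (Weaver) derivation is a bounded linear map $D:\mathrm{Lip}_b(X)\to L^\infty(\mu)$ that is weak*-weak* continuous and satisfies $D(fg)=fDg+gDf$. The derivations form an $L^\infty(\mu)$-module $\mathscr X(\mu)$; "independent" means linearly independent over $L^\infty(\mu)$. *)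

theory Defs
  imports "HOL-Probability.Probability"
begin

section \<open>Lipschitz functions and Radon measures\<close>

definition Lip :: "('a::metric_space \<Rightarrow> real) set" where
  "Lip = {f. \<exists>L. L-lipschitz_on UNIV f}"

definition Lipb :: "('a::metric_space \<Rightarrow> real) set" where
  "Lipb = {f \<in> Lip. bounded (range f)}"

text \<open>Only meaningful for \<open>f \<in> Lip\<close>, where the infimum is attained.\<close>

definition lip_const :: "('a::metric_space \<Rightarrow> real) \<Rightarrow> real" where
  "lip_const f = Inf {L. L-lipschitz_on UNIV f}"

definition sup_norm :: "('a \<Rightarrow> real) \<Rightarrow> real" where
  "sup_norm f = (SUP x. \<bar>f x\<bar>)"

definition Lipb_norm :: "('a::metric_space \<Rightarrow> real) \<Rightarrow> real" where
  "Lipb_norm f = max (sup_norm f) (lip_const f)"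

definition wstar_conv :: "(nat \<Rightarrow> 'a::metric_space \<Rightarrow> real) \<Rightarrow> ('a \<Rightarrow> real) \<Rightarrow> bool" where
  "wstar_conv fs f \<longleftrightarrow> (\<forall>n. fs n \<in> Lip) \<and> f \<in> Lip \<and> (\<forall>x. (\<lambda>n. fs n x) \<longlonglongrightarrow> f x) \<and>
     bdd_above (range (\<lambda>n. lip_const (fs n)))"

definition finite_radon :: "'a::t2_space measure \<Rightarrow> bool" where
  "finite_radon \<mu> \<longleftrightarrow> sets \<mu> = sets borel \<and> finite_measure \<mu> \<and>
     (\<forall>A \<in> sets borel. emeasure \<mu> A = (SUP K \<in> {K. compact K \<and> K \<subseteq> A}. emeasure \<mu> K))"

definition regular_borel_prob :: "'a::t2_space measure \<Rightarrow> bool" where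
  "regular_borel_prob P \<longleftrightarrow> prob_space P \<and> finite_radon P \<and>
     (\<forall>A \<in> sets borel. emeasure P A = (INF U \<in> {U. open U \<and> A \<subseteq> U}. emeasure P U))"


section \<open>Metric currents\<close>

text \<open>
  The \<open>k\<close> functions \<open>\<pi>\<^sub>1, \<dots>, \<pi>\<^sub>k\<close> are indexed by a finite type \<open>'k\<close> with \<open>k = CARD('k)\<close>
  elements. Functionals are total functions of which only the values on \<open>forms\<close> are ever used.
\<close>

definition forms :: "(('a::metric_space \<Rightarrow> real) \<times> ('k::finite \<Rightarrow> 'a \<Rightarrow> real)) set" where
  "forms = {(f, \<pi>). f \<in> Lipb \<and> (\<forall>i. \<pi> i \<in> Lip)}"

definition metric_functional ::
    "(('a::metric_space \<Rightarrow> real) \<Rightarrow> ('k::finite \<Rightarrow> 'a \<Rightarrow> real) \<Rightarrow> real) \<Rightarrow> bool" where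
  "metric_functional T \<longleftrightarrow> (\<forall>(f, \<pi>) \<in> forms.
     (\<forall>g \<in> Lipb. \<bar>T (\<lambda>x. f x + g x) \<pi>\<bar> \<le> \<bar>T f \<pi>\<bar> + \<bar>T g \<pi>\<bar>) \<and>
     (\<forall>c \<ge> 0. \<bar>T (\<lambda>x. c * f x) \<pi>\<bar> = c * \<bar>T f \<pi>\<bar>) \<and>
     (\<forall>i. \<forall>g \<in> Lip. \<bar>T f (\<pi>(i := \<lambda>x. \<pi> i x + g x))\<bar> \<le> \<bar>T f \<pi>\<bar> + \<bar>T f (\<pi>(i := g))\<bar>) \<and>
     (\<forall>i. \<forall>c \<ge> 0. \<bar>T f (\<pi>(i := \<lambda>x. c * \<pi> i x))\<bar> = c * \<bar>T f \<pi>\<bar>))"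

definition mass_bound ::
    "(('a::metric_space \<Rightarrow> real) \<Rightarrow> ('k::finite \<Rightarrow> 'a \<Rightarrow> real) \<Rightarrow> real) \<Rightarrow> 'a measure \<Rightarrow> bool" where
  "mass_bound T \<mu> \<longleftrightarrow> finite_radon \<mu> \<and>
     (\<forall>(f, \<pi>) \<in> forms. \<bar>T f \<pi>\<bar> \<le> (\<Prod>i\<in>UNIV. lip_const (\<pi> i)) * (\<integral>x. \<bar>f x\<bar> \<partial>\<mu>))"

definition finite_mass ::
    "(('a::metric_space \<Rightarrow> real) \<Rightarrow> ('k::finite \<Rightarrow> 'a \<Rightarrow> real) \<Rightarrow> real) \<Rightarrow> bool" where
  "finite_mass T \<longleftrightarrow> (\<exists>\<mu>. mass_bound T \<mu>)"

definition mass ::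
    "(('a::metric_space \<Rightarrow> real) \<Rightarrow> ('k::finite \<Rightarrow> 'a \<Rightarrow> real) \<Rightarrow> real) \<Rightarrow> 'a measure" where
  "mass T = (THE \<mu>. mass_bound T \<mu> \<and>
     (\<forall>\<mu>'. mass_bound T \<mu>' \<longrightarrow> (\<forall>A \<in> sets borel. emeasure \<mu> A \<le> emeasure \<mu>' A)))"

definition multilinear_functional ::
    "(('a::metric_space \<Rightarrow> real) \<Rightarrow> ('k::finite \<Rightarrow> 'a \<Rightarrow> real) \<Rightarrow> real) \<Rightarrow> bool" where
  "multilinear_functional T \<longleftrightarrow> (\<forall>(f, \<pi>) \<in> forms.
     (\<forall>g \<in> Lipb. \<forall>a b. T (\<lambda>x. a * f x + b * g x) \<pi> = a * T f \<pi> + b * T g \<pi>) \<and>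
     (\<forall>i. \<forall>g \<in> Lip. \<forall>a b. T f (\<pi>(i := \<lambda>x. a * \<pi> i x + b * g x)) =
        a * T f \<pi> + b * T f (\<pi>(i := g))))"

definition alternating_functional ::
    "(('a::metric_space \<Rightarrow> real) \<Rightarrow> ('k::finite \<Rightarrow> 'a \<Rightarrow> real) \<Rightarrow> real) \<Rightarrow> bool" where
  "alternating_functional T \<longleftrightarrow>
     (\<forall>(f, \<pi>) \<in> forms. \<forall>i j. i \<noteq> j \<and> \<pi> i = \<pi> j \<longrightarrow> T f \<pi> = 0)"

definition local_functional ::
    "(('a::metric_space \<Rightarrow> real) \<Rightarrow> ('k::finite \<Rightarrow> 'a \<Rightarrow> real) \<Rightarrow> real) \<Rightarrow> bool" where
  "local_functional T \<longleftrightarrow>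
     (\<forall>(f, \<pi>) \<in> forms. \<forall>i. \<pi> i constant_on {x. f x \<noteq> 0} \<longrightarrow> T f \<pi> = 0)"

definition wstar_continuous_functional ::
    "(('a::metric_space \<Rightarrow> real) \<Rightarrow> ('k::finite \<Rightarrow> 'a \<Rightarrow> real) \<Rightarrow> real) \<Rightarrow> bool" where
  "wstar_continuous_functional T \<longleftrightarrow> (\<forall>fs f \<pi>s \<pi>.
     (\<forall>n. fs n \<in> Lipb) \<and> f \<in> Lipb \<and> wstar_conv fs f \<and> bdd_above (range (\<lambda>n. sup_norm (fs n))) \<and>
     (\<forall>i. wstar_conv (\<lambda>n. \<pi>s n i) (\<pi> i)) \<longrightarrow>
     (\<lambda>n. T (fs n) (\<pi>s n)) \<longlonglongrightarrow> T f \<pi>)"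

definition metric_current ::
    "(('a::metric_space \<Rightarrow> real) \<Rightarrow> ('k::finite \<Rightarrow> 'a \<Rightarrow> real) \<Rightarrow> real) \<Rightarrow> bool" where
  "metric_current T \<longleftrightarrow> metric_functional T \<and> finite_mass T \<and> multilinear_functional T \<and>
     alternating_functional T \<and> local_functional T \<and> wstar_continuous_functional T"

definition nonzero_current ::
    "(('a::metric_space \<Rightarrow> real) \<Rightarrow> ('k::finite \<Rightarrow> 'a \<Rightarrow> real) \<Rightarrow> real) \<Rightarrow> bool" where
  "nonzero_current T \<longleftrightarrow> (\<exists>(f, \<pi>) \<in> forms. T f \<pi> \<noteq> 0)"


section \<open>Fragments\<close>

typedef (overloaded) ('a::metric_space) fragment =
  "{\<gamma> :: real \<rightharpoonup> 'a. compact (dom \<gamma>) \<and> dom \<gamma> \<noteq> {} \<and> (\<exists>L. L-lipschitz_on (dom \<gamma>) (\<lambda>t. the (\<gamma> t)))}"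
  morphisms frag_map Fragment
proof -
  have "(\<lambda>t. if t = (0::real) then Some undefined else None) \<in>
    {\<gamma> :: real \<rightharpoonup> 'a. compact (dom \<gamma>) \<and> dom \<gamma> \<noteq> {} \<and> (\<exists>L. L-lipschitz_on (dom \<gamma>) (\<lambda>t. the (\<gamma> t)))}"
    by (auto simp: dom_def lipschitz_on_def intro!: exI[of _ 0])
  then show ?thesis by blast
qed

definition frag_dom :: "'a::metric_space fragment \<Rightarrow> real set" where
  "frag_dom \<gamma> = dom (frag_map \<gamma>)"

definition frag_eval :: "'a::metric_space fragment \<Rightarrow> real \<Rightarrow> 'a" where
  "frag_eval \<gamma> t = the (frag_map \<gamma> t)"

definition frag_graph :: "'a::metric_space fragment \<Rightarrow> (real \<times> 'a) set" where
  "frag_graph \<gamma> = (\<lambda>t. (t, frag_eval \<gamma> t)) ` frag_dom \<gamma>"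

lemma compact_frag_dom: "compact (frag_dom \<gamma>)"
  and frag_dom_nonempty: "frag_dom \<gamma> \<noteq> {}"
  and lipschitz_frag_eval: "\<exists>L. L-lipschitz_on (frag_dom \<gamma>) (frag_eval \<gamma>)"
  using frag_map[of \<gamma>] by (auto simp: frag_dom_def frag_eval_def[abs_def])

lemma compact_frag_graph: "compact (frag_graph \<gamma>)"
proof -
  obtain L where "L-lipschitz_on (frag_dom \<gamma>) (frag_eval \<gamma>)"
    using lipschitz_frag_eval by blast
  then have "continuous_on (frag_dom \<gamma>) (frag_eval \<gamma>)"
    by (rule lipschitz_on_continuous_on)
  then show ?thesis
    unfolding frag_graph_def
    by (intro compact_continuous_image compact_frag_dom continuous_intros)
qed

lemma frag_graph_nonempty: "frag_graph \<gamma> \<noteq> {}"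
  by (simp add: frag_graph_def frag_dom_nonempty)

lemma frag_graph_inject: "frag_graph \<gamma> = frag_graph \<gamma>' \<longleftrightarrow> \<gamma> = \<gamma>'"
proof
  assume eq: "frag_graph \<gamma> = frag_graph \<gamma>'"
  have mem: "(t, x) \<in> frag_graph \<gamma> \<longleftrightarrow> frag_map \<gamma> t = Some x" for t x and \<gamma> :: "'a fragment"
    by (auto simp: frag_graph_def frag_dom_def frag_eval_def)
  have "frag_map \<gamma> t = frag_map \<gamma>' t" for t
    using eq mem[of t _ \<gamma>] mem[of t _ \<gamma>'] by (metis not_Some_eq)
  then show "\<gamma> = \<gamma>'"
    by (metis ext frag_map_inject)
qed simp

definition hausdorff_dist :: "'a::metric_space set \<Rightarrow> 'a set \<Rightarrow> real" where
  "hausdorff_dist A B = max (SUP a\<in>A. infdist a B) (SUP b\<in>B. infdist b A)"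

lemma bdd_above_infdist:
  assumes "compact A" shows "bdd_above ((\<lambda>a. infdist a B) ` A)"
proof -
  have "compact ((\<lambda>a. infdist a B) ` A)"
    by (intro compact_continuous_image continuous_intros assms)
  then show ?thesis
    by (intro bounded_imp_bdd_above compact_imp_bounded)
qed

lemma hausdorff_dist_le_iff:
  assumes "compact A" "compact B" "A \<noteq> {}" "B \<noteq> {}"
  shows "hausdorff_dist A B \<le> e \<longleftrightarrow> (\<forall>a\<in>A. infdist a B \<le> e) \<and> (\<forall>b\<in>B. infdist b A \<le> e)"
  using assms by (simp add: hausdorff_dist_def cSUP_le_iff bdd_above_infdist)

lemma hausdorff_dist_eq_0_iff:
  assumes "compact A" "compact B" "A \<noteq> {}" "B \<noteq> {}"
  shows "hausdorff_dist A B = 0 \<longleftrightarrow> A = B"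
proof
  assume "hausdorff_dist A B = 0"
  then have "\<forall>a\<in>A. infdist a B = 0" "\<forall>b\<in>B. infdist b A = 0"
    using hausdorff_dist_le_iff[OF assms, of 0] by (auto intro: antisym infdist_nonneg)
  then show "A = B"
    using assms compact_imp_closed in_closed_iff_infdist_zero by blast
next
  assume "A = B"
  then show "hausdorff_dist A B = 0"
    using assms by (simp add: hausdorff_dist_def)
qed

lemma infdist_triangle_set:
  assumes "C \<noteq> {}" "compact C" and le: "\<And>c. c \<in> C \<Longrightarrow> infdist c B \<le> e"
  shows "infdist a B \<le> infdist a C + e"
proof -
  have "continuous_on C (dist a)"
    by (intro continuous_intros)
  then obtain c where c: "c \<in> C" "\<forall>y\<in>C. dist a c \<le> dist a y"
    using continuous_attains_inf[of C "dist a"] assms by blast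
  then have "dist a c \<le> infdist a C"
    using assms(1) by (auto simp: infdist_notempty intro: cINF_greatest)
  then show ?thesis
    using infdist_triangle[of a B c] le[OF c(1)] by simp
qed

lemma hausdorff_dist_triangle:
  assumes "compact A" "compact B" "compact C" "A \<noteq> {}" "B \<noteq> {}" "C \<noteq> {}"
  shows "hausdorff_dist A B \<le> hausdorff_dist A C + hausdorff_dist B C"
proof -
  let ?x = "hausdorff_dist A C" and ?y = "hausdorff_dist B C"
  have 1: "\<forall>a\<in>A. infdist a C \<le> ?x" "\<forall>c\<in>C. infdist c A \<le> ?x"
    using hausdorff_dist_le_iff[of A C ?x] assms by auto
  have 2: "\<forall>b\<in>B. infdist b C \<le> ?y" "\<forall>c\<in>C. infdist c B \<le> ?y"
    using hausdorff_dist_le_iff[of B C ?y] assms by auto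
  have "infdist a B \<le> ?x + ?y" if "a \<in> A" for a
    using infdist_triangle_set[of C B ?y a] 1 2 that assms by fastforce
  moreover have "infdist b A \<le> ?x + ?y" if "b \<in> B" for b
    using infdist_triangle_set[of C A ?x b] 1 2 that assms by fastforce
  ultimately show ?thesis
    using assms by (simp add: hausdorff_dist_le_iff)
qed

instantiation fragment :: (metric_space) metric_space
begin

definition dist_fragment :: "'a fragment \<Rightarrow> 'a fragment \<Rightarrow> real" where
  "dist_fragment \<gamma> \<gamma>' = hausdorff_dist (frag_graph \<gamma>) (frag_graph \<gamma>')"

definition uniformity_fragment :: "('a fragment \<times> 'a fragment) filter" where
  "uniformity_fragment = (INF e\<in>{0<..}. principal {(x, y). dist x y < e})"

definition open_fragment :: "'a fragment set \<Rightarrow> bool" where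
  "open_fragment U \<longleftrightarrow> (\<forall>x\<in>U. \<forall>\<^sub>F (x', y) in uniformity. x' = x \<longrightarrow> y \<in> U)"

instance
proof
  show "dist \<gamma> \<gamma>' = 0 \<longleftrightarrow> \<gamma> = \<gamma>'" for \<gamma> \<gamma>' :: "'a fragment"
    by (simp add: dist_fragment_def hausdorff_dist_eq_0_iff compact_frag_graph
        frag_graph_nonempty frag_graph_inject)
  show "dist \<gamma> \<gamma>' \<le> dist \<gamma> \<gamma>'' + dist \<gamma>' \<gamma>''" for \<gamma> \<gamma>' \<gamma>'' :: "'a fragment"
    unfolding dist_fragment_def
    by (intro hausdorff_dist_triangle compact_frag_graph frag_graph_nonempty)
qed (simp_all add: uniformity_fragment_def open_fragment_def)

end


section \<open>Alberti representations\<close>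

text \<open>One-dimensional Hausdorff outer measure. The covering sets are required to be bounded since
  \<^const>\<open>diameter\<close> is real-valued and meaningless on unbounded sets.\<close>

definition hausdorff1 :: "'a::metric_space set \<Rightarrow> ennreal" where
  "hausdorff1 A = (SUP \<delta> \<in> {0<..}. INF E \<in> {E :: nat \<Rightarrow> 'a set.
     A \<subseteq> (\<Union>n. E n) \<and> (\<forall>n. bounded (E n) \<and> diameter (E n) \<le> \<delta>)}. \<Sum>n. ennreal (diameter (E n)))"

text \<open>The set \<open>M(X)\<close> of finite Radon measures with the weak* topology, tested against bounded
  continuous functions; its Borel sets form \<open>radon_borel\<close>.\<close>

definition radon_topology :: "'a::t2_space measure topology" where
  "radon_topology = topology_generated_by
     {{\<mu>. finite_radon \<mu> \<and> (\<integral>x. g x \<partial>\<mu>) \<in> U} | (g :: 'a \<Rightarrow> real) U.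
        continuous_on UNIV g \<and> bounded (range g) \<and> open U}"

definition radon_borel :: "'a::t2_space measure measure" where
  "radon_borel = sigma {\<mu>. finite_radon \<mu>} {W. openin radon_topology W}"

definition alberti_representation ::
    "'a::metric_space measure \<Rightarrow> 'a fragment measure \<Rightarrow> ('a fragment \<Rightarrow> 'a measure) \<Rightarrow> bool" where
  "alberti_representation \<mu> P \<nu> \<longleftrightarrow>
     regular_borel_prob P \<and>
     \<nu> \<in> borel \<rightarrow>\<^sub>M radon_borel \<and>
     (\<forall>\<gamma>. \<forall>A \<in> sets borel. hausdorff1 (A \<inter> frag_eval \<gamma> ` frag_dom \<gamma>) = 0 \<longrightarrow> emeasure (\<nu> \<gamma>) A = 0) \<and>
     (\<forall>A \<in> sets borel. emeasure \<mu> A = (\<integral>\<^sup>+ \<gamma>. emeasure (\<nu> \<gamma>) A \<partial>P)) \<and>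
     (\<forall>A \<in> sets borel. \<forall>a b. a \<le> b \<longrightarrow>
        (\<lambda>\<gamma>. emeasure (\<nu> \<gamma>) (A \<inter> frag_eval \<gamma> ` (frag_dom \<gamma> \<inter> {a..b}))) \<in> borel_measurable borel)"

definition bilipschitz_representation :: "real \<Rightarrow> real \<Rightarrow> 'a::metric_space fragment measure \<Rightarrow> bool" where
  "bilipschitz_representation C D P \<longleftrightarrow> (AE \<gamma> in P. \<forall>s \<in> frag_dom \<gamma>. \<forall>t \<in> frag_dom \<gamma>.
     C * \<bar>s - t\<bar> \<le> dist (frag_eval \<gamma> s) (frag_eval \<gamma> t) \<and>
     dist (frag_eval \<gamma> s) (frag_eval \<gamma> t) \<le> D * \<bar>s - t\<bar>)"

text \<open>For unit vectors \<open>w\<close>, where \<open>u - (w \<bullet> u) *\<^sub>R w\<close> is the orthogonal projection of \<open>u\<close> onto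
  the complement of \<open>w\<close>.\<close>

definition open_cone :: "'v::euclidean_space \<Rightarrow> real \<Rightarrow> 'v set" where
  "open_cone w \<alpha> = {u. tan \<alpha> * (w \<bullet> u) > norm (u - (w \<bullet> u) *\<^sub>R w)}"

definition cone_field :: "('a::metric_space \<Rightarrow> 'v::euclidean_space set) \<Rightarrow> bool" where
  "cone_field C \<longleftrightarrow> (\<exists>w \<alpha>. w \<in> borel_measurable borel \<and> \<alpha> \<in> borel_measurable borel \<and>
     (\<forall>x. norm (w x) = 1 \<and> 0 < \<alpha> x \<and> \<alpha> x < pi / 2 \<and> C x = open_cone (w x) (\<alpha> x)))"

text \<open>The restriction to \<open>V\<close> of an Alberti representation \<open>(P, \<nu>)\<close> is in the \<open>f\<close>-direction of
  \<open>C\<close>; this does not involve \<open>\<nu>\<close>. The derivative is taken within the domain of the fragment, where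
  it is unique except at the (at most countably many) isolated points of the domain.\<close>

definition in_direction_on ::
    "'a set \<Rightarrow> 'a::metric_space fragment measure \<Rightarrow> ('a \<Rightarrow> 'v::euclidean_space) \<Rightarrow>
     ('a \<Rightarrow> 'v set) \<Rightarrow> bool" where
  "in_direction_on V P f C \<longleftrightarrow> (AE \<gamma> in P. AE t in lebesgue.
     t \<in> frag_dom \<gamma> \<and> frag_eval \<gamma> t \<in> V \<longrightarrow>
     (\<exists>u. ((f \<circ> frag_eval \<gamma>) has_vector_derivative u) (at t within frag_dom \<gamma>) \<and>
          u \<in> C (frag_eval \<gamma> t)))"


section \<open>Weaver derivations\<close>

text \<open>The predual of \<open>Lipb\<close>: the norm closure, in the dual of \<open>Lipb\<close>, of the linear span of the
  point evaluations. Membership forces \<open>\<phi>\<close> to be linear and bounded on \<open>Lipb\<close>.\<close>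

definition Lipb_predual :: "(('a::metric_space \<Rightarrow> real) \<Rightarrow> real) set" where
  "Lipb_predual = {\<phi>. \<forall>e>0. \<exists>S c. finite S \<and>
     (\<forall>f \<in> Lipb. \<bar>\<phi> f - (\<Sum>x\<in>S. c x * f x)\<bar> \<le> e * Lipb_norm f)}"

definition Lipb_wstar :: "('a::metric_space \<Rightarrow> real) topology" where
  "Lipb_wstar = topology_generated_by {{f \<in> Lipb. \<phi> f \<in> U} | \<phi> U. \<phi> \<in> Lipb_predual \<and> open U}"

text \<open>Elements of \<open>L\<^sup>\<infinity>(\<mu>)\<close> are given by representatives, so equality is equality almost everywhere;
  \<open>Linf_wstar\<close> is the weak* topology coming from \<open>L\<^sup>1(\<mu>)\<close>, pulled back to representatives.\<close>

definition Linf :: "'a measure \<Rightarrow> ('a \<Rightarrow> real) set" where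
  "Linf \<mu> = {g \<in> borel_measurable \<mu>. \<exists>M. AE x in \<mu>. \<bar>g x\<bar> \<le> M}"

definition Linf_wstar :: "'a measure \<Rightarrow> ('a \<Rightarrow> real) topology" where
  "Linf_wstar \<mu> = topology_generated_by
     {{g \<in> Linf \<mu>. (\<integral>x. g x * h x \<partial>\<mu>) \<in> U} | (h :: 'a \<Rightarrow> real) U. integrable \<mu> h \<and> open U}"

definition weaver_derivation ::
    "'a::metric_space measure \<Rightarrow> (('a \<Rightarrow> real) \<Rightarrow> 'a \<Rightarrow> real) \<Rightarrow> bool" where
  "weaver_derivation \<mu> D \<longleftrightarrow>
     (\<forall>f \<in> Lipb. D f \<in> Linf \<mu>) \<and>
     (\<forall>f \<in> Lipb. \<forall>g \<in> Lipb. \<forall>a b. AE x in \<mu>. D (\<lambda>y. a * f y + b * g y) x = a * D f x + b * D g x) \<and>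
     (\<exists>M. \<forall>f \<in> Lipb. AE x in \<mu>. \<bar>D f x\<bar> \<le> M * Lipb_norm f) \<and>
     continuous_map Lipb_wstar (Linf_wstar \<mu>) D \<and>
     (\<forall>f \<in> Lipb. \<forall>g \<in> Lipb. AE x in \<mu>. D (\<lambda>y. f y * g y) x = f x * D g x + g x * D f x)"

definition independent_derivations ::
    "'a::metric_space measure \<Rightarrow> ('k::finite \<Rightarrow> ('a \<Rightarrow> real) \<Rightarrow> 'a \<Rightarrow> real) \<Rightarrow> bool" where
  "independent_derivations \<mu> D \<longleftrightarrow> (\<forall>c. (\<forall>i. c i \<in> Linf \<mu>) \<and>
     (\<forall>f \<in> Lipb. AE x in \<mu>. (\<Sum>i\<in>UNIV. c i x * D i f x) = 0) \<longrightarrow>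
     (\<forall>i. AE x in \<mu>. c i x = 0))"

end

theory Submission
  imports Defs "HOL-Library.Diagonal_Subsequence"
begin

text \<open>
  On a countable Borel partition \<open>V j\<close> of the mass measure, coordinates \<open>\<pi> j\<close> can be chosen for which the density of
  \<open>T\<close> does not vanish. Replacing the \<open>i\<close>-th coordinate by \<open>f\<close> gives a local, weak* continuous operator \<open>D i\<close>
  with \<open>D i (\<pi> j m) = 0\<close> for \<open>i ~= m\<close>; glued over \<open>j\<close>, these operators are independent derivations.

  For a unit vector \<open>w\<close> let \<open>u = w \<bullet> \<pi> j\<close> and let \<open>p\<close> be the components of \<open>\<pi> j\<close> orthogonal to \<open>w\<close>. The operator
  \<open>N = \<Sum>i. w i D i\<close> kills \<open>p\<close> but not \<open>u\<close>. On a compact set which no fragment in a thin cone around \<open>w\<close>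
  charges, \<open>u\<close> is a limit of infima of chain costs that grow slowly except along \<open>p\<close>, which forces
  \<open>N u = 0\<close>. Hence such fragments exist in every set of positive mass, and a reparametrization by their variation
  makes them almost isometric. A minimax argument turns this into laws on compact sets of fragments which
  charge every non-null part of a small set. Their mixture over an exhaustion dominates the mass measure, and
  the Radon-Nikodym derivative provides the densities of the Alberti representation.
\<close>

section \<open>Lipschitz functions and densities of functionals\<close>

text \<open>Every requirement on a fragment is a closed relation between pairs of points of its
  graph: the cone condition is a difference inequality with slack \<open>\<kappa>\<close> rather
  than a statement about derivatives, and the biLipschitz bounds have the same shape. Such relations
  pass to Hausdorff limits, so the fragments with fixed \<open>\<kappa>\<close>, times in
  \<open>{0..1}\<close> and values in a compact set form a compact set; the condition on derivatives
  is recovered at almost every time. Compactness is needed twice, for the finite graphs read off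
  from chains and for the finitely supported laws of the minimax argument. A compact set of
  fragments is a continuous image of a compact set of reals, so the second limit is taken among
  measures on the line. A cone field varies from point to point, but countably many constant
  directions and widths cut the space into pieces on which a fixed thin cone lies inside the field.
  Locality of the operators allows a function to be replaced by a truncation, a minimum or an
  extension that agrees with it on the set in question.\<close>

lemma lipschitz_on_lip_const:
  assumes "f \<in> Lip"
  shows "(lip_const f)-lipschitz_on UNIV f"
proof -
  let ?S = "{L. L-lipschitz_on UNIV f}"
  have ne: "?S ~= {}" using assms by (auto simp: Lip_def)
  have ge: "\<And>L. L \<in> ?S ==> 0 <= L" by (auto dest: lipschitz_on_nonneg)
  have "0 <= lip_const f" unfolding lip_const_def using ne ge by (intro cInf_greatest) auto
  moreover have "dist (f x) (f y) <= lip_const f * dist x y" for x y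
  proof (cases "dist x y = 0")
    case False
    then have pos: "dist x y > 0" by simp
    have "dist (f x) (f y) / dist x y <= lip_const f"
      unfolding lip_const_def using ne pos
      by (intro cInf_greatest) (auto simp: field_simps dest!: lipschitz_onD[of _ _ _ x y])
    then show ?thesis using pos by (simp add: field_simps)
  qed simp
  ultimately show ?thesis by (auto simp: lipschitz_on_def)
qed

lemma lip_const_le: "L-lipschitz_on UNIV f ==> lip_const f <= L"
  unfolding lip_const_def
  by (rule cInf_lower) (auto intro!: bdd_belowI[of _ 0] dest: lipschitz_on_nonneg)

lemma lip_const_nonneg: "f \<in> Lip ==> 0 <= lip_const f"
  using lipschitz_on_lip_const lipschitz_on_nonneg by blast

lemma LipI: "L-lipschitz_on UNIV f ==> f \<in> Lip"
  by (auto simp: Lip_def)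

lemma Lip_abs_le: "f \<in> Lip ==> \<bar>f x - f y\<bar> <= lip_const f * dist x y"
  using lipschitz_onD[OF lipschitz_on_lip_const, of f x y] by (simp add: dist_real_def)

lemma lipschitz_on_real_absI:
  fixes f :: "'a::metric_space => real"
  assumes "\<And>x y. \<bar>f x - f y\<bar> <= L * dist x y" "0 <= L"
  shows "L-lipschitz_on UNIV f"
  using assms by (auto simp: lipschitz_on_def dist_real_def)

lemma Lip_linear:
  assumes "f \<in> Lip" "g \<in> Lip"
  shows "(\<lambda>x. a * f x + b * g x) \<in> Lip"
    and "lip_const (\<lambda>x. a * f x + b * g x) <= \<bar>a\<bar> * lip_const f + \<bar>b\<bar> * lip_const g"
proof -
  have "(\<bar>a\<bar> * lip_const f + \<bar>b\<bar> * lip_const g)-lipschitz_on UNIV (\<lambda>x. a * f x + b * g x)"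
    using assms by (intro lipschitz_intros lipschitz_on_lip_const)
  then show "(\<lambda>x. a * f x + b * g x) \<in> Lip"
    "lip_const (\<lambda>x. a * f x + b * g x) <= \<bar>a\<bar> * lip_const f + \<bar>b\<bar> * lip_const g"
    by (auto intro: LipI lip_const_le)
qed

lemma Lip_const: "(\<lambda>x. c) \<in> Lip" "lip_const (\<lambda>x. c) = 0"
proof -
  show *: "(\<lambda>x. c) \<in> Lip" by (rule LipI[OF lipschitz_on_constant])
  show "lip_const (\<lambda>x. c) = 0"
    using lip_const_le[OF lipschitz_on_constant, of c] lip_const_nonneg[OF *] by (intro antisym)
qed

lemma Lip_borel [measurable]: "f \<in> Lip ==> f \<in> borel_measurable borel"
  by (intro borel_measurable_continuous_onI lipschitz_on_continuous_on[OF lipschitz_on_lip_const])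

lemma Lip_comp:
  assumes "f \<in> Lip" "L-lipschitz_on UNIV \<phi>"
  shows "(\<lambda>x. \<phi> (f x)) \<in> Lip" "lip_const (\<lambda>x. \<phi> (f x)) <= L * lip_const f"
proof -
  have "(L * lip_const f)-lipschitz_on UNIV (\<lambda>x. \<phi> (f x))"
    by (rule lipschitz_on_compose2[OF lipschitz_on_lip_const[OF assms(1)]])
      (rule lipschitz_on_subset[OF assms(2)], simp)
  then show "(\<lambda>x. \<phi> (f x)) \<in> Lip" "lip_const (\<lambda>x. \<phi> (f x)) <= L * lip_const f"
    by (auto intro: LipI lip_const_le)
qed

lemma Lip_minmax:
  assumes "L-lipschitz_on UNIV f" "L-lipschitz_on UNIV g"
  shows "L-lipschitz_on UNIV (\<lambda>x. min (f x) (g x) :: real)" "L-lipschitz_on UNIV (\<lambda>x. max (f x) (g x) :: real)"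
proof -
  have L: "0 <= L" using assms lipschitz_on_nonneg by blast
  have "\<bar>f x - f y\<bar> <= L * dist x y" "\<bar>g x - g y\<bar> <= L * dist x y" for x y
    using lipschitz_onD[OF assms(1), of x y] lipschitz_onD[OF assms(2), of x y] by (auto simp: dist_real_def)
  then have *: "f x <= f y + L * dist x y" "g x <= g y + L * dist x y" "f y <= f x + L * dist x y" "g y <= g x + L * dist x y" for x y
    by (smt (verit))+
  show "L-lipschitz_on UNIV (\<lambda>x. min (f x) (g x) :: real)" "L-lipschitz_on UNIV (\<lambda>x. max (f x) (g x) :: real)"
    using L *[of x y for x y] by (auto intro!: lipschitz_on_real_absI simp: abs_le_iff) (smt (verit) *)+
qed

lemma wstar_conv_lipschitz:
  assumes h: "\<And>n. M-lipschitz_on UNIV (h n)" and H: "\<And>x. (\<lambda>n. h n x) \<longlonglongrightarrow> H x"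
  shows "M-lipschitz_on UNIV H" "wstar_conv h H"
proof -
  show HL: "M-lipschitz_on UNIV H"
  proof (rule lipschitz_on_real_absI[OF _ lipschitz_on_nonneg[OF h]])
    fix x x'
    have "(\<lambda>n. \<bar>h n x - h n x'\<bar>) \<longlonglongrightarrow> \<bar>H x - H x'\<bar>" by (intro tendsto_intros H)
    then show "\<bar>H x - H x'\<bar> <= M * dist x x'"
      by (rule LIMSEQ_le_const2) (use lipschitz_onD[OF h, of x x'] in \<open>auto simp: dist_real_def\<close>)
  qed
  show "wstar_conv h H"
    unfolding wstar_conv_def using LipI[OF h] LipI[OF HL] H lip_const_le[OF h] by (auto intro!: bdd_aboveI2)
qed

lemma Lipb_Lip: "f \<in> Lipb ==> f \<in> Lip" by (auto simp: Lipb_def)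

lemma LipbI: "f \<in> Lip ==> (\<And>x. \<bar>f x\<bar> <= B) ==> f \<in> Lipb"
  by (auto simp: Lipb_def bounded_iff)

lemma Lipb_bound:
  assumes "f \<in> Lipb" obtains B where "0 <= B" "\<And>x. \<bar>f x\<bar> <= B"
proof -
  obtain B where "\<And>x. \<bar>f x\<bar> <= B" using assms by (auto simp: Lipb_def bounded_iff)
  then show ?thesis using that[of "max B 0"] by (meson max.coboundedI1 max.cobounded2)
qed

lemma Lipb_linear:
  assumes "f \<in> Lipb" "g \<in> Lipb" shows "(\<lambda>x. a * f x + b * g x) \<in> Lipb"
proof -
  obtain B where B: "\<And>x. \<bar>f x\<bar> <= B" "0 <= B" using Lipb_bound[OF assms(1)] by metis
  obtain C where C: "\<And>x. \<bar>g x\<bar> <= C" "0 <= C" using Lipb_bound[OF assms(2)] by metis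
  have "\<bar>a * f x + b * g x\<bar> <= \<bar>a\<bar> * B + \<bar>b\<bar> * C" for x
    using mult_left_mono[OF B(1)[of x], of "\<bar>a\<bar>"] mult_left_mono[OF C(1)[of x], of "\<bar>b\<bar>"]
      abs_triangle_ineq[of "a * f x" "b * g x"] by (simp add: abs_mult)
  then show ?thesis by (rule LipbI[OF Lip_linear(1)[OF Lipb_Lip[OF assms(1)] Lipb_Lip[OF assms(2)]]])
qed

lemma Lipb_integrable:
  assumes "f \<in> Lipb" "finite_measure \<mu>" "sets \<mu> = sets borel"
  shows "integrable \<mu> f"
proof -
  obtain B where B: "\<And>x. \<bar>f x\<bar> <= B" using Lipb_bound[OF assms(1)] by metis
  show ?thesis
    using assms B Lip_borel[OF Lipb_Lip[OF assms(1)]]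
    by (intro finite_measure.integrable_const_bound[where B=B]) (auto simp: measurable_cong_sets[OF assms(3) refl])
qed

lemma lip_const_mult:
  assumes "F \<in> Lip" "G \<in> Lip" "\<And>x. \<bar>F x\<bar> <= r" "\<And>x. \<bar>G x\<bar> <= s"
  shows "(\<lambda>x. F x * G x) \<in> Lip" "lip_const (\<lambda>x. F x * G x) <= r * lip_const G + s * lip_const F"
proof -
  have rs: "0 <= r" "0 <= s" using assms(3,4)[of undefined] by linarith+
  have "(r * lip_const G + s * lip_const F)-lipschitz_on UNIV (\<lambda>x. F x * G x)"
  proof (rule lipschitz_on_real_absI)
    fix x y
    have "F x * G x - F y * G y = F x * (G x - G y) + G y * (F x - F y)" by (simp add: algebra_simps)
    also have "\<bar>...\<bar> <= \<bar>F x\<bar> * \<bar>G x - G y\<bar> + \<bar>G y\<bar> * \<bar>F x - F y\<bar>"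
      by (metis abs_mult abs_triangle_ineq)
    also have "... <= r * (lip_const G * dist x y) + s * (lip_const F * dist x y)"
      using assms rs by (intro add_mono mult_mono Lip_abs_le) auto
    finally show "\<bar>F x * G x - F y * G y\<bar> <= (r * lip_const G + s * lip_const F) * dist x y" by (simp add: algebra_simps)
  qed (use rs assms(1,2) lip_const_nonneg in \<open>auto intro!: add_nonneg_nonneg mult_nonneg_nonneg\<close>)
  then show "(\<lambda>x. F x * G x) \<in> Lip" "lip_const (\<lambda>x. F x * G x) <= r * lip_const G + s * lip_const F"
    by (auto intro: LipI lip_const_le)
qed

lemma Lipb_mult:
  assumes "f \<in> Lipb" "g \<in> Lipb" shows "(\<lambda>x. f x * g x) \<in> Lipb"
proof -
  obtain B where B: "\<And>x. \<bar>f x\<bar> <= B" using Lipb_bound[OF assms(1)] by metis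
  obtain C where C: "\<And>x. \<bar>g x\<bar> <= C" using Lipb_bound[OF assms(2)] by metis
  have "\<bar>f x * g x\<bar> <= B * C" for x
    unfolding abs_mult using B[of x] C[of x] by (intro mult_mono) auto
  with lip_const_mult(1)[OF Lipb_Lip[OF assms(1)] Lipb_Lip[OF assms(2)] B C] show ?thesis by (rule LipbI)
qed

text \<open>Ulam's theorem: on a Polish space tightness is automatic. The fragments carry only a
  metric, so laws on them go through \<open>regular_borel_probI\<close> instead.\<close>

lemma finite_radonI:
  fixes \<mu> :: "'a::polish_space measure"
  assumes "sets \<mu> = sets borel" "finite_measure \<mu>" shows "finite_radon \<mu>"
  unfolding finite_radon_def
  using inner_regular[OF assms(1), unfolded infinity_ennreal_def, OF finite_measure.emeasure_finite[OF assms(2)]] assms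
  by (auto simp: conj_commute)

lemma finite_measure_compact_approx:
  fixes \<mu> :: "'a::polish_space measure"
  assumes "sets \<mu> = sets borel" "finite_measure \<mu>" "A \<in> sets borel" "0 < e"
  obtains K where "compact K" "K \<subseteq> A" "measure \<mu> A < measure \<mu> K + e"
proof -
  interpret finite_measure \<mu> by fact
  have eq: "emeasure \<mu> A = (SUP K \<in> {K. K \<subseteq> A \<and> compact K}. emeasure \<mu> K)"
    using inner_regular[OF assms(1), unfolded infinity_ennreal_def, OF finite_measure.emeasure_finite[OF assms(2)] assms(3)] .
  show ?thesis
  proof (cases "measure \<mu> A < e")
    case True then show ?thesis using that[of "{}"] by simp
  next
    case False
    have "emeasure \<mu> A - ennreal e < emeasure \<mu> A"
      using False assms(4) by (simp add: emeasure_eq_measure ennreal_minus ennreal_less_iff)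
    also note eq
    finally obtain K where "K \<subseteq> A" "compact K" "emeasure \<mu> A - ennreal e < emeasure \<mu> K"
      unfolding less_SUP_iff by auto
    then show ?thesis using that[of K] assms(4) False
      by (simp add: emeasure_eq_measure ennreal_minus ennreal_less_iff)
  qed
qed

text \<open>Decreases, as \<open>m\<close> grows, to the indicator of the zero set of
  \<open>u\<close>; with a distance function for \<open>u\<close> it approximates closed
  sets.\<close>

definition bump :: "('a => real) => nat => 'a => real" where
  "bump u m x = max 0 (1 - real m * \<bar>u x\<bar>)"

lemma bump_bounds: "0 <= bump u m x" "bump u m x <= 1"
  by (auto simp: bump_def)

lemma bump_Lipb:
  assumes "u \<in> Lip" shows "bump u m \<in> Lipb"
proof (rule LipbI[of _ 1])
  have "(real m)-lipschitz_on UNIV (\<lambda>t. max 0 (1 - real m * \<bar>t\<bar>))"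
  proof (intro Lip_minmax(2) lipschitz_on_real_absI)
    show "\<bar>(1 - real m * \<bar>s\<bar>) - (1 - real m * \<bar>t\<bar>)\<bar> <= real m * dist s t" for s t
      using mult_left_mono[OF abs_triangle_ineq3[of s t], of "real m"]
      by (simp add: abs_minus_commute dist_real_def abs_mult flip: right_diff_distrib)
  qed auto
  from Lip_comp(1)[OF assms this] show "bump u m \<in> Lip" by (simp add: bump_def[abs_def])
qed (simp add: bump_def)

lemma bump_tendsto_indicator: "(\<lambda>m. bump u m x) \<longlonglongrightarrow> indicator {x. u x = 0} x"
proof (cases "u x = 0")
  case F: False
  then obtain N :: nat where N: "1 < real N * \<bar>u x\<bar>" using reals_Archimedean3[of "\<bar>u x\<bar>"] by auto
  have "1 < real m * \<bar>u x\<bar>" if "m >= N" for m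
    using N mult_right_mono[of "real N" "real m" "\<bar>u x\<bar>"] that by simp
  then have "eventually (\<lambda>m. bump u m x = indicator {x. u x = 0} x) sequentially"
    using F by (auto simp: eventually_sequentially bump_def intro!: exI[of _ N] less_imp_le)
  then show ?thesis by (rule tendsto_eventually)
qed (simp add: bump_def)

lemma AE_le_if_set_integrals_le:
  fixes f g :: "'a => real"
  assumes "integrable M f" "integrable M g"
    and le: "\<And>A. A \<in> sets M ==> (LINT x|M. indicator A x * f x) <= (LINT x|M. indicator A x * g x)"
  shows "AE x in M. f x <= g x"
proof -
  note [measurable] = borel_measurable_integrable[OF assms(1)] borel_measurable_integrable[OF assms(2)]
  let ?A = "{x \<in> space M. g x < f x}"
  have A: "?A \<in> sets M" by measurable
  have int: "integrable M (\<lambda>x. indicator ?A x * f x)" "integrable M (\<lambda>x. indicator ?A x * g x)"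
    using integrable_mult_indicator[OF A assms(1)] integrable_mult_indicator[OF A assms(2)] by auto
  have "(LINT x|M. indicator ?A x * f x - indicator ?A x * g x) <= 0"
    using le[OF A] int by simp
  moreover have nn: "AE x in M. 0 <= indicator ?A x * f x - indicator ?A x * g x"
    by (auto simp: indicator_def)
  ultimately have "(LINT x|M. indicator ?A x * f x - indicator ?A x * g x) = 0"
    using integral_nonneg_AE[OF nn] by linarith
  then have "AE x in M. indicator ?A x * f x - indicator ?A x * g x = 0"
    using integral_nonneg_eq_0_iff_AE[OF _ nn] int by auto
  then show ?thesis
    by (rule AE_mp) (auto simp: indicator_def split: if_splits)
qed

text \<open>The \<open>good\<close> functions form a linear space that is closed under L1 limits.
  Induction over integrable functions reduces the claim to indicators, inner regularity to compact
  sets, and there a \<open>bump\<close> of the distance function does it.\<close>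

lemma Lipb_dense_L1:
  fixes \<mu> :: "'a::polish_space measure"
  assumes \<mu>: "sets \<mu> = sets borel" "finite_measure \<mu>" and h: "integrable \<mu> h" and "0 < e"
  shows "\<exists>f\<in>Lipb. (LINT x|\<mu>. \<bar>f x - h x\<bar>) < e"
proof -
  interpret finite_measure \<mu> by fact
  define good where "good h \<longleftrightarrow> integrable \<mu> h \<and> (\<forall>e>0. \<exists>f\<in>Lipb. (LINT x|\<mu>. \<bar>f x - h x\<bar>) < e)" for h :: "'a => real"
  have int: "integrable \<mu> f" if "f \<in> Lipb" for f using Lipb_integrable[OF that \<mu>(2,1)] .
  have lip: "good f" if "f \<in> Lipb" for f using that int by (auto simp: good_def intro!: bexI[of _ f])
  have close: "good h" if h: "integrable \<mu> h" and ex: "\<And>e. 0 < e ==> \<exists>g. good g \<and> (LINT x|\<mu>. \<bar>g x - h x\<bar>) < e" for h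
    unfolding good_def
  proof (intro conjI h allI impI)
    fix e :: real assume e: "0 < e"
    then obtain g where g: "good g" "(LINT x|\<mu>. \<bar>g x - h x\<bar>) < e / 2" using ex[of "e / 2"] by auto
    then obtain f where f: "f \<in> Lipb" "(LINT x|\<mu>. \<bar>f x - g x\<bar>) < e / 2" and gi: "integrable \<mu> g" using e unfolding good_def by (meson half_gt_zero)
    have "(LINT x|\<mu>. \<bar>f x - h x\<bar>) <= (LINT x|\<mu>. \<bar>f x - g x\<bar> + \<bar>g x - h x\<bar>)" using int[OF f(1)] gi h by (intro integral_mono) auto
    also have "... < e" using f(2) g(2) int[OF f(1)] gi h by simp
    finally show "\<exists>f\<in>Lipb. (LINT x|\<mu>. \<bar>f x - h x\<bar>) < e" using f(1) by blast
  qed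
  have limI: "good h" if s: "\<And>i. good (s i)" and h: "integrable \<mu> h" and l: "\<And>x. (\<lambda>i. s i x) \<longlonglongrightarrow> h x"
    and w: "integrable \<mu> w" "\<And>i x. \<bar>s i x\<bar> <= w x" for s :: "nat => 'a => real" and h w
  proof (rule close[OF h])
    fix e :: real assume e: "0 < e"
    have si: "integrable \<mu> (s i)" for i using s[of i] by (simp add: good_def)
    have "(\<lambda>i. LINT x|\<mu>. \<bar>s i x - h x\<bar>) \<longlonglongrightarrow> (LINT x|\<mu>. 0)"
    proof (rule integral_dominated_convergence[where w="\<lambda>x. w x + \<bar>h x\<bar>"])
      show "AE x in \<mu>. norm \<bar>s i x - h x\<bar> <= w x + \<bar>h x\<bar>" for i
        by (rule AE_I2) (metis abs_triangle_ineq4 add_right_mono order_trans real_norm_def abs_abs w(2))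
    qed (use si h w l in \<open>auto intro!: AE_I2 tendsto_rabs_zero LIM_zero\<close>)
    then have "eventually (\<lambda>i. (LINT x|\<mu>. \<bar>s i x - h x\<bar>) < e) sequentially" using e by (intro order_tendstoD(2)) auto
    then show "\<exists>g. good g \<and> (LINT x|\<mu>. \<bar>g x - h x\<bar>) < e" using s by (auto simp: eventually_sequentially)
  qed
  have lin: "good (\<lambda>x. a * f x + b * g x)" if f: "good f" and g: "good g" for f g a b
    unfolding good_def
  proof (intro conjI allI impI)
    have fg: "integrable \<mu> f" "integrable \<mu> g" using f g by (simp_all add: good_def)
    then show "integrable \<mu> (\<lambda>x. a * f x + b * g x)" by simp
    fix e :: real assume e: "0 < e"
    define d where "d = e / (\<bar>a\<bar> + \<bar>b\<bar> + 1)"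
    have d: "0 < d" "(\<bar>a\<bar> + \<bar>b\<bar>) * d < e" using e by (simp_all add: d_def field_simps)
    obtain u v where u: "u \<in> Lipb" "(LINT x|\<mu>. \<bar>u x - f x\<bar>) < d" and v: "v \<in> Lipb" "(LINT x|\<mu>. \<bar>v x - g x\<bar>) < d"
      using f g d(1) unfolding good_def by blast
    have "(LINT x|\<mu>. \<bar>(a * u x + b * v x) - (a * f x + b * g x)\<bar>) <= (LINT x|\<mu>. \<bar>a\<bar> * \<bar>u x - f x\<bar> + \<bar>b\<bar> * \<bar>v x - g x\<bar>)"
    proof (intro integral_mono)
      show "\<bar>(a * u x + b * v x) - (a * f x + b * g x)\<bar> <= \<bar>a\<bar> * \<bar>u x - f x\<bar> + \<bar>b\<bar> * \<bar>v x - g x\<bar>" for x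
        unfolding abs_mult[symmetric] by (rule order_trans[OF _ abs_triangle_ineq]) (simp add: algebra_simps)
    qed (use int[OF u(1)] int[OF v(1)] fg in auto)
    also have "... = \<bar>a\<bar> * (LINT x|\<mu>. \<bar>u x - f x\<bar>) + \<bar>b\<bar> * (LINT x|\<mu>. \<bar>v x - g x\<bar>)"
      using int[OF u(1)] int[OF v(1)] fg by (subst Bochner_Integration.integral_add) auto
    also have "... <= \<bar>a\<bar> * d + \<bar>b\<bar> * d" using u(2) v(2) by (intro add_mono mult_left_mono) auto
    finally show "\<exists>w\<in>Lipb. (LINT x|\<mu>. \<bar>w x - (a * f x + b * g x)\<bar>) < e"
      using d(2) by (intro bexI[OF _ Lipb_linear[OF u(1) v(1), of a b]]) (simp add: distrib_right)
  qed
  have ind: "good (indicator A)" if A: "A \<in> sets \<mu>" for A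
  proof (rule close)
    have i: "integrable \<mu> (indicat_real B)" if "B \<in> sets \<mu>" for B
      using that by (intro integrable_real_indicator) (auto simp: less_top[symmetric])
    then show "integrable \<mu> (indicat_real A)" using A .
    fix e :: real assume "0 < e"
    with A \<mu>(1) obtain K where K: "compact K" "K \<subseteq> A" "measure \<mu> A < measure \<mu> K + e"
      by (metis finite_measure_compact_approx[OF \<mu>])
    have Kb: "K \<in> sets \<mu>" using K \<mu> by (simp add: compact_imp_closed)
    have "good (indicator K)"
    \<comment> \<open>\<open>infdist x {}\<close> is 0 by convention, so the empty set is not the
      zero set of its distance function.\<close>
    proof (cases "K = {}")
      case True
      then show ?thesis using lip[OF LipbI[OF Lip_const(1), of 0 0]] by (simp add: indicator_def[abs_def])
    next
      case False
      have "1-lipschitz_on UNIV (\<lambda>x. infdist x K)"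
        using infdist_triangle_abs[of _ K] by (intro lipschitz_on_real_absI) auto
      then have "(\<lambda>x. infdist x K) \<in> Lip" by (rule LipI)
      moreover have "{x. infdist x K = 0} = K"
        using in_closed_iff_infdist_zero[OF compact_imp_closed[OF K(1)] False] by auto
      ultimately show ?thesis
        using limI[OF lip[OF bump_Lipb] _ bump_tendsto_indicator, of "\<lambda>x. infdist x K" "\<lambda>_. 1"] i[OF Kb] by (simp add: bump_bounds)
    qed
    moreover have "(LINT x|\<mu>. \<bar>indicat_real K x - indicator A x\<bar>) = (LINT x|\<mu>. indicator A x - indicat_real K x)"
      using K(2) by (intro Bochner_Integration.integral_cong) (auto simp: indicator_def)
    moreover have "... < e" using K(3) i[OF A] i[OF Kb] A Kb sets.sets_into_space by (simp add: Int_absorb2)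
    ultimately show "\<exists>g. good g \<and> (LINT x|\<mu>. \<bar>g x - indicator A x\<bar>) < e" by auto
  qed
  from h have "good h"
  proof induction
    case (base A c)
    then show ?case using lin[OF ind[OF base(1)] ind[OF base(1)], of c 0] by (simp add: mult.commute)
  next
    case (add f g)
    then show ?case using lin[of f g 1 1] by simp
  next
    case (lim f s)
    have x: "space \<mu> = UNIV" using sets_eq_imp_space_eq[OF \<mu>(1)] by simp
    show ?case
      by (rule limI[OF lim.IH lim.hyps(4), where w="\<lambda>x. 2 * \<bar>f x\<bar>"]) (use lim.hyps x in auto)
  qed
  then show ?thesis using \<open>0 < e\<close> by (simp add: good_def)
qed

lemma LIMSEQ_abs_le_zero:
  fixes f g :: "nat => real"
  assumes "\<And>n. \<bar>f n\<bar> <= g n" "g \<longlonglongrightarrow> 0" shows "f \<longlonglongrightarrow> 0"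
  by (rule Lim_null_comparison[OF _ assms(2)]) (simp add: assms(1))

text \<open>The density is the minimiser of \<open>\<integral>f\<^sup>2 - 2 \<phi>(f)\<close>: truncating \<open>f\<close> at \<open>\<plusminus>M\<close> decreases this
  functional, and by the parallelogram law minimising sequences converge in \<open>L\<^sup>2\<close>.\<close>

lemma bounded_functional_density:
  fixes \<mu> :: "'a::polish_space measure"
  assumes \<mu>: "sets \<mu> = sets borel" "finite_measure \<mu>"
    and lin: "\<And>f g a b. f \<in> Lipb ==> g \<in> Lipb ==> \<phi> (\<lambda>x. a * f x + b * g x) = a * \<phi> f + b * \<phi> g"
    and bd: "\<And>f. f \<in> Lipb ==> \<bar>\<phi> f\<bar> <= M * (LINT x|\<mu>. \<bar>f x\<bar>)" and M: "0 <= M"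
  obtains l where "l \<in> borel_measurable borel" "\<And>x. \<bar>l x\<bar> <= M"
    "\<And>f. f \<in> Lipb ==> \<phi> f = (LINT x|\<mu>. f x * l x)"
proof -
  interpret finite_measure \<mu> by fact
  have int: "integrable \<mu> f" if "f \<in> Lipb" for f using Lipb_integrable[OF that \<mu>(2,1)] .
  have ii: "integrable \<mu> (\<lambda>x. f x * g x)" if "f \<in> Lipb" "g \<in> Lipb" for f g by (rule int[OF Lipb_mult[OF that]])
  define F where "F f = (LINT x|\<mu>. f x * f x) - 2 * \<phi> f" for f
  have F_lin: "F (\<lambda>x. a * f x + b * g x) = a * a * (LINT x|\<mu>. f x * f x) + 2 * a * b * (LINT x|\<mu>. f x * g x) + b * b * (LINT x|\<mu>. g x * g x) - 2 * (a * \<phi> f + b * \<phi> g)"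
    if fg: "f \<in> Lipb" "g \<in> Lipb" for f g a b
  proof -
    have "(LINT x|\<mu>. (a * f x + b * g x) * (a * f x + b * g x)) = (LINT x|\<mu>. a * a * (f x * f x) + 2 * a * b * (f x * g x) + b * b * (g x * g x))"
      by (intro Bochner_Integration.integral_cong) (simp_all add: algebra_simps)
    then show ?thesis using ii fg by (simp add: F_def lin[OF fg])
  qed
  have F_ge: "- (M * M * measure \<mu> (space \<mu>)) <= F f" if f: "f \<in> Lipb" for f
  proof -
    have "0 <= (LINT x|\<mu>. f x * f x - 2 * M * \<bar>f x\<bar> + M * M)"
    proof (intro integral_nonneg_AE AE_I2)
      fix x
      have "0 <= (\<bar>f x\<bar> - M) * (\<bar>f x\<bar> - M)" by simp
      then show "0 <= f x * f x - 2 * M * \<bar>f x\<bar> + M * M" by (simp add: algebra_simps abs_mult[symmetric])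
    qed
    also have "... = (LINT x|\<mu>. f x * f x) - 2 * M * (LINT x|\<mu>. \<bar>f x\<bar>) + M * M * measure \<mu> (space \<mu>)"
      using ii[OF f f] int[OF f] by simp
    finally show ?thesis using bd[OF f] by (simp add: F_def)
  qed
  define m where "m = Inf (F ` Lipb)"
  have m: "m <= F f" if "f \<in> Lipb" for f unfolding m_def by (rule cINF_lower[OF bdd_belowI2[OF F_ge] that])
  have "\<exists>f\<in>Lipb. (\<forall>x. \<bar>f x\<bar> <= M) \<and> F f < m + e" if e: "0 < e" for e
  proof -
    have "F ` Lipb ~= {}" using LipbI[OF Lip_const(1), of 0 0] by auto
    moreover have "Inf (F ` Lipb) < m + e" using e by (simp add: m_def)
    ultimately obtain f where f: "f \<in> Lipb" "F f < m + e" using cInf_lessD[of "F ` Lipb" "m + e"] by auto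
    define g where "g x = max (- M) (min M (f x))" for x
    have "1-lipschitz_on UNIV (\<lambda>t. max (- M) (min M t))" by (rule lipschitz_on_real_absI) (auto simp: dist_real_def)
    from Lip_comp(1)[OF Lipb_Lip[OF f(1)] this] have "g \<in> Lip" by (simp add: g_def[abs_def])
    moreover have gM: "\<bar>g x\<bar> <= M" for x using M by (auto simp: g_def)
    ultimately have g: "g \<in> Lipb" by (rule LipbI)
    \<comment> \<open>Where truncation changes \<open>f\<close>,
      \<open>\<bar>f\<bar> + \<bar>g\<bar>\<close> is at least \<open>2 * M\<close>, so the loss in
      the quadratic term outweighs the change of \<open>2 * \<phi>\<close>, which \<open>bd\<close>
      bounds by \<open>2 * M\<close> times the L1 distance.\<close>
    have "2 * M * (LINT x|\<mu>. \<bar>f x - g x\<bar>) = (LINT x|\<mu>. 2 * M * \<bar>f x - g x\<bar>)" by simp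
    also have "... <= (LINT x|\<mu>. f x * f x - g x * g x)"
    proof (intro integral_mono)
      fix x
      show "2 * M * \<bar>f x - g x\<bar> <= f x * f x - g x * g x"
        using M zero_le_square[of "f x - M"] zero_le_square[of "f x + M"]
        by (auto simp: g_def max_def min_def abs_if algebra_simps simp del: zero_le_square split: if_splits)
    qed (use int[OF f(1)] int[OF g] ii f(1) g in auto)
    also have "... = (LINT x|\<mu>. f x * f x) - (LINT x|\<mu>. g x * g x)" using ii f(1) g by simp
    finally have "F g <= F f"
      using bd[OF Lipb_linear[OF f(1) g, of 1 "-1"]] lin[OF f(1) g, of 1 "-1"] by (simp add: F_def)
    then show ?thesis using g gM f(2) by (intro bexI[of _ g]) auto
  qed
  \<comment> \<open>The rate \<open>(1/4)^n\<close> bounds the squared L2 distance of consecutive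
    terms by \<open>4 * (1/4)^n\<close>. The L1 distances are then summable, and the sequence itself
    converges almost everywhere, without passing to a subsequence.\<close>
  from this[of "(1/4)^n" for n] obtain f where f: "\<And>n. f n \<in> Lipb" "\<And>n x. \<bar>f n x\<bar> <= M" "\<And>n. F (f n) < m + (1/4)^n"
    by (metis zero_less_divide_1_iff zero_less_numeral zero_less_power)
  have conv: "(\<lambda>n. LINT x|\<mu>. f n x * g x) \<longlonglongrightarrow> \<phi> g" if g: "g \<in> Lipb" for g
  proof (rule LIM_zero_cancel, rule LIMSEQ_abs_le_zero)
    define G where "G = (LINT x|\<mu>. g x * g x)"
    show "\<bar>(LINT x|\<mu>. f n x * g x) - \<phi> g\<bar> <= (1/2)^n * ((G + 1) / 2)" for n
    proof -
      \<comment> \<open>Perturbing \<open>f n\<close> by \<open>t * g\<close> and by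
        \<open>- t * g\<close> cannot lower \<open>F\<close> by more than \<open>t * t\<close>;
        dividing by \<open>t\<close> bounds the derivative of \<open>F\<close> at \<open>f n\<close>
        in direction \<open>g\<close>.\<close>
      define t :: real where "t = (1/2)^n"
      have t: "0 < t" "(1/4)^n = t * t" by (simp_all add: t_def power_mult_distrib[symmetric])
      have "m <= F (\<lambda>x. 1 * f n x + s * g x)" for s by (rule m[OF Lipb_linear[OF f(1) g]])
      from this[of t] this[of "- t"] have "t * (2 * \<bar>(LINT x|\<mu>. f n x * g x) - \<phi> g\<bar>) <= t * (t * (G + 1))"
        using f(3)[of n] unfolding F_lin[OF f(1) g] t(2) by (auto simp: F_def G_def abs_if algebra_simps)
      then show ?thesis using t(1) by (simp add: t_def)
    qed
    show "(\<lambda>n. (1/2)^n * ((G + 1) / 2)) \<longlonglongrightarrow> 0" by (intro tendsto_mult_left_zero LIMSEQ_realpow_zero) auto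
  qed
  define d where "d n x = f (Suc n) x - f n x" for n x
  have di: "integrable \<mu> (d n)" for n unfolding d_def[abs_def] using int[OF f(1)] by simp
  have d1: "(LINT x|\<mu>. \<bar>d n x\<bar>) <= (4 + measure \<mu> (space \<mu>)) * (1/2)^n" for n
  proof -
    define t :: real where "t = (1/2)^n"
    have t: "0 < t" "(1/4)^n = t * t" by (simp_all add: t_def power_mult_distrib[symmetric])
    have dL: "d n \<in> Lipb" unfolding d_def[abs_def] using Lipb_linear[OF f(1,1), of 1 "Suc n" "-1" n] by simp
    have "(LINT x|\<mu>. d n x * d n x) = (LINT x|\<mu>. f (Suc n) x * f (Suc n) x - 2 * (f (Suc n) x * f n x) + f n x * f n x)"
      by (intro Bochner_Integration.integral_cong) (simp_all add: d_def algebra_simps)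
    also have "... = 2 * F (f (Suc n)) + 2 * F (f n) - 4 * F (\<lambda>x. 1/2 * f (Suc n) x + 1/2 * f n x)"
      using ii[OF f(1,1)] unfolding F_lin[OF f(1,1)] by (simp add: F_def)
    also have "... <= 4 * (t * t)"
      using f(3)[of n] f(3)[of "Suc n"] m[OF Lipb_linear[OF f(1,1), of "1/2" "Suc n" "1/2" n]] zero_le_square[of t]
      unfolding power_Suc t(2) by linarith
    finally have d2: "(LINT x|\<mu>. d n x * d n x) <= 4 * (t * t)" .
    have "(LINT x|\<mu>. \<bar>d n x\<bar>) <= (LINT x|\<mu>. d n x * d n x / t + t)"
    proof (intro integral_mono)
      fix x
      have "2 * (\<bar>d n x\<bar> * t) <= d n x * d n x + t * t" "0 <= \<bar>d n x\<bar> * t"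
        using zero_le_square[of "\<bar>d n x\<bar> - t"] t(1) by (simp_all add: algebra_simps abs_mult[symmetric])
      then have "\<bar>d n x\<bar> * t <= d n x * d n x + t * t" by linarith
      then show "\<bar>d n x\<bar> <= d n x * d n x / t + t" using t(1) by (simp add: field_simps)
    qed (use di ii[OF dL dL] in auto)
    also have "... = (LINT x|\<mu>. d n x * d n x) / t + t * measure \<mu> (space \<mu>)" using ii[OF dL dL] by simp
    also have "... <= 4 * t + t * measure \<mu> (space \<mu>)" using d2 t(1) by (simp add: divide_le_eq)
    finally show ?thesis by (simp add: t_def algebra_simps)
  qed
  have "(\<integral>\<^sup>+ x. (\<Sum>n. ennreal \<bar>d n x\<bar>) \<partial>\<mu>) = (\<Sum>n. \<integral>\<^sup>+ x. ennreal \<bar>d n x\<bar> \<partial>\<mu>)"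
    using borel_measurable_integrable[OF di] by (intro nn_integral_suminf) auto
  also have "... = (\<Sum>n. ennreal (LINT x|\<mu>. \<bar>d n x\<bar>))" using di by (simp add: nn_integral_eq_integral)
  also have "... <= (\<Sum>n. ennreal ((4 + measure \<mu> (space \<mu>)) * (1/2)^n))" by (intro suminf_le ennreal_leI d1) simp_all
  also have "... < \<infinity>" by (subst suminf_ennreal2) (auto intro!: summable_mult)
  finally have "AE x in \<mu>. (\<Sum>n. ennreal \<bar>d n x\<bar>) ~= \<infinity>"
    using borel_measurable_integrable[OF di] by (intro nn_integral_PInf_AE) auto
  then have AEc: "AE x in \<mu>. convergent (\<lambda>n. f n x)"
  proof (rule eventually_mono)
    fix x assume "(\<Sum>n. ennreal \<bar>d n x\<bar>) ~= \<infinity>"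
    then have "summable (\<lambda>n. \<bar>d n x\<bar>)" by (intro summable_suminf_not_top) simp_all
    then have "summable (\<lambda>n. d n x)" by (rule summable_rabs_cancel)
    then have "convergent (\<lambda>n. \<Sum>i<n. d i x)" by (simp add: summable_iff_convergent)
    moreover have "(\<Sum>i<n. d i x) = f n x - f 0 x" for n unfolding d_def by (rule sum_lessThan_telescope)
    ultimately show "convergent (\<lambda>n. f n x)" by (simp add: convergent_diff_const_right_iff)
  qed
  \<comment> \<open>Off the set of convergence \<open>lim\<close> is arbitrary; clamping gives the
    bound by \<open>M\<close> at every point.\<close>
  define l where "l x = max (- M) (min M (lim (\<lambda>n. f n x)))" for x
  have fm: "f n \<in> borel_measurable borel" for n by (rule Lip_borel[OF Lipb_Lip[OF f(1)]])
  have lm: "l \<in> borel_measurable borel" unfolding l_def[abs_def] using fm by measurable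
  have fl: "(\<lambda>n. f n x) \<longlonglongrightarrow> l x" if "convergent (\<lambda>n. f n x)" for x
  proof -
    have c: "(\<lambda>n. f n x) \<longlonglongrightarrow> lim (\<lambda>n. f n x)" using that by (simp add: convergent_LIMSEQ_iff)
    have "lim (\<lambda>n. f n x) <= M" "- M <= lim (\<lambda>n. f n x)"
      by (rule LIMSEQ_le_const2[OF c] LIMSEQ_le_const[OF c], use f(2) in \<open>auto simp: abs_le_iff minus_le_iff\<close>)+
    then show ?thesis using c by (simp add: l_def)
  qed
  have "\<phi> g = (LINT x|\<mu>. g x * l x)" if g: "g \<in> Lipb" for g
  proof -
    have "(\<lambda>n. LINT x|\<mu>. f n x * g x) \<longlonglongrightarrow> (LINT x|\<mu>. l x * g x)"
    proof (rule integral_dominated_convergence[where w="\<lambda>x. M * \<bar>g x\<bar>"])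
      show "AE x in \<mu>. (\<lambda>n. f n x * g x) \<longlonglongrightarrow> l x * g x" using AEc by eventually_elim (intro tendsto_mult tendsto_const fl)
      show "(\<lambda>x. l x * g x) \<in> borel_measurable \<mu>" "(\<lambda>x. f n x * g x) \<in> borel_measurable \<mu>" for n
        using lm fm Lip_borel[OF Lipb_Lip[OF g]] unfolding measurable_cong_sets[OF \<mu>(1) refl] by measurable
    qed (use int[OF g] f(2) in \<open>auto simp: abs_mult intro!: mult_right_mono\<close>)
    from LIMSEQ_unique[OF conv[OF g] this] show ?thesis by (simp add: mult.commute)
  qed
  moreover have "\<bar>l x\<bar> <= M" for x using M by (auto simp: l_def)
  ultimately show ?thesis using that lm by blast
qed

section \<open>Densities of a current\<close>

lemma L1_bounded_mult_le:
  fixes f l :: "'a => real"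
  assumes f: "integrable M f" and l: "l \<in> borel_measurable M" and b: "\<And>x. \<bar>l x\<bar> <= B"
  shows "integrable M (\<lambda>x. f x * l x)" "\<bar>LINT x|M. f x * l x\<bar> <= B * (LINT x|M. \<bar>f x\<bar>)"
proof -
  have le: "\<bar>f x * l x\<bar> <= B * \<bar>f x\<bar>" for x
    using mult_left_mono[OF b[of x] abs_ge_zero[of "f x"]] by (simp add: abs_mult mult.commute)
  have i: "integrable M (\<lambda>x. B * \<bar>f x\<bar>)" by (rule integrable_mult_right[OF integrable_abs[OF f]])
  show fl: "integrable M (\<lambda>x. f x * l x)"
  proof (rule Bochner_Integration.integrable_bound[OF i])
    show "(\<lambda>x. f x * l x) \<in> borel_measurable M" using borel_measurable_integrable[OF f] l by measurable
    show "AE x in M. norm (f x * l x) <= norm (B * \<bar>f x\<bar>)"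
      by (rule AE_I2) (use le in \<open>simp add: order_trans[OF le abs_ge_self]\<close>)
  qed
  have "\<bar>LINT x|M. f x * l x\<bar> <= (LINT x|M. \<bar>f x * l x\<bar>)" by (rule integral_abs_bound)
  also have "... <= (LINT x|M. B * \<bar>f x\<bar>)"
    by (rule integral_mono[OF integrable_abs[OF fl] i le])
  finally show "\<bar>LINT x|M. f x * l x\<bar> <= B * (LINT x|M. \<bar>f x\<bar>)" by simp
qed

text \<open>For densities uniformly bounded by \<open>B\<close>, an L1 error in the test function
  costs at most \<open>B\<close> times that error, so convergence against the dense Lipschitz
  functions extends to all of L1.\<close>

lemma Lipb_weak_conv_L1:
  fixes \<mu> :: "'a::polish_space measure"
  assumes \<mu>: "sets \<mu> = sets borel" "finite_measure \<mu>"
    and m: "\<And>n. L n \<in> borel_measurable \<mu>" "l \<in> borel_measurable \<mu>"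
    and b: "\<And>n x. \<bar>L n x\<bar> <= B" "\<And>x. \<bar>l x\<bar> <= B"
    and conv: "\<And>f. f \<in> Lipb ==> (\<lambda>n. LINT x|\<mu>. f x * L n x) \<longlonglongrightarrow> (LINT x|\<mu>. f x * l x)"
    and h: "integrable \<mu> h"
  shows "(\<lambda>n. LINT x|\<mu>. h x * L n x) \<longlonglongrightarrow> (LINT x|\<mu>. h x * l x)"
proof (rule LIMSEQ_I)
  fix e :: real assume e: "0 < e"
  have B: "0 <= B" using b(2)[of undefined] by linarith
  define d where "d = e / (3 * (B + 1))"
  have d: "0 < d" using e B by (simp add: d_def)
  have Bd: "B * d < e / 3"
  proof -
    have "3 * (B + 1) * d = e" using B unfolding d_def by (intro nonzero_mult_div_cancel_left[of "3 * (B + 1)", unfolded times_divide_eq_right[symmetric]]) simp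
    then show ?thesis using d by (simp add: algebra_simps)
  qed
  obtain f where f: "f \<in> Lipb" "(LINT x|\<mu>. \<bar>f x - h x\<bar>) < d" using Lipb_dense_L1[OF \<mu> h d] by blast
  have fi: "integrable \<mu> f" using Lipb_integrable[OF f(1) \<mu>(2,1)] .
  have close: "\<bar>(LINT x|\<mu>. f x * k x) - (LINT x|\<mu>. h x * k x)\<bar> < e / 3"
    if k: "k \<in> borel_measurable \<mu>" "\<And>x. \<bar>k x\<bar> <= B" for k
  proof -
    have "(LINT x|\<mu>. f x * k x) - (LINT x|\<mu>. h x * k x) = (LINT x|\<mu>. (f x - h x) * k x)"
      using L1_bounded_mult_le(1)[OF fi k] L1_bounded_mult_le(1)[OF h k] by (simp add: left_diff_distrib)
    also have "\<bar>...\<bar> <= B * (LINT x|\<mu>. \<bar>f x - h x\<bar>)"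
      by (rule L1_bounded_mult_le(2)[OF Bochner_Integration.integrable_diff[OF fi h] k])
    also have "... <= B * d" using f(2) B by (intro mult_left_mono) auto
    finally show ?thesis using Bd by linarith
  qed
  obtain N where N: "\<And>n. n >= N ==> \<bar>(LINT x|\<mu>. f x * L n x) - (LINT x|\<mu>. f x * l x)\<bar> < e / 3"
    using LIMSEQ_D[OF conv[OF f(1)], of "e/3"] e by auto
  have "norm ((LINT x|\<mu>. h x * L n x) - (LINT x|\<mu>. h x * l x)) < e" if "n >= N" for n
    using N[OF that] close[OF m(1) b(1), of n] close[OF m(2) b(2)] unfolding real_norm_def by linarith
  then show "\<exists>no. \<forall>n\<ge>no. norm ((LINT x|\<mu>. h x * L n x) - (LINT x|\<mu>. h x * l x)) < e" by blast
qed

lemma integrable_bounded_borel: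
  fixes \<mu> :: "'a::topological_space measure" and l :: "'a => real"
  assumes "sets \<mu> = sets borel" "finite_measure \<mu>" "l \<in> borel_measurable borel" "\<And>x. \<bar>l x\<bar> <= B"
  shows "integrable \<mu> l"
  using assms by (intro finite_measure.integrable_const_bound[where B=B]) (simp_all add: measurable_cong_sets[OF assms(1) refl])

lemma Lipb_density_unique:
  fixes \<mu> :: "'a::polish_space measure"
  assumes \<mu>: "sets \<mu> = sets borel" "finite_measure \<mu>"
    and m: "k \<in> borel_measurable borel" "l \<in> borel_measurable borel"
    and b: "\<And>x. \<bar>k x\<bar> <= B" "\<And>x. \<bar>l x\<bar> <= C"
    and eq: "\<And>f. f \<in> Lipb ==> (LINT x|\<mu>. f x * k x) = (LINT x|\<mu>. f x * l x)"
  shows "AE x in \<mu>. k x = l x"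
proof -
  have m': "k \<in> borel_measurable \<mu>" "l \<in> borel_measurable \<mu>"
    using m measurable_cong_sets[OF \<mu>(1) refl] by blast+
  have b': "\<bar>k x\<bar> <= max B C" "\<bar>l x\<bar> <= max B C" for x using b[of x] by auto
  \<comment> \<open>Weak convergence of a constant sequence is equality of integrals; this carries
    \<open>eq\<close> over from Lipschitz to integrable test functions.\<close>
  have "(LINT x|\<mu>. h x * k x) = (LINT x|\<mu>. h x * l x)" if h: "integrable \<mu> h" for h
    using Lipb_weak_conv_L1[OF \<mu> m' b' _ h] eq by (simp add: LIMSEQ_const_iff)
  moreover have "integrable \<mu> (indicat_real A)" if "A \<in> sets \<mu>" for A
    using that finite_measure.emeasure_finite[OF \<mu>(2)] by (intro integrable_real_indicator) (auto simp: less_top[symmetric])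
  ultimately have e: "(LINT x|\<mu>. indicator A x * k x) = (LINT x|\<mu>. indicator A x * l x)" if "A \<in> sets \<mu>" for A
    using that by blast
  have i: "integrable \<mu> k" "integrable \<mu> l"
    using integrable_bounded_borel[OF \<mu> m(1) b(1)] integrable_bounded_borel[OF \<mu> m(2) b(2)] by auto
  have "AE x in \<mu>. k x <= l x" "AE x in \<mu>. l x <= k x"
    by (rule AE_le_if_set_integrals_le[OF i] AE_le_if_set_integrals_le[OF i(2,1)], simp add: e)+
  then show ?thesis by eventually_elim simp
qed

definition lip_operator :: "'a::metric_space measure => real => (('a => real) => 'a => real) => bool" where
  "lip_operator \<mu> B D \<longleftrightarrow>
     (\<forall>f\<in>Lip. D f \<in> borel_measurable borel \<and> (\<forall>x. \<bar>D f x\<bar> <= B * lip_const f)) \<and>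
     (\<forall>f\<in>Lip. \<forall>g\<in>Lip. \<forall>a b. AE x in \<mu>. D (\<lambda>x. a * f x + b * g x) x = a * D f x + b * D g x) \<and>
     (\<forall>f\<in>Lip. \<forall>g\<in>Lip. AE x in \<mu>. f x = g x --> D f x = D g x) \<and>
     (\<forall>fs f h. wstar_conv fs f \<and> integrable \<mu> h -->
        (\<lambda>n. LINT x|\<mu>. h x * D (fs n) x) \<longlonglongrightarrow> (LINT x|\<mu>. h x * D f x))"

lemma lip_operatorD:
  assumes "lip_operator \<mu> B D"
  shows "f \<in> Lip ==> D f \<in> borel_measurable borel"
    and "f \<in> Lip ==> \<bar>D f x\<bar> <= B * lip_const f"
    and "f \<in> Lip ==> g \<in> Lip ==> AE x in \<mu>. D (\<lambda>x. a * f x + b * g x) x = a * D f x + b * D g x"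
    and "f \<in> Lip ==> g \<in> Lip ==> (\<And>x. x \<in> A ==> f x = g x) ==> AE x in \<mu>. x \<in> A --> D f x = D g x"
    and "wstar_conv fs f ==> integrable \<mu> h ==> (\<lambda>n. LINT x|\<mu>. h x * D (fs n) x) \<longlonglongrightarrow> (LINT x|\<mu>. h x * D f x)"
proof -
  note * = assms[unfolded lip_operator_def]
  note 1 = *[THEN conjunct1] and 2 = *[THEN conjunct2, THEN conjunct1]
    and 3 = *[THEN conjunct2, THEN conjunct2, THEN conjunct1] and 4 = *[THEN conjunct2, THEN conjunct2, THEN conjunct2]
  show "D f \<in> borel_measurable borel" if "f \<in> Lip" using 1 that by blast
  show "\<bar>D f x\<bar> <= B * lip_const f" if "f \<in> Lip" using 1 that by blast
  show "AE x in \<mu>. D (\<lambda>x. a * f x + b * g x) x = a * D f x + b * D g x" if "f \<in> Lip" "g \<in> Lip"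
    using 2 that by blast
  show "AE x in \<mu>. x \<in> A --> D f x = D g x" if "f \<in> Lip" "g \<in> Lip" "\<And>x. x \<in> A ==> f x = g x"
    using 3[THEN bspec, OF that(1), THEN bspec, OF that(2)] by eventually_elim (simp add: that(3))
  show "(\<lambda>n. LINT x|\<mu>. h x * D (fs n) x) \<longlonglongrightarrow> (LINT x|\<mu>. h x * D f x)" if "wstar_conv fs f" "integrable \<mu> h"
    using 4 that by blast
qed

definition Lips :: "('k => 'a::metric_space => real) => bool" where
  "Lips \<pi> \<longleftrightarrow> (\<forall>i. \<pi> i \<in> Lip)"

lemma LipsD: "Lips \<pi> ==> \<pi> i \<in> Lip"
  by (simp add: Lips_def)

lemma Lips_upd: "Lips \<pi> ==> f \<in> Lip ==> Lips (\<pi>(i := f))"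
  by (simp add: Lips_def)

lemma forms_iff: "(f, \<pi>) \<in> forms \<longleftrightarrow> f \<in> Lipb \<and> Lips \<pi>"
  by (simp add: forms_def Lips_def)

abbreviation lip_prod :: "('k::finite => 'a::metric_space => real) => real" where
  "lip_prod \<pi> \<equiv> \<Prod>i\<in>UNIV. lip_const (\<pi> i)"

lemma lip_prod_nonneg: "Lips \<pi> ==> 0 <= lip_prod \<pi>"
  using lip_const_nonneg[OF LipsD] by (auto intro!: prod_nonneg)

text \<open>The density with respect to \<open>\<mu>\<close> of the signed measure that
  \<open>T\<close> represents when the coordinates are fixed. The representative is chosen to be
  bounded at every point, not just almost everywhere.\<close>

definition cur_dens :: "(('a::metric_space => real) => ('k::finite => 'a => real) => real) => 'a measure =>
    ('k => 'a => real) => 'a => real" where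
  "cur_dens T \<mu> \<pi> = (SOME l. l \<in> borel_measurable borel \<and> (\<forall>x. \<bar>l x\<bar> <= lip_prod \<pi>) \<and>
     (\<forall>f\<in>Lipb. T f \<pi> = (LINT x|\<mu>. f x * l x)))"

text \<open>\<open>\<mu>\<close> is any measure that bounds the mass, because densities are already
  used to construct the minimal one. Afterwards everything is applied again with
  \<open>mass T\<close>.\<close>

locale current_with_mass =
  fixes T :: "('a::polish_space => real) => ('k::finite => 'a => real) => real" and \<mu> :: "'a measure"
  assumes current: "metric_current T" and mass_bound: "mass_bound T \<mu>"
begin

abbreviation "dens \<equiv> cur_dens T \<mu>"

lemma sets_mu: "sets \<mu> = sets borel" and finite_mu: "finite_measure \<mu>"
  using mass_bound by (auto simp: mass_bound_def finite_radon_def)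

lemma measurable_mu: "f \<in> borel_measurable borel ==> f \<in> borel_measurable \<mu>"
  using measurable_cong_sets[OF sets_mu refl] by blast

lemma mass_boundD: "f \<in> Lipb ==> Lips \<pi> ==> \<bar>T f \<pi>\<bar> <= lip_prod \<pi> * (LINT x|\<mu>. \<bar>f x\<bar>)"
  using mass_bound by (auto simp: mass_bound_def forms_iff)

lemma linear_fst: "f \<in> Lipb ==> g \<in> Lipb ==> Lips \<pi> ==> T (\<lambda>x. a * f x + b * g x) \<pi> = a * T f \<pi> + b * T g \<pi>"
  using current[unfolded metric_current_def multilinear_functional_def] forms_iff[of f \<pi>] by fast

lemma linear_slot:
  assumes "h \<in> Lipb" "Lips \<pi>" "f \<in> Lip" "g \<in> Lip"
  shows "T h (\<pi>(i := \<lambda>x. a * f x + b * g x)) = a * T h (\<pi>(i := f)) + b * T h (\<pi>(i := g))"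
proof -
  have "(h, \<pi>(i := f)) \<in> forms" using assms by (simp add: forms_iff Lips_upd)
  then have "T h ((\<pi>(i := f))(i := \<lambda>x. a * (\<pi>(i := f)) i x + b * g x)) = a * T h (\<pi>(i := f)) + b * T h ((\<pi>(i := f))(i := g))"
    using current assms(4) unfolding metric_current_def multilinear_functional_def by fast
  then show ?thesis by simp
qed

lemma cur_dens:
  assumes "Lips \<pi>"
  shows "dens \<pi> \<in> borel_measurable borel"
    and "\<bar>dens \<pi> x\<bar> <= lip_prod \<pi>"
    and "f \<in> Lipb ==> T f \<pi> = (LINT x|\<mu>. f x * dens \<pi> x)"
proof -
  have "\<exists>l. l \<in> borel_measurable borel \<and> (\<forall>x. \<bar>l x\<bar> <= lip_prod \<pi>) \<and>
     (\<forall>f\<in>Lipb. T f \<pi> = (LINT x|\<mu>. f x * l x))"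
  proof -
    show ?thesis
      by (rule bounded_functional_density[OF sets_mu finite_mu, of "\<lambda>f. T f \<pi>", OF linear_fst[OF _ _ assms] mass_boundD[OF _ assms] lip_prod_nonneg[OF assms]])
        blast+
  qed
  from someI_ex[OF this] show "dens \<pi> \<in> borel_measurable borel"
    "\<bar>dens \<pi> x\<bar> <= lip_prod \<pi>"
    "f \<in> Lipb ==> T f \<pi> = (LINT x|\<mu>. f x * dens \<pi> x)"
    unfolding cur_dens_def by blast+
qed

lemma cur_dens_cong:
  assumes "Lips \<pi>" "l \<in> borel_measurable borel" "\<And>x. \<bar>l x\<bar> <= B"
    "\<And>f. f \<in> Lipb ==> T f \<pi> = (LINT x|\<mu>. f x * l x)"
  shows "AE x in \<mu>. dens \<pi> x = l x"
  by (rule Lipb_density_unique[OF sets_mu finite_mu cur_dens(1)[OF assms(1)] assms(2) cur_dens(2)[OF assms(1)] assms(3)])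
    (use cur_dens(3)[OF assms(1)] assms(4) in simp)

lemma cur_dens_linear:
  assumes "Lips \<pi>" "f \<in> Lip" "g \<in> Lip"
  shows "AE x in \<mu>. dens (\<pi>(i := \<lambda>x. a * f x + b * g x)) x =
    a * dens (\<pi>(i := f)) x + b * dens (\<pi>(i := g)) x"
proof -
  have F: "Lips (\<pi>(i := f))" and G: "Lips (\<pi>(i := g))" and H: "Lips (\<pi>(i := \<lambda>x. a * f x + b * g x))"
    using assms Lip_linear(1)[OF assms(2,3), of a b] by (simp_all add: Lips_upd)
  let ?k = "dens (\<pi>(i := f))" and ?l = "dens (\<pi>(i := g))"
  let ?B = "\<bar>a\<bar> * lip_prod (\<pi>(i := f)) + \<bar>b\<bar> * lip_prod (\<pi>(i := g))"
  show ?thesis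
  proof (rule cur_dens_cong[where B="?B"])
    show "(\<lambda>x. a * ?k x + b * ?l x) \<in> borel_measurable borel"
      using cur_dens(1)[OF F] cur_dens(1)[OF G] by measurable
    show "\<bar>a * ?k x + b * ?l x\<bar> <= ?B" for x
      using mult_left_mono[OF cur_dens(2)[OF F, of x], of "\<bar>a\<bar>"] mult_left_mono[OF cur_dens(2)[OF G, of x], of "\<bar>b\<bar>"]
        abs_triangle_ineq[of "a * ?k x" "b * ?l x"] unfolding abs_mult by simp
    fix h :: "'a => real" assume h: "h \<in> Lipb"
    have hi: "integrable \<mu> h" using Lipb_integrable[OF h finite_mu sets_mu] .
    have "T h (\<pi>(i := \<lambda>x. a * f x + b * g x)) = a * (LINT x|\<mu>. h x * ?k x) + b * (LINT x|\<mu>. h x * ?l x)"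
      using linear_slot[OF h assms] cur_dens(3)[OF F h] cur_dens(3)[OF G h] by simp
    also have "... = (LINT x|\<mu>. a * (h x * ?k x) + b * (h x * ?l x))"
      using L1_bounded_mult_le(1)[OF hi measurable_mu[OF cur_dens(1)[OF F]] cur_dens(2)[OF F]]
        L1_bounded_mult_le(1)[OF hi measurable_mu[OF cur_dens(1)[OF G]] cur_dens(2)[OF G]] by simp
    finally show "T h (\<pi>(i := \<lambda>x. a * f x + b * g x)) = (LINT x|\<mu>. h x * (a * ?k x + b * ?l x))"
      by (simp add: algebra_simps)
  qed (rule H)
qed

lemma cur_dens_alternating:
  assumes "Lips \<pi>" "i ~= j" "\<pi> i = \<pi> j"
  shows "AE x in \<mu>. dens \<pi> x = 0"
proof (rule cur_dens_cong[where B=0])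
  fix f :: "'a => real" assume "f \<in> Lipb"
  then have "(f, \<pi>) \<in> forms" using assms by (simp add: forms_iff)
  then have "T f \<pi> = 0"
    using current assms(2,3) unfolding metric_current_def alternating_functional_def by fast
  then show "T f \<pi> = (LINT x|\<mu>. f x * 0)" by simp
qed (use assms in auto)

lemma prod_upd:
  fixes \<pi> :: "'k => 'a => real"
  shows "lip_prod (\<pi>(i := f)) = lip_const f * (\<Prod>j\<in>UNIV - {i}. lip_const (\<pi> j))"
  by (subst prod.remove[of _ i]) (auto intro!: prod.cong)

lemma cur_dens_weak_conv:
  assumes \<pi>: "Lips \<pi>" and w: "wstar_conv fs f" and h: "integrable \<mu> h"
  shows "(\<lambda>n. LINT x|\<mu>. h x * dens (\<pi>(i := fs n)) x) \<longlonglongrightarrow> (LINT x|\<mu>. h x * dens (\<pi>(i := f)) x)"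
proof -
  have fs: "\<And>n. fs n \<in> Lip" and f: "f \<in> Lip" and bd: "bdd_above (range (\<lambda>n. lip_const (fs n)))"
    using w by (auto simp: wstar_conv_def)
  have F: "Lips (\<pi>(i := fs n))" and G: "Lips (\<pi>(i := f))" for n using \<pi> fs f by (simp_all add: Lips_upd)
  obtain L where L: "\<And>n. lip_const (fs n) <= L" using bd by (auto simp: bdd_above_def)
  define P where "P = (\<Prod>j\<in>UNIV - {i}. lip_const (\<pi> j))"
  have P: "0 <= P" unfolding P_def using lip_const_nonneg[OF LipsD[OF \<pi>]] by (intro prod_nonneg) blast
  define B where "B = max L (lip_const f) * P"
  have b1: "\<bar>dens (\<pi>(i := fs n)) x\<bar> <= B" for n x
  proof -
    have "\<bar>dens (\<pi>(i := fs n)) x\<bar> <= lip_const (fs n) * P"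
      using cur_dens(2)[OF F, of n x] unfolding prod_upd P_def .
    also have "... <= B" unfolding B_def using L[of n] P by (intro mult_right_mono) auto
    finally show ?thesis .
  qed
  have b2: "\<bar>dens (\<pi>(i := f)) x\<bar> <= B" for x
  proof -
    have "\<bar>dens (\<pi>(i := f)) x\<bar> <= lip_const f * P"
      using cur_dens(2)[OF G, of x] unfolding prod_upd P_def .
    also have "... <= B" unfolding B_def using P by (intro mult_right_mono) auto
    finally show ?thesis .
  qed
  show ?thesis
  proof (rule Lipb_weak_conv_L1[OF sets_mu finite_mu measurable_mu[OF cur_dens(1)[OF F]] measurable_mu[OF cur_dens(1)[OF G]] b1 b2 _ h])
    fix g :: "'a => real" assume g: "g \<in> Lipb"
    have c: "wstar_conv (\<lambda>n. k) k" if "k \<in> Lip" for k :: "'a => real"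
      using that by (auto simp: wstar_conv_def)
    have "wstar_conv (\<lambda>n. (\<pi>(i := fs n)) j) ((\<pi>(i := f)) j)" for j
      using w c[OF LipsD[OF \<pi>]] by (cases "j = i") auto
    then have "(\<lambda>n. T g (\<pi>(i := fs n))) \<longlonglongrightarrow> T g (\<pi>(i := f))"
      using current g c[OF Lipb_Lip[OF g]] unfolding metric_current_def wstar_continuous_functional_def
      by (elim conjE allE[of _ "\<lambda>_. g"] allE[of _ g] allE[of _ "\<lambda>n. \<pi>(i := fs n)"] allE[of _ "\<pi>(i := f)"]) auto
    then show "(\<lambda>n. LINT x|\<mu>. g x * dens (\<pi>(i := fs n)) x) \<longlonglongrightarrow> (LINT x|\<mu>. g x * dens (\<pi>(i := f)) x)"
      unfolding cur_dens(3)[OF F g] cur_dens(3)[OF G g] .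
  qed
qed

text \<open>The axiom of locality concerns functions constant on the open set where the test
  function does not vanish, whereas the zero set of \<open>u\<close> is only closed. The
  modification \<open>un n\<close> vanishes where \<open>\<bar>u\<bar>\<close> is at most
  \<open>1 / (n + 1)\<close>, so it is constant where a narrow \<open>bump\<close> is nonzero. The
  limit in \<open>m\<close> shrinks the bump to the zero set, and weak* continuity returns from
  \<open>un n\<close> to \<open>u\<close>.\<close>

lemma cur_dens_zero_level:
  assumes \<pi>: "Lips \<pi>" and u: "u \<in> Lip"
  shows "AE x in \<mu>. u x = 0 --> dens (\<pi>(i := u)) x = 0"
proof -
  define \<beta> where "\<beta> n t = t - max (- 1 / real (Suc n)) (min t (1 / real (Suc n)))" for n t
  have \<beta>L: "2-lipschitz_on UNIV (\<beta> n)" for n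
  proof (rule lipschitz_on_real_absI)
    have "\<bar>(x - max (- e) (min x e)) - (y - max (- e) (min y e))\<bar> <= 2 * \<bar>x - y\<bar>" if "0 <= e" for x y e :: real
      using that by (simp add: min_def max_def abs_if)
    from this[of "1 / real (Suc n)"] show "\<bar>\<beta> n x - \<beta> n y\<bar> <= 2 * dist x y" for x y
      by (simp add: \<beta>_def dist_real_def)
  qed simp
  define un where "un n x = \<beta> n (u x)" for n x
  have un: "un n \<in> Lip" "lip_const (un n) <= 2 * lip_const u" for n
    unfolding un_def[abs_def] using Lip_comp[OF u \<beta>L] by auto
  have "(\<lambda>n. un n x) \<longlonglongrightarrow> u x" for x
  proof (rule LIM_zero_cancel, rule LIMSEQ_abs_le_zero)
    have "\<bar>(y - max (- e) (min y e)) - y\<bar> <= e" if "0 <= e" for y e :: real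
      using that by (simp add: min_def max_def abs_if)
    from this[of "1 / real (Suc n)" "u x" for n] show "\<bar>un n x - u x\<bar> <= 1 / real (Suc n)" for n by (simp add: un_def \<beta>_def)
  qed (rule LIMSEQ_inverse_real_of_nat[unfolded inverse_eq_divide])
  with un have w: "wstar_conv un u"
    by (intro wstar_conv_lipschitz(2)[of "2 * lip_const u"] lipschitz_on_le[OF lipschitz_on_lip_const])
  have U: "Lips (\<pi>(i := un n))" and G: "Lips (\<pi>(i := u))" for n using \<pi> un u by (simp_all add: Lips_upd)
  let ?Z = "{x. u x = 0}"
  have Z: "?Z \<in> sets borel" using measurable_sets[OF Lip_borel[OF u], of "{0}"] by (simp add: vimage_def)
  have ib: "integrable \<mu> (\<lambda>x. h x * indicator ?Z x)" if h: "h \<in> Lipb" for h :: "'a => real"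
    using integrable_mult_indicator[OF _ Lipb_integrable[OF h finite_mu sets_mu]] Z sets_mu by (simp add: mult.commute)
  have zero: "(LINT x|\<mu>. (h x * indicator ?Z x) * dens (\<pi>(i := un n)) x) = 0" if h: "h \<in> Lipb" for h n
  proof -
    obtain H where H: "0 <= H" "\<And>x. \<bar>h x\<bar> <= H" using Lipb_bound[OF h] by metis
    have hb: "(\<lambda>x. h x * bump u m x) \<in> Lipb" for m by (rule Lipb_mult[OF h bump_Lipb[OF u]])
    have hm: "(\<lambda>x. h x * bump u m x) \<in> borel_measurable \<mu>" "dens (\<pi>(i := un n)) \<in> borel_measurable \<mu>" for m
      by (rule measurable_mu[OF Lip_borel[OF Lipb_Lip[OF hb]]] measurable_mu[OF cur_dens(1)[OF U]])+
    have "(\<lambda>m. LINT x|\<mu>. h x * bump u m x * dens (\<pi>(i := un n)) x) \<longlonglongrightarrow> (LINT x|\<mu>. h x * indicator ?Z x * dens (\<pi>(i := un n)) x)"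
    proof (rule integral_dominated_convergence[where w="\<lambda>x. H * 1 * lip_prod (\<pi>(i := un n))"])
      show "AE x in \<mu>. norm (h x * bump u m x * dens (\<pi>(i := un n)) x) <= H * 1 * lip_prod (\<pi>(i := un n))" for m
        unfolding real_norm_def abs_mult
        using H cur_dens(2)[OF U] by (intro AE_I2 mult_mono) (auto simp: bump_bounds)
    qed (use hm borel_measurable_integrable[OF ib[OF h]] finite_measure.integrable_const[OF finite_mu] in \<open>auto intro!: AE_I2 tendsto_mult bump_tendsto_indicator\<close>)
    \<comment> \<open>The bump is nonzero only where \<open>m * \<bar>u\<bar> < 1\<close>, and for
      \<open>m > n\<close> this set lies inside the zero set of \<open>un n\<close>.\<close>
    moreover have "(LINT x|\<mu>. h x * bump u m x * dens (\<pi>(i := un n)) x) = 0" if m: "Suc n <= m" for m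
    proof -
      have "un n x = 0" if "h x * bump u m x ~= 0" for x
      proof -
        have "real (Suc n) * \<bar>u x\<bar> <= real m * \<bar>u x\<bar>" using m by (intro mult_right_mono) auto
        also have "... < 1" using that by (auto simp: bump_def max_def split: if_splits)
        finally have "\<bar>u x\<bar> < 1 / real (Suc n)" by (simp add: field_simps)
        then show ?thesis by (auto simp: un_def \<beta>_def)
      qed
      then have "(\<pi>(i := un n)) i constant_on {x. h x * bump u m x ~= 0}" by (auto simp: constant_on_def)
      moreover have "((\<lambda>x. h x * bump u m x), \<pi>(i := un n)) \<in> forms" using hb U by (simp add: forms_iff)
      ultimately have "T (\<lambda>x. h x * bump u m x) (\<pi>(i := un n)) = 0"
        using current unfolding metric_current_def local_functional_def by fast
      then show ?thesis by (simp add: cur_dens(3)[OF U hb])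
    qed
    then have "eventually (\<lambda>m. (LINT x|\<mu>. h x * bump u m x * dens (\<pi>(i := un n)) x) = 0) sequentially"
      by (auto simp: eventually_sequentially)
    then have "(\<lambda>m. LINT x|\<mu>. h x * bump u m x * dens (\<pi>(i := un n)) x) \<longlonglongrightarrow> 0" by (rule tendsto_eventually)
    ultimately show ?thesis by (rule LIMSEQ_unique)
  qed
  have "AE x in \<mu>. indicator ?Z x * dens (\<pi>(i := u)) x = (0::real)"
  proof (rule Lipb_density_unique[OF sets_mu finite_mu])
    show "(\<lambda>x. indicator ?Z x * dens (\<pi>(i := u)) x) \<in> borel_measurable borel"
      using Z cur_dens(1)[OF G] by measurable
    show "\<bar>indicator ?Z x * dens (\<pi>(i := u)) x\<bar> <= \<bar>lip_prod (\<pi>(i := u))\<bar>" for x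
      using cur_dens(2)[OF G, of x] by (auto simp: indicator_def)
    show "(\<lambda>x. 0) \<in> borel_measurable borel" "\<And>x. \<bar>0\<bar> <= (0::real)" by auto
    show "(LINT x|\<mu>. h x * (indicator ?Z x * dens (\<pi>(i := u)) x)) = (LINT x|\<mu>. h x * 0)" if h: "h \<in> Lipb" for h
      using cur_dens_weak_conv[OF \<pi> w ib[OF h], of i] unfolding zero[OF h] by (simp add: LIMSEQ_const_iff mult.assoc)
  qed
  then show ?thesis by eventually_elim (simp add: indicator_def)
qed

lemma cur_dens_local:
  assumes "Lips \<pi>" "f \<in> Lip" "g \<in> Lip"
  shows "AE x in \<mu>. f x = g x --> dens (\<pi>(i := f)) x = dens (\<pi>(i := g)) x"
  using cur_dens_zero_level[OF assms(1) Lip_linear(1)[OF assms(2,3), of 1 "-1"], of i] cur_dens_linear[OF assms, of i 1 "-1"]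
  by eventually_elim simp

lemma lip_operator_cur_dens:
  assumes \<pi>: "Lips \<pi>" and le1: "\<And>i. lip_const (\<pi> i) <= 1"
  shows "lip_operator \<mu> 1 (\<lambda>f. dens (\<pi>(i := f)))"
  unfolding lip_operator_def
proof (intro conjI ballI allI impI)
  fix f :: "'a => real" assume f: "f \<in> Lip"
  have F: "Lips (\<pi>(i := f))" using \<pi> f by (rule Lips_upd)
  show "dens (\<pi>(i := f)) \<in> borel_measurable borel" by (rule cur_dens(1)[OF F])
  fix x
  have "\<bar>dens (\<pi>(i := f)) x\<bar> <= lip_const f * (\<Prod>j\<in>UNIV - {i}. lip_const (\<pi> j))"
    using cur_dens(2)[OF F, of x] unfolding prod_upd .
  also have "... <= lip_const f * 1"
    using le1 lip_const_nonneg[OF LipsD[OF \<pi>]] lip_const_nonneg[OF f] by (intro mult_left_mono prod_le_1) auto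
  finally show "\<bar>dens (\<pi>(i := f)) x\<bar> <= 1 * lip_const f" by simp
qed (auto intro!: cur_dens_linear \<pi> cur_dens_local cur_dens_weak_conv)

end

text \<open>Greedy choice: each step removes from the remainder a good set with at least half of the
  largest measure available. The measures of the chosen sets are summable, hence tend to zero, so a
  residue of positive measure would contain a good set that was too large to be passed over.\<close>

lemma exhaustion:
  assumes fin: "finite_measure M"
    and ex: "\<And>B. B \<in> sets M ==> 0 < measure M B ==> \<exists>S\<in>sets M. S \<subseteq> B \<and> 0 < measure M S \<and> G S"
  obtains S :: "nat => 'a set" where "disjoint_family S" "\<And>i. S i \<in> sets M" "\<And>i. S i = {} \<or> G (S i)"
    "emeasure M (space M - (\<Union>i. S i)) = 0"
proof -
  interpret finite_measure M by fact
  \<comment> \<open>The empty set is the default once the remainder contains no good set of positive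
    measure.\<close>
  have "\<exists>S\<in>sets M. S \<subseteq> R \<and> (S = {} \<or> G S) \<and> (\<forall>S'\<in>sets M. S' \<subseteq> R --> G S' --> measure M S' <= 2 * measure M S)" for R
  proof (cases "\<exists>S\<in>sets M. S \<subseteq> R \<and> G S \<and> 0 < measure M S")
    case False
    then show ?thesis by (intro bexI[of _ "{}"]) (auto simp: not_less)
  next
    case True
    define X where "X = measure M ` {S \<in> sets M. S \<subseteq> R \<and> G S}"
    have bdd: "bdd_above X" by (auto simp: X_def intro!: bdd_aboveI[of _ "measure M (space M)"] bounded_measure)
    obtain S0 where S0: "S0 \<in> sets M" "S0 \<subseteq> R" "G S0" "0 < measure M S0" using True by blast
    then have "0 < Sup X" using cSup_upper[OF _ bdd, of "measure M S0"] by (auto simp: X_def)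
    then have "Sup X / 2 < Sup X" by simp
    then obtain m where "m \<in> X" "Sup X / 2 < m"
      using less_cSup_iff[of X "Sup X / 2"] bdd S0 by (auto simp: X_def)
    then obtain S where S: "S \<in> sets M" "S \<subseteq> R" "G S" "Sup X / 2 < measure M S" by (auto simp: X_def)
    have "measure M S' <= 2 * measure M S" if "S' \<in> sets M" "S' \<subseteq> R" "G S'" for S'
      using cSup_upper[OF _ bdd, of "measure M S'"] that S(4) by (auto simp: X_def)
    then show ?thesis using S by blast
  qed
  then obtain pick where pick: "\<And>R. pick R \<in> sets M" "\<And>R. pick R \<subseteq> R" "\<And>R. pick R = {} \<or> G (pick R)"
    "\<And>R S'. S' \<in> sets M ==> S' \<subseteq> R ==> G S' ==> measure M S' <= 2 * measure M (pick R)" by metis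
  define R where "R = rec_nat (space M) (\<lambda>n R. R - pick R)"
  have R0: "R 0 = space M" and RS: "\<And>n. R (Suc n) = R n - pick (R n)" by (auto simp: R_def)
  define S where "S n = pick (R n)" for n
  have Ranti: "R n \<subseteq> R m" if "m <= n" for m n using that
    by (induction n rule: dec_induct) (auto simp: RS)
  have SR: "S n \<subseteq> R n" for n by (simp add: S_def pick)
  have disj: "disjoint_family S"
  proof -
    have "S m \<inter> S n = {}" if "m < n" for m n
      using Ranti[of "Suc m" n] that SR[of n] by (auto simp: RS S_def)
    then show ?thesis by (metis disjoint_family_on_def inf_commute linorder_neqE_nat)
  qed
  define Z where "Z = space M - (\<Union>i. S i)"
  have Sm: "S n \<in> sets M" for n by (simp add: S_def pick)
  have Z: "Z \<in> sets M" unfolding Z_def using Sm by auto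
  have ZR: "Z \<subseteq> R n" for n
  proof (induction n)
    case (Suc n) then show ?case by (auto simp: RS Z_def S_def)
  qed (auto simp: R0 Z_def)
  have "measure M Z = 0"
  proof (rule ccontr)
    assume "measure M Z ~= 0"
    then have "0 < measure M Z" by (simp add: zero_less_measure_iff)
    then obtain S' where S': "S' \<in> sets M" "S' \<subseteq> Z" "0 < measure M S'" "G S'" using ex[OF Z] by blast
    have ge: "measure M S' / 2 <= measure M (S n)" for n
      using pick(4)[OF S'(1) order_trans[OF S'(2) ZR[of n]] S'(4)] by (simp add: S_def)
    have "summable (\<lambda>n. measure M (S n))"
      using sums_summable[OF finite_measure_UNION[of S]] Sm disj by blast
    then have "(\<lambda>n. measure M (S n)) \<longlonglongrightarrow> 0" by (rule summable_LIMSEQ_zero)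
    then have "eventually (\<lambda>n. measure M (S n) < measure M S' / 2) sequentially"
      using S'(3) by (intro order_tendstoD(2)) auto
    then show False using ge by (auto simp: eventually_sequentially not_less[symmetric])
  qed
  then have "emeasure M (space M - (\<Union>i. S i)) = 0" by (simp add: Z_def emeasure_eq_measure)
  then show ?thesis using that[OF disj Sm] pick(3) by (auto simp: S_def)
qed

section \<open>Existence of the mass measure\<close>

lemma sum_measure_exists:
  assumes s: "sets M = sets N"
  shows "\<exists>\<xi>. sets \<xi> = sets M \<and> (\<forall>A\<in>sets M. emeasure \<xi> A = emeasure M A + emeasure N A)"
proof -
  define \<xi> where "\<xi> = measure_of (space M) (sets M) (\<lambda>A. emeasure M A + emeasure N A)"
  have "sets \<xi> = sets M" by (simp add: \<xi>_def)
  moreover have "emeasure \<xi> A = emeasure M A + emeasure N A" if A: "A \<in> sets M" for A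
    unfolding \<xi>_def
  proof (rule emeasure_measure_of_sigma)
    show "sigma_algebra (space M) (sets M)" by (rule sets.sigma_algebra_axioms)
    show "positive (sets M) (\<lambda>A. emeasure M A + emeasure N A)" by (simp add: positive_def)
    show "countably_additive (sets M) (\<lambda>A. emeasure M A + emeasure N A)"
      unfolding countably_additive_def
    proof (intro allI impI)
      fix B :: "nat => 'a set" assume B: "range B \<subseteq> sets M" "disjoint_family B" "(\<Union>i. B i) \<in> sets M"
      have "(\<Sum>i. emeasure M (B i) + emeasure N (B i)) = (\<Sum>i. emeasure M (B i)) + (\<Sum>i. emeasure N (B i))"
        by (rule suminf_add[symmetric]) simp_all
      also have "... = emeasure M (\<Union>i. B i) + emeasure N (\<Union>i. B i)"
        using B s by (simp add: suminf_emeasure)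
      finally show "(\<Sum>i. emeasure M (B i) + emeasure N (B i)) = emeasure M (\<Union>i. B i) + emeasure N (\<Union>i. B i)" .
    qed
  qed (rule A)
  ultimately show ?thesis by blast
qed

lemma integral_abs_mono_measure:
  fixes f :: "'a => real"
  assumes "sets M = sets N" "M <= N" "integrable N f"
  shows "integrable M f" "(LINT x|M. \<bar>f x\<bar>) <= (LINT x|N. \<bar>f x\<bar>)"
proof -
  have m: "f \<in> borel_measurable N" "f \<in> borel_measurable M"
    using borel_measurable_integrable[OF assms(3)] measurable_cong_sets[OF assms(1) refl] by blast+
  have le: "(\<integral>\<^sup>+x. ennreal \<bar>f x\<bar> \<partial>M) <= (\<integral>\<^sup>+x. ennreal \<bar>f x\<bar> \<partial>N)"
    using assms by (intro nn_integral_mono_measure)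
  have fin: "(\<integral>\<^sup>+x. ennreal \<bar>f x\<bar> \<partial>N) < \<infinity>" using integrableD(2)[OF integrable_abs[OF assms(3)]] by (simp add: less_top[symmetric])
  then show "integrable M f" using le m(2) by (intro integrableI_bounded) (auto intro: le_less_trans)
  show "(LINT x|M. \<bar>f x\<bar>) <= (LINT x|N. \<bar>f x\<bar>)"
    using m fin enn2real_mono[OF le] by (simp add: integral_eq_nn_integral)
qed

text \<open>The bound by \<open>\<mu>'\<close> is given for Lipschitz test functions, and the
  density refers to the other measure \<open>\<mu>\<close>. Approximating the indicator of
  \<open>B\<close> in L1 of the sum \<open>\<xi>\<close> of the two measures controls both errors at
  once.\<close>

lemma mass_bound_borel_le:
  assumes cm: "current_with_mass T \<mu>" and mb: "mass_bound T \<mu>'" and \<pi>: "Lips \<pi>" and B: "B \<in> sets borel"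
  shows "\<bar>LINT x|\<mu>. indicator B x * cur_dens T \<mu> \<pi> x\<bar> <= lip_prod \<pi> * measure \<mu>' B"
proof (rule field_le_epsilon)
  interpret current_with_mass T \<mu> by fact
  interpret M': current_with_mass T \<mu>' using mb current by unfold_locales
  interpret m': finite_measure \<mu>' by (rule M'.finite_mu)
  have P: "0 <= lip_prod \<pi>" by (rule lip_prod_nonneg[OF \<pi>])
  fix e :: real assume e: "0 < e"
  define d where "d = e / (2 * lip_prod \<pi> + 1)"
  have d: "0 < d" "lip_prod \<pi> * (2 * d) <= e" using e P by (simp_all add: d_def field_simps)
  obtain \<xi> where \<xi>: "sets \<xi> = sets \<mu>" "\<And>A. A \<in> sets \<mu> ==> emeasure \<xi> A = emeasure \<mu> A + emeasure \<mu>' A"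
    using sum_measure_exists[of \<mu> \<mu>'] sets_mu M'.sets_mu by metis
  have s: "sets \<mu> = sets \<xi>" "sets \<mu>' = sets \<xi>" "sets \<xi> = sets borel" using \<xi>(1) sets_mu M'.sets_mu by simp_all
  have fin: "finite_measure \<xi>"
    using \<xi> finite_measure.emeasure_finite[OF finite_mu] m'.emeasure_finite
    by (intro finite_measureI) (metis ennreal_add_eq_top infinity_ennreal_def sets.top)
  have le: "\<mu> <= \<xi>" "\<mu>' <= \<xi>" using s \<xi> by (simp_all add: le_measure)
  have i: "integrable \<xi> (indicat_real B)"
    using B s finite_measure.emeasure_finite[OF fin] by (intro integrable_real_indicator) (auto simp: less_top[symmetric])
  obtain f where f: "f \<in> Lipb" "(LINT x|\<xi>. \<bar>f x - indicator B x\<bar>) < d"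
    using Lipb_dense_L1[OF s(3) fin i d(1)] by blast
  have fi: "integrable \<xi> f" "integrable \<xi> (\<lambda>x. f x - indicator B x)" using Lipb_integrable[OF f(1) fin s(3)] i by simp_all
  note \<mu>i = integral_abs_mono_measure[OF s(1) le(1)] and \<mu>'i = integral_abs_mono_measure[OF s(2) le(2)]
  note il = L1_bounded_mult_le[OF _ measurable_mu[OF cur_dens(1)[OF \<pi>]] cur_dens(2)[OF \<pi>]]
  have "(LINT x|\<mu>'. \<bar>f x\<bar>) <= (LINT x|\<mu>'. indicator B x + \<bar>f x - indicator B x\<bar>)"
    using \<mu>'i(1)[OF i] \<mu>'i(1)[OF fi(1)] \<mu>'i(1)[OF fi(2)] by (intro integral_mono Bochner_Integration.integrable_add integrable_abs) (auto split: split_indicator)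
  also have "... <= measure \<mu>' B + d"
    using \<mu>'i(1)[OF i] \<mu>'i[OF fi(2)] f(2) B M'.sets_mu sets_eq_imp_space_eq[OF M'.sets_mu] by simp
  finally have "\<bar>T f \<pi>\<bar> <= lip_prod \<pi> * (measure \<mu>' B + d)"
    using M'.mass_boundD[OF f(1) \<pi>] P by (meson mult_left_mono order_trans)
  moreover have "\<bar>T f \<pi> - (LINT x|\<mu>. indicator B x * dens \<pi> x)\<bar> <= lip_prod \<pi> * d"
  proof -
    have "T f \<pi> - (LINT x|\<mu>. indicator B x * dens \<pi> x) = (LINT x|\<mu>. (f x - indicator B x) * dens \<pi> x)"
      using il(1)[OF \<mu>i(1)[OF fi(1)]] il(1)[OF \<mu>i(1)[OF i]] by (simp add: cur_dens(3)[OF \<pi> f(1)] left_diff_distrib)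
    also have "\<bar>...\<bar> <= lip_prod \<pi> * (LINT x|\<mu>. \<bar>f x - indicator B x\<bar>)" by (rule il(2)[OF \<mu>i(1)[OF fi(2)]])
    also have "... <= lip_prod \<pi> * d" using \<mu>i(2)[OF fi(2)] f(2) P by (intro mult_left_mono) auto
    finally show ?thesis .
  qed
  ultimately show "\<bar>LINT x|\<mu>. indicator B x * dens \<pi> x\<bar> <= lip_prod \<pi> * measure \<mu>' B + e"
    using d(2) by (simp add: distrib_left)
qed

text \<open>The minimal bound is the supremum, in the lattice of measures, of the normalized total
  variations \<open>\<nu> \<pi>\<close>. Each of them lies below every mass bound, by
  \<open>mass_bound_borel_le\<close> on the two sets where the density has a sign. Conversely a
  measure above all of them bounds the mass.\<close>

lemma mass_minimal_exists:
  fixes T :: "('a::polish_space => real) => ('k::finite => 'a => real) => real"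
  assumes "metric_current T"
  shows "\<exists>\<mu>. mass_bound T \<mu> \<and> (\<forall>\<mu>'. mass_bound T \<mu>' --> (\<forall>A \<in> sets borel. emeasure \<mu> A <= emeasure \<mu>' A))"
proof -
  obtain \<mu>0 where \<mu>0: "mass_bound T \<mu>0" using assms by (auto simp: metric_current_def finite_mass_def)
  have cm: "current_with_mass T \<mu>0" using assms \<mu>0 by unfold_locales
  interpret current_with_mass T \<mu>0 by (rule cm)
  interpret m: finite_measure \<mu>0 by (rule finite_mu)
  define \<nu> where "\<nu> \<pi> = density \<mu>0 (\<lambda>x. ennreal (\<bar>dens \<pi> x\<bar> / lip_prod \<pi>))" for \<pi>
  \<comment> \<open>The zero measure keeps \<open>S\<close> nonempty and pins down the space and the
    sigma-algebra of its supremum.\<close>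
  define S where "S = insert (density \<mu>0 (\<lambda>x. 0)) (\<nu> ` {\<pi>. Lips \<pi> \<and> 0 < lip_prod \<pi>})"
  have sp: "space \<mu>0 = UNIV" using sets_eq_imp_space_eq[OF sets_mu] by simp
  have le: "\<nu> \<pi> <= \<mu>'" if \<pi>: "Lips \<pi>" "0 < lip_prod \<pi>" and \<mu>': "mass_bound T \<mu>'" for \<pi> \<mu>'
  proof -
    interpret M': current_with_mass T \<mu>' using \<mu>' current by unfold_locales
    interpret m': finite_measure \<mu>' by (rule M'.finite_mu)
    note [measurable] = measurable_mu[OF cur_dens(1)[OF \<pi>(1)]]
    have "emeasure (\<nu> \<pi>) A <= emeasure \<mu>' A" if A: "A \<in> sets \<mu>0" for A
    proof -
      have Ab: "A \<in> sets borel" using A sets_mu by simp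
      define A1 where "A1 = {x \<in> A. 0 <= dens \<pi> x}"
      define A2 where "A2 = {x \<in> A. dens \<pi> x < 0}"
      have A12: "A1 \<in> sets borel" "A2 \<in> sets borel" "A = A1 \<union> A2" "A1 \<inter> A2 = {}"
        unfolding A1_def A2_def using Ab cur_dens(1)[OF \<pi>(1)] by (measurable, measurable, auto)
      have i: "integrable \<mu>0 (indicat_real A)" if "A \<in> sets borel" for A
        using that m.emeasure_finite sets_mu by (intro integrable_real_indicator) (auto simp: less_top[symmetric])
      note il = L1_bounded_mult_le(1)[OF i measurable_mu[OF cur_dens(1)[OF \<pi>(1)]] cur_dens(2)[OF \<pi>(1)]]
      have "(LINT x|\<mu>0. indicator A x * \<bar>dens \<pi> x\<bar>) =
          (LINT x|\<mu>0. indicator A1 x * dens \<pi> x - indicator A2 x * dens \<pi> x)"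
        by (intro Bochner_Integration.integral_cong) (auto simp: indicator_def A1_def A2_def)
      also have "... = (LINT x|\<mu>0. indicator A1 x * dens \<pi> x) - (LINT x|\<mu>0. indicator A2 x * dens \<pi> x)"
        by (intro Bochner_Integration.integral_diff il A12)
      also have "... <= lip_prod \<pi> * measure \<mu>' A1 + lip_prod \<pi> * measure \<mu>' A2"
        using mass_bound_borel_le[OF cm \<mu>' \<pi>(1) A12(1)] mass_bound_borel_le[OF cm \<mu>' \<pi>(1) A12(2)]  by linarith
      also have "... = lip_prod \<pi> * measure \<mu>' A"
        using A12 M'.sets_mu by (simp add: m'.finite_measure_Union distrib_left)
      finally have *: "(LINT x|\<mu>0. indicator A x * \<bar>dens \<pi> x\<bar>) <= lip_prod \<pi> * measure \<mu>' A" .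
      have ia: "integrable \<mu>0 (\<lambda>x. indicator A x * \<bar>dens \<pi> x\<bar>)"
        using integrable_abs[OF il[OF Ab]] by (simp add: abs_mult)
      have "emeasure (\<nu> \<pi>) A = (\<integral>\<^sup>+ x. ennreal (indicator A x * \<bar>dens \<pi> x\<bar> / lip_prod \<pi>) \<partial>\<mu>0)"
        unfolding \<nu>_def using A by (subst emeasure_density) (auto intro!: nn_integral_cong simp: indicator_def)
      also have "... = ennreal (LINT x|\<mu>0. indicator A x * \<bar>dens \<pi> x\<bar> / lip_prod \<pi>)"
        using ia \<pi>(2) by (intro nn_integral_eq_integral) auto
      also have "... <= ennreal (measure \<mu>' A)"
        using * \<pi>(2) by (intro ennreal_leI) (simp add: field_simps)
      also have "... = emeasure \<mu>' A" by (simp add: m'.emeasure_eq_measure)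
      finally show ?thesis .
    qed
    then show ?thesis
      by (subst le_measure) (auto simp: \<nu>_def sets_mu M'.sets_mu)
  qed
  have le0: "density \<mu>0 (\<lambda>x. 0) <= \<mu>'" if "mass_bound T \<mu>'" for \<mu>'
  proof -
    interpret M': current_with_mass T \<mu>' using that current by unfold_locales
    show ?thesis by (subst le_measure) (auto simp: sets_mu M'.sets_mu emeasure_density)
  qed
  define \<mu> where "\<mu> = Sup S"
  have ub: "\<mu> <= \<mu>'" if "mass_bound T \<mu>'" for \<mu>'
    unfolding \<mu>_def by (rule Sup_least) (use le le0 that in \<open>auto simp: S_def\<close>)
  have lb: "N <= \<mu>" if "N \<in> S" for N unfolding \<mu>_def using that by (rule Sup_upper)
  have z: "density \<mu>0 (\<lambda>x. 0) <= \<mu>" by (rule lb) (simp add: S_def)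
  have spm: "space \<mu> = space \<mu>0"
    using le_measureD1[OF z] le_measureD1[OF ub[OF \<mu>0]] by auto
  have setsm0: "sets \<mu> = sets \<mu>0"
    using le_measureD2[OF z] le_measureD2[OF ub[OF \<mu>0]] spm by auto
  then have setsm: "sets \<mu> = sets borel" using sets_mu by simp
  have eml: "emeasure \<mu> A <= emeasure \<mu>' A" if "mass_bound T \<mu>'" for \<mu>' A
  proof -
    interpret M': current_with_mass T \<mu>' using that current by unfold_locales
    show ?thesis by (rule le_measureD3[OF ub[OF that]]) (simp add: setsm M'.sets_mu)
  qed
  have fin: "finite_measure \<mu>"
    by (rule finite_measureI) (use eml[OF \<mu>0, of UNIV] m.emeasure_finite[of UNIV] spm sp in \<open>auto simp: top_unique\<close>)
  have "mass_bound T \<mu>"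
    unfolding mass_bound_def
  proof (intro conjI finite_radonI setsm fin ballI, clarsimp simp: forms_iff)
    fix f :: "'a => real" and \<pi> :: "'k => 'a => real" assume f: "f \<in> Lipb" and \<pi>: "Lips \<pi>"
    have P0: "0 <= lip_prod \<pi>" by (rule lip_prod_nonneg[OF \<pi>])
    have fi: "integrable \<mu>0 f" "integrable \<mu> f" using Lipb_integrable[OF f finite_mu sets_mu] Lipb_integrable[OF f fin setsm] .
    note lm = cur_dens(1,2)[OF \<pi>]
    note [measurable] = measurable_mu[OF lm(1)] borel_measurable_integrable[OF fi(1)]
    show "\<bar>T f \<pi>\<bar> <= lip_prod \<pi> * (LINT x|\<mu>. \<bar>f x\<bar>)"
    proof (cases "lip_prod \<pi> = 0")
      case True then show ?thesis using mass_boundD[OF f \<pi>] unfolding True by simp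
    next
      case False
      then have Pp: "0 < lip_prod \<pi>" using P0 by linarith
      have "\<bar>T f \<pi>\<bar> <= (LINT x|\<mu>0. \<bar>f x * dens \<pi> x\<bar>)"
        unfolding cur_dens(3)[OF \<pi> f] by (rule integral_abs_bound)
      also have "... = lip_prod \<pi> * (LINT x|\<mu>0. (\<bar>dens \<pi> x\<bar> / lip_prod \<pi>) * \<bar>f x\<bar>)"
        using Pp by (subst integral_mult_right_zero[symmetric]) (simp add: abs_mult mult.commute del: prod_zero_iff)
      also have "(LINT x|\<mu>0. (\<bar>dens \<pi> x\<bar> / lip_prod \<pi>) * \<bar>f x\<bar>) = (LINT x|\<nu> \<pi>. \<bar>f x\<bar>)"
        unfolding \<nu>_def using Pp by (subst integral_density) auto
      also have "... <= (LINT x|\<mu>. \<bar>f x\<bar>)"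
        using \<pi> Pp fi(2) by (intro integral_abs_mono_measure(2) lb) (auto simp: \<nu>_def setsm0 S_def)
      finally show ?thesis using Pp by simp
    qed
  qed
  then show ?thesis using eml by blast
qed

lemma mass_properties:
  fixes T :: "('a::polish_space => real) => ('k::finite => 'a => real) => real"
  assumes "metric_current T"
  shows "current_with_mass T (mass T)"
    and "mass_bound T \<mu>' ==> A \<in> sets borel ==> emeasure (mass T) A <= emeasure \<mu>' A"
proof -
  let ?Q = "\<lambda>\<mu>. mass_bound T \<mu> \<and> (\<forall>\<mu>'. mass_bound T \<mu>' --> (\<forall>A \<in> sets borel. emeasure \<mu> A <= emeasure \<mu>' A))"
  obtain \<mu> where \<mu>: "?Q \<mu>" using mass_minimal_exists[OF assms] by blast
  have s: "sets \<nu> = sets borel" if "mass_bound T \<nu>" for \<nu>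
    using that by (auto simp: mass_bound_def finite_radon_def)
  have "\<nu> = \<mu>" if \<nu>: "?Q \<nu>" for \<nu>
    by (rule measure_eqI) (use \<mu> \<nu> s in \<open>auto intro: antisym\<close>)
  then have "mass T = \<mu>" unfolding mass_def using \<mu> by (intro the_equality)
  then have "?Q (mass T)" using \<mu> by simp
  then show "current_with_mass T (mass T)" "mass_bound T \<mu>' ==> A \<in> sets borel ==> emeasure (mass T) A <= emeasure \<mu>' A"
    using assms by (auto simp: current_with_mass_def)
qed

section \<open>Coordinates with nonvanishing density\<close>

context current_with_mass
begin

lemma scale_slots:
  assumes f: "f \<in> Lipb" and \<pi>: "Lips \<pi>" and "finite F"
  shows "T f (\<lambda>i. if i \<in> F then (\<lambda>x. c i * \<pi> i x) else \<pi> i) = (\<Prod>i\<in>F. c i) * T f \<pi>"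
  using assms(3)
proof induction
  case (insert j F)
  let ?\<rho> = "\<lambda>i. if i \<in> F then (\<lambda>x. c i * \<pi> i x) else \<pi> i"
  have cl: "(\<lambda>x. c i * \<pi> i x) \<in> Lip" for i
    using Lip_linear(1)[OF LipsD[OF \<pi>] LipsD[OF \<pi>], of "c i" i 0 i] by simp
  have \<rho>: "Lips ?\<rho>" using cl LipsD[OF \<pi>] by (simp add: Lips_def)
  have "(\<lambda>i. if i \<in> insert j F then (\<lambda>x. c i * \<pi> i x) else \<pi> i) = ?\<rho>(j := \<lambda>x. c j * \<pi> j x + 0 * \<pi> j x)"
    using insert.hyps by (auto simp: fun_eq_iff)
  moreover have "T f (?\<rho>(j := \<lambda>x. c j * \<pi> j x + 0 * \<pi> j x)) = c j * T f (?\<rho>(j := \<pi> j)) + 0 * T f (?\<rho>(j := \<pi> j))"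
    by (rule linear_slot[OF f \<rho> LipsD[OF \<pi>] LipsD[OF \<pi>]])
  moreover have "?\<rho>(j := \<pi> j) = ?\<rho>" using insert.hyps by (auto simp: fun_eq_iff)
  ultimately show ?case using insert by simp
qed simp

text \<open>If the densities of all coordinates with Lipschitz constants at most 1 vanished on
  \<open>B\<close>, then the restriction of \<open>\<mu>\<close> to the complement of
  \<open>B\<close> would still bound the mass, against minimality. Rescaling the slots reduces
  arbitrary coordinates to these.\<close>

lemma nonvanishing:
  assumes min: "\<And>\<mu>' A. mass_bound T \<mu>' ==> A \<in> sets borel ==> emeasure \<mu> A <= emeasure \<mu>' A"
    and B: "B \<in> sets borel" "emeasure \<mu> B ~= 0"
  shows "\<exists>\<pi>. Lips \<pi> \<and> (\<forall>i. lip_const (\<pi> i) <= 1) \<and> \<not> (AE x in \<mu>. x \<in> B --> dens \<pi> x = 0)"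
proof (rule ccontr)
  assume neg: "\<not> ?thesis"
  let ?\<nu> = "density \<mu> (indicator (- B))"
  have Bc: "- B \<in> sets \<mu>" using B sets_mu by auto
  have fin: "finite_measure ?\<nu>"
    using finite_measure.finite_measure_restricted[OF finite_mu Bc] by (simp add: nn_integral_set_ennreal)
  have "mass_bound T ?\<nu>"
    unfolding mass_bound_def
  proof (intro conjI finite_radonI fin ballI, simp add: sets_mu, clarsimp simp: forms_iff)
    fix f :: "'a => real" and \<pi> :: "'k => 'a => real" assume f: "f \<in> Lipb" and \<pi>: "Lips \<pi>"
    \<comment> \<open>The summand 1 avoids a division by zero for constant coordinates.\<close>
    define c where "c i = 1 / (lip_const (\<pi> i) + 1)" for i
    have c: "0 < c i" "c i * lip_const (\<pi> i) <= 1" for i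
      using lip_const_nonneg[OF LipsD[OF \<pi>], of i] by (auto simp: c_def)
    define \<rho> where "\<rho> i = (\<lambda>x. c i * \<pi> i x)" for i
    have \<rho>L: "\<rho> i \<in> Lip" "lip_const (\<rho> i) <= c i * lip_const (\<pi> i)" for i
      using Lip_linear[OF LipsD[OF \<pi>] LipsD[OF \<pi>], of "c i" i 0 i] c(1)[of i] by (auto simp: \<rho>_def)
    then have \<rho>: "Lips \<rho>" by (simp add: Lips_def)
    have "lip_const (\<rho> i) <= 1" for i using \<rho>L(2)[of i] c(2)[of i] by linarith
    then have z: "AE x in \<mu>. x \<in> B --> dens \<rho> x = 0" using neg \<rho> by blast
    have T\<rho>: "T f \<rho> = (\<Prod>i\<in>UNIV. c i) * T f \<pi>" using scale_slots[OF f \<pi>, of UNIV c] by (simp add: \<rho>_def[abs_def])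
    have fm: "f \<in> borel_measurable \<mu>" by (rule measurable_mu[OF Lip_borel[OF Lipb_Lip[OF f]]])
    have fi: "integrable \<mu> (\<lambda>x. f x * indicator (- B) x)"
      using integrable_mult_indicator[OF Bc Lipb_integrable[OF f finite_mu sets_mu]] by (simp add: mult.commute)
    have "T f \<rho> = (LINT x|\<mu>. f x * dens \<rho> x)" by (rule cur_dens(3)[OF \<rho> f])
    also have "... = (LINT x|\<mu>. (f x * indicator (- B) x) * dens \<rho> x)"
    proof (rule integral_cong_AE)
      show "AE x in \<mu>. f x * dens \<rho> x = f x * indicator (- B) x * dens \<rho> x"
        using z by eventually_elim (auto simp: indicator_def)
    qed (use fm measurable_mu[OF cur_dens(1)[OF \<rho>]] Bc in measurable)
    finally have "\<bar>T f \<rho>\<bar> <= lip_prod \<rho> * (LINT x|\<mu>. \<bar>f x * indicator (- B) x\<bar>)"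
      using L1_bounded_mult_le(2)[OF fi measurable_mu[OF cur_dens(1)[OF \<rho>]] cur_dens(2)[OF \<rho>]] by simp
    also have "(LINT x|\<mu>. \<bar>f x * indicator (- B) x\<bar>) = (LINT x|?\<nu>. \<bar>f x\<bar>)"
    proof -
      have "(LINT x|density \<mu> (\<lambda>x. ennreal (indicat_real (- B) x)). \<bar>f x\<bar>) = (LINT x|\<mu>. indicat_real (- B) x *\<^sub>R \<bar>f x\<bar>)"
        using fm Bc by (intro integral_density) auto
      moreover have "(\<lambda>x. ennreal (indicat_real (- B) x)) = indicator (- B)" by (auto simp: indicator_def)
      ultimately show ?thesis by (simp add: abs_mult mult.commute)
    qed
    also have "lip_prod \<rho> * (LINT x|?\<nu>. \<bar>f x\<bar>) <= (\<Prod>i\<in>UNIV. c i * lip_const (\<pi> i)) * (LINT x|?\<nu>. \<bar>f x\<bar>)"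
      using \<rho>L lip_const_nonneg[OF \<rho>L(1)] by (intro mult_right_mono prod_mono) auto
    also have "... = (\<Prod>i\<in>UNIV. c i) * (lip_prod \<pi> * (LINT x|?\<nu>. \<bar>f x\<bar>))"
      by (simp add: prod.distrib)
    finally have "(\<Prod>i\<in>UNIV. c i) * \<bar>T f \<pi>\<bar> <= (\<Prod>i\<in>UNIV. c i) * (lip_prod \<pi> * (LINT x|?\<nu>. \<bar>f x\<bar>))"
      using c(1) by (simp add: T\<rho> abs_mult abs_prod less_imp_le)
    moreover have "0 < (\<Prod>i\<in>UNIV. c i)" using c(1) by (intro prod_pos) auto
    ultimately show "\<bar>T f \<pi>\<bar> <= lip_prod \<pi> * (LINT x|?\<nu>. \<bar>f x\<bar>)"
      by (rule mult_left_le_imp_le)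
  qed
  from min[OF this B(1)] have "emeasure \<mu> B <= 0"
    using Bc B sets_mu by (subst (asm) emeasure_density) (auto simp: indicator_inter_arith[symmetric])
  then show False using B(2) by simp
qed

end

lemma current_coordinates:
  fixes T :: "('a::polish_space => real) => ('k::finite => 'a => real) => real"
  assumes T: "metric_current T"
  obtains V :: "nat => 'a set" and \<pi> :: "nat => 'k => 'a => real" where
    "disjoint_family V" "\<And>j. V j \<in> sets borel" "emeasure (mass T) (UNIV - (\<Union>j. V j)) = 0"
    "\<And>j. Lips (\<pi> j)" "\<And>j i. lip_const (\<pi> j i) <= 1" "\<And>j x. x \<in> V j ==> cur_dens T (mass T) (\<pi> j) x ~= 0"
proof -
  interpret current_with_mass T "mass T" by (rule mass_properties(1)[OF T])
  define G where "G S \<longleftrightarrow> (\<exists>\<pi>::'k => 'a => real. Lips \<pi> \<and> (\<forall>i. lip_const (\<pi> i) <= 1) \<and> (\<forall>x\<in>S. dens \<pi> x ~= 0))" for S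
  have sp: "space (mass T) = UNIV" using sets_eq_imp_space_eq[OF sets_mu] by simp
  have ex: "\<exists>S\<in>sets (mass T). S \<subseteq> B \<and> 0 < measure (mass T) S \<and> G S" if B: "B \<in> sets (mass T)" "0 < measure (mass T) B" for B
  proof -
    have Bb: "B \<in> sets borel" using B sets_mu by simp
    have "emeasure (mass T) B ~= 0" using B(2) by (auto simp: measure_def)
    then obtain \<pi> where \<pi>: "Lips \<pi>" "\<forall>i. lip_const (\<pi> i) <= 1" "\<not> (AE x in mass T. x \<in> B --> dens \<pi> x = 0)"
      using nonvanishing[OF mass_properties(2)[OF T] Bb] by blast
    define S where "S = {x \<in> B. dens \<pi> x ~= 0}"
    have "S \<in> sets borel" unfolding S_def using Bb cur_dens(1)[OF \<pi>(1)] by measurable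
    then have S: "S \<in> sets (mass T)" by (simp add: sets_mu)
    have "{x \<in> space (mass T). \<not> (x \<in> B --> dens \<pi> x = 0)} = S" by (auto simp: S_def sp)
    then have "emeasure (mass T) S ~= 0"
      using \<pi>(3) AE_iff_measurable[OF S, of "\<lambda>x. x \<in> B --> dens \<pi> x = 0"] by simp
    then have "0 < measure (mass T) S"
      using finite_measure.emeasure_eq_measure[OF finite_mu] by (simp add: zero_less_measure_iff)
    then show ?thesis using S \<pi> by (intro bexI[of _ S]) (auto simp: S_def G_def)
  qed
  obtain V :: "nat => 'a set" where V: "disjoint_family V" "\<And>i. V i \<in> sets (mass T)" "\<And>i. V i = {} \<or> G (V i)"
    "emeasure (mass T) (space (mass T) - (\<Union>i. V i)) = 0"
    using exhaustion[OF finite_mu ex] by blast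
  \<comment> \<open>Members of the exhaustion may be empty, and they need coordinates as
    well.\<close>
  have "G {}"
    unfolding G_def by (intro exI[of _ "\<lambda>i x. 0"]) (simp add: Lips_def Lip_const)
  then have "G (V i)" for i using V(3)[of i] by metis
  then obtain \<pi> where "\<And>j. Lips (\<pi> j)" "\<And>j i. lip_const (\<pi> j i) <= 1" "\<And>j x. x \<in> V j ==> dens (\<pi> j) x ~= 0"
    unfolding G_def by metis
  then show ?thesis using that[of V \<pi>] V sets_mu sp by simp
qed

section \<open>Operators on Lipschitz functions and Weaver derivations\<close>

lemma lip_operator_const:
  assumes "lip_operator \<mu> B D" shows "D (\<lambda>x. c) x = 0"
  using lip_operatorD(2)[OF assms Lip_const(1), of c x] by (simp add: Lip_const)

lemma lip_operator_lincomb: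
  fixes D :: "'k::finite => ('a::metric_space => real) => 'a => real"
  assumes \<mu>: "sets \<mu> = sets borel" "finite_measure \<mu>" and D: "\<And>i. lip_operator \<mu> B (D i)"
  shows "lip_operator \<mu> ((\<Sum>i\<in>UNIV. \<bar>w i\<bar>) * B) (\<lambda>f x. \<Sum>i\<in>UNIV. w i * D i f x)"
  unfolding lip_operator_def
proof (intro conjI ballI allI impI)
  fix f :: "'a => real" assume f: "f \<in> Lip"
  note [measurable] = lip_operatorD(1)[OF D f]
  show "(\<lambda>x. \<Sum>i\<in>UNIV. w i * D i f x) \<in> borel_measurable borel" by measurable
  fix x
  have "\<bar>\<Sum>i\<in>UNIV. w i * D i f x\<bar> <= (\<Sum>i\<in>UNIV. \<bar>w i\<bar> * (B * lip_const f))"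
    using lip_operatorD(2)[OF D f, of _ x]
    by (intro order_trans[OF sum_abs] sum_mono) (auto simp: abs_mult intro!: mult_left_mono)
  then show "\<bar>\<Sum>i\<in>UNIV. w i * D i f x\<bar> <= (\<Sum>i\<in>UNIV. \<bar>w i\<bar>) * B * lip_const f"
    by (simp add: sum_distrib_right mult.assoc)
next
  fix f g :: "'a => real" and a b :: real assume fg: "f \<in> Lip" "g \<in> Lip"
  have "AE x in \<mu>. \<forall>i\<in>UNIV. D i (\<lambda>x. a * f x + b * g x) x = a * D i f x + b * D i g x"
    by (subst AE_finite_all) (auto intro: lip_operatorD(3)[OF D fg])
  then show "AE x in \<mu>. (\<Sum>i\<in>UNIV. w i * D i (\<lambda>x. a * f x + b * g x) x) =
      a * (\<Sum>i\<in>UNIV. w i * D i f x) + b * (\<Sum>i\<in>UNIV. w i * D i g x)"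
    by eventually_elim (simp add: sum_distrib_left sum.distrib algebra_simps)
next
  fix f g :: "'a => real" assume *: "f \<in> Lip" "g \<in> Lip"
  have "AE x in \<mu>. \<forall>i\<in>UNIV. f x = g x --> D i f x = D i g x"
    by (subst AE_finite_all) (auto intro: lip_operatorD(4)[OF D *, of "{x. f x = g x}", simplified])
  then show "AE x in \<mu>. f x = g x --> (\<Sum>i\<in>UNIV. w i * D i f x) = (\<Sum>i\<in>UNIV. w i * D i g x)"
    by eventually_elim simp
next
  fix fs and f h :: "'a => real" assume *: "wstar_conv fs f \<and> integrable \<mu> h"
  have L: "f \<in> Lip" "\<And>n. fs n \<in> Lip" using * by (auto simp: wstar_conv_def)
  have c: "borel_measurable \<mu> = (borel_measurable borel :: ('a => real) set)" by (rule measurable_cong_sets[OF \<mu>(1) refl])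
  have i: "integrable \<mu> (\<lambda>x. h x * D i g x)" if "g \<in> Lip" for g i
    by (rule L1_bounded_mult_le(1)[OF _ _ lip_operatorD(2)[OF D that]])
      (use * lip_operatorD(1)[OF D that] c in auto)
  have e: "(LINT x|\<mu>. h x * (\<Sum>i\<in>UNIV. w i * D i g x)) = (\<Sum>i\<in>UNIV. w i * (LINT x|\<mu>. h x * D i g x))" if "g \<in> Lip" for g
  proof -
    have "(LINT x|\<mu>. h x * (\<Sum>i\<in>UNIV. w i * D i g x)) = (LINT x|\<mu>. (\<Sum>i\<in>UNIV. w i * (h x * D i g x)))"
      by (simp add: sum_distrib_left algebra_simps)
    also have "... = (\<Sum>i\<in>UNIV. w i * (LINT x|\<mu>. h x * D i g x))"
      using i[OF that] by (subst Bochner_Integration.integral_sum) auto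
    finally show ?thesis .
  qed
  show "(\<lambda>n. LINT x|\<mu>. h x * (\<Sum>i\<in>UNIV. w i * D i (fs n) x)) \<longlonglongrightarrow> (LINT x|\<mu>. h x * (\<Sum>i\<in>UNIV. w i * D i f x))"
    unfolding e[OF L(1)] e[OF L(2)] using * by (intro tendsto_sum tendsto_mult tendsto_const lip_operatorD(5)[OF D]) auto
qed

definition glue_op :: "(nat => 'a set) => (nat => ('a => real) => 'a => real) => ('a => real) => 'a => real" where
  "glue_op V D f x = (\<Sum>j. indicator (V j) x * D j f x)"

lemma glue_op_in:
  assumes "disjoint_family V" "x \<in> V j" shows "glue_op V D f x = D j f x"
proof -
  have "indicator (V i) x * D i f x = 0" if "i \<notin> {j}" for i
    using assms that by (auto simp: disjoint_family_on_def indicator_def)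
  then have "glue_op V D f x = (\<Sum>i\<in>{j}. indicator (V i) x * D i f x)"
    unfolding glue_op_def by (intro suminf_finite) auto
  then show ?thesis using assms by simp
qed

lemma glue_op_out: "x \<notin> (\<Union>j. V j) ==> glue_op V D f x = 0"
  by (simp add: glue_op_def indicator_def)

text \<open>All laws but weak* continuity are checked pointwise. For continuity the integral is
  split over the pieces: each summand converges, and it is dominated by \<open>C * M j\<close>,
  where \<open>M j\<close> is the integral of \<open>\<bar>h\<bar>\<close> over \<open>V j\<close>.
  These are summable by disjointness, so limit and sum may be exchanged.\<close>

lemma lip_operator_glue:
  fixes D :: "nat => ('a::metric_space => real) => 'a => real"
  assumes \<mu>: "sets \<mu> = sets borel" "finite_measure \<mu>" and D: "\<And>j. lip_operator \<mu> B (D j)"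
    and V: "disjoint_family V" "\<And>j. V j \<in> sets borel" and B: "0 <= B"
  shows "lip_operator \<mu> B (glue_op V D)"
proof -
  note gi = glue_op_in[OF V(1)] and go = glue_op_out
  have c: "borel_measurable \<mu> = (borel_measurable borel :: ('a => real) set)" by (rule measurable_cong_sets[OF \<mu>(1) refl])
  have meas: "glue_op V D f \<in> borel_measurable borel" if "f \<in> Lip" for f
  proof -
    note [measurable] = lip_operatorD(1)[OF D that] V(2)
    show ?thesis unfolding glue_op_def[abs_def] by measurable
  qed
  have bd: "\<bar>glue_op V D f x\<bar> <= B * lip_const f" if "f \<in> Lip" for f x
  proof (cases "x \<in> (\<Union>j. V j)")
    case True then show ?thesis using gi lip_operatorD(2)[OF D that] by auto
  next
    case False then show ?thesis using go[OF False] B lip_const_nonneg[OF that] by simp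
  qed
  show ?thesis
    unfolding lip_operator_def
  proof (intro conjI ballI allI impI meas bd)
    fix f g :: "'a => real" and a b :: real assume fg: "f \<in> Lip" "g \<in> Lip"
    have "AE x in \<mu>. \<forall>j. D j (\<lambda>x. a * f x + b * g x) x = a * D j f x + b * D j g x"
      by (subst AE_all_countable) (auto intro: lip_operatorD(3)[OF D fg])
    then show "AE x in \<mu>. glue_op V D (\<lambda>x. a * f x + b * g x) x = a * glue_op V D f x + b * glue_op V D g x"
    proof eventually_elim
      case (elim x)
      show ?case
      proof (cases "x \<in> (\<Union>j. V j)")
        case True then show ?thesis using elim gi by auto
      qed (simp add: go)
    qed
  next
    fix f g :: "'a => real" assume *: "f \<in> Lip" "g \<in> Lip"
    have "AE x in \<mu>. \<forall>j. f x = g x --> D j f x = D j g x"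
      by (subst AE_all_countable) (auto intro: lip_operatorD(4)[OF D *, of "{x. f x = g x}", simplified])
    then show "AE x in \<mu>. f x = g x --> glue_op V D f x = glue_op V D g x"
    proof eventually_elim
      case (elim x)
      show ?case
      proof (cases "x \<in> (\<Union>j. V j)")
        case True then show ?thesis using elim gi by auto
      qed (simp add: go)
    qed
  next
    fix fs and f h :: "'a => real" assume *: "wstar_conv fs f \<and> integrable \<mu> h"
    then have h: "integrable \<mu> h" by simp
    note [measurable] = borel_measurable_integrable[OF h]
    have L: "f \<in> Lip" "\<And>n. fs n \<in> Lip" "bdd_above (range (\<lambda>n. lip_const (fs n)))" using * by (auto simp: wstar_conv_def)
    obtain L0 where L0: "\<And>n. lip_const (fs n) <= L0" using L(3) by (auto simp: bdd_above_def)
    define C where "C = B * max L0 (lip_const f)"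
    have Cf: "\<bar>D j f x\<bar> <= C" for j x
      unfolding C_def by (rule order_trans[OF lip_operatorD(2)[OF D L(1)] mult_left_mono]) (use B in auto)
    have Cn: "\<bar>D j (fs n) x\<bar> <= C" for n j x
      unfolding C_def by (rule order_trans[OF lip_operatorD(2)[OF D L(2)] mult_left_mono]) (use B L0[of n] in auto)
    have Vm[measurable]: "V j \<in> sets \<mu>" for j using V \<mu> by simp
    have ih: "integrable \<mu> (\<lambda>x. h x * indicator (V j) x)" for j
      using integrable_mult_indicator[OF Vm h] by (simp add: mult.commute)
    define M where "M j = (LINT x|\<mu>. \<bar>h x * indicator (V j) x\<bar>)" for j
    have M: "summable M"
    proof (rule summableI_nonneg_bounded)
      fix J
      have "(\<Sum>j<J. M j) = (LINT x|\<mu>. (\<Sum>j<J. \<bar>h x * indicator (V j) x\<bar>))"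
        unfolding M_def using ih by (intro Bochner_Integration.integral_sum[symmetric]) auto
      also have "... <= (LINT x|\<mu>. \<bar>h x\<bar>)"
      proof (rule integral_mono)
        fix x
        have "(\<Sum>j<J. indicator (V j) x :: real) = indicator (\<Union>j<J. V j) x"
          using V(1) by (intro indicator_UN_disjoint[symmetric]) (auto simp: disjoint_family_on_def)
        then have "(\<Sum>j<J. \<bar>h x * indicator (V j) x\<bar>) = \<bar>h x\<bar> * indicator (\<Union>j<J. V j) x"
          by (simp add: abs_mult sum_distrib_left[symmetric])
        then show "(\<Sum>j<J. \<bar>h x * indicator (V j) x\<bar>) <= \<bar>h x\<bar>" by (simp add: indicator_def)
      qed (use ih h in auto)
      finally show "(\<Sum>j<J. M j) <= (LINT x|\<mu>. \<bar>h x\<bar>)" .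
    qed (simp add: M_def)
    define t where "t g j = (LINT x|\<mu>. h x * indicator (V j) x * D j g x)" for g j
    have tM: "\<bar>t g j\<bar> <= C * M j" and tI: "(LINT x|\<mu>. h x * glue_op V D g x) = (\<Sum>j. t g j)"
      if g: "g \<in> Lip" "\<And>j x. \<bar>D j g x\<bar> <= C" for g j
    proof -
      have m: "D j g \<in> borel_measurable \<mu>" for j using lip_operatorD(1)[OF D g(1)] c by simp
      note b = L1_bounded_mult_le[OF ih m g(2)]
      show "\<bar>t g j\<bar> <= C * M j" unfolding t_def M_def by (rule b(2))
      have fin: "finite {j. h x * indicator (V j) x * D j g x ~= 0}" for x
      proof (cases "x \<in> (\<Union>j. V j)")
        case True
        then obtain i where "x \<in> V i" by blast
        then have "{j. h x * indicator (V j) x * D j g x ~= 0} \<subseteq> {i}"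
          using V(1) by (auto simp: disjoint_family_on_def indicator_def split: if_splits)
        then show ?thesis by (rule finite_subset) simp
      qed (auto simp: indicator_def)
      have "h x * glue_op V D g x = (\<Sum>j. h x * indicator (V j) x * D j g x)" for x
      proof (cases "x \<in> (\<Union>j. V j)")
        case True
        then obtain i where i: "x \<in> V i" by blast
        have "(\<Sum>j. h x * indicator (V j) x * D j g x) = (\<Sum>j\<in>{i}. h x * indicator (V j) x * D j g x)"
          using V(1) i by (intro suminf_finite) (auto simp: disjoint_family_on_def indicator_def)
        then show ?thesis using gi[OF i] i by simp
      qed (simp add: go)
      then have "(LINT x|\<mu>. h x * glue_op V D g x) = (LINT x|\<mu>. (\<Sum>j. h x * indicator (V j) x * D j g x))" by simp
      also have "... = (\<Sum>j. t g j)"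
        unfolding t_def
      proof (rule integral_suminf[OF b(1)])
        show "AE x in \<mu>. summable (\<lambda>j. norm (h x * indicator (V j) x * D j g x))"
          by (rule AE_I2, rule summable_finite[OF fin]) auto
        show "summable (\<lambda>j. LINT x|\<mu>. norm (h x * indicator (V j) x * D j g x))"
        proof (rule summable_comparison_test'[OF summable_mult[OF M, of C], of 0])
          fix j
          have "(LINT x|\<mu>. \<bar>h x * indicator (V j) x * D j g x\<bar>) = (LINT x|\<mu>. \<bar>h x * indicator (V j) x\<bar> * \<bar>D j g x\<bar>)" by (simp add: abs_mult)
          also have "\<bar>...\<bar> <= C * M j"
            using L1_bounded_mult_le(2)[OF integrable_abs[OF ih], of "\<lambda>x. \<bar>D j g x\<bar>" C] m g(2) by (simp add: M_def)
          finally show "norm (LINT x|\<mu>. norm (h x * indicator (V j) x * D j g x)) <= C * M j" by simp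
        qed
      qed
      finally show "(LINT x|\<mu>. h x * glue_op V D g x) = (\<Sum>j. t g j)" .
    qed
    have t: "(\<lambda>n. t (fs n) j) \<longlonglongrightarrow> t f j" for j
      unfolding t_def using * ih by (intro lip_operatorD(5)[OF D]) auto
    show "(\<lambda>n. LINT x|\<mu>. h x * glue_op V D (fs n) x) \<longlonglongrightarrow> (LINT x|\<mu>. h x * glue_op V D f x)"
      unfolding tI[OF L(1) Cf] tI[OF L(2) Cn]
    proof (rule tannerys_theorem[OF t _ summable_mult[OF M, of C], THEN conjunct2, THEN conjunct2])
      show "\<forall>\<^sub>F (j, n) in at_top \<times>\<^sub>F sequentially. norm (t (fs n) j) <= C * M j"
        by (intro always_eventually) (use tM[OF L(2) Cn] in auto)
    qed simp
  qed
qed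

text \<open>Where \<open>f\<close> stays within \<open>r\<close> above \<open>p\<close>, \<open>f\<^sup>2 = 2 p f - p\<^sup>2 + F\<^sup>2\<close> for a truncation \<open>F\<close> of
  \<open>f - p\<close> bounded by \<open>r\<close>, and \<open>D (F\<^sup>2)\<close> is of order \<open>r\<close>.\<close>

lemma lip_operator_square:
  assumes D: "lip_operator \<mu> B D" and B: "0 <= B" and f: "f \<in> Lipb"
  shows "AE x in \<mu>. D (\<lambda>y. f y * f y) x = 2 * f x * D f x"
proof -
  note fL = Lipb_Lip[OF f] and ffL = Lipb_Lip[OF Lipb_mult[OF f f]]
  define L where "L = lip_const f"
  have main: "AE x in \<mu>. \<bar>D (\<lambda>y. f y * f y) x - 2 * f x * D f x\<bar> <= 4 * B * L * r" if r: "0 < r" for r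
  proof -
    define A where "A a = {x. real_of_int a * r <= f x \<and> f x < (real_of_int a + 1) * r}" for a
    have "AE x in \<mu>. x \<in> A a --> \<bar>D (\<lambda>y. f y * f y) x - 2 * f x * D f x\<bar> <= 4 * B * L * r" for a
    proof -
      define p where "p = real_of_int a * r"
      define cl where "cl y = max 0 (min r (y - p))" for y :: real
      have clL: "1-lipschitz_on UNIV cl"
        unfolding cl_def by (intro Lip_minmax lipschitz_on_le[OF lipschitz_on_constant] lipschitz_on_real_absI) (auto simp: dist_real_def)
      define F where "F x = cl (f x)" for x
      have F: "F \<in> Lip" "lip_const F <= L" "\<And>x. \<bar>F x\<bar> <= r"
        using Lip_comp[OF fL clL] r by (auto simp: F_def[abs_def] L_def cl_def)
      note FF = lip_const_mult[OF F(1) F(1) F(3) F(3)]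
      define H where "H x = 1 * (F x * F x) + (- (p * p)) * 1" for x
      have H: "H \<in> Lip" unfolding H_def[abs_def] by (rule Lip_linear(1)[OF FF(1) Lip_const(1)])
      have 1: "AE x in \<mu>. x \<in> A a --> D (\<lambda>y. f y * f y) x = D (\<lambda>x. (2 * p) * f x + 1 * H x) x"
      proof (rule lip_operatorD(4)[OF D ffL Lip_linear(1)[OF fL H]])
        fix x assume "x \<in> A a"
        then have "f x = F x + p" by (auto simp: A_def F_def cl_def p_def algebra_simps)
        then show "f x * f x = (2 * p) * f x + 1 * H x" by (simp add: H_def algebra_simps)
      qed
      have 2: "AE x in \<mu>. D H x = 1 * D (\<lambda>x. F x * F x) x + (- (p * p)) * D (\<lambda>x. 1) x"
        unfolding H_def[abs_def] by (rule lip_operatorD(3)[OF D FF(1) Lip_const(1)])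
      from 1 2 lip_operatorD(3)[OF D fL H, of "2 * p" 1] show ?thesis
      proof eventually_elim
        case (elim x)
        show ?case
        proof
          assume x: "x \<in> A a"
          have eq: "D (\<lambda>y. f y * f y) x - 2 * f x * D f x = 2 * ((p - f x) * D f x) + D (\<lambda>x. F x * F x) x"
            using elim x lip_operator_const[OF D, of 1 x] by (simp add: algebra_simps)
          have "\<bar>p - f x\<bar> <= r" using x by (auto simp: A_def p_def algebra_simps)
          then have "\<bar>(p - f x) * D f x\<bar> <= r * (B * L)"
            using lip_operatorD(2)[OF D fL, of x] r unfolding abs_mult L_def by (auto intro!: mult_mono)
          moreover have "lip_const (\<lambda>x. F x * F x) <= 2 * (r * L)"
            using FF(2) mult_left_mono[OF F(2), of r] r by linarith
          then have "\<bar>D (\<lambda>x. F x * F x) x\<bar> <= B * (2 * (r * L))"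
            by (intro order_trans[OF lip_operatorD(2)[OF D FF(1)] mult_left_mono[OF _ B]])
          ultimately show "\<bar>D (\<lambda>y. f y * f y) x - 2 * f x * D f x\<bar> <= 4 * B * L * r"
            unfolding eq by (simp add: algebra_simps)
        qed
      qed
    qed
    then have "AE x in \<mu>. \<forall>a. x \<in> A a --> \<bar>D (\<lambda>y. f y * f y) x - 2 * f x * D f x\<bar> <= 4 * B * L * r"
      by (intro AE_all_countable[THEN iffD2] allI)
    moreover have "x \<in> A \<lfloor>f x / r\<rfloor>" for x
      unfolding A_def
      using pos_le_divide_eq[OF r, THEN iffD1, OF of_int_floor_le]
        pos_divide_less_eq[OF r, THEN iffD1, OF real_of_int_floor_add_one_gt] by blast
    ultimately show ?thesis by (auto elim: eventually_mono)
  qed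
  have "AE x in \<mu>. \<forall>n. \<bar>D (\<lambda>y. f y * f y) x - 2 * f x * D f x\<bar> <= 4 * B * L * inverse (real (Suc n))"
    by (subst AE_all_countable) (intro allI main, simp)
  then show ?thesis
  proof eventually_elim
    case (elim x)
    have "(\<lambda>n. 4 * B * L * inverse (real (Suc n))) \<longlonglongrightarrow> 4 * B * L * 0"
      by (intro tendsto_intros LIMSEQ_inverse_real_of_nat)
    then have "\<bar>D (\<lambda>y. f y * f y) x - 2 * f x * D f x\<bar> <= 4 * B * L * 0"
      by (rule LIMSEQ_le_const) (use elim in blast)
    then show ?case by simp
  qed
qed

text \<open>Polarization: \<open>f * g\<close> is a quarter of the difference of the squares of
  \<open>f + g\<close> and \<open>f - g\<close>.\<close>

lemma lip_operator_Leibniz: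
  assumes D: "lip_operator \<mu> B D" and B: "0 <= B" and f: "f \<in> Lipb" and g: "g \<in> Lipb"
  shows "AE x in \<mu>. D (\<lambda>y. f y * g y) x = f x * D g x + g x * D f x"
proof -
  define h where "h c x = 1 * f x + c * g x" for c x
  have h: "h c \<in> Lipb" for c unfolding h_def[abs_def] by (rule Lipb_linear[OF f g])
  have e: "(\<lambda>y. f y * g y) = (\<lambda>y. 1/4 * (h 1 y * h 1 y) + (- 1/4) * (h (- 1) y * h (- 1) y))"
    by (auto simp: h_def algebra_simps)
  have 1: "AE x in \<mu>. D (h c) x = 1 * D f x + c * D g x" for c
    unfolding h_def[abs_def] by (rule lip_operatorD(3)[OF D Lipb_Lip[OF f] Lipb_Lip[OF g]])
  from 1[of 1] 1[of "- 1"] lip_operator_square[OF D B h[of 1]] lip_operator_square[OF D B h[of "- 1"]]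
    lip_operatorD(3)[OF D Lipb_Lip[OF Lipb_mult[OF h h]] Lipb_Lip[OF Lipb_mult[OF h h]], of "1/4" 1 1 "- 1/4" "- 1" "- 1"]
  show ?thesis
    unfolding e
  proof eventually_elim
    case (elim x)
    show ?case unfolding elim h_def[of _ x] by (simp add: field_simps)
  qed
qed

section \<open>Weak* continuity and the predual\<close>

lemma Lipb_norm_nonneg: "f \<in> Lipb ==> 0 <= Lipb_norm f"
  using lip_const_nonneg[OF Lipb_Lip, of f] by (simp add: Lipb_norm_def max_def)

lemma lip_const_le_Lipb_norm: "lip_const f <= Lipb_norm f"
  by (simp add: Lipb_norm_def)

lemma sup_norm_ge:
  assumes "f \<in> Lipb" shows "\<bar>f x\<bar> <= sup_norm f"
proof -
  obtain B where "\<And>x. \<bar>f x\<bar> <= B" using Lipb_bound[OF assms] by metis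
  then show ?thesis unfolding sup_norm_def by (intro cSUP_upper bdd_aboveI2) auto
qed

lemma abs_le_Lipb_norm: "f \<in> Lipb ==> \<bar>f x\<bar> <= Lipb_norm f"
  using sup_norm_ge[of f x] by (simp add: Lipb_norm_def)

lemma sup_norm_le: "(\<And>x. \<bar>f x\<bar> <= B) ==> sup_norm f <= B"
  unfolding sup_norm_def by (rule cSUP_least) auto

lemma Lipb_norm_linear:
  assumes "f \<in> Lipb" "g \<in> Lipb"
  shows "Lipb_norm (\<lambda>x. a * f x + b * g x) <= \<bar>a\<bar> * Lipb_norm f + \<bar>b\<bar> * Lipb_norm g"
proof -
  have "\<bar>a * f x + b * g x\<bar> <= \<bar>a\<bar> * Lipb_norm f + \<bar>b\<bar> * Lipb_norm g" for x
    using mult_left_mono[OF abs_le_Lipb_norm[OF assms(1), of x], of "\<bar>a\<bar>"] mult_left_mono[OF abs_le_Lipb_norm[OF assms(2), of x], of "\<bar>b\<bar>"]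
      abs_triangle_ineq[of "a * f x" "b * g x"] by (simp add: abs_mult)
  then have 1: "sup_norm (\<lambda>x. a * f x + b * g x) <= \<bar>a\<bar> * Lipb_norm f + \<bar>b\<bar> * Lipb_norm g" by (rule sup_norm_le)
  have "lip_const (\<lambda>x. a * f x + b * g x) <= \<bar>a\<bar> * lip_const f + \<bar>b\<bar> * lip_const g"
    by (rule Lip_linear(2)[OF Lipb_Lip[OF assms(1)] Lipb_Lip[OF assms(2)]])
  also have "... <= \<bar>a\<bar> * Lipb_norm f + \<bar>b\<bar> * Lipb_norm g"
    by (intro add_mono mult_left_mono lip_const_le_Lipb_norm) auto
  finally show ?thesis using 1 by (simp add: Lipb_norm_def[of "\<lambda>x. a * f x + b * g x"])
qed

text \<open>A Hahn-Banach argument that fixes the coefficients one point at a time. For the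
  functions \<open>f\<close> in \<open>Y\<close>, that is, with \<open>f z = 1\<close> and zeros on
  \<open>S\<close>, the intervals of radius \<open>e * Lipb_norm f\<close> around
  \<open>\<phi> f\<close> meet pairwise, because a difference of two such functions vanishes on all
  of \<open>insert z S\<close>. A common point \<open>c\<close> of them is the coefficient at
  \<open>z\<close>.\<close>

lemma Lipb_functional_extension:
  assumes "finite S"
    and "\<And>f g a b. f \<in> Lipb ==> g \<in> Lipb ==> \<phi> (\<lambda>x. a * f x + b * g x) = a * \<phi> f + b * \<phi> g"
    and "\<And>f. f \<in> Lipb ==> (\<forall>x\<in>S. f x = 0) ==> \<bar>\<phi> f\<bar> <= e * Lipb_norm f" and e: "0 <= e"
  shows "\<exists>c. \<forall>f\<in>Lipb. \<bar>\<phi> f - (\<Sum>x\<in>S. c x * f x)\<bar> <= e * Lipb_norm f"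
  using assms(1-3)
proof (induction S arbitrary: \<phi>)
  case empty
  then show ?case by auto
next
  case (insert z S)
  note lin = insert.prems(1) and bd = insert.prems(2)
  have sc: "\<phi> (\<lambda>x. a * f x) = a * \<phi> f" if "f \<in> Lipb" for f a using lin[OF that that, of a 0] by simp
  define Y where "Y = {f \<in> Lipb. (\<forall>x\<in>S. f x = 0) \<and> f z = 1}"
  have cross: "\<phi> f - e * Lipb_norm f <= \<phi> g + e * Lipb_norm g" if "f \<in> Y" "g \<in> Y" for f g
  proof -
    have fg: "f \<in> Lipb" "g \<in> Lipb" using that by (auto simp: Y_def)
    have "\<bar>\<phi> (\<lambda>x. 1 * f x + (-1) * g x)\<bar> <= e * Lipb_norm (\<lambda>x. 1 * f x + (-1) * g x)"
      using that by (intro bd Lipb_linear[OF fg]) (auto simp: Y_def)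
    also have "... <= e * (\<bar>1\<bar> * Lipb_norm f + \<bar>-1\<bar> * Lipb_norm g)"
      by (intro mult_left_mono Lipb_norm_linear[OF fg] e)
    finally show ?thesis unfolding lin[OF fg] by (simp add: algebra_simps)
  qed
  define c where "c = (SUP f\<in>Y. \<phi> f - e * Lipb_norm f)"
  have cY: "\<bar>\<phi> f - c\<bar> <= e * Lipb_norm f" if f: "f \<in> Y" for f
  proof -
    have "\<phi> f - e * Lipb_norm f <= c" unfolding c_def
      by (rule cSUP_upper[OF f bdd_aboveI2[where M="\<phi> f + e * Lipb_norm f"]]) (rule cross[OF _ f])
    moreover have "c <= \<phi> f + e * Lipb_norm f" unfolding c_def
      by (rule cSUP_least) (use f cross[OF _ f] in auto)
    ultimately show ?thesis by (simp add: abs_le_iff)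
  qed
  have cS: "\<bar>\<phi> f - c * f z\<bar> <= e * Lipb_norm f" if f: "f \<in> Lipb" "\<forall>x\<in>S. f x = 0" for f
  proof (cases "f z = 0")
    case True then show ?thesis using bd[OF f(1)] f(2) by simp
  next
    case False
    define t where "t = f z"
    have t: "t ~= 0" using False by (simp add: t_def)
    have gY: "(\<lambda>x. (1 / t) * f x) \<in> Y" using Lipb_linear[OF f(1) f(1), of "1/t" 0] f t by (auto simp: Y_def t_def)
    have n: "Lipb_norm (\<lambda>x. (1 / t) * f x) <= \<bar>1 / t\<bar> * Lipb_norm f"
      using Lipb_norm_linear[OF f(1) f(1), of "1/t" 0] by simp
    have "\<bar>\<phi> f - c * t\<bar> = \<bar>t\<bar> * \<bar>\<phi> (\<lambda>x. (1 / t) * f x) - c\<bar>"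
      unfolding sc[OF f(1)] using t by (simp add: field_simps flip: abs_mult)
    also have "... <= \<bar>t\<bar> * (e * (\<bar>1 / t\<bar> * Lipb_norm f))"
      by (intro mult_left_mono order_trans[OF cY[OF gY]] n e) simp
    also have "... = e * Lipb_norm f" using t by (simp add: field_simps)
    finally show ?thesis by (simp add: t_def)
  qed
  have "\<exists>c'. \<forall>f\<in>Lipb. \<bar>(\<phi> f - c * f z) - (\<Sum>x\<in>S. c' x * f x)\<bar> <= e * Lipb_norm f"
    by (rule insert.IH) (use lin cS in \<open>auto simp: algebra_simps\<close>)
  then obtain c' where c': "\<And>f. f \<in> Lipb ==> \<bar>(\<phi> f - c * f z) - (\<Sum>x\<in>S. c' x * f x)\<bar> <= e * Lipb_norm f" by blast
  have "(\<Sum>x\<in>insert z S. (c'(z := c)) x * f x) = c * f z + (\<Sum>x\<in>S. c' x * f x)" for f :: "'a => real"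
    using insert.hyps by (auto intro!: sum.cong)
  then show ?case using c' by (intro exI[of _ "c'(z := c)"]) (simp add: algebra_simps)
qed

lemma dense_sequence:
  "\<exists>z :: nat => 'a::{metric_space, second_countable_topology}. \<forall>x e. 0 < e --> (\<exists>k. dist x (z k) < e)"
proof -
  obtain Z :: "'a set" where Z: "countable Z" "\<And>Y :: 'a set. open Y ==> Y ~= {} ==> \<exists>d\<in>Z. d \<in> Y"
    using countable_dense_setE by blast
  have "\<exists>k. dist x (from_nat_into Z k) < e" if "0 < e" for x e
  proof -
    have "\<exists>d\<in>Z. d \<in> ball x e" using that by (intro Z(2)) auto
    then obtain d where "d \<in> Z" "dist x d < e" by auto
    then show ?thesis using from_nat_into_surj[OF Z(1)] by auto
  qed
  then show ?thesis by blast
qed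

text \<open>A substitute for the Krein-Smulian theorem; separability makes sequences sufficient. If
  \<open>\<phi>\<close> were not small on the functions vanishing on some finite set, then functions
  of norm at most 1 vanishing on longer and longer parts of a dense sequence would violate
  continuity, as they tend to zero pointwise. Smallness on such functions is what
  \<open>Lipb_functional_extension\<close> turns into an approximation by point evaluations.\<close>

lemma seq_continuous_predual:
  fixes \<phi> :: "('a::polish_space => real) => real"
  assumes lin: "\<And>f g a b. f \<in> Lipb ==> g \<in> Lipb ==> \<phi> (\<lambda>x. a * f x + b * g x) = a * \<phi> f + b * \<phi> g"
    and cont: "\<And>fs f. wstar_conv fs f ==> (\<lambda>n. \<phi> (fs n)) \<longlonglongrightarrow> \<phi> f"
  shows "\<phi> \<in> Lipb_predual"
  unfolding Lipb_predual_def
proof (intro CollectI allI impI)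
  fix e :: real assume e: "0 < e"
  have z0: "(\<lambda>x::'a. 0::real) \<in> Lipb" by (rule LipbI[OF Lip_const(1), of 0 0]) simp
  have \<phi>0: "\<phi> (\<lambda>x. 0) = 0" using lin[OF z0 z0, of 0 0] by simp
  have "\<exists>S. finite S \<and> (\<forall>f\<in>Lipb. (\<forall>x\<in>S. f x = 0) --> \<bar>\<phi> f\<bar> <= e * Lipb_norm f)"
  proof (rule ccontr)
    assume neg: "\<not> ?thesis"
    obtain z :: "nat => 'a" where z: "\<And>x e. 0 < e ==> \<exists>k. dist x (z k) < e" using dense_sequence by blast
    have "\<exists>f\<in>Lipb. (\<forall>x\<in>z ` {..n}. f x = 0) \<and> e * Lipb_norm f < \<bar>\<phi> f\<bar>" for n
      using neg by (meson finite_atMost finite_imageI not_le)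
    then obtain f where f: "\<And>n. f n \<in> Lipb" "\<And>n x. x \<in> z ` {..n} ==> f n x = 0" "\<And>n. e * Lipb_norm (f n) < \<bar>\<phi> (f n)\<bar>"
      by metis
    have N: "0 < Lipb_norm (f n)" for n
    proof (rule ccontr)
      assume "\<not> 0 < Lipb_norm (f n)"
      then have "\<bar>f n x\<bar> <= 0" for x using abs_le_Lipb_norm[OF f(1), of n x] by linarith
      then have "f n = (\<lambda>x. 0)" by (simp add: fun_eq_iff)
      then show False using f(3)[of n] \<phi>0 Lipb_norm_nonneg[OF f(1), of n] e by (simp add: mult_less_0_iff)
    qed
    define g where "g n = (\<lambda>x. (1 / Lipb_norm (f n)) * f n x)" for n
    have gL: "g n \<in> Lipb" for n using Lipb_linear[OF f(1) f(1), of "1 / Lipb_norm (f n)" n 0 n] by (simp add: g_def)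
    have gN: "Lipb_norm (g n) <= 1" for n
      using Lipb_norm_linear[OF f(1) f(1), of "1 / Lipb_norm (f n)" n 0 n] N[of n] by (simp add: g_def)
    have \<phi>g: "e < \<bar>\<phi> (g n)\<bar>" for n
    proof -
      have "\<phi> (g n) = \<phi> (f n) / Lipb_norm (f n)"
        using lin[OF f(1) f(1), of "1 / Lipb_norm (f n)" n 0 n] by (simp add: g_def)
      then show ?thesis using N[of n] f(3)[of n] by (simp add: abs_divide pos_less_divide_eq)
    qed
    have gL1: "1-lipschitz_on UNIV (g n)" for n
      using lipschitz_on_le[OF lipschitz_on_lip_const[OF Lipb_Lip[OF gL]]] lip_const_le_Lipb_norm[of "g n"] gN[of n] by (meson order_trans)
    have "(\<lambda>n. g n x) \<longlonglongrightarrow> 0" for x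
    proof (rule LIMSEQ_I)
      fix r :: real assume "0 < r"
      then obtain k where k: "dist x (z k) < r" using z by blast
      have "norm (g n x - 0) < r" if "n >= k" for n
      proof -
        have "g n (z k) = 0" using f(2)[of "z k" n] that by (simp add: g_def)
        then have "\<bar>g n x\<bar> <= 1 * dist x (z k)" using lipschitz_onD[OF gL1, of x "z k" n] by (simp add: dist_real_def)
        then show ?thesis using k by simp
      qed
      then show "\<exists>no. \<forall>n\<ge>no. norm (g n x - 0) < r" by blast
    qed
    then have "wstar_conv g (\<lambda>x. 0)" by (rule wstar_conv_lipschitz(2)[OF gL1])
    then have "(\<lambda>n. \<phi> (g n)) \<longlonglongrightarrow> 0" using cont \<phi>0 by metis
    then have "eventually (\<lambda>n. \<bar>\<phi> (g n)\<bar> < e) sequentially" using e by (auto dest: tendstoD[of _ _ _ e] simp: dist_real_def)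
    then show False using \<phi>g by (auto simp: eventually_sequentially dest: less_asym)
  qed
  then obtain S where "finite S" "\<And>f. f \<in> Lipb ==> (\<forall>x\<in>S. f x = 0) ==> \<bar>\<phi> f\<bar> <= e * Lipb_norm f" by blast
  from this(1) Lipb_functional_extension[OF this(1) lin this(2)] e
  show "\<exists>S c. finite S \<and> (\<forall>f\<in>Lipb. \<bar>\<phi> f - (\<Sum>x\<in>S. c x * f x)\<bar> <= e * Lipb_norm f)"
    by (meson less_imp_le)
qed

text \<open>The target topology is generated by integrals against L1 functions \<open>h\<close>, and
  composing such an integral with \<open>D\<close> gives a functional in the predual. Hence
  preimages of generators are themselves generators of the source topology.\<close>

lemma weaver_derivation_lip_operator:
  fixes \<mu> :: "'a::polish_space measure"
  assumes \<mu>: "sets \<mu> = sets borel" "finite_measure \<mu>" and D: "lip_operator \<mu> B D" and B: "0 <= B"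
  shows "weaver_derivation \<mu> D"
proof -
  have c: "borel_measurable \<mu> = (borel_measurable borel :: ('a => real) set)" by (rule measurable_cong_sets[OF \<mu>(1) refl])
  have m: "D f \<in> borel_measurable \<mu>" if "f \<in> Lipb" for f
    using lip_operatorD(1)[OF D Lipb_Lip[OF that]] c by simp
  have bd: "\<bar>D f x\<bar> <= B * Lipb_norm f" if "f \<in> Lipb" for f x
    by (rule order_trans[OF lip_operatorD(2)[OF D Lipb_Lip[OF that]] mult_left_mono[OF lip_const_le_Lipb_norm B]])
  have Linf: "D f \<in> Linf \<mu>" if "f \<in> Lipb" for f
    unfolding Linf_def using m[OF that] bd[OF that] by blast
  have top: "topspace Lipb_wstar = (Lipb :: ('a => real) set)"
  proof (intro antisym subsetI)
    have z: "(\<lambda>f::'a => real. 0) \<in> Lipb_predual" by (rule seq_continuous_predual) simp_all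
    show "f \<in> topspace Lipb_wstar" if "f \<in> Lipb" for f :: "'a => real"
      unfolding Lipb_wstar_def topology_generated_by_topspace
      by (rule UnionI[of "{f \<in> Lipb. 0 \<in> (UNIV::real set)}"]) (use z that in \<open>auto intro!: exI[of _ "\<lambda>f. 0"] exI[of _ UNIV]\<close>)
  qed (auto simp: Lipb_wstar_def)
  have cont: "continuous_map Lipb_wstar (Linf_wstar \<mu>) D"
    unfolding Linf_wstar_def
  proof (rule continuous_on_generated_topo)
    fix W assume "W \<in> {{g \<in> Linf \<mu>. (LINT x|\<mu>. g x * h x) \<in> U} | (h :: 'a => real) U. integrable \<mu> h \<and> open U}"
    then obtain h and U :: "real set" where W: "W = {g \<in> Linf \<mu>. (LINT x|\<mu>. g x * h x) \<in> U}" and h: "integrable \<mu> h" and U: "open U" by blast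
    define \<phi> where "\<phi> f = (LINT x|\<mu>. h x * D f x)" for f
    have "\<phi> \<in> Lipb_predual"
    proof (rule seq_continuous_predual)
      fix f g :: "'a => real" and a b assume fg: "f \<in> Lipb" "g \<in> Lipb"
      have fgL: "(\<lambda>x. a * f x + b * g x) \<in> Lipb" by (rule Lipb_linear[OF fg])
      have i: "integrable \<mu> (\<lambda>x. h x * D k x)" if "k \<in> Lipb" for k
        by (rule L1_bounded_mult_le(1)[OF h m[OF that] bd[OF that]])
      have "\<phi> (\<lambda>x. a * f x + b * g x) = (LINT x|\<mu>. a * (h x * D f x) + b * (h x * D g x))"
        unfolding \<phi>_def
      proof (rule integral_cong_AE)
        show "AE x in \<mu>. h x * D (\<lambda>x. a * f x + b * g x) x = a * (h x * D f x) + b * (h x * D g x)"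
          using lip_operatorD(3)[OF D Lipb_Lip[OF fg(1)] Lipb_Lip[OF fg(2)], of a b]
          by eventually_elim (simp add: algebra_simps)
      qed (use i[OF fg(1)] i[OF fg(2)] i[OF fgL] in \<open>auto intro!: borel_measurable_add borel_measurable_times\<close>)
      also have "... = a * \<phi> f + b * \<phi> g"
        unfolding \<phi>_def using i[OF fg(1)] i[OF fg(2)] by simp
      finally show "\<phi> (\<lambda>x. a * f x + b * g x) = a * \<phi> f + b * \<phi> g" .
    next
      fix fs f assume "wstar_conv fs (f :: 'a => real)"
      then show "(\<lambda>n. \<phi> (fs n)) \<longlonglongrightarrow> \<phi> f" unfolding \<phi>_def by (rule lip_operatorD(5)[OF D _ h])
    qed
    moreover have "D -` W \<inter> topspace Lipb_wstar = {f \<in> Lipb. \<phi> f \<in> U}"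
      unfolding top W \<phi>_def using Linf by (auto simp: mult.commute)
    ultimately show "openin Lipb_wstar (D -` W \<inter> topspace Lipb_wstar)"
      using U unfolding Lipb_wstar_def by (intro topology_generated_by_Basis) blast
  next
    have "{g \<in> Linf \<mu>. (LINT x|\<mu>. g x * (0::real)) \<in> (UNIV::real set)} \<in> {{g \<in> Linf \<mu>. (LINT x|\<mu>. g x * h x) \<in> U} | (h :: 'a => real) U. integrable \<mu> h \<and> open U}"
      by (intro CollectI exI[of _ "\<lambda>x. 0"] exI[of _ UNIV]) auto
    then show "D ` topspace Lipb_wstar \<subseteq> \<Union> {{g \<in> Linf \<mu>. (LINT x|\<mu>. g x * h x) \<in> U} | (h :: 'a => real) U. integrable \<mu> h \<and> open U}"
      unfolding top using Linf by blast
  qed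
  show ?thesis
    unfolding weaver_derivation_def
  proof (intro conjI ballI allI)
    show "\<exists>M. \<forall>f\<in>Lipb. AE x in \<mu>. \<bar>D f x\<bar> <= M * Lipb_norm f" using bd by blast
    show "AE x in \<mu>. D (\<lambda>y. a * f y + b * g y) x = a * D f x + b * D g x" if "f \<in> Lipb" "g \<in> Lipb" for f g a b
      by (rule lip_operatorD(3)[OF D Lipb_Lip[OF that(1)] Lipb_Lip[OF that(2)]])
    show "AE x in \<mu>. D (\<lambda>y. f y * g y) x = f x * D g x + g x * D f x" if "f \<in> Lipb" "g \<in> Lipb" for f g
      by (rule lip_operator_Leibniz[OF D B that])
  qed (use Linf cont in auto)
qed

text \<open>The interface between the current and the construction of fragments. Up to the factor
  \<open>l j\<close>, which has no zero on \<open>V j\<close>, the operators \<open>D j i\<close>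
  are dual to the coordinates, like partial derivatives.\<close>

definition operator_charts :: "'a::metric_space measure => (nat => 'a set) => (nat => 'k::finite => 'a => real) =>
    (nat => 'k => ('a => real) => 'a => real) => (nat => 'a => real) => bool" where
  "operator_charts \<mu> V \<pi> D l \<longleftrightarrow> disjoint_family V \<and> (\<forall>j. V j \<in> sets borel) \<and> emeasure \<mu> (UNIV - (\<Union>j. V j)) = 0 \<and>
    (\<forall>j i. \<pi> j i \<in> Lip \<and> lip_const (\<pi> j i) <= 1) \<and> (\<forall>j. \<forall>x\<in>V j. l j x ~= 0) \<and>
    (\<forall>j i. lip_operator \<mu> 1 (D j i)) \<and> (\<forall>j i m. AE x in \<mu>. D j i (\<pi> j m) x = (if i = m then l j x else 0))"

lemma current_operators:
  fixes T :: "('a::polish_space => real) => ('k::finite => 'a => real) => real"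
  assumes T: "metric_current T"
  shows "\<exists>V \<pi> D (l :: nat => 'a => real). operator_charts (mass T) V (\<pi> :: nat => 'k => 'a => real) D l"
proof -
  interpret current_with_mass T "mass T" by (rule mass_properties(1)[OF T])
  obtain V :: "nat => 'a set" and \<pi> :: "nat => 'k => 'a => real" where
    V: "disjoint_family V" "\<And>j. V j \<in> sets borel" "emeasure (mass T) (UNIV - (\<Union>j. V j)) = 0"
    and \<pi>: "\<And>j. Lips (\<pi> j)" "\<And>j i. lip_const (\<pi> j i) <= 1" and nz: "\<And>j x. x \<in> V j ==> cur_dens T (mass T) (\<pi> j) x ~= 0"
    using current_coordinates[OF T] by metis
  have "operator_charts (mass T) V \<pi> (\<lambda>j i f. cur_dens T (mass T) ((\<pi> j)(i := f))) (\<lambda>j. cur_dens T (mass T) (\<pi> j))"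
    unfolding operator_charts_def
  proof (intro conjI allI ballI)
    show "AE x in mass T. cur_dens T (mass T) ((\<pi> j)(i := \<pi> j m)) x = (if i = m then cur_dens T (mass T) (\<pi> j) x else 0)" for j i m
    proof (cases "i = m")
      \<comment> \<open>The function \<open>\<pi> j m\<close> now occupies both slot
        \<open>i\<close> and slot \<open>m\<close>, so the alternating property applies.\<close>
      case False
      then show ?thesis
        using cur_dens_alternating[OF Lips_upd[OF \<pi>(1) LipsD[OF \<pi>(1)]], of i m j i j m] by simp
    qed simp
    show "lip_operator (mass T) 1 (\<lambda>f. cur_dens T (mass T) ((\<pi> j)(i := f)))" for j i
      by (rule lip_operator_cur_dens[OF \<pi>])
  qed (use V \<pi> nz LipsD[OF \<pi>(1)] in auto)
  then show ?thesis by blast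
qed

lemma current_derivations:
  fixes T :: "('a::polish_space => real) => ('k::finite => 'a => real) => real"
  assumes T: "metric_current T"
  shows "\<exists>D :: 'k => ('a => real) => 'a => real.
            (\<forall>i. weaver_derivation (mass T) (D i)) \<and> independent_derivations (mass T) D"
proof -
  interpret current_with_mass T "mass T" by (rule mass_properties(1)[OF T])
  obtain V and \<pi> :: "nat => 'k => 'a => real" and D l where *: "operator_charts (mass T) V \<pi> D l"
    using current_operators[OF T] by blast
  note V = *[unfolded operator_charts_def, THEN conjunct1]
    *[unfolded operator_charts_def, THEN conjunct2, THEN conjunct1, rule_format]
    *[unfolded operator_charts_def, THEN conjunct2, THEN conjunct2, THEN conjunct1]
  have \<pi>: "\<And>j i. \<pi> j i \<in> Lip" and l: "\<And>j x. x \<in> V j ==> l j x ~= 0" and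
    D: "\<And>j i. lip_operator (mass T) 1 (D j i)" and
    D\<pi>: "\<And>j i m. AE x in mass T. D j i (\<pi> j m) x = (if i = m then l j x else 0)"
    using * unfolding operator_charts_def by blast+
  define G where "G i = glue_op V (\<lambda>j. D j i)" for i
  have G: "lip_operator (mass T) 1 (G i)" for i
    unfolding G_def by (rule lip_operator_glue[OF sets_mu finite_mu D V(1,2)]) simp
  have "independent_derivations (mass T) G"
    unfolding independent_derivations_def
  proof (intro allI impI)
    fix c :: "'k => 'a => real" and i0
    assume c: "(\<forall>i. c i \<in> Linf (mass T)) \<and> (\<forall>f\<in>Lipb. AE x in mass T. (\<Sum>i\<in>UNIV. c i x * G i f x) = 0)"
    \<comment> \<open>Independence is tested on bounded functions, so the coordinates are truncated;
      by locality the truncation is invisible where \<open>\<bar>\<pi> j i0\<bar>\<close> is at most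
      \<open>m\<close>.\<close>
    define f where "f j m = (\<lambda>x. max (- real m) (min (real m) (\<pi> j i0 x)))" for j m
    have clip: "1-lipschitz_on UNIV (\<lambda>y. max (- real m) (min (real m) y))" for m
      by (intro Lip_minmax lipschitz_on_le[OF lipschitz_on_constant] lipschitz_on_id) auto
    have fL: "f j m \<in> Lip" for j m unfolding f_def by (rule Lip_comp(1)[OF \<pi> clip])
    then have fb: "f j m \<in> Lipb" for j m by (rule LipbI[of _ "real m"]) (auto simp: f_def)
    define A where "A j m = {x. \<bar>\<pi> j i0 x\<bar> <= real m}" for j m
    have 1: "AE x in mass T. \<forall>j m. (\<Sum>i\<in>UNIV. c i x * G i (f j m) x) = 0"
      by (intro AE_all_countable[THEN iffD2] allI) (use c fb in blast)
    have 2: "AE x in mass T. \<forall>j m i. x \<in> A j m --> D j i (f j m) x = D j i (\<pi> j i0) x"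
    proof (intro AE_all_countable[THEN iffD2] allI)
      fix j m i
      show "AE x in mass T. x \<in> A j m --> D j i (f j m) x = D j i (\<pi> j i0) x"
        by (rule lip_operatorD(4)[OF D fL \<pi>]) (auto simp: A_def f_def)
    qed
    have 3: "AE x in mass T. \<forall>j i. D j i (\<pi> j i0) x = (if i = i0 then l j x else 0)"
      by (intro AE_all_countable[THEN iffD2] allI D\<pi>)
    have "UNIV - (\<Union>j. V j) \<in> sets (mass T)" using V(2) sets_mu by auto
    then have "UNIV - (\<Union>j. V j) \<in> null_sets (mass T)" using V(3) by (simp add: null_sets_def)
    then have 4: "AE x in mass T. x \<notin> UNIV - (\<Union>j. V j)" by (rule AE_not_in)
    from 1 2 3 4 show "AE x in mass T. c i0 x = 0"
    proof eventually_elim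
      case (elim x)
      then obtain j where j: "x \<in> V j" by auto
      obtain m :: nat where m: "\<bar>\<pi> j i0 x\<bar> <= real m" using real_arch_simple by blast
      have Gv: "G i (f j m) x = (if i = i0 then l j x else 0)" for i
        using glue_op_in[OF V(1) j, of "\<lambda>j. D j i" "f j m"] elim m by (simp add: G_def A_def)
      have "(\<Sum>i\<in>UNIV. c i x * G i (f j m) x) = 0" using elim by blast
      then have "(\<Sum>i\<in>UNIV. c i x * (if i = i0 then l j x else 0)) = 0" by (simp only: Gv)
      moreover have "(\<Sum>i\<in>UNIV. c i x * (if i = i0 then l j x else 0)) = (\<Sum>i\<in>UNIV. if i = i0 then c i0 x * l j x else 0)"
        by (intro sum.cong) auto
      ultimately show ?case using l[OF j] by simp
    qed
  qed
  then show ?thesis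
    using weaver_derivation_lip_operator[OF sets_mu finite_mu G] by (intro exI[of _ G]) simp
qed

section \<open>Hausdorff limits\<close>

lemma compact_convergent_subsequence:
  fixes f :: "nat => 'c::metric_space"
  assumes "compact S" "\<And>n. f n \<in> S"
  shows "\<exists>l\<in>S. \<exists>r. strict_mono (r :: nat => nat) \<and> (\<lambda>n. f (r n)) \<longlonglongrightarrow> l"
  using assms(1)[unfolded compact_def, THEN spec, of f] assms(2) by (simp add: o_def)

text \<open>Sequential compactness of the Cantor space, used to pass to subsequences and to code
  points by bits.\<close>

lemma diagonal_bits:
  fixes X :: "nat => nat => bool"
  obtains r x where "strict_mono (r :: nat => nat)" "\<And>k. eventually (\<lambda>n. X (r n) k = x k) sequentially"
proof -
  interpret subseqs "\<lambda>k s. \<exists>b. eventually (\<lambda>n. X (s n) k = b) sequentially"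
  proof
    fix k and s :: "nat => nat"
    obtain m where "infinite {n. X (s n) k = X (s m) k}"
      using pigeonhole_infinite[of UNIV "\<lambda>n. X (s n) k"] by auto
    from infinite_enumerate[OF this] obtain r' :: "nat => nat" where "strict_mono r'" "\<forall>n. r' n \<in> {n. X (s n) k = X (s m) k}" by blast
    then show "\<exists>r'. strict_mono r' \<and> (\<exists>b. eventually (\<lambda>n. X ((s \<circ> r') n) k = b) sequentially)"
      by (intro exI[of _ r'] conjI exI[of _ "X (s m) k"] always_eventually) auto
  qed
  have "\<exists>b. eventually (\<lambda>n. X (diagseq n) k = b) sequentially" for k
  proof -
    have "\<exists>b. eventually (\<lambda>n. X ((diagseq \<circ> ((+) (Suc k))) n) k = b) sequentially"
    proof (rule diagseq_holds)
      fix r s n assume "strict_mono (r :: nat => nat)" "\<exists>b. eventually (\<lambda>i. X (s i) n = b) sequentially"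
      then show "\<exists>b. eventually (\<lambda>i. X ((s \<circ> r) i) n = b) sequentially" by (auto dest: eventually_subseq)
    qed
    then show ?thesis using eventually_sequentially_seg[of "\<lambda>n. X (diagseq n) k = b" "Suc k" for b] by (auto simp: add.commute)
  qed
  from choice[OF allI, OF this] obtain x where "\<forall>k. eventually (\<lambda>n. X (diagseq n) k = x k) sequentially" ..
  then show ?thesis by (intro that[OF subseq_diagseq]) (rule spec)
qed

text \<open>The balls separate points and form arbitrarily small neighbourhoods, so the answers to
  countably many yes-no questions describe a point of \<open>Z\<close>, or a compact subset of
  it.\<close>

lemma compact_countable_balls:
  fixes Z :: "'a::metric_space set"
  assumes "compact Z"
  obtains z :: "nat => 'a" and \<rho> :: "nat => real" where "\<And>g e. g \<in> Z ==> 0 < e ==> \<exists>k. dist (z k) g < \<rho> k \<and> \<rho> k < e"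
proof -
  have "\<exists>k. finite k \<and> Z \<subseteq> (\<Union>x\<in>k. ball x (1 / real (Suc m)))" for m
    by (rule assms[unfolded compact_eq_totally_bounded, THEN conjunct2, rule_format]) simp
  then have "\<forall>m. \<exists>k. finite k \<and> Z \<subseteq> (\<Union>x\<in>k. ball x (1 / real (Suc m)))" by blast
  from choice[OF this] obtain N where N: "\<And>m. finite (N m)" "\<And>m. Z \<subseteq> (\<Union>x\<in>N m. ball x (1 / real (Suc m)))" by blast
  have "countable (Sigma UNIV N)" using N(1) by (intro countable_SIGMA) (auto intro: countable_finite)
  from from_nat_into_surj[OF this] have surj: "\<exists>k. from_nat_into (Sigma UNIV N) k = (m, y)" if "y \<in> N m" for m y using that by blast
  show ?thesis
  proof (rule that)
    fix g and e :: real assume g: "g \<in> Z" and e: "0 < e"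
    obtain m where m: "1 / real (Suc m) < e" using reals_Archimedean[OF e] by (auto simp: inverse_eq_divide)
    obtain y where y: "y \<in> N m" "dist y g < 1 / real (Suc m)" using subsetD[OF N(2)[of m] g] by auto
    then obtain k where "from_nat_into (Sigma UNIV N) k = (m, y)" using surj by blast
    then show "\<exists>k. dist (snd (from_nat_into (Sigma UNIV N) k)) g < 1 / real (Suc (fst (from_nat_into (Sigma UNIV N) k))) \<and>
        1 / real (Suc (fst (from_nat_into (Sigma UNIV N) k))) < e"
      using m y by (intro exI[of _ k]) simp
  qed
qed

lemma infdist_attained:
  assumes "compact A" "A ~= {}" shows "\<exists>a\<in>A. infdist x A = dist x a"
proof -
  have "continuous_on A (dist x)" by (intro continuous_intros)
  then obtain c where c: "c \<in> A" "\<forall>y\<in>A. dist x c <= dist x y"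
    using continuous_attains_inf[of A "dist x"] assms by blast
  then have "dist x c <= infdist x A"
    using assms(2) by (auto simp: infdist_notempty intro: cINF_greatest)
  then show ?thesis using c infdist_le[OF c(1), of x] by (intro bexI[of _ c]) auto
qed

lemma hausdorff_distD:
  assumes "compact A" "compact B" "A ~= {}" "B ~= {}" "hausdorff_dist A B < e" "a \<in> A"
  shows "\<exists>b\<in>B. dist a b < e"
proof -
  have "infdist a B <= hausdorff_dist A B" using hausdorff_dist_le_iff[OF assms(1-4), of "hausdorff_dist A B"] assms(6) by auto
  moreover obtain b where "b \<in> B" "infdist a B = dist a b" using infdist_attained[OF assms(2,4), of a] by blast
  ultimately show ?thesis using assms(5) by (intro bexI[of _ b]) auto
qed

lemma hausdorff_limit_point:
  assumes G: "\<And>n. compact (G n)" "\<And>n. G n ~= {}" and G0: "compact G0" "G0 ~= {}"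
    and lim: "(\<lambda>n. hausdorff_dist (G n) G0) \<longlonglongrightarrow> 0" and b: "b \<in> G0"
  shows "\<exists>c. (\<forall>n. c n \<in> G n) \<and> c \<longlonglongrightarrow> b"
proof -
  have "\<exists>c\<in>G n. dist b c <= hausdorff_dist (G n) G0" for n
  proof -
    have "infdist b (G n) <= hausdorff_dist (G n) G0"
      using hausdorff_dist_le_iff[OF G(1) G0(1) G(2) G0(2), of n "hausdorff_dist (G n) G0"] b by auto
    moreover obtain c where "c \<in> G n" "infdist b (G n) = dist b c" using infdist_attained[OF G(1,2), of n b] by blast
    ultimately show ?thesis by (intro bexI[of _ c]) auto
  qed
  then obtain c where c: "\<And>n. c n \<in> G n" "\<And>n. dist b (c n) <= hausdorff_dist (G n) G0" by metis
  have "(\<lambda>n. dist (c n) b) \<longlonglongrightarrow> 0"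
    by (rule tendsto_sandwich[OF _ _ tendsto_const lim]) (simp_all add: c(2) dist_commute)
  then have "c \<longlonglongrightarrow> b" using tendsto_dist_iff[of c b sequentially] by blast
  then show ?thesis using c(1) by blast
qed

text \<open>Blaschke's selection theorem. Along a subsequence each ball of a countable family is
  either met by all late sets or missed by all late sets; the limit consists of the points of
  \<open>Z\<close> in no ball of the second kind.\<close>

lemma hausdorff_sequentially_compact:
  fixes Z :: "'a::metric_space set"
  assumes Z: "compact Z" and G: "\<And>n. compact (G n)" "\<And>n. G n ~= {}" "\<And>n. G n \<subseteq> Z"
  shows "\<exists>r G0. strict_mono (r :: nat => nat) \<and> compact G0 \<and> G0 ~= {} \<and> G0 \<subseteq> Z \<and>
    (\<lambda>n. hausdorff_dist (G (r n)) G0) \<longlonglongrightarrow> 0"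
proof -
  obtain z :: "nat => 'a" and \<rho> where fine: "\<And>g e. g \<in> Z ==> 0 < e ==> \<exists>k. dist (z k) g < \<rho> k \<and> \<rho> k < e"
    by (rule compact_countable_balls[OF Z]) (rule that)
  obtain r x where r: "strict_mono (r :: nat => nat)" and ev: "\<And>k. eventually (\<lambda>n. (ball (z k) (\<rho> k) \<inter> G (r n) ~= {}) = x k) sequentially"
    by (rule diagonal_bits[of "\<lambda>n k. ball (z k) (\<rho> k) \<inter> G n ~= {}"]) (rule that)
  define G0 where "G0 = Z \<inter> (\<Inter>k\<in>{k. \<not> x k}. - ball (z k) (\<rho> k))"
  have G0c: "compact G0" unfolding G0_def using Z by (intro compact_Int_closed closed_INT) auto
  have ev': "eventually (\<lambda>n. (ball (z k) (\<rho> k) \<inter> G (r (t n)) ~= {}) = x k) sequentially" if "\<And>n. n <= t n" for t k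
    using ev[of k] that unfolding eventually_sequentially by (meson le_trans)
  \<comment> \<open>\<open>t\<close> need not be monotone: \<open>n <= t n\<close> is enough for the
    bits to be eventually constant along it. This lets \<open>t\<close> select the indices at which
    convergence is supposed to fail.\<close>
  have sub: "\<exists>b\<in>G0. \<exists>s. strict_mono (s :: nat => nat) \<and> (\<lambda>n. p (s n)) \<longlonglongrightarrow> b"
    if p: "\<And>n. p n \<in> G (r (t n)) \<union> G0" and t: "\<And>n. n <= t n" for p t
  proof -
    have "p n \<in> Z" for n using p[of n] G(3) by (auto simp: G0_def)
    from compact_convergent_subsequence[OF Z, of p, OF this]
    obtain b s where b: "b \<in> Z" "strict_mono (s :: nat => nat)" "(\<lambda>m. p (s m)) \<longlonglongrightarrow> b" by (elim bexE exE conjE) (rule that)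
    have "x k" if "b \<in> ball (z k) (\<rho> k)" for k
    proof -
      have "n <= t (s n)" for n using seq_suble[OF b(2), of n] t[of "s n"] by simp
      from eventually_conj[OF ev'[of "\<lambda>n. t (s n)" k, OF this] topological_tendstoD[OF b(3) open_ball that]]
      obtain n where "(ball (z k) (\<rho> k) \<inter> G (r (t (s n))) ~= {}) = x k" "p (s n) \<in> ball (z k) (\<rho> k)"
        unfolding eventually_sequentially by blast
      then show ?thesis using p[of "s n"] unfolding G0_def by blast
    qed
    then show ?thesis using b by (auto simp: G0_def)
  qed
  have "\<forall>n. \<exists>a. a \<in> G n" using G(2) by blast
  from choice[OF this] obtain a where "\<And>n. a n \<in> G n" by blast
  then have G0ne: "G0 ~= {}" using sub[of "\<lambda>n. a (r n)" "\<lambda>n. n"] by auto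
  have "(\<lambda>n. hausdorff_dist (G (r n)) G0) \<longlonglongrightarrow> 0"
  proof (rule ccontr)
    assume "\<not> ?thesis"
    then obtain e where e: "0 < e" "\<And>N. \<exists>n\<ge>N. e <= \<bar>hausdorff_dist (G (r n)) G0\<bar>"
      unfolding tendsto_iff eventually_sequentially by (auto simp: not_less)
    from e(2) obtain t where t: "\<And>N. N <= t N" "\<And>N. e <= \<bar>hausdorff_dist (G (r (t N))) G0\<bar>" by metis
    have "\<exists>q. q \<in> G (r (t n)) \<and> e / 2 < infdist q G0 \<or> q \<in> G0 \<and> e / 2 < infdist q (G (r (t n)))" for n
    proof -
      note le = hausdorff_dist_le_iff[OF G(1) G0c G(2) G0ne, of "r (t n)"]
      have "0 <= hausdorff_dist (G (r (t n))) G0"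
        using iffD1[OF le order_refl] G0ne infdist_nonneg order_trans by blast
      then have "\<not> hausdorff_dist (G (r (t n))) G0 <= e / 2" using e(1) t(2)[of n] by linarith
      then show ?thesis unfolding le by (auto simp: not_le)
    qed
    then obtain p where p: "\<And>n. p n \<in> G (r (t n)) \<and> e / 2 < infdist (p n) G0 \<or> p n \<in> G0 \<and> e / 2 < infdist (p n) (G (r (t n)))" by metis
    then have "p n \<in> G (r (t n)) \<union> G0" for n by blast
    from sub[of p t, OF this t(1)] obtain b s where b: "b \<in> G0" "strict_mono (s :: nat => nat)" "(\<lambda>n. p (s n)) \<longlonglongrightarrow> b"
      by blast
    \<comment> \<open>As \<open>b\<close> lies in \<open>G0\<close>, every small ball around it from
      the family is met by all late sets. This puts a point of \<open>G (r (t (s n)))\<close> within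
      \<open>e / 2\<close> of \<open>p (s n)\<close>.\<close>
    obtain k where k: "dist (z k) b < \<rho> k" "\<rho> k < e / 8" using fine[of b "e / 8"] b(1) e(1) by (auto simp: G0_def)
    have "n <= t (s n)" for n using seq_suble[OF b(2), of n] t(1)[of "s n"] by simp
    moreover have "0 < e / 4" using e(1) by simp
    ultimately have "eventually (\<lambda>n. (ball (z k) (\<rho> k) \<inter> G (r (t (s n))) ~= {}) = x k \<and> dist (p (s n)) b < e / 4) sequentially"
      by (intro eventually_conj ev'[of "\<lambda>n. t (s n)"] tendstoD[OF b(3)])
    then
    obtain n where n: "(ball (z k) (\<rho> k) \<inter> G (r (t (s n))) ~= {}) = x k" "dist (p (s n)) b < e / 4"
      using eventually_happens'[OF sequentially_bot] by blast
    have "x k" using b(1) k(1) by (auto simp: G0_def)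
    then obtain y where y: "dist (z k) y < \<rho> k" "y \<in> G (r (t (s n)))" using n(1) by auto
    have "dist (p (s n)) y < e / 2"
      using n(2) y(1) k dist_triangle[of "p (s n)" y b] dist_triangle3[of b y "z k"] by linarith
    then show False
      using p[of "s n"] infdist_le[OF b(1), of "p (s n)"] infdist_le[OF y(2), of "p (s n)"] n(2) e(1) by linarith
  qed
  then show ?thesis using r G0c G0ne by (intro exI[of _ r] exI[of _ G0]) (auto simp: G0_def)
qed

lemma hausdorff_limit_relation:
  assumes G: "\<And>n. compact (G n)" "\<And>n. G n ~= {}" and G0: "compact G0" "G0 ~= {}"
    and lim: "(\<lambda>n. hausdorff_dist (G n) G0) \<longlonglongrightarrow> 0" and R: "closed R" "\<And>n. G n \<times> G n \<subseteq> R"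
  shows "G0 \<times> G0 \<subseteq> R"
proof
  fix p assume "p \<in> G0 \<times> G0"
  then obtain a b where p: "p = (a, b)" "a \<in> G0" "b \<in> G0" by blast
  obtain c where c: "\<forall>n. c n \<in> G n" "c \<longlonglongrightarrow> a" using hausdorff_limit_point[OF G G0 lim p(2)] by blast
  obtain d where d: "\<forall>n. d n \<in> G n" "d \<longlonglongrightarrow> b" using hausdorff_limit_point[OF G G0 lim p(3)] by blast
  have "(\<lambda>n. (c n, d n)) \<longlonglongrightarrow> p" unfolding p by (intro tendsto_Pair c d)
  moreover have "\<forall>n. (c n, d n) \<in> R" using R(2) c d by blast
  ultimately show "p \<in> R" using R(1) using closed_sequentially[OF R(1), of "\<lambda>n. (c n, d n)" p] by blast
qed

text \<open>A graph close to \<open>G0\<close> may lose points of \<open>F\<close>, but it cannot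
  acquire any far from the slice of \<open>G0\<close>: points of \<open>F\<close> on graphs tending
  to \<open>G0\<close> accumulate in \<open>G0 \<inter> F\<close>. This is the source of all
  semicontinuity of occupation times.\<close>

lemma hausdorff_slice_usc:
  fixes G0 :: "('b::metric_space \<times> 'a::metric_space) set"
  assumes G0: "compact G0" "G0 ~= {}" and F: "closed F" and r: "0 < r"
  shows "\<exists>\<delta>>0. \<forall>G. compact G \<and> G ~= {} \<and> hausdorff_dist G G0 < \<delta> --> fst ` (G \<inter> F) \<subseteq> (\<Union>c\<in>fst ` (G0 \<inter> F). ball c r)"
proof (rule ccontr)
  assume neg: "\<not> ?thesis"
  have "\<exists>G p. compact G \<and> G ~= {} \<and> hausdorff_dist G G0 < 1 / real (Suc n) \<and> p \<in> G \<and> p \<in> F \<and> fst p \<notin> (\<Union>c\<in>fst ` (G0 \<inter> F). ball c r)" for n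
  proof -
    have "0 < 1 / real (Suc n)" by simp
    with neg have "\<not> (\<forall>G. compact G \<and> G ~= {} \<and> hausdorff_dist G G0 < 1 / real (Suc n) --> fst ` (G \<inter> F) \<subseteq> (\<Union>c\<in>fst ` (G0 \<inter> F). ball c r))"
      by blast
    then show ?thesis by blast
  qed
  then obtain G p where Gp: "\<And>n. compact (G n) \<and> G n ~= {} \<and> hausdorff_dist (G n) G0 < 1 / real (Suc n) \<and> p n \<in> G n \<and> p n \<in> F \<and> fst (p n) \<notin> (\<Union>c\<in>fst ` (G0 \<inter> F). ball c r)"
    by metis
  then have G: "\<And>n. compact (G n)" "\<And>n. G n ~= {}" "\<And>n. hausdorff_dist (G n) G0 < 1 / real (Suc n)"
    and p: "\<And>n. p n \<in> G n" "\<And>n. p n \<in> F" "\<And>n. fst (p n) \<notin> (\<Union>c\<in>fst ` (G0 \<inter> F). ball c r)" by blast+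
  have "\<exists>q\<in>G0. dist (p n) q < 1 / real (Suc n)" for n
    by (rule hausdorff_distD[OF G(1) G0(1) G(2) G0(2) G(3) p(1)])
  then obtain q where q: "\<And>n. q n \<in> G0" "\<And>n. dist (p n) (q n) < 1 / real (Suc n)" by metis
  from compact_convergent_subsequence[OF G0(1), of q, OF q(1)]
  obtain q0 s where s: "q0 \<in> G0" "strict_mono (s :: nat => nat)" "(\<lambda>n. q (s n)) \<longlonglongrightarrow> q0" by (elim bexE exE conjE) (rule that)
  have d0: "(\<lambda>n. dist (p n) (q n)) \<longlonglongrightarrow> 0"
    by (rule tendsto_sandwich[OF _ _ tendsto_const LIMSEQ_inverse_real_of_nat])
      (auto intro!: always_eventually less_imp_le q(2) simp: inverse_eq_divide simp del: of_nat_Suc)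
  have q1: "(\<lambda>n. dist (q (s n)) q0) \<longlonglongrightarrow> 0" using s(3) tendsto_dist_iff[of "\<lambda>n. q (s n)" q0 sequentially] by simp
  have q2: "(\<lambda>n. dist (p (s n)) (q (s n))) \<longlonglongrightarrow> 0" using LIMSEQ_subseq_LIMSEQ[OF d0 s(2)] by (simp add: o_def)
  have q3: "(\<lambda>n. dist (p (s n)) (q (s n)) + dist (q (s n)) q0) \<longlonglongrightarrow> 0"
    using tendsto_add[OF q2 q1] by simp
  have "(\<lambda>n. dist (p (s n)) q0) \<longlonglongrightarrow> 0"
    by (rule tendsto_sandwich[OF _ _ tendsto_const q3]) (simp_all add: dist_triangle)
  then have pq: "(\<lambda>n. p (s n)) \<longlonglongrightarrow> q0" using tendsto_dist_iff[of "\<lambda>n. p (s n)" q0 sequentially] by simp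
  then have "q0 \<in> F" using closed_sequentially[OF F] p(2) by metis
  then have q0: "fst q0 \<in> fst ` (G0 \<inter> F)" using s(1) by blast
  have "(\<lambda>n. fst (p (s n))) \<longlonglongrightarrow> fst q0" by (intro tendsto_fst pq)
  then have "eventually (\<lambda>n. dist (fst (p (s n))) (fst q0) < r) sequentially" using r by (rule tendstoD)
  then obtain n where "dist (fst (p (s n))) (fst q0) < r" by (auto simp: eventually_sequentially)
  then have "fst (p (s n)) \<in> ball (fst q0) r" by (simp add: dist_commute)
  then show False using p(3)[of "s n"] q0 by blast
qed

lemma compact_nbhd_measure:
  fixes C :: "real set"
  assumes C: "compact C" and y: "emeasure lborel C < y"
  obtains r where "0 < r" "emeasure lborel (\<Union>c\<in>C. ball c r) < y"
proof -
  have Cb: "C \<in> sets borel" using C by (rule borel_compact)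
  obtain m where m: "0 <= m" "emeasure lborel C = ennreal m"
    using emeasure_bounded_finite[OF compact_imp_bounded[OF C]] by (cases "emeasure lborel C") auto
  obtain e where e: "0 < e" "ennreal (m + e) <= y"
  proof (cases y)
    case (real q)
    then show ?thesis using that[of "q - m"] y m by (simp add: ennreal_less_iff)
  next
    case top
    then show ?thesis using that[of 1] by simp
  qed
  obtain U where U: "open U" "C \<subseteq> U" "emeasure lborel (U - C) < ennreal e" using outer_regular_lborel[OF Cb e(1)] by blast
  obtain r where r: "0 < r" "(\<Union>c\<in>C. ball c r) \<subseteq> U" using compact_subset_open_imp_ball_epsilon_subset[OF C U(1,2)] by blast
  have "emeasure lborel (\<Union>c\<in>C. ball c r) <= emeasure lborel (C \<union> (U - C))" using r(2) U Cb by (intro emeasure_mono) auto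
  also have "... <= emeasure lborel C + emeasure lborel (U - C)" using U(1) Cb by (intro emeasure_subadditive) auto
  also have "... < ennreal m + ennreal e" using U(3) m(2) by (simp add: ennreal_add_left_cancel_less)
  also have "... <= y" using e m(1) by (simp add: ennreal_plus[symmetric] del: ennreal_plus)
  finally show ?thesis using that r(1) by blast
qed

text \<open>Ratio \<open>1/3\<close> makes the code injective, unlike a binary expansion: all later
  digits together change the sum by at most half of the term of the first digit in which two
  sequences differ.\<close>

definition cantor_sum :: "(nat => bool) => real" where
  "cantor_sum x = (\<Sum>k. of_bool (x k) * (1/3)^k)"

lemma cantor_sum_summable: "summable (\<lambda>k. of_bool (x k) * (1/3::real)^k)"
  by (rule summable_comparison_test'[of "\<lambda>k. (1/3::real)^k" 0]) auto

lemma cantor_sum_inj: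
  assumes eq: "cantor_sum x = cantor_sum y"
  shows "x = y"
proof (rule ccontr)
  assume "x ~= y"
  then have ex: "\<exists>k. x k ~= y k" by auto
  define K where "K = (LEAST k. x k ~= y k)"
  have K: "x K ~= y K" unfolding K_def by (rule LeastI_ex[OF ex])
  have lt: "x k = y k" if "k < K" for k using not_less_Least[of k "\<lambda>k. x k ~= y k"] that by (auto simp: K_def)
  define d where "d k = (of_bool (x k) - of_bool (y k)) * (1/3::real)^k" for k
  have ds: "summable d" unfolding d_def[abs_def] left_diff_distrib
    by (intro summable_diff cantor_sum_summable)
  have "suminf d = 0" unfolding d_def[abs_def] left_diff_distrib
    using eq by (simp add: suminf_diff[OF cantor_sum_summable cantor_sum_summable, symmetric] cantor_sum_def)
  also have "suminf d = (\<Sum>k. d (k + Suc K)) + (\<Sum>k<Suc K. d k)" by (rule suminf_split_initial_segment[OF ds])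
  also have "(\<Sum>k<Suc K. d k) = d K" using lt by (simp add: d_def)
  finally have "\<bar>d K\<bar> = \<bar>\<Sum>k. d (k + Suc K)\<bar>" by simp
  have bd: "\<bar>d (k + Suc K)\<bar> <= (1/3::real)^Suc K * (1/3)^k" for k
    by (cases "x (k + Suc K)"; cases "y (k + Suc K)") (simp_all add: d_def power_add)
  have s3: "summable (\<lambda>k. (1/3::real)^Suc K * (1/3)^k)" by (intro summable_mult summable_geometric) simp
  have "\<bar>\<Sum>k. d (k + Suc K)\<bar> <= (\<Sum>k. \<bar>d (k + Suc K)\<bar>)"
    by (rule summable_rabs[OF summable_comparison_test'[OF s3, of 0]]) (use bd in auto)
  also have "... <= (\<Sum>k. (1/3::real)^Suc K * (1/3)^k)"
    by (rule suminf_le[OF bd summable_comparison_test'[OF s3, of 0] s3]) (use bd in auto)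
  also have "... = (1/3)^Suc K * (3/2)" by (subst suminf_mult) (simp_all add: suminf_geometric)
  also have "... = (1/3)^K * (1/2)" by simp
  also have "... < (1/3)^K" by simp
  also have "(1/3)^K = \<bar>d K\<bar>" using K by (auto simp: d_def)
  finally show False using \<open>\<bar>d K\<bar> = \<bar>\<Sum>k. d (k + Suc K)\<bar>\<close> by simp
qed

lemma cantor_sum_tendsto:
  assumes "\<And>k. eventually (\<lambda>n. X n k = x k) sequentially"
  shows "(\<lambda>n. cantor_sum (X n)) \<longlonglongrightarrow> cantor_sum x"
  unfolding cantor_sum_def
proof (rule tannerys_theorem[where M="\<lambda>k. (1/3::real)^k", THEN conjunct2, THEN conjunct2])
  show "((\<lambda>n. of_bool (X n k) * (1/3)^k) \<longlonglongrightarrow> of_bool (x k) * (1/3)^k)" for k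
    by (rule tendsto_eventually) (use assms[of k] in eventually_elim, simp)
  show "\<forall>\<^sub>F (k, n) in at_top \<times>\<^sub>F sequentially. norm (of_bool (X n k) * (1/3::real)^k) <= (1/3::real)^k"
    by (intro always_eventually) auto
qed auto

text \<open>The Hausdorff-Alexandroff theorem. A point is coded by the balls that contain it, and a
  point on the boundary sphere may be coded either way, which makes the set \<open>Q\<close> of
  admissible pairs compact. Small balls around a point make its code determine it, so the first
  projection of \<open>Q\<close> is injective and has a continuous inverse.\<close>

lemma compact_is_continuous_image_of_real_compact:
  fixes \<Gamma> :: "'b::metric_space set"
  assumes \<Gamma>: "compact \<Gamma>"
  obtains E :: "real set" and \<Psi> where "compact E" "continuous_on E \<Psi>" "\<Psi> ` E = \<Gamma>"
proof -
  obtain z :: "nat => 'b" and \<rho> where fine: "\<And>g e. g \<in> \<Gamma> ==> 0 < e ==> \<exists>k. dist (z k) g < \<rho> k \<and> \<rho> k < e"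
    by (rule compact_countable_balls[OF \<Gamma>]) (rule that)
  define R where "R x g \<longleftrightarrow> g \<in> \<Gamma> \<and> (\<forall>k. if x k then dist (z k) g <= \<rho> k else \<rho> k <= dist (z k) g)" for x :: "nat => bool" and g
  have R_unique: "g = h" if "R x g" "R x h" for x g h
  proof (rule ccontr)
    assume "g ~= h"
    moreover have "g \<in> \<Gamma>" using that(1) by (simp add: R_def)
    ultimately obtain k where k: "dist (z k) g < \<rho> k" "\<rho> k < dist g h / 2" using fine[of g "dist g h / 2"] by auto
    then have "x k" using that(1) unfolding R_def by (meson not_le)
    then have "dist (z k) h <= \<rho> k" using that(2) by (auto simp: R_def)
    then show False using k dist_triangle3[of g h "z k"] by linarith
  qed
  define Q where "Q = {(cantor_sum x, g) | x g. R x g}"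
  have Q: "compact Q"
    unfolding compact_def
  proof (intro allI impI)
    fix f :: "nat => real \<times> 'b" assume "\<forall>n. f n \<in> Q"
    then have "\<exists>x g. f n = (cantor_sum x, g) \<and> R x g" for n by (auto simp: Q_def)
    then obtain X :: "nat => nat => bool" and G where f: "\<And>n. f n = (cantor_sum (X n), G n)" and XG: "\<And>n. R (X n) (G n)" by metis
    obtain r x where r: "strict_mono (r :: nat => nat)" and x: "\<And>k. eventually (\<lambda>n. X (r n) k = x k) sequentially"
      by (rule diagonal_bits[of X]) (rule that)
    have "G (r n) \<in> \<Gamma>" for n using XG by (simp add: R_def)
    from compact_convergent_subsequence[OF \<Gamma>, of "\<lambda>n. G (r n)", OF this]
    obtain g s where g: "g \<in> \<Gamma>" and s: "strict_mono s" and gs: "(\<lambda>n. G (r (s n))) \<longlonglongrightarrow> g" by (elim bexE exE conjE) (rule that)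
    have ev: "eventually (\<lambda>n. X (r (s n)) k = x k) sequentially" for k by (rule eventually_subseq[OF s x])
    have dl: "(\<lambda>n. dist (z k) (G (r (s n)))) \<longlonglongrightarrow> dist (z k) g" for k by (intro tendsto_intros gs)
    have "if x k then dist (z k) g <= \<rho> k else \<rho> k <= dist (z k) g" for k
    proof (cases "x k")
      case True
      have "eventually (\<lambda>n. dist (z k) (G (r (s n))) <= \<rho> k) sequentially"
        using ev[of k] by eventually_elim (use XG True in \<open>auto simp: R_def split: if_splits\<close>)
      from tendsto_upperbound[OF dl this] True show ?thesis by simp
    next
      case False
      have "eventually (\<lambda>n. \<rho> k <= dist (z k) (G (r (s n)))) sequentially"
        using ev[of k] by eventually_elim (use XG False in \<open>auto simp: R_def split: if_splits\<close>)
      from tendsto_lowerbound[OF dl this] False show ?thesis by simp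
    qed
    then have "R x g" using g by (simp add: R_def)
    moreover have "(\<lambda>n. f (r (s n))) \<longlonglongrightarrow> (cantor_sum x, g)"
      unfolding f by (intro tendsto_Pair cantor_sum_tendsto ev gs)
    ultimately show "\<exists>l\<in>Q. \<exists>r. strict_mono r \<and> (f \<circ> r) \<longlonglongrightarrow> l"
      using r s by (intro bexI[of _ "(cantor_sum x, g)"] exI[of _ "r \<circ> s"]) (auto simp: Q_def o_def strict_mono_def)
  qed
  have "inj_on fst Q" by (auto simp: Q_def inj_on_def dest: cantor_sum_inj R_unique)
  note inv = the_inv_into_f_f[OF this] and cont = continuous_on_inv_into[OF continuous_on_fst[OF continuous_on_id] Q this]
  show ?thesis
  proof (rule that)
    show "compact (fst ` Q)" by (intro compact_continuous_image continuous_intros Q)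
    show "continuous_on (fst ` Q) (\<lambda>e. snd (the_inv_into Q fst e))" by (rule continuous_on_snd[OF cont])
    have "\<exists>x. R x g" if "g \<in> \<Gamma>" for g
      using that by (intro exI[of _ "\<lambda>k. dist (z k) g <= \<rho> k"]) (auto simp: R_def)
    then have "snd ` Q = \<Gamma>" by (force simp: Q_def R_def image_iff)
    moreover have "(\<lambda>e. snd (the_inv_into Q fst e)) ` fst ` Q = snd ` Q"
      unfolding image_image by (rule image_cong) (simp_all add: inv)
    ultimately show "(\<lambda>e. snd (the_inv_into Q fst e)) ` fst ` Q = \<Gamma>" by simp
  qed
qed

section \<open>A minimax principle\<close>

lemma exp_minus_le_quadratic: "0 <= y ==> exp (- y) <= 1 - y + y * y" for y :: real
proof -
  assume y: "0 <= y"
  have "1 <= (1 + y) * (1 - y + y * y)" using y by (simp add: algebra_simps)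
  also have "... <= exp y * (1 - y + y * y)"
  proof (rule mult_right_mono)
    have "0 <= (y - 1/2) * (y - 1/2)" by simp
    then show "0 <= 1 - y + y * y" by (simp add: algebra_simps)
  qed (use exp_ge_add_one_self[of y] in simp)
  finally show ?thesis by (simp add: exp_minus field_simps)
qed

text \<open>The multiplicative weights method. In each round \<open>hyp\<close> provides a good
  reply to the current weighted average of the payoffs, and each weight then shrinks exponentially
  in the payoff just received, so neglected payoffs gain influence. No single weight exceeds the
  total weight, which decays at rate about \<open>h * c\<close>; this forces every averaged payoff
  to be nearly \<open>c\<close>.\<close>

lemma multiplicative_weights:
  fixes J :: "nat => 'e => real"
  assumes N: "0 < N" and J: "\<And>n e. e \<in> E ==> 0 <= J n e \<and> J n e <= 1"
    and hyp: "\<And>p. (\<And>n. n < N ==> 0 <= p n) ==> (\<Sum>n<N. p n) = 1 ==> \<exists>e\<in>E. c <= (\<Sum>n<N. p n * J n e)"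
    and \<eta>: "0 < \<eta>"
  shows "\<exists>R>0. \<exists>s. (\<forall>t. s t \<in> E) \<and> (\<forall>n<N. c - \<eta> <= (\<Sum>t<R. J n (s t)) / real R)"
proof -
  \<comment> \<open>One half of \<open>\<eta>\<close> pays for the quadratic error of the
    exponential in each round, the other for the logarithm of the initial total weight spread over
    \<open>R\<close> rounds.\<close>
  define h where "h = \<eta> / 2"
  have h: "0 < h" using \<eta> by (simp add: h_def)
  define pick where "pick w = (SOME e. e \<in> E \<and> c * (\<Sum>n<N. w n) <= (\<Sum>n<N. w n * J n e))" for w :: "nat => real"
  have pick: "pick w \<in> E \<and> c * (\<Sum>n<N. w n) <= (\<Sum>n<N. w n * J n (pick w))" if w: "\<And>n. 0 < w n" for w
  proof -
    define S where "S = (\<Sum>n<N. w n)"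
    have S: "0 < S" unfolding S_def using w N by (intro sum_pos) auto
    have "(\<Sum>n<N. w n / S) = 1" using S by (simp add: S_def sum_divide_distrib[symmetric])
    then obtain e where e: "e \<in> E" "c <= (\<Sum>n<N. w n / S * J n e)"
      using hyp[of "\<lambda>n. w n / S"] w S by (auto simp: less_imp_le)
    have "(\<Sum>n<N. w n / S * J n e) = (\<Sum>n<N. w n * J n e) / S" by (simp add: sum_divide_distrib)
    then have "c * S <= (\<Sum>n<N. w n * J n e)" using e(2) S by (simp add: pos_le_divide_eq)
    then have "\<exists>e. e \<in> E \<and> c * (\<Sum>n<N. w n) <= (\<Sum>n<N. w n * J n e)" using e(1) by (auto simp: S_def)
    from someI_ex[OF this] show ?thesis unfolding pick_def .
  qed
  define W where "W = rec_nat (\<lambda>n. 1) (\<lambda>t w n. w n * exp (- (h * J n (pick w))))"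
  have W0: "W 0 n = 1" and WS: "W (Suc t) n = W t n * exp (- (h * J n (pick (W t))))" for n t by (auto simp: W_def)
  have Wpos: "0 < W t n" for t n by (induction t) (auto simp: W0 WS)
  define s where "s t = pick (W t)" for t
  have s: "s t \<in> E" "c * (\<Sum>n<N. W t n) <= (\<Sum>n<N. W t n * J n (s t))" for t
    using pick[of "W t", OF Wpos] by (auto simp: s_def)
  have Wexp: "W t n = exp (- (h * (\<Sum>i<t. J n (s i))))" for t n
    by (induction t) (simp_all add: W0 WS s_def[symmetric] distrib_left exp_add[symmetric])
  have step: "(\<Sum>n<N. W (Suc t) n) <= (\<Sum>n<N. W t n) * exp (h * h - h * c)" for t
  proof -
    have "(\<Sum>n<N. W (Suc t) n) <= (\<Sum>n<N. W t n * (1 - h * J n (s t) + h * h))"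
    proof (rule sum_mono)
      fix n
      have j: "0 <= J n (s t)" "J n (s t) <= 1" using J[OF s(1)] by auto
      have "exp (- (h * J n (s t))) <= 1 - h * J n (s t) + (h * J n (s t)) * (h * J n (s t))"
        by (rule exp_minus_le_quadratic) (use h j in simp)
      also have "(h * J n (s t)) * (h * J n (s t)) <= h * h"
        using h j by (intro mult_mono) (auto simp: mult_le_cancel_left1 mult_le_one)
      finally show "W (Suc t) n <= W t n * (1 - h * J n (s t) + h * h)"
        unfolding WS s_def[symmetric] using Wpos[of t n] by (intro mult_left_mono) auto
    qed
    also have "... = (1 + h * h) * (\<Sum>n<N. W t n) - h * (\<Sum>n<N. W t n * J n (s t))"
      by (simp add: sum_distrib_left sum_distrib_right sum.distrib sum_subtractf algebra_simps)
    also have "... <= (1 + h * h) * (\<Sum>n<N. W t n) - h * (c * (\<Sum>n<N. W t n))"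
      using s(2)[of t] h by (intro diff_left_mono mult_left_mono) auto
    also have "... = (\<Sum>n<N. W t n) * (1 + (h * h - h * c))" by (simp add: algebra_simps)
    also have "... <= (\<Sum>n<N. W t n) * exp (h * h - h * c)"
      using exp_ge_add_one_self[of "h * h - h * c"] Wpos by (intro mult_left_mono sum_nonneg) (auto simp: less_imp_le)
    finally show ?thesis .
  qed
  have \<Phi>: "(\<Sum>n<N. W t n) <= real N * exp (real t * (h * h - h * c))" for t
  proof (induction t)
    case (Suc t)
    have "(\<Sum>n<N. W (Suc t) n) <= real N * exp (real t * (h * h - h * c)) * exp (h * h - h * c)"
      by (rule order_trans[OF step mult_right_mono[OF Suc]]) simp
    also have "... = real N * exp (real (Suc t) * (h * h - h * c))" by (simp add: exp_add[symmetric] algebra_simps)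
    finally show ?case .
  qed (simp add: W0)
  obtain R0 :: nat where R0: "ln (real N) / (h * h) < real R0" using reals_Archimedean2 by blast
  define R where "R = Suc R0"
  have R: "0 < R" "ln (real N) / (h * h) < real R" using R0 by (auto simp: R_def)
  have "c - \<eta> <= (\<Sum>t<R. J n (s t)) / real R" if n: "n < N" for n
  proof -
    have "W R n <= (\<Sum>n<N. W R n)" using n Wpos by (intro member_le_sum) (auto simp: less_imp_le)
    also note \<Phi>[of R]
    also have "real N = exp (ln (real N))" using N by simp
    finally have "- (h * (\<Sum>i<R. J n (s i))) <= ln (real N) + real R * (h * h - h * c)"
      unfolding Wexp exp_add[symmetric] by simp
    moreover have "ln (real N) <= h * h * real R" using R(2) h by (simp add: divide_less_eq mult.commute less_imp_le)
    ultimately have "h * (real R * (c - 2 * h)) <= h * (\<Sum>i<R. J n (s i))" by (simp add: algebra_simps)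
    then have "real R * (c - \<eta>) <= (\<Sum>i<R. J n (s i))" using h by (simp add: h_def)
    then show ?thesis using R(1) by (simp add: pos_le_divide_eq mult.commute)
  qed
  then show ?thesis using R(1) s(1) by blast
qed

text \<open>Averaged replies to the first \<open>N + 1\<close> payoffs are finitely supported laws
  on the compact set \<open>E\<close>, hence tight. A weak limit serves all payoffs, because an
  upper semicontinuous payoff is a limit from above of Lipschitz ones.\<close>

lemma minimax_measure:
  fixes J :: "nat => real => real"
  assumes E: "compact E" "E ~= {}" and J: "\<And>n e. e \<in> E ==> 0 <= J n e \<and> J n e <= 1"
    and usc: "\<And>n e \<eta>. e \<in> E ==> 0 < \<eta> ==> \<exists>\<delta>>0. \<forall>e'\<in>E. \<bar>e' - e\<bar> < \<delta> --> J n e' < J n e + \<eta>"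
    and hyp: "\<And>N p. (\<And>n. 0 <= p n) ==> (\<Sum>n<N. p n) = 1 ==> \<exists>e\<in>E. c <= (\<Sum>n<N. p n * J n e)"
  shows "\<exists>M. real_distribution M \<and> (AE e in M. e \<in> E) \<and>
     (\<forall>n. (\<lambda>e. indicator E e * J n e) \<in> borel_measurable borel \<and> c <= (LINT e|M. indicator E e * J n e))"
proof -
  have Eb: "E \<in> sets borel" using E(1) by (simp add: compact_imp_closed)
  have "\<exists>R s. 0 < R \<and> (\<forall>t. s t \<in> E) \<and> (\<forall>n<Suc N. c - 1 / real (Suc N) <= (\<Sum>t<R. J n (s t)) / real R)" for N
  proof -
    have "\<exists>R>0. \<exists>s. (\<forall>t. s t \<in> E) \<and> (\<forall>n<Suc N. c - 1 / real (Suc N) <= (\<Sum>t<R. J n (s t)) / real R)"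
    proof (rule multiplicative_weights[OF _ J])
      fix p :: "nat => real" assume p: "\<And>n. n < Suc N ==> 0 <= p n" "(\<Sum>n<Suc N. p n) = 1"
      have "\<exists>e\<in>E. c <= (\<Sum>n<Suc N. (if n < Suc N then p n else 0) * J n e)"
        using p by (intro hyp) auto
      then show "\<exists>e\<in>E. c <= (\<Sum>n<Suc N. p n * J n e)" by simp
    qed auto
    then show ?thesis by blast
  qed
  then obtain R s where R: "\<And>N. 0 < (R N :: nat)" and s: "\<And>N t. s N t \<in> E"
    and Rs: "\<And>N n. n < Suc N ==> c - 1 / real (Suc N) <= (\<Sum>t<R N. J n (s N t)) / real (R N)" by metis
  define \<mu> where "\<mu> N = distr (measure_pmf (pmf_of_set {..<R N})) borel (s N)" for N
  have rd: "real_distribution (\<mu> N)" for N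
    unfolding \<mu>_def real_distribution_def real_distribution_axioms_def
    by (auto intro!: prob_space.prob_space_distr measure_pmf.prob_space_axioms)
  have int\<mu>: "(LINT e|\<mu> N. f e) = (\<Sum>t<R N. f (s N t)) / real (R N)" if "f \<in> borel_measurable borel" for f :: "real => real" and N
  proof -
    have ne: "{..<R N} ~= {}" using R[of N] by (auto simp: lessThan_empty_iff)
    show ?thesis unfolding \<mu>_def using that by (subst integral_distr) (simp_all add: integral_pmf_of_set[OF ne])
  qed
  obtain B where B: "\<And>e. e \<in> E ==> \<bar>e\<bar> <= B" using compact_imp_bounded[OF E(1)] unfolding bounded_real by blast
  have tight: "tight \<mu>"
    unfolding tight_def
  proof (intro conjI allI impI rd)
    fix \<epsilon> :: real assume "0 < \<epsilon>"
    have "measure (\<mu> n) {- \<bar>B\<bar> - 1<..\<bar>B\<bar> + 1} = 1" for n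
    proof -
      have "measure (\<mu> n) {- \<bar>B\<bar> - 1<..\<bar>B\<bar> + 1} = (LINT e|\<mu> n. indicator {- \<bar>B\<bar> - 1<..\<bar>B\<bar> + 1} e)"
        by (simp add: \<mu>_def)
      also have "... = (\<Sum>t<R n. indicator {- \<bar>B\<bar> - 1<..\<bar>B\<bar> + 1} (s n t)) / real (R n)" by (rule int\<mu>) simp
      also have "(\<Sum>t<R n. indicator {- \<bar>B\<bar> - 1<..\<bar>B\<bar> + 1} (s n t)) = (\<Sum>t<R n. 1::real)"
      proof (rule sum.cong)
        fix t show "indicator {- \<bar>B\<bar> - 1<..\<bar>B\<bar> + 1} (s n t) = (1::real)"
          using B[OF s[of n t]] by (auto simp: indicator_def)
      qed simp
      finally show ?thesis using R[of n] by simp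
    qed
    then show "\<exists>a b. a < b \<and> (\<forall>n. 1 - \<epsilon> < measure (\<mu> n) {a<..b})"
      using \<open>0 < \<epsilon>\<close> by (intro exI[of _ "- \<bar>B\<bar> - 1"] exI[of _ "\<bar>B\<bar> + 1"]) auto
  qed
  obtain r M where r: "strict_mono (r :: nat => nat)" and M: "real_distribution M" and wc: "weak_conv_m (\<mu> \<circ> id \<circ> r) M"
    using tight_imp_convergent_subsubsequence[OF tight strict_mono_id] by blast
  interpret M: real_distribution M by fact
  have wc': "weak_conv_m (\<lambda>n. \<mu> (r n)) M" using wc by (simp add: o_def)
  have conv: "(\<lambda>n. LINT e|\<mu> (r n). f e) \<longlonglongrightarrow> (LINT e|M. f e)" if "\<And>x. isCont f x" "\<And>x. norm (f x) <= 1" for f :: "real => real"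
    by (rule weak_conv_imp_integral_bdd_continuous_conv[OF rd M wc' that])
  have AE_E: "AE e in M. e \<in> E"
  proof -
    let ?f = "\<lambda>e. min 1 (infdist e E)"
    have fm: "?f \<in> borel_measurable borel" by (intro borel_measurable_continuous_onI continuous_intros)
    have "(LINT e|\<mu> N. ?f e) = 0" for N unfolding int\<mu>[OF fm] using s by (simp add: infdist_zero)
    moreover have "(\<lambda>n. LINT e|\<mu> (r n). ?f e) \<longlonglongrightarrow> (LINT e|M. ?f e)"
      by (rule conv) (auto intro!: continuous_intros simp: infdist_nonneg)
    ultimately have z: "(LINT e|M. ?f e) = 0" by (simp add: LIMSEQ_const_iff)
    have "integrable M ?f"
      by (rule M.integrable_const_bound[where B=1]) (use fm in \<open>auto simp: infdist_nonneg\<close>)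
    moreover have "AE e in M. 0 <= ?f e" by (auto simp: infdist_nonneg)
    ultimately have "AE e in M. ?f e = 0" using integral_nonneg_eq_0_iff_AE z by blast
    then show ?thesis
      by eventually_elim (use in_closed_iff_infdist_zero[OF compact_imp_closed[OF E(1)] E(2)] in \<open>auto simp: min_def split: if_splits\<close>)
  qed
  \<comment> \<open>The sup-convolution of \<open>J n\<close>: it lies above \<open>J n\<close> on
    \<open>E\<close>, has Lipschitz constant \<open>m\<close>, and converges to \<open>J n\<close>
    on \<open>E\<close> by semicontinuity. Off \<open>E\<close> it may be negative, which is why
    \<open>\<psi>\<close> takes its positive part.\<close>
  define \<phi> where "\<phi> n m e = (SUP e'\<in>E. J n e' - real m * \<bar>e - e'\<bar>)" for n m e
  have nn: "0 <= real m * \<bar>e - e'\<bar>" for m e e' by simp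
  have bdd: "bdd_above ((\<lambda>e'. J n e' - real m * \<bar>e - e'\<bar>) ` E)" for n m e
  proof (rule bdd_aboveI2)
    fix e' assume "e' \<in> E" then show "J n e' - real m * \<bar>e - e'\<bar> <= 1"
      using J[of e' n] nn[of m e e'] by linarith
  qed
  have \<phi>1: "\<phi> n m e <= 1" for n m e
    unfolding \<phi>_def
  proof (rule cSUP_least[OF E(2)])
    fix e' assume "e' \<in> E" then show "J n e' - real m * \<bar>e - e'\<bar> <= 1"
      using J[of e' n] nn[of m e e'] by linarith
  qed
  have \<phi>J: "J n e <= \<phi> n m e" if "e \<in> E" for n m e
    unfolding \<phi>_def using cSUP_upper[OF that bdd, of n m e] by simp
  have \<phi>L: "\<phi> n m e <= \<phi> n m d + real m * \<bar>e - d\<bar>" for n m e d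
    unfolding \<phi>_def[of n m e]
  proof (rule cSUP_least[OF E(2)])
    fix e' assume e': "e' \<in> E"
    have "J n e' - real m * \<bar>d - e'\<bar> <= \<phi> n m d" unfolding \<phi>_def by (rule cSUP_upper[OF e' bdd])
    moreover have "real m * \<bar>d - e'\<bar> <= real m * (\<bar>e - e'\<bar> + \<bar>e - d\<bar>)" by (intro mult_left_mono) auto
    ultimately show "J n e' - real m * \<bar>e - e'\<bar> <= \<phi> n m d + real m * \<bar>e - d\<bar>" by (simp add: distrib_left)
  qed
  define \<psi> where "\<psi> n m e = max 0 (\<phi> n m e)" for n m e
  have \<psi>b: "0 <= \<psi> n m e" "\<psi> n m e <= 1" for n m e using \<phi>1 by (auto simp: \<psi>_def)
  have "(real m)-lipschitz_on UNIV (\<psi> n m)" for n m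
    unfolding lipschitz_on_def dist_real_def \<psi>_def
  proof (intro conjI ballI)
    show "\<bar>max 0 (\<phi> n m x) - max 0 (\<phi> n m y)\<bar> <= real m * \<bar>x - y\<bar>" for x y
      using \<phi>L[of n m x y] \<phi>L[of n m y x] by (auto simp: abs_minus_commute)
  qed simp
  then have \<psi>cont: "continuous_on UNIV (\<psi> n m)" for n m by (rule lipschitz_on_continuous_on)
  then have \<psi>m[measurable]: "\<psi> n m \<in> borel_measurable borel" for n m by (rule borel_measurable_continuous_onI)
  have \<psi>c: "c <= (LINT e|M. \<psi> n m e)" for n m
  proof -
    have L1: "(\<lambda>N. LINT e|\<mu> (r N). \<psi> n m e) \<longlonglongrightarrow> (LINT e|M. \<psi> n m e)"
      by (rule conv) (use \<psi>cont \<psi>b in \<open>auto simp: continuous_on_eq_continuous_at\<close>)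
    have L2: "(\<lambda>N. c - 1 / real (Suc (r N))) \<longlonglongrightarrow> c - 0"
      using LIMSEQ_subseq_LIMSEQ[OF LIMSEQ_inverse_real_of_nat r]
      by (intro tendsto_diff tendsto_const) (simp add: o_def inverse_eq_divide)
    have "c - 0 <= (LINT e|M. \<psi> n m e)"
    proof (rule LIMSEQ_le[OF L2 L1])
      have "c - 1 / real (Suc (r N)) <= (LINT e|\<mu> (r N). \<psi> n m e)" if "N >= n" for N
      proof -
        have "n < Suc (r N)" using seq_suble[OF r, of N] that by simp
        from Rs[OF this] have "c - 1 / real (Suc (r N)) <= (\<Sum>t<R (r N). J n (s (r N) t)) / real (R (r N))" .
        also have "... <= (\<Sum>t<R (r N). \<psi> n m (s (r N) t)) / real (R (r N))"
          using \<phi>J[OF s] by (intro divide_right_mono sum_mono) (auto simp: \<psi>_def le_max_iff_disj)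
        finally show ?thesis unfolding int\<mu>[OF \<psi>m] .
      qed
      then show "\<exists>N0. \<forall>N\<ge>N0. c - 1 / real (Suc (r N)) <= (LINT e|\<mu> (r N). \<psi> n m e)" by blast
    qed
    then show ?thesis by simp
  qed
  have \<psi>lim: "(\<lambda>m. \<psi> n m e) \<longlonglongrightarrow> J n e" if e: "e \<in> E" for n e
  proof (rule LIMSEQ_I)
    fix \<eta> :: real assume \<eta>: "0 < \<eta>"
    obtain \<delta> where \<delta>: "0 < \<delta>" "\<And>e'. e' \<in> E ==> \<bar>e' - e\<bar> < \<delta> ==> J n e' < J n e + \<eta> / 2"
      using usc[OF e, of "\<eta>/2" n] \<eta> by (meson half_gt_zero)
    obtain m0 :: nat where m0: "1 / \<delta> < real m0" using reals_Archimedean2 by blast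
    have "norm (\<psi> n m e - J n e) < \<eta>" if m: "m >= m0" for m
    proof -
      have "\<phi> n m e <= J n e + \<eta> / 2"
        unfolding \<phi>_def
      proof (rule cSUP_least[OF E(2)])
        fix e' assume e': "e' \<in> E"
        show "J n e' - real m * \<bar>e - e'\<bar> <= J n e + \<eta> / 2"
        proof (cases "\<bar>e' - e\<bar> < \<delta>")
          case True
          then show ?thesis using \<delta>(2)[OF e'] nn[of m e e'] \<eta> by linarith
        next
          case False
          have "1 <= real m * \<delta>" using m0 m \<delta>(1) by (simp add: pos_divide_less_eq) (meson less_imp_le mult_right_mono of_nat_le_iff order.trans)
          also have "... <= real m * \<bar>e - e'\<bar>" using False by (intro mult_left_mono) auto
          finally show ?thesis using J[OF e', of n] J[OF e, of n] \<eta> by simp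
        qed
      qed
      then show ?thesis using \<phi>J[OF e, of n m] J[OF e, of n] \<eta> by (auto simp: \<psi>_def)
    qed
    then show "\<exists>no. \<forall>m\<ge>no. norm (\<psi> n m e - J n e) < \<eta>" by blast
  qed
  have lim: "(\<lambda>m. indicator E e * \<psi> n m e) \<longlonglongrightarrow> indicator E e * J n e" for n e
    using \<psi>lim[of e n] by (cases "e \<in> E") auto
  have meas: "(\<lambda>e. indicator E e * J n e) \<in> borel_measurable borel" for n
    by (rule borel_measurable_LIMSEQ_real[OF lim]) (use Eb in measurable)
  have "c <= (LINT e|M. indicator E e * J n e)" for n
  proof -
    have "(\<lambda>m. LINT e|M. indicator E e * \<psi> n m e) \<longlonglongrightarrow> (LINT e|M. indicator E e * J n e)"
    proof (rule integral_dominated_convergence[where w="\<lambda>_. 1"])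
      show "AE e in M. norm (indicator E e * \<psi> n m e) <= 1" for m
        using \<psi>b[of n m] by (auto simp: indicator_def)
      show "(\<lambda>e. indicator E e * J n e) \<in> borel_measurable M" using meas by simp
      show "(\<lambda>e. indicator E e * \<psi> n m e) \<in> borel_measurable M" for m using Eb by simp
    qed (use lim in auto)
    moreover have "(LINT e|M. indicator E e * \<psi> n m e) = (LINT e|M. \<psi> n m e)" for m
    proof (rule integral_cong_AE)
      show "AE e in M. indicator E e * \<psi> n m e = \<psi> n m e" using AE_E by eventually_elim simp
    qed (use Eb in auto)
    ultimately show ?thesis using \<psi>c by (intro LIMSEQ_le_const) auto
  qed
  then show ?thesis using M AE_E meas by blast
qed

section \<open>Fragments in the direction of a cone\<close>

lemma lip_operator_weak_le:
  assumes \<mu>: "sets \<mu> = sets borel" "finite_measure \<mu>" and D: "lip_operator \<mu> B D" and S: "S \<in> sets borel"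
    and w: "wstar_conv fs f" and le: "\<And>n. AE x in \<mu>. x \<in> S --> D (fs n) x <= b"
  shows "AE x in \<mu>. x \<in> S --> D f x <= b"
proof -
  have fL: "f \<in> Lip" "\<And>n. fs n \<in> Lip" using w by (auto simp: wstar_conv_def)
  have SM: "S \<in> sets \<mu>" using S \<mu> by simp
  have c: "borel_measurable \<mu> = (borel_measurable borel :: ('a => real) set)" by (rule measurable_cong_sets[OF \<mu>(1) refl])
  have ind: "integrable \<mu> (indicat_real A)" if "A \<in> sets \<mu>" for A
    using that finite_measure.emeasure_finite[OF \<mu>(2)] by (intro integrable_real_indicator) (auto simp: less_top[symmetric])
  have Dm: "D g \<in> borel_measurable \<mu>" if "g \<in> Lip" for g using lip_operatorD(1)[OF D that] c by simp
  have iD: "integrable \<mu> (\<lambda>x. indicator A x * D g x)" if "A \<in> sets \<mu>" "g \<in> Lip" for A g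
    by (rule L1_bounded_mult_le(1)[OF ind[OF that(1)] Dm[OF that(2)] lip_operatorD(2)[OF D that(2)]])
  have "AE x in \<mu>. indicator S x * D f x <= indicator S x * b"
  proof (rule AE_le_if_set_integrals_le[OF iD[OF SM fL(1)]])
    show "integrable \<mu> (\<lambda>x. indicator S x * b)" using ind[OF SM] by simp
    fix A assume A: "A \<in> sets \<mu>"
    have AS: "A \<inter> S \<in> sets \<mu>" using A SM by auto
    have e: "(LINT x|\<mu>. indicator A x * (indicator S x * g x)) = (LINT x|\<mu>. indicator (A \<inter> S) x * g x)" for g :: "'a => real"
      by (intro Bochner_Integration.integral_cong) (auto simp: indicator_def)
    have "(LINT x|\<mu>. indicator (A \<inter> S) x * D f x) <= (LINT x|\<mu>. indicator (A \<inter> S) x * b)"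
    proof (rule LIMSEQ_le_const2[OF lip_operatorD(5)[OF D w ind[OF AS]]])
      have "(LINT x|\<mu>. indicator (A \<inter> S) x * D (fs n) x) <= (LINT x|\<mu>. indicator (A \<inter> S) x * b)" for n
      proof (rule integral_mono_AE[OF iD[OF AS fL(2)]])
        show "integrable \<mu> (\<lambda>x. indicator (A \<inter> S) x * b)" using ind[OF AS] by simp
        show "AE x in \<mu>. indicator (A \<inter> S) x * D (fs n) x <= indicator (A \<inter> S) x * b"
          using le[of n] by eventually_elim (auto simp: indicator_def)
      qed
      then show "\<exists>N. \<forall>n\<ge>N. (LINT x|\<mu>. indicator (A \<inter> S) x * D (fs n) x) <= (LINT x|\<mu>. indicator (A \<inter> S) x * b)" by blast
    qed
    then show "(LINT x|\<mu>. indicator A x * (indicator S x * D f x)) <= (LINT x|\<mu>. indicator A x * (indicator S x * b))"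
      unfolding e by simp
  qed
  then show ?thesis by eventually_elim (auto simp: indicator_def)
qed

lemma lip_operator_sum:
  assumes D: "lip_operator \<mu> B D" and "finite F" and f: "\<And>i. i \<in> F ==> f i \<in> Lip"
  shows "(\<lambda>x. \<Sum>i\<in>F. f i x) \<in> Lip \<and> (AE x in \<mu>. D (\<lambda>x. \<Sum>i\<in>F. f i x) x = (\<Sum>i\<in>F. D (f i) x))"
  using assms(2,3)
proof (induction F)
  case empty
  then show ?case using lip_operator_const[OF D, of 0] by (simp add: Lip_const)
next
  case (insert j F)
  have fj: "f j \<in> Lip" and L: "(\<lambda>x. \<Sum>i\<in>F. f i x) \<in> Lip" and ae: "AE x in \<mu>. D (\<lambda>x. \<Sum>i\<in>F. f i x) x = (\<Sum>i\<in>F. D (f i) x)"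
    using insert by auto
  have e: "(\<lambda>x. \<Sum>i\<in>insert j F. f i x) = (\<lambda>x. 1 * f j x + 1 * (\<Sum>i\<in>F. f i x))" using insert.hyps by simp
  have "AE x in \<mu>. D (\<lambda>x. 1 * f j x + 1 * (\<Sum>i\<in>F. f i x)) x = 1 * D (f j) x + 1 * D (\<lambda>x. \<Sum>i\<in>F. f i x) x"
    by (rule lip_operatorD(3)[OF D fj L])
  then have "AE x in \<mu>. D (\<lambda>x. 1 * f j x + 1 * (\<Sum>i\<in>F. f i x)) x = (\<Sum>i\<in>insert j F. D (f i) x)"
    using ae by eventually_elim (use insert.hyps in simp)
  moreover have "(\<lambda>x. 1 * f j x + 1 * (\<Sum>i\<in>F. f i x)) \<in> Lip" by (rule Lip_linear(1)[OF fj L])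
  ultimately show ?case unfolding e by blast
qed

text \<open>Locality on the sets \<open>{x. c <= f x}\<close> and \<open>{x. f x <= c}\<close>
  replaces the chain rule for the absolute value.\<close>

lemma lip_operator_abs_diff_zero:
  assumes D: "lip_operator \<mu> B D" and f: "f \<in> Lip" and z: "AE x in \<mu>. x \<in> S --> D f x = 0"
  shows "(\<lambda>x. \<bar>f x - c\<bar>) \<in> Lip" "lip_const (\<lambda>x. \<bar>f x - c\<bar>) <= lip_const f" "AE x in \<mu>. x \<in> S --> D (\<lambda>x. \<bar>f x - c\<bar>) x = 0"
proof -
  have l: "1-lipschitz_on UNIV (\<lambda>y. \<bar>y - c\<bar>)" by (rule lipschitz_on_real_absI) (auto simp: dist_real_def)
  show aL: "(\<lambda>x. \<bar>f x - c\<bar>) \<in> Lip" and "lip_const (\<lambda>x. \<bar>f x - c\<bar>) <= lip_const f" using Lip_comp[OF f l] by auto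
  have s: "AE x in \<mu>. D (\<lambda>x. a * f x + b * 1) x = a * D f x" for a b
    using lip_operatorD(3)[OF D f Lip_const(1)[of 1], of a b] lip_operator_const[OF D] by simp
  have L: "(\<lambda>x. a * f x + b * 1) \<in> Lip" for a b by (rule Lip_linear(1)[OF f Lip_const(1)])
  have 1: "AE x in \<mu>. x \<in> {x. c <= f x} --> D (\<lambda>x. \<bar>f x - c\<bar>) x = D (\<lambda>x. 1 * f x + (- c) * 1) x"
    by (rule lip_operatorD(4)[OF D aL L]) auto
  have 2: "AE x in \<mu>. x \<in> {x. f x <= c} --> D (\<lambda>x. \<bar>f x - c\<bar>) x = D (\<lambda>x. (- 1) * f x + c * 1) x"
    by (rule lip_operatorD(4)[OF D aL L]) auto
  from 1 2 s[of 1 "- c"] s[of "- 1" c] z show "AE x in \<mu>. x \<in> S --> D (\<lambda>x. \<bar>f x - c\<bar>) x = 0"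
  proof eventually_elim
    case (elim x)
    then show ?case by (cases "c <= f x") auto
  qed
qed

text \<open>On a piece of diameter below \<open>r\<close>, \<open>g\<close> is the infimum of the functions \<open>\<tau> y\<close> for a dense sequence of
  \<open>y\<close>. Each satisfies the bound, finite minima do by locality, and the infimum does by weak* continuity.\<close>

lemma lip_operator_local_bound:
  fixes \<mu> :: "'a::polish_space measure" and p :: "'k::finite => 'a => real"
  assumes \<mu>: "sets \<mu> = sets borel" "finite_measure \<mu>" and D: "lip_operator \<mu> B D" and B: "0 <= B"
    and S: "S \<in> sets borel" and p: "\<And>i. p i \<in> Lip" and Dp: "\<And>i. AE x in \<mu>. x \<in> S --> D (p i) x = 0"
    and g: "g \<in> Lip" and r: "0 < r" and \<delta>: "0 <= \<delta>" and C: "0 <= C"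
    and loc: "\<And>x y. x \<in> S ==> y \<in> S ==> dist x y < r ==> g x <= g y + \<delta> * dist x y + C * (\<Sum>i\<in>UNIV. \<bar>p i x - p i y\<bar>)"
  shows "AE x in \<mu>. x \<in> S --> D g x <= \<delta> * B"
proof -
  define q where "q y x = (\<Sum>i\<in>UNIV. \<bar>p i x - p i y\<bar>)" for y x
  \<comment> \<open>The upper bound for \<open>g\<close> that \<open>loc\<close> yields when seen
    from \<open>y\<close>, with equality at \<open>y\<close>. The factors \<open>1\<close> give it
    the shape of the linearity law.\<close>
  define \<tau> where "\<tau> y x = 1 * (\<delta> * dist x y + C * q y x) + g y * 1" for y x
  define M where "M = \<delta> + C * (\<Sum>i\<in>UNIV. lip_const (p i))"
  have M: "0 <= M" unfolding M_def using \<delta> C lip_const_nonneg[OF p] by (intro add_nonneg_nonneg mult_nonneg_nonneg sum_nonneg) auto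
  have dd: "\<bar>dist x y - dist x' y\<bar> <= dist x x'" for x x' y :: 'a
    using abs_dist_diff_le[of x y x'] by (simp add: dist_commute)
  have dL: "1-lipschitz_on UNIV (\<lambda>x. dist x y)" for y :: 'a
    by (rule lipschitz_on_real_absI) (auto simp: dd)
  have dLip: "(\<lambda>x. dist x y) \<in> Lip" "lip_const (\<lambda>x. dist x y) <= 1" for y :: 'a
    using LipI[OF dL] lip_const_le[OF dL] by auto
  have qs: "q y \<in> Lip \<and> (AE x in \<mu>. D (q y) x = (\<Sum>i\<in>UNIV. D (\<lambda>x. \<bar>p i x - p i y\<bar>) x))" for y
    unfolding q_def by (rule lip_operator_sum[OF D finite]) (rule lip_operator_abs_diff_zero(1)[OF D p Dp])
  have q0: "AE x in \<mu>. x \<in> S --> D (q y) x = 0" for y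
  proof -
    have "AE x in \<mu>. \<forall>i\<in>UNIV. x \<in> S --> D (\<lambda>x. \<bar>p i x - p i y\<bar>) x = 0"
      by (subst AE_finite_all) (auto intro: lip_operator_abs_diff_zero(3)[OF D p Dp])
    with conjunct2[OF qs, of y] show ?thesis by eventually_elim simp
  qed
  have q\<^sub>L: "\<bar>q y x - q y x'\<bar> <= (\<Sum>i\<in>UNIV. lip_const (p i)) * dist x x'" for y x x'
  proof -
    have "\<bar>q y x - q y x'\<bar> <= (\<Sum>i\<in>UNIV. \<bar>p i x - p i x'\<bar>)"
      unfolding q_def sum_subtractf[symmetric] by (rule order_trans[OF sum_abs sum_mono]) auto
    also have "... <= (\<Sum>i\<in>UNIV. lip_const (p i) * dist x x')" by (rule sum_mono[OF Lip_abs_le[OF p]])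
    finally show ?thesis by (simp add: sum_distrib_right)
  qed
  have \<tau>L: "M-lipschitz_on UNIV (\<tau> y)" for y
  proof (rule lipschitz_on_real_absI[OF _ M])
    fix x x'
    have "\<tau> y x - \<tau> y x' = \<delta> * (dist x y - dist x' y) + C * (q y x - q y x')" by (simp add: \<tau>_def algebra_simps)
    also have "\<bar>...\<bar> <= \<delta> * \<bar>dist x y - dist x' y\<bar> + C * \<bar>q y x - q y x'\<bar>"
      using \<delta> C by (metis abs_mult abs_of_nonneg abs_triangle_ineq)
    also have "... <= \<delta> * dist x x' + C * ((\<Sum>i\<in>UNIV. lip_const (p i)) * dist x x')"
      using \<delta> C q\<^sub>L[of y x x'] dd[of x y x'] by (intro add_mono mult_left_mono) auto
    finally show "\<bar>\<tau> y x - \<tau> y x'\<bar> <= M * dist x x'" by (simp add: M_def algebra_simps)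
  qed
  have \<tau>D: "AE x in \<mu>. x \<in> S --> D (\<tau> y) x <= \<delta> * B" for y
  proof -
    have L1: "(\<lambda>x. \<delta> * dist x y + C * q y x) \<in> Lip" by (rule Lip_linear(1)[OF dLip(1) conjunct1[OF qs]])
    have 1: "AE x in \<mu>. D (\<lambda>x. \<delta> * dist x y + C * q y x) x = \<delta> * D (\<lambda>x. dist x y) x + C * D (q y) x"
      by (rule lip_operatorD(3)[OF D dLip(1) conjunct1[OF qs]])
    have 2: "AE x in \<mu>. D (\<tau> y) x = 1 * D (\<lambda>x. \<delta> * dist x y + C * q y x) x + g y * D (\<lambda>x. 1) x"
      unfolding \<tau>_def by (rule lip_operatorD(3)[OF D L1 Lip_const(1)])
    have 3: "D (\<lambda>x. dist x y) x <= B" for x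
    proof -
      have "\<bar>D (\<lambda>x. dist x y) x\<bar> <= B * lip_const (\<lambda>x. dist x y)" by (rule lip_operatorD(2)[OF D dLip(1)])
      also have "... <= B * 1" by (rule mult_left_mono[OF dLip(2) B])
      finally show ?thesis by simp
    qed
    from 1 2 q0[of y] show ?thesis
      by eventually_elim (use lip_operator_const[OF D] mult_left_mono[OF 3 \<delta>] in simp)
  qed
  \<comment> \<open>\<open>loc\<close> compares only points at distance below \<open>r\<close>,
    hence the restriction to sets of small diameter; countably many of them cover
    \<open>S\<close>.\<close>
  have piece: "AE x in \<mu>. x \<in> A --> D g x <= \<delta> * B" if A: "A \<subseteq> S" and diam: "\<And>x y. x \<in> A ==> y \<in> A ==> dist x y < r" for A
  proof (cases "A = {}")
    case False
    obtain Y where Y: "countable Y" "Y \<subseteq> A" "A \<subseteq> closure Y" using separable[of A] by metis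
    have Yne: "Y ~= {}" using False Y(3) by auto
    define y where "y = from_nat_into Y"
    have yY: "y j \<in> A" for j using from_nat_into[OF Yne, of j] Y(2) by (auto simp: y_def)
    have dense: "\<exists>j. dist (y j) x < e" if x: "x \<in> A" and e: "0 < e" for x e
    proof -
      have "x \<in> closure Y" using x Y(3) by blast
      then obtain z where "z \<in> Y" "dist z x < e" using e unfolding closure_approachable by blast
      then show ?thesis using from_nat_into_surj[OF Y(1)] unfolding y_def by metis
    qed
    define h where "h = rec_nat (\<tau> (y 0)) (\<lambda>n w x. min (w x) (\<tau> (y (Suc n)) x))"
    have h0: "h 0 = \<tau> (y 0)" and hS: "h (Suc n) = (\<lambda>x. min (h n x) (\<tau> (y (Suc n)) x))" for n by (auto simp: h_def)
    have hL: "M-lipschitz_on UNIV (h n)" for n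
      by (induction n) (auto simp: h0 hS \<tau>L intro!: Lip_minmax(1))
    have hLip: "h n \<in> Lip" for n by (rule LipI[OF hL])
    have \<tau>Lip: "\<tau> z \<in> Lip" for z by (rule LipI[OF \<tau>L])
    have hD: "AE x in \<mu>. x \<in> S --> D (h n) x <= \<delta> * B" for n
    proof (induction n)
      case (Suc n)
      have 1: "AE x in \<mu>. x \<in> {x. h n x <= \<tau> (y (Suc n)) x} --> D (h (Suc n)) x = D (h n) x"
        by (rule lip_operatorD(4)[OF D hLip hLip]) (auto simp: hS)
      have 2: "AE x in \<mu>. x \<in> {x. \<tau> (y (Suc n)) x <= h n x} --> D (h (Suc n)) x = D (\<tau> (y (Suc n))) x"
        by (rule lip_operatorD(4)[OF D hLip \<tau>Lip]) (auto simp: hS)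
      from 1 2 Suc \<tau>D[of "y (Suc n)"] show ?case
      proof eventually_elim
        case (elim x)
        then show ?case by (cases "h n x <= \<tau> (y (Suc n)) x") auto
      qed
    qed (simp add: h0 \<tau>D)
    have h_le: "h n x <= \<tau> (y j) x" if "j <= n" for n j x using that
      by (induction n) (auto simp: h0 hS le_Suc_eq min_le_iff_disj)
    have h_ex: "\<exists>j. h n x = \<tau> (y j) x" for n x by (induction n) (auto simp: h0 hS min_def)
    have g_le: "g x <= h n x" if "x \<in> A" for n x
    proof -
      obtain j where "h n x = \<tau> (y j) x" using h_ex by blast
      moreover have "g x <= g (y j) + \<delta> * dist x (y j) + C * (\<Sum>i\<in>UNIV. \<bar>p i x - p i (y j)\<bar>)"
        by (rule loc[OF subsetD[OF A that] subsetD[OF A yY] diam[OF that yY]])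
      moreover have "... = \<tau> (y j) x" by (simp add: \<tau>_def q_def)
      ultimately show ?thesis by simp
    qed
    have q_nn: "0 <= q z x" for z x unfolding q_def by (rule sum_nonneg) simp
    have lb: "g (y 0) - lip_const g * r <= h n x" for n x
    proof -
      obtain j where j: "h n x = \<tau> (y j) x" using h_ex by blast
      have "\<bar>g (y 0) - g (y j)\<bar> <= lip_const g * r"
        by (rule order_trans[OF Lip_abs_le[OF g] mult_left_mono]) (use diam[OF yY yY] lip_const_nonneg[OF g] in \<open>auto intro: less_imp_le\<close>)
      moreover have "g (y j) <= \<tau> (y j) x" using q_nn \<delta> C by (simp add: \<tau>_def)
      ultimately show ?thesis using j by linarith
    qed
    have dec: "decseq (\<lambda>n. h n x)" for x by (rule decseq_SucI) (simp add: hS)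
    define H where "H x = (INF n. h n x)" for x
    have H: "(\<lambda>n. h n x) \<longlonglongrightarrow> H x" for x
      unfolding H_def by (rule LIMSEQ_decseq_INF[OF _ dec]) (rule bdd_belowI2[OF lb])
    note HL = wstar_conv_lipschitz(1)[OF hL H] and w = wstar_conv_lipschitz(2)[OF hL H]
    have HD: "AE x in \<mu>. x \<in> S --> D H x <= \<delta> * B"
      by (rule lip_operator_weak_le[OF \<mu> D S w hD])
    have Hg: "g x = H x" if x: "x \<in> A" for x
    proof (rule antisym)
      show "g x <= H x" by (rule LIMSEQ_le_const[OF H]) (use g_le[OF x] in blast)
      show "H x <= g x"
      proof (rule field_le_epsilon)
        fix e :: real assume e: "0 < e"
        define K where "K = lip_const g + M + 1"
        have K: "0 < K" using lip_const_nonneg[OF g] M by (simp add: K_def)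
        obtain j where j: "dist (y j) x < e / K" using dense[OF x, of "e/K"] e K by auto
        have "H x <= h j x" unfolding H_def by (rule cINF_lower[OF bdd_belowI2[OF lb]]) simp
        also have "... <= \<tau> (y j) x" by (rule h_le) simp
        also have "... <= \<tau> (y j) (y j) + M * dist (y j) x"
          using lipschitz_onD[OF \<tau>L, of x "y j" "y j"] by (simp add: dist_real_def dist_commute abs_le_iff)
        also have "\<tau> (y j) (y j) = g (y j)" by (simp add: \<tau>_def q_def)
        also have "g (y j) <= g x + lip_const g * dist (y j) x" using Lip_abs_le[OF g, of "y j" x] by linarith
        finally have "H x <= g x + (lip_const g + M) * dist (y j) x" by (simp add: algebra_simps)
        also have "(lip_const g + M) * dist (y j) x <= K * (e / K)"
          using j K lip_const_nonneg[OF g] M by (intro mult_mono) (auto simp: K_def)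
        finally show "H x <= g x + e" using K by simp
      qed
    qed
    have "AE x in \<mu>. x \<in> A --> D g x = D H x"
      by (rule lip_operatorD(4)[OF D g LipI[OF HL] Hg])
    with HD show ?thesis by eventually_elim (use A in auto)
  qed simp
  obtain z :: "nat => 'a" where z: "\<forall>x e. 0 < e --> (\<exists>k. dist x (z k) < e)" using dense_sequence by blast
  have "AE x in \<mu>. \<forall>k. x \<in> S \<inter> ball (z k) (r/2) --> D g x <= \<delta> * B"
  proof (intro AE_all_countable[THEN iffD2] allI piece)
    fix k x y assume "x \<in> S \<inter> ball (z k) (r/2)" "y \<in> S \<inter> ball (z k) (r/2)"
    then show "dist x y < r" using dist_triangle2[of x y "z k"] by (auto simp: dist_commute)
  qed auto
  then show ?thesis
  proof eventually_elim
    case (elim x)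
    obtain k where "dist x (z k) < r / 2" using z r half_gt_zero by blast
    then show ?case using elim by (auto simp: dist_commute)
  qed
qed

section \<open>Chains of points and the graphs extracted from them\<close>

definition cone_gap :: "real => ('a => real) => ('k::finite => 'a => real) => 'a => 'a => real" where
  "cone_gap C u p x y = u y - u x - C * (\<Sum>i\<in>UNIV. \<bar>p i x - p i y\<bar>)"

text \<open>A relation between an earlier and a later point, made symmetric so that it can be
  required of \<open>G \<times> G\<close> and stays closed. At equal times one of the two orders
  suffices.\<close>

definition graph_rel :: "(real => 'a => real => 'a => bool) => ((real \<times> 'a) \<times> (real \<times> 'a)) set" where
  "graph_rel Q = {(a, b). (fst a <= fst b \<and> Q (fst a) (snd a) (fst b) (snd b)) \<or> (fst b <= fst a \<and> Q (fst b) (snd b) (fst a) (snd a))}"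

text \<open>Speed between \<open>A\<close> and \<open>B\<close>, and growth of \<open>u\<close> at
  rate \<open>\<kappa>\<close> beyond \<open>C\<close> times the change of \<open>p\<close>. In
  terms of derivatives this is a cone around the direction of \<open>u\<close> with opening of order
  \<open>1 / C\<close>; the positive rate \<open>\<kappa>\<close> keeps the direction away from
  zero.\<close>

abbreviation "cone_rel A B \<kappa> C u p \<equiv>
  graph_rel (\<lambda>s x t y. A * (t - s) <= dist x y \<and> dist x y <= B * (t - s) \<and> \<kappa> * (t - s) <= cone_gap C u p x y)"

lemma graph_relD:
  assumes "G \<times> G \<subseteq> graph_rel Q" "(s, x) \<in> G" "(t, y) \<in> G" "s <= t"
  shows "Q s x t y \<or> (s = t \<and> Q t y s x)"
proof -
  have "((s, x), (t, y)) \<in> graph_rel Q" using assms by blast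
  then show ?thesis using assms(4) by (auto simp: graph_rel_def)
qed

lemma mcshane_extension:
  fixes g :: "'a::metric_space => real"
  assumes S: "S ~= {}" and g: "\<And>x y. x \<in> S ==> y \<in> S ==> g x <= g y + M * dist x y" and M: "0 <= M"
  defines "h \<equiv> \<lambda>x. INF y\<in>S. g y + M * dist x y"
  shows "M-lipschitz_on UNIV h" "\<And>x. x \<in> S ==> h x = g x" "\<And>x y. y \<in> S ==> h x <= g y + M * dist x y"
proof -
  have hx: "h x = (INF y\<in>S. g y + M * dist x y)" for x by (simp add: h_def)
  obtain y0 where y0: "y0 \<in> S" using S by blast
  have bdd: "bdd_below ((\<lambda>y. g y + M * dist x y) ` S)" for x
  proof (rule bdd_belowI2)
    fix y assume y: "y \<in> S"
    have "M * dist y0 y <= M * (dist x y0 + dist x y)" by (rule mult_left_mono[OF dist_triangle3 M])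
    then show "g y0 - M * dist x y0 <= g y + M * dist x y" using g[OF y0 y] by (simp add: distrib_left)
  qed
  show up: "\<And>x y. y \<in> S ==> h x <= g y + M * dist x y" unfolding h_def by (rule cINF_lower[OF bdd])
  have le: "h x <= h x' + M * dist x x'" for x x'
  proof -
    have "h x - M * dist x x' <= h x'"
      unfolding hx[of x']
    proof (rule cINF_greatest[OF S])
      fix y assume y: "y \<in> S"
      have "M * dist x y <= M * (dist x x' + dist x' y)" by (rule mult_left_mono[OF dist_triangle M])
      then show "h x - M * dist x x' <= g y + M * dist x' y" using up[OF y, of x] by (simp add: distrib_left)
    qed
    then show ?thesis by simp
  qed
  show "M-lipschitz_on UNIV h"
  proof (rule lipschitz_on_real_absI[OF _ M])
    show "\<bar>h x - h y\<bar> <= M * dist x y" for x y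
      using le[of x y] le[of y x] by (simp add: abs_le_iff dist_commute)
  qed
  show "h x = g x" if "x \<in> S" for x
  proof (rule antisym)
    show "h x <= g x" using up[OF that, of x] by simp
    show "g x <= h x" unfolding h_def by (rule cINF_greatest[OF S]) (rule g[OF that])
  qed
qed

text \<open>A discrete rising sun lemma. \<open>I\<close> holds the indices after which
  \<open>H\<close> never drops below its present value, and steps starting elsewhere contribute
  nothing to the net growth: by backward induction, \<open>H m\<close> minus the increments from
  \<open>I\<close> after \<open>k\<close> stays below all values of \<open>H\<close> from
  \<open>k\<close> on.\<close>

lemma suffix_record_sum:
  fixes H :: "nat => real" and m :: nat
  defines "I \<equiv> {i. i <= m \<and> (\<forall>j. i <= j \<and> j <= m --> H i <= H j)}"
  shows "H m - H 0 <= (\<Sum>i\<in>{i\<in>I. i < m}. H (Suc i) - H i)"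
proof -
  define A where "A k = H m - (\<Sum>i\<in>{i\<in>I. k <= i \<and> i < m}. H (Suc i) - H i)" for k
  have "\<forall>j. 0 <= j \<and> j <= m --> A 0 <= H j"
  proof (rule inc_induct[of 0 m "\<lambda>k. \<forall>j. k <= j \<and> j <= m --> A k <= H j"])
    show "\<forall>j. m <= j \<and> j <= m --> A m <= H j"
    proof -
      have "{i\<in>I. m <= i \<and> i < m} = {}" by auto
      then have "A m = H m" unfolding A_def by (simp only: sum.empty)
      then show ?thesis by (auto dest: antisym)
    qed
    fix k assume k: "k < m" and IH: "\<forall>j. Suc k <= j \<and> j <= m --> A (Suc k) <= H j"
    have fin: "finite {i\<in>I. Suc k <= i \<and> i < m}" by (rule finite_subset[of _ "{..<m}"]) auto
    show "\<forall>j. k <= j \<and> j <= m --> A k <= H j"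
    proof (cases "k \<in> I")
      case True
      then have "{i\<in>I. k <= i \<and> i < m} = insert k {i\<in>I. Suc k <= i \<and> i < m}" using k by (auto simp: Suc_le_eq less_le)
      then have Ak: "A k = A (Suc k) - (H (Suc k) - H k)" using fin by (simp add: A_def)
      have "H k <= H (Suc k)" using True k by (auto simp: I_def)
      moreover have "A (Suc k) <= H (Suc k)" using IH k by auto
      ultimately have "A k <= A (Suc k)" "A k <= H k" using Ak by linarith+
      then show ?thesis using IH by (metis Suc_leI le_eq_less_or_eq order_trans)
    next
      case False
      then have "{i\<in>I. k <= i \<and> i < m} = {i\<in>I. Suc k <= i \<and> i < m}" by (auto simp: Suc_le_eq less_le)
      then have Ak: "A k = A (Suc k)" by (simp add: A_def)
      obtain j where j: "k <= j" "j <= m" "H j < H k" using False k by (auto simp: I_def not_le)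
      then have "j ~= k" by auto
      then have "A (Suc k) <= H j" using IH j by auto
      then have "A k <= H k" using Ak j by simp
      then show ?thesis using Ak IH by (metis Suc_leI le_eq_less_or_eq)
    qed
  qed simp
  then have "A 0 <= H 0" by auto
  then show ?thesis by (simp add: A_def)
qed

text \<open>The points of the chain are placed at times equal to the length travelled.
  \<open>H\<close> is the growth of \<open>u\<close> minus the cost and minus
  \<open>\<kappa>\<close> times the length, and it still rises by half of \<open>\<eta>\<close>.
  Keeping only the indices after which \<open>H\<close> does not drop turns the total surplus into
  the cone inequality for every pair of remaining points. Long jumps cannot make \<open>H\<close>
  rise, so short steps starting at kept points have total length at least
  \<open>\<eta> / (2 * Lu)\<close>; they are covered by balls of radius \<open>r\<close> around the
  kept times.\<close>

lemma chain_fragment: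
  fixes u :: "'a::metric_space => real" and p :: "'k::finite => 'a => real" and z :: "nat => 'a" and r :: real
  assumes z: "\<And>i. i <= m ==> z i \<in> S" and u: "\<And>x y. \<bar>u x - u y\<bar> <= Lu * dist x y" and Lu: "0 < Lu"
    and p: "\<And>x y. (\<Sum>i\<in>UNIV. \<bar>p i x - p i y\<bar>) <= \<Lambda> * dist x y" and \<Lambda>: "0 <= \<Lambda>" and \<delta>: "0 < \<delta>" and C: "0 <= C"
    and U: "\<And>x. x \<in> S ==> \<bar>u x\<bar> <= U" and \<eta>: "0 < \<eta>"
  defines "c \<equiv> \<lambda>x y. if dist x y < r then \<delta> * dist x y + C * (\<Sum>i\<in>UNIV. \<bar>p i x - p i y\<bar>) else (\<delta> + Lu + C * \<Lambda>) * dist x y"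
    and "l \<equiv> 2 * U / \<delta> + 1"
  assumes hyp: "u (z 0) + (\<Sum>i<m. c (z i) (z (Suc i))) < u (z m) - \<eta>"
  shows "\<exists>G. finite G \<and> G ~= {} \<and> G \<subseteq> {0..l} \<times> S \<and>
    G \<times> G \<subseteq> graph_rel (\<lambda>s x t y. dist x y <= t - s \<and> \<eta> / (2 * l) * (t - s) <= cone_gap C u p x y) \<and>
    ennreal (\<eta> / (2 * Lu)) <= emeasure lborel (\<Union>c\<in>fst ` G. ball c r)"
proof -
  define P where "P x y = (\<Sum>i\<in>UNIV. \<bar>p i x - p i y\<bar>)" for x y
  have P0: "0 <= P x y" for x y unfolding P_def by (rule sum_nonneg) simp
  have P_tri: "P x w <= P x y + P y w" for x y w
    unfolding P_def sum.distrib[symmetric] by (rule sum_mono) simp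
  have Pself: "P x x = 0" for x by (simp add: P_def)
  define d where "d i = dist (z i) (z (Suc i))" for i
  have d0: "0 <= d i" for i by (simp add: d_def)
  define cc where "cc i = c (z i) (z (Suc i))" for i
  have PL: "C * P x y <= C * \<Lambda> * dist x y" for x y
    using mult_left_mono[OF p[of x y] C] by (simp add: P_def mult.assoc)
  have cc_long: "cc i = (\<delta> + Lu + C * \<Lambda>) * d i" if "\<not> d i < r" for i using that by (simp add: cc_def c_def d_def)
  have cc_short: "cc i = \<delta> * d i + C * P (z i) (z (Suc i))" if "d i < r" for i using that by (simp add: cc_def c_def d_def P_def)
  have cc_ge: "\<delta> * d i + C * P (z i) (z (Suc i)) <= cc i" for i
  proof (cases "d i < r")
    case False
    have "C * P (z i) (z (Suc i)) <= C * \<Lambda> * d i" using PL by (simp add: d_def)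
    moreover have "0 <= Lu * d i" using Lu d0 by simp
    ultimately show ?thesis using cc_long[OF False] by (simp add: distrib_right)
  qed (simp add: cc_short)
  define t where "t k = (\<Sum>i<k. d i)" for k
  define cs where "cs k = (\<Sum>i<k. cc i)" for k
  \<comment> \<open>A unit of length costs at least \<open>\<delta>\<close> while \<open>u\<close>
    varies by at most \<open>2 * U\<close>, so the total length is at most \<open>l\<close>. With
    this \<open>\<kappa>\<close> the term \<open>\<kappa> * t m\<close> consumes at most half of the
    surplus.\<close>
  define \<kappa> where "\<kappa> = \<eta> / (2 * l)"
  define F where "F k = u (z k) - u (z 0) - cs k" for k
  define H where "H k = F k - \<kappa> * t k" for k
  have tS: "t (Suc k) = t k + d k" and csS: "cs (Suc k) = cs k + cc k" for k by (simp_all add: t_def cs_def)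
  have t0: "t 0 = 0" by (simp add: t_def)
  have tmono: "t i <= t j" if "i <= j" for i j using that
    by (induction j rule: dec_induct) (auto simp: tS intro: order_trans[OF _ add_increasing2[OF d0]])
  have \<delta>t: "\<delta> * t k <= cs k" for k
  proof (induction k)
    case (Suc k)
    have "\<delta> * d k <= cc k" using cc_ge[of k] mult_nonneg_nonneg[OF C P0, of "z k" "z (Suc k)"] by linarith
    then show ?case using Suc by (simp add: tS csS distrib_left)
  qed (simp add: t_def cs_def)
  have U0: "0 <= U" using U[OF z[of 0]] by auto
  have l: "0 < l" using U0 \<delta> by (simp add: l_def add_nonneg_pos)
  have \<kappa>: "0 < \<kappa>" using \<eta> l by (simp add: \<kappa>_def)
  have hyp': "cs m < u (z m) - u (z 0) - \<eta>" using hyp by (simp add: cs_def cc_def)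
  have tm: "t m <= l"
  proof -
    have "u (z m) - u (z 0) <= 2 * U" using U[OF z[of m]] U[OF z[of 0]] by auto
    then have "\<delta> * t m <= 2 * U" using \<delta>t[of m] hyp' \<eta> by linarith
    then have "t m <= 2 * U / \<delta>" using \<delta> by (simp add: pos_le_divide_eq mult.commute)
    then show ?thesis by (simp add: l_def)
  qed
  have Hm: "\<eta> / 2 <= H m - H 0"
  proof -
    have "\<kappa> * t m <= \<kappa> * l" using tm \<kappa> by (intro mult_left_mono) auto
    also have "\<kappa> * l = \<eta> / 2" using l by (simp add: \<kappa>_def)
    finally show ?thesis using hyp' by (simp add: H_def F_def t0 cs_def)
  qed
  have dist_t: "dist (z i) (z j) <= t j - t i" if "i <= j" for i j using that
  proof (induction j rule: dec_induct)
    case (step j)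
    then show ?case using dist_triangle[of "z i" "z (Suc j)" "z j"] by (simp add: tS d_def)
  qed simp
  have P_cs: "C * P (z i) (z j) <= cs j - cs i" if "i <= j" for i j using that
  proof (induction j rule: dec_induct)
    case (step j)
    have "C * P (z i) (z (Suc j)) <= C * P (z i) (z j) + C * P (z j) (z (Suc j))"
      using mult_left_mono[OF P_tri C] by (simp add: distrib_left)
    moreover have "C * P (z j) (z (Suc j)) <= cc j" using cc_ge[of j] mult_nonneg_nonneg[OF less_imp_le[OF \<delta>] d0[of j]] by linarith
    ultimately show ?case using step by (simp add: csS)
  qed (simp add: Pself)
  define I where "I = {i. i <= m \<and> (\<forall>j. i <= j \<and> j <= m --> H i <= H j)}"
  define J where "J = {i\<in>I. i < m \<and> d i < r}"
  have finI: "finite I" unfolding I_def by (rule finite_subset[of _ "{..m}"]) auto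
  have finJ: "finite J" using finI by (simp add: J_def)
  define G where "G = (\<lambda>i. (t i, z i)) ` I"
  have mI: "m \<in> I" by (auto simp: I_def)
  have Im: "i <= m" if "i \<in> I" for i using that by (simp add: I_def)
  have GZ: "G \<subseteq> {0..l} \<times> S"
    unfolding G_def using Im tmono[of 0] tmono[of _ m] tm z t0 by (fastforce intro: order_trans)
  have rel: "dist (z i) (z j) <= t j - t i \<and> \<kappa> * (t j - t i) <= cone_gap C u p (z i) (z j)" if i: "i \<in> I" and ij: "i <= j" and j: "j <= m" for i j
  proof -
    have "H i <= H j" using i ij j by (simp add: I_def)
    then have "\<kappa> * (t j - t i) <= u (z j) - u (z i) - (cs j - cs i)" by (simp add: H_def F_def algebra_simps)
    also have "... <= cone_gap C u p (z i) (z j)" using P_cs[OF ij] by (simp add: cone_gap_def P_def)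
    finally show ?thesis using dist_t[OF ij] by simp
  qed
  have GR: "G \<times> G \<subseteq> graph_rel (\<lambda>s x t y. dist x y <= t - s \<and> \<kappa> * (t - s) <= cone_gap C u p x y)"
  proof
    fix q assume "q \<in> G \<times> G"
    then obtain i j where q: "q = ((t i, z i), (t j, z j))" "i \<in> I" "j \<in> I" by (auto simp: G_def)
    show "q \<in> graph_rel (\<lambda>s x t y. dist x y <= t - s \<and> \<kappa> * (t - s) <= cone_gap C u p x y)"
    proof (cases "i <= j")
      case True
      then show ?thesis using rel[OF q(2) True Im[OF q(3)]] tmono[OF True] q(1) by (simp add: graph_rel_def)
    next
      case False
      then have ji: "j <= i" by simp
      show ?thesis using rel[OF q(3) ji Im[OF q(2)]] tmono[OF ji] q(1) by (simp add: graph_rel_def)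
    qed
  qed
  have "\<eta> / 2 <= (\<Sum>i\<in>{i\<in>I. i < m}. H (Suc i) - H i)"
    using Hm suffix_record_sum[of H m] unfolding I_def by linarith
  also have "... <= (\<Sum>i\<in>{i\<in>I. i < m}. if d i < r then Lu * d i else 0)"
  proof (rule sum_mono)
    fix i
    have ud: "u (z (Suc i)) - u (z i) <= Lu * d i" using u[of "z (Suc i)" "z i"] by (simp add: d_def dist_commute)
    have e: "H (Suc i) - H i = u (z (Suc i)) - u (z i) - cc i - \<kappa> * d i" by (simp add: H_def F_def tS csS algebra_simps)
    have nn: "0 <= \<kappa> * d i" "0 <= \<delta> * d i" "0 <= C * P (z i) (z (Suc i))" "0 <= C * \<Lambda> * d i"
      using \<kappa> \<delta> C \<Lambda> d0 P0 by (auto intro!: mult_nonneg_nonneg)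
    show "H (Suc i) - H i <= (if d i < r then Lu * d i else 0)"
    proof (cases "d i < r")
      case True
      then show ?thesis using e ud nn cc_ge[of i] by simp
    next
      \<comment> \<open>The price of a long jump already exceeds everything that \<open>u\<close>
        can gain on it.\<close>
      case False
      have "cc i = \<delta> * d i + Lu * d i + C * \<Lambda> * d i" using cc_long[OF False] by (simp add: distrib_right)
      then show ?thesis using False e ud nn by simp
    qed
  qed
  also have "... = (\<Sum>i\<in>J. Lu * d i)"
  proof -
    have "finite {i\<in>I. i < m}" "J = {i\<in>{i\<in>I. i < m}. d i < r}" using finI by (auto simp: J_def)
    then show ?thesis by (simp only: sum.inter_filter)
  qed
  finally have "\<eta> / (2 * Lu) <= (\<Sum>i\<in>J. d i)"
    using Lu by (simp add: sum_distrib_left[symmetric] field_simps)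
  then have "ennreal (\<eta> / (2 * Lu)) <= ennreal (\<Sum>i\<in>J. d i)" by (rule ennreal_leI)
  also have "... = (\<Sum>i\<in>J. emeasure lborel {t i..<t (Suc i)})"
    using d0 by (simp add: tS sum_ennreal)
  also have "... = emeasure lborel (\<Union>i\<in>J. {t i..<t (Suc i)})"
  proof (rule sum_emeasure)
    show "disjoint_family_on (\<lambda>i. {t i..<t (Suc i)}) J"
      unfolding disjoint_family_on_def
    proof (intro ballI impI)
      fix i j :: nat assume "i ~= j"
      then have "t (Suc i) <= t j \<or> t (Suc j) <= t i" using tmono[of "Suc i" j] tmono[of "Suc j" i] by linarith
      then show "{t i..<t (Suc i)} \<inter> {t j..<t (Suc j)} = {}" by auto
    qed
  qed (use finJ in auto)
  also have "... <= emeasure lborel (\<Union>c\<in>fst ` G. ball c r)"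
  proof (rule emeasure_mono)
    show "(\<Union>i\<in>J. {t i..<t (Suc i)}) \<subseteq> (\<Union>c\<in>fst ` G. ball c r)"
    proof
      fix x assume "x \<in> (\<Union>i\<in>J. {t i..<t (Suc i)})"
      then obtain i where i: "i \<in> J" "t i <= x" "x < t i + d i" by (auto simp: tS)
      then have "x \<in> ball (t i) r" "t i \<in> fst ` G" by (auto simp: J_def G_def dist_real_def image_iff)
      then show "x \<in> (\<Union>c\<in>fst ` G. ball c r)" by blast
    qed
  qed (simp, rule borel_open, auto)
  finally show ?thesis using GZ GR mI finI unfolding \<kappa>_def by (intro exI[of _ G]) (auto simp: G_def)
qed

lemma closed_graph_rel_gap:
  assumes u: "continuous_on UNIV u" and p: "\<And>i. continuous_on UNIV (p i)"
  shows "closed (cone_rel A B \<kappa> C u (p :: 'k::finite => 'a::metric_space => real))"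
proof -
  have cu: "continuous_on UNIV (\<lambda>q::(real \<times> 'a) \<times> (real \<times> 'a). f (snd (fst q)))"
    "continuous_on UNIV (\<lambda>q::(real \<times> 'a) \<times> (real \<times> 'a). f (snd (snd q)))" if "continuous_on UNIV f" for f :: "'a => real"
    by (intro continuous_on_compose2[OF that] continuous_intros, simp)+
  show ?thesis
    unfolding graph_rel_def case_prod_unfold cone_gap_def
    by (intro closed_Collect_disj closed_Collect_conj closed_Collect_le continuous_intros cu[OF u] cu[OF p])
qed

text \<open>The cost of a chain increases with \<open>n\<close>, as only jumps shorter than \<open>1 / (n + 1)\<close> are cheap. If chains
  never beat \<open>u\<close>, their costs converge to \<open>u\<close> on \<open>S\<close>, which contradicts the bound on \<open>D u\<close>. A chain that
  beats \<open>u\<close> yields finite graphs, and their Hausdorff limit is the graph of a fragment.\<close>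

lemma fragment_exists:
  fixes \<mu> :: "'a::polish_space measure" and p :: "'k::finite => 'a => real"
  assumes \<mu>: "sets \<mu> = sets borel" "finite_measure \<mu>" and D: "lip_operator \<mu> B D" and B: "0 <= B"
    and S: "compact S" and u: "u \<in> Lip" and p: "\<And>i. p i \<in> Lip" and Dp: "\<And>i. AE x in \<mu>. x \<in> S --> D (p i) x = 0"
    and \<delta>: "0 < \<delta>" and C: "0 <= C" and nle: "\<not> (AE x in \<mu>. x \<in> S --> D u x <= \<delta> * B)"
  shows "\<exists>\<kappa>>0. \<exists>l G. compact G \<and> G ~= {} \<and> G \<subseteq> {0..l} \<times> S \<and> 0 < emeasure lborel (fst ` G) \<and>
    G \<times> G \<subseteq> cone_rel 0 1 \<kappa> C u p"
proof -
  have Sne: "S ~= {}" using nle by auto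
  then obtain y0 where y0: "y0 \<in> S" by blast
  define Lu where "Lu = lip_const u + 1"
  have Lu: "0 < Lu" using lip_const_nonneg[OF u] by (simp add: Lu_def)
  have uL: "\<bar>u x - u y\<bar> <= Lu * dist x y" for x y
    using Lip_abs_le[OF u, of x y] by (simp add: Lu_def distrib_right) (metis add_increasing2 zero_le_dist)
  define \<Lambda> where "\<Lambda> = (\<Sum>i\<in>UNIV. lip_const (p i))"
  have \<Lambda>: "0 <= \<Lambda>" unfolding \<Lambda>_def using lip_const_nonneg[OF p] by (intro sum_nonneg) auto
  define P where "P x y = (\<Sum>i\<in>UNIV. \<bar>p i x - p i y\<bar>)" for x y
  have P: "P x y <= \<Lambda> * dist x y" for x y
    unfolding P_def \<Lambda>_def sum_distrib_right by (rule sum_mono[OF Lip_abs_le[OF p]])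
  have P0: "0 <= P x y" for x y unfolding P_def by (rule sum_nonneg) simp
  define M where "M = \<delta> + Lu + C * \<Lambda>"
  have M: "0 <= M" using \<delta> Lu C \<Lambda> by (simp add: M_def)
  define c where "c n x y = (if dist x y < 1 / real (Suc n) then \<delta> * dist x y + C * P x y else M * dist x y)" for n :: nat and x y
  have short_le: "\<delta> * dist x y + C * P x y <= M * dist x y" for x y
  proof -
    have "C * P x y <= C * \<Lambda> * dist x y" using mult_left_mono[OF P C] by (simp add: mult.assoc)
    moreover have "0 <= Lu * dist x y" using Lu by simp
    ultimately show ?thesis by (simp add: M_def distrib_right)
  qed
  have c_le: "c n x y <= M * dist x y" for n x y using short_le by (simp add: c_def)
  have c0: "0 <= c n x y" for n x y using \<delta> C P0 M by (simp add: c_def)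
  have c_mono: "c n x y <= c (Suc n) x y" for n x y
  proof -
    have "1 / real (Suc (Suc n)) <= 1 / real (Suc n)" by (simp add: divide_simps)
    then show ?thesis using short_le by (auto simp: c_def)
  qed
  have u_cont: "continuous_on UNIV u" by (rule lipschitz_on_continuous_on[OF lipschitz_on_lip_const[OF u]])
  have p_cont: "continuous_on UNIV (p i)" for i by (rule lipschitz_on_continuous_on[OF lipschitz_on_lip_const[OF p]])
  obtain U where U: "\<And>x. x \<in> S ==> \<bar>u x\<bar> <= U"
    using compact_imp_bounded[OF compact_continuous_image[OF continuous_on_subset[OF u_cont subset_UNIV] S]] unfolding bounded_real by auto
  define Ch where "Ch n x = {u (z 0) + (\<Sum>i<m. c n (z i) (z (Suc i))) | z m. (\<forall>i\<le>m. z i \<in> S) \<and> z m = x}" for n x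
  have Ch_bdd: "- U <= v" if "v \<in> Ch n x" for v n x
  proof -
    obtain z m where v: "v = u (z 0) + (\<Sum>i<m. c n (z i) (z (Suc i)))" "\<forall>i\<le>m. z i \<in> S" using \<open>v \<in> Ch n x\<close> by (auto simp: Ch_def)
    have "- U <= u (z 0)" using U[of "z 0"] v(2) by auto
    moreover have "0 <= (\<Sum>i<m. c n (z i) (z (Suc i)))" by (intro sum_nonneg c0)
    ultimately show ?thesis using v(1) by simp
  qed
  have bdd: "bdd_below (Ch n x)" for n x by (rule bdd_belowI[OF Ch_bdd])
  have uCh: "u x \<in> Ch n x" if "x \<in> S" for n x
    unfolding Ch_def by (rule CollectI, rule exI[of _ "\<lambda>_. x"], rule exI[of _ 0]) (use that in simp)
  define g where "g n x = Inf (Ch n x)" for n x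
  have g_le: "g n x <= u x" if "x \<in> S" for n x unfolding g_def by (rule cInf_lower[OF uCh[OF that] bdd])
  have g_step: "g n y <= g n x + c n x y" if x: "x \<in> S" and y: "y \<in> S" for n x y
  proof -
    have "g n y - c n x y <= g n x"
      unfolding g_def[of n x]
    proof (rule cInf_greatest)
      show "Ch n x ~= {}" using uCh[OF x] by blast
      fix v assume "v \<in> Ch n x"
      then obtain z m where v: "v = u (z 0) + (\<Sum>i<m. c n (z i) (z (Suc i)))" "\<forall>i\<le>m. z i \<in> S" "z m = x" by (auto simp: Ch_def)
      have "v + c n x y \<in> Ch n y"
        unfolding Ch_def
      proof (rule CollectI, rule exI[of _ "z(Suc m := y)"], rule exI[of _ "Suc m"], intro conjI)
        have "(\<Sum>i<m. c n ((z(Suc m := y)) i) ((z(Suc m := y)) (Suc i))) = (\<Sum>i<m. c n (z i) (z (Suc i)))"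
          by (rule sum.cong) auto
        then show "v + c n x y = u ((z(Suc m := y)) 0) + (\<Sum>i<Suc m. c n ((z(Suc m := y)) i) ((z(Suc m := y)) (Suc i)))"
          using v(1,3) by simp
      qed (use v(2) y in auto)
      then have "g n y <= v + c n x y" unfolding g_def by (rule cInf_lower[OF _ bdd])
      then show "g n y - c n x y <= v" by simp
    qed
    then show ?thesis by simp
  qed
  have c_sym: "c n x y = c n y x" for n x y by (simp add: c_def P_def dist_commute abs_minus_commute)
  have g_lip: "g n x <= g n y + M * dist x y" if "x \<in> S" "y \<in> S" for n x y
    using g_step[OF that(2,1), of n] c_le[of n y x] by (simp add: dist_commute)
  have g_mono: "g n x <= g (Suc n) x" if x: "x \<in> S" for n x
    unfolding g_def[of "Suc n"]
  proof (rule cInf_greatest)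
    show "Ch (Suc n) x ~= {}" using uCh[OF x] by blast
    fix v assume "v \<in> Ch (Suc n) x"
    then obtain z m where v: "v = u (z 0) + (\<Sum>i<m. c (Suc n) (z i) (z (Suc i)))" "\<forall>i\<le>m. z i \<in> S" "z m = x" by (auto simp: Ch_def)
    have "u (z 0) + (\<Sum>i<m. c n (z i) (z (Suc i))) \<in> Ch n x" using v by (auto simp: Ch_def)
    then have "g n x <= u (z 0) + (\<Sum>i<m. c n (z i) (z (Suc i)))" unfolding g_def by (rule cInf_lower[OF _ bdd])
    also have "... <= v" unfolding v(1) by (intro add_left_mono sum_mono c_mono)
    finally show "g n x <= v" .
  qed
  \<comment> \<open>The chain costs \<open>g n\<close> live on \<open>S\<close>, whereas the
    operators act on functions on the whole space.\<close>
  define h where "h n x = (INF y\<in>S. g n y + M * dist x y)" for n x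
  have hL: "M-lipschitz_on UNIV (h n)" and h_eq: "\<And>x. x \<in> S ==> h n x = g n x" and h_le: "\<And>x y. y \<in> S ==> h n x <= g n y + M * dist x y" for n
    using mcshane_extension[OF Sne g_lip M] unfolding h_def by blast+
  have hLip: "h n \<in> Lip" for n by (rule LipI[OF hL])
  have h_mono: "h n x <= h (Suc n) x" for n x
    unfolding h_def[of "Suc n"] by (rule cINF_greatest[OF Sne]) (rule order_trans[OF h_le], use g_mono in auto)
  have h_ub: "h n x <= u y0 + M * dist x y0" for n x using h_le[OF y0, of n x] g_le[OF y0, of n] by linarith
  define H where "H x = (SUP n. h n x)" for x
  have H: "(\<lambda>n. h n x) \<longlonglongrightarrow> H x" for x
    unfolding H_def by (rule LIMSEQ_incseq_SUP) (use h_ub h_mono in \<open>auto intro!: bdd_aboveI2 incseq_SucI\<close>)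
  note HL = wstar_conv_lipschitz(1)[OF hL H] and w = wstar_conv_lipschitz(2)[OF hL H]
  have Sb: "S \<in> sets borel" using S by (simp add: compact_imp_closed)
  have Dh: "AE x in \<mu>. x \<in> S --> D (h n) x <= \<delta> * B" for n
  proof (rule lip_operator_local_bound[OF \<mu> D B Sb p Dp hLip, where r="1 / real (Suc n)"])
    fix x y assume xy: "x \<in> S" "y \<in> S" "dist x y < 1 / real (Suc n)"
    have "g n x <= g n y + c n y x" by (rule g_step[OF xy(2,1)])
    also have "c n y x = \<delta> * dist x y + C * P x y" using xy(3) c_sym[of n y x] by (simp add: c_def)
    finally show "h n x <= h n y + \<delta> * dist x y + C * (\<Sum>i\<in>UNIV. \<bar>p i x - p i y\<bar>)"
      using h_eq[OF xy(1), of n] h_eq[OF xy(2), of n] by (simp add: P_def)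
  qed (use \<delta> C in auto)
  have DH: "AE x in \<mu>. x \<in> S --> D H x <= \<delta> * B" by (rule lip_operator_weak_le[OF \<mu> D Sb w Dh])
  have "\<exists>x\<in>S. H x < u x"
  proof (rule ccontr)
    assume "\<not> ?thesis"
    then have ge: "u x <= H x" if "x \<in> S" for x using that by (auto simp: not_less)
    have "H x <= u x" if "x \<in> S" for x
      by (rule LIMSEQ_le_const2[OF H]) (use g_le[OF that] h_eq[OF that] in auto)
    then have eq: "u x = H x" if "x \<in> S" for x using ge that by (simp add: antisym)
    have "AE x in \<mu>. x \<in> S --> D u x = D H x" by (rule lip_operatorD(4)[OF D u LipI[OF HL] eq])
    with DH have "AE x in \<mu>. x \<in> S --> D u x <= \<delta> * B" by eventually_elim simp
    then show False using nle by simp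
  qed
  then obtain x0 where x0: "x0 \<in> S" "H x0 < u x0" by blast
  define \<eta> where "\<eta> = (u x0 - H x0) / 2"
  have \<eta>: "0 < \<eta>" using x0 by (simp add: \<eta>_def)
  define l where "l = 2 * U / \<delta> + 1"
  define \<kappa> where "\<kappa> = \<eta> / (2 * l)"
  have l: "0 < l" using U[OF y0] \<delta> by (simp add: l_def add_nonneg_pos)
  let ?R = "cone_rel 0 1 \<kappa> C u p"
  define \<Phi> where "\<Phi> n G \<longleftrightarrow> finite G \<and> G ~= {} \<and> G \<subseteq> {0..l} \<times> S \<and> G \<times> G \<subseteq> ?R \<and>
    ennreal (\<eta> / (2 * Lu)) <= emeasure lborel (\<Union>c\<in>fst ` G. ball c (1 / real (Suc n)))" for n G
  have "\<exists>G. \<Phi> n G" for n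
  proof -
    have "h n x0 <= H x0" unfolding H_def by (rule cSUP_upper) (use h_ub in \<open>auto intro!: bdd_aboveI2\<close>)
    moreover have "H x0 < u x0 - \<eta>" using x0(2) by (simp add: \<eta>_def field_simps)
    ultimately have "g n x0 < u x0 - \<eta>" using h_eq[OF x0(1), of n] by linarith
    moreover have "Ch n x0 ~= {}" using uCh[OF x0(1)] by blast
    ultimately obtain v where "v \<in> Ch n x0" "v < u x0 - \<eta>" unfolding g_def using cInf_lessD by blast
    then obtain z m where z: "\<forall>i\<le>m. z i \<in> S" "z m = x0" "u (z 0) + (\<Sum>i<m. c n (z i) (z (Suc i))) < u (z m) - \<eta>" by (auto simp: Ch_def)
    have "\<exists>G. finite G \<and> G ~= {} \<and> G \<subseteq> {0..2 * U / \<delta> + 1} \<times> S \<and>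
      G \<times> G \<subseteq> graph_rel (\<lambda>s x t y. dist x y <= t - s \<and> \<eta> / (2 * (2 * U / \<delta> + 1)) * (t - s) <= cone_gap C u p x y) \<and>
      ennreal (\<eta> / (2 * Lu)) <= emeasure lborel (\<Union>c\<in>fst ` G. ball c (1 / real (Suc n)))"
      by (rule chain_fragment[OF _ uL Lu _ \<Lambda> \<delta> C U \<eta>, where z=z and m=m])
        (use z(1) z(3)[unfolded c_def P_def M_def] P[unfolded P_def] in auto)
    then show ?thesis by (simp add: \<Phi>_def l_def \<kappa>_def)
  qed
  then obtain G where "\<And>n. \<Phi> n (G n)" by metis
  then have G: "\<And>n. finite (G n)" "\<And>n. G n ~= {}" "\<And>n. G n \<subseteq> {0..l} \<times> S" "\<And>n. G n \<times> G n \<subseteq> ?R"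
    "\<And>n. ennreal (\<eta> / (2 * Lu)) <= emeasure lborel (\<Union>c\<in>fst ` G n. ball c (1 / real (Suc n)))" unfolding \<Phi>_def by blast+
  have Gc: "compact (G n)" for n using G(1) by (rule finite_imp_compact)
  obtain r G0 where r: "strict_mono (r :: nat => nat)" and G0: "compact G0" "G0 ~= {}" "G0 \<subseteq> {0..l} \<times> S"
    and lim: "(\<lambda>n. hausdorff_dist (G (r n)) G0) \<longlonglongrightarrow> 0"
    using hausdorff_sequentially_compact[OF compact_Times[OF compact_Icc S], of G, OF Gc G(2,3)] by (elim exE conjE) (rule that)
  have R: "closed ?R" by (rule closed_graph_rel_gap[OF u_cont p_cont])
  have rel: "G0 \<times> G0 \<subseteq> ?R" by (rule hausdorff_limit_relation[OF Gc G(2) G0(1,2) lim R G(4)])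
  \<comment> \<open>If the domain of the limit were null, a thin neighbourhood of it would have
    small measure; but it contains the thickened time sets of late graphs, whose measure is bounded
    below.\<close>
  have "0 < emeasure lborel (fst ` G0)"
  proof (rule ccontr)
    assume "\<not> ?thesis"
    then have z: "emeasure lborel (fst ` G0) = 0" by simp
    have fc: "compact (fst ` G0)" by (intro compact_continuous_image continuous_intros G0)
    have "emeasure lborel (fst ` G0) < ennreal (\<eta> / (2 * Lu))" using z \<eta> Lu by simp
    then obtain \<rho> where \<rho>: "0 < \<rho>" "emeasure lborel (\<Union>c\<in>fst ` G0. ball c \<rho>) < ennreal (\<eta> / (2 * Lu))"
      using compact_nbhd_measure[OF fc] by blast
    have "eventually (\<lambda>n. hausdorff_dist (G (r n)) G0 < \<rho> / 2) sequentially" using \<rho> by (intro order_tendstoD(2)[OF lim]) auto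
    moreover have "(\<lambda>n. inverse (real (Suc (r n)))) \<longlonglongrightarrow> 0"
      using LIMSEQ_subseq_LIMSEQ[OF LIMSEQ_inverse_real_of_nat r] by (simp add: o_def)
    then have "eventually (\<lambda>n. inverse (real (Suc (r n))) < \<rho> / 2) sequentially" using \<rho> by (intro order_tendstoD(2)) auto
    ultimately have "eventually (\<lambda>n. hausdorff_dist (G (r n)) G0 < \<rho> / 2 \<and> inverse (real (Suc (r n))) < \<rho> / 2) sequentially"
      by (rule eventually_conj)
    then obtain n where n: "hausdorff_dist (G (r n)) G0 < \<rho> / 2" "inverse (real (Suc (r n))) < \<rho> / 2" by (auto simp: eventually_sequentially)
    have sub: "(\<Union>c\<in>fst ` G (r n). ball c (1 / real (Suc (r n)))) \<subseteq> (\<Union>c\<in>fst ` G0. ball c \<rho>)"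
    proof
      fix x assume "x \<in> (\<Union>c\<in>fst ` G (r n). ball c (1 / real (Suc (r n))))"
      then obtain a where a: "a \<in> G (r n)" "dist (fst a) x < 1 / real (Suc (r n))" by auto
      obtain b where b: "b \<in> G0" "dist a b < \<rho> / 2"
        using hausdorff_distD[OF Gc G0(1) G(2) G0(2) n(1) a(1)] by blast
      have "dist (fst b) x <= dist (fst a) (fst b) + dist (fst a) x" by (rule dist_triangle3)
      also have "dist (fst a) (fst b) <= dist a b" by (rule dist_fst_le)
      finally have "dist (fst b) x < \<rho>" using a(2) b(2) n(2) by (simp add: inverse_eq_divide)
      then show "x \<in> (\<Union>c\<in>fst ` G0. ball c \<rho>)" using b(1) by auto
    qed
    have "ennreal (\<eta> / (2 * Lu)) <= emeasure lborel (\<Union>c\<in>fst ` G (r n). ball c (1 / real (Suc (r n))))" by (rule G(5))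
    also have "... <= emeasure lborel (\<Union>c\<in>fst ` G0. ball c \<rho>)" by (rule emeasure_mono[OF sub]) (simp, rule borel_open, auto)
    finally show False using \<rho>(2) by simp
  qed
  moreover have "0 < \<kappa>" using \<eta> l by (simp add: \<kappa>_def)
  ultimately show ?thesis using G0 rel by blast
qed

section \<open>Reparametrization\<close>

text \<open>A weak-type estimate for the maximal slope. Every bad point \<open>s\<close> has a
  partner \<open>T s\<close> such that \<open>H\<close> changes between them by more than
  \<open>\<theta>\<close> times their distance \<open>r s\<close>. Vitali's lemma selects disjoint
  balls of radius \<open>r s\<close> whose fivefold enlargements cover the bad points, and by
  monotonicity the value intervals over disjoint balls do not overlap. The factor 10 is the length
  of a fivefold ball over \<open>r s\<close>.\<close>

lemma monotone_weak_type:
  fixes H :: "real => real"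
  assumes K: "bounded K" and mono: "\<And>s t. s \<in> K ==> t \<in> K ==> s <= t ==> H s <= H t"
    and rng: "\<And>s. s \<in> K ==> a <= H s \<and> H s <= b" and ab: "a <= b" and \<theta>: "0 < \<theta>"
  shows "\<exists>U. open U \<and> emeasure lborel U <= ennreal (10 * (b - a) / \<theta>) \<and>
    (\<forall>s\<in>K - U. \<forall>t\<in>K. \<bar>H t - H s\<bar> <= \<theta> * \<bar>t - s\<bar>)"
proof -
  define B where "B = {s\<in>K. \<exists>t\<in>K. \<theta> * \<bar>t - s\<bar> < \<bar>H t - H s\<bar>}"
  have "\<exists>t\<in>K. \<theta> * \<bar>t - s\<bar> < \<bar>H t - H s\<bar>" if "s \<in> B" for s using that by (simp add: B_def)
  then obtain T where T: "\<And>s. s \<in> B ==> T s \<in> K" "\<And>s. s \<in> B ==> \<theta> * \<bar>T s - s\<bar> < \<bar>H (T s) - H s\<bar>" by metis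
  have BK: "s \<in> K" if "s \<in> B" for s using that by (simp add: B_def)
  define r where "r s = \<bar>T s - s\<bar>" for s
  obtain D where D: "\<And>x. x \<in> K ==> \<bar>x\<bar> <= D" using K unfolding bounded_real by blast
  have r: "0 < r s \<and> r s <= 2 * D" if s: "s \<in> B" for s
  proof -
    have "T s ~= s" using T(2)[OF s] by auto
    then show ?thesis using D[OF T(1)[OF s]] D[OF BK[OF s]] by (auto simp: r_def)
  qed
  obtain C where C: "countable C" "C \<subseteq> B" "pairwise (\<lambda>i j. disjnt (ball i (r i)) (ball j (r j))) C"
    "B \<subseteq> (\<Union>i\<in>C. ball i (5 * r i))"
  proof (rule Vitali_covering_lemma_balls[where S = B and K = B and a = "\<lambda>s. s" and r = r and B = "2 * D"])
    show "B \<subseteq> (\<Union>i\<in>B. ball i (r i))" using r by force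
  next
    show "\<And>i. i \<in> B ==> 0 < r i \<and> r i <= 2 * D" by (rule r)
  qed (rule that)
  define lo where "lo s = min s (T s)" for s
  define hi where "hi s = max s (T s)" for s
  have lohi: "lo s \<in> K" "hi s \<in> K" "lo s <= hi s" if "s \<in> B" for s
    using T(1)[OF that] BK[OF that] by (auto simp: lo_def hi_def min_def max_def)
  have rH: "\<theta> * r s <= H (hi s) - H (lo s)" if s: "s \<in> B" for s
  proof (cases "s <= T s")
    case True
    then show ?thesis using T(2)[OF s] mono[OF BK[OF s] T(1)[OF s]] by (auto simp: lo_def hi_def r_def min_def max_def)
  next
    case False
    then show ?thesis using T(2)[OF s] mono[OF T(1)[OF s] BK[OF s]] by (auto simp: lo_def hi_def r_def min_def max_def)
  qed
  have sep: "hi s <= lo s'" if "s \<in> C" "s' \<in> C" "s < s'" for s s'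
  proof -
    have d: "disjnt (ball s (r s)) (ball s' (r s'))" using C(3) that by (auto simp: pairwise_def)
    have rs: "0 < r s" "0 < r s'" using r C(2) that by auto
    have "s + r s <= s' - r s'"
    proof (rule ccontr)
      assume n: "\<not> s + r s <= s' - r s'"
      define m where "m = (max s (s' - r s') + min s' (s + r s)) / 2"
      have "max s (s' - r s') < min s' (s + r s)" using n that(3) rs by auto
      then have "s <= m" "m < s + r s" "s' - r s' < m" "m <= s'" unfolding m_def by (auto simp: max_def min_def split: if_splits)
      then have "m \<in> ball s (r s) \<inter> ball s' (r s')" by (auto simp: dist_real_def)
      then show False using d by (auto simp: disjnt_def)
    qed
    then show ?thesis using rs by (auto simp: hi_def lo_def r_def)
  qed
  define e where "e = from_nat_into C"
  define N where "N = to_nat_on C ` C"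
  have eN: "e n \<in> C" if "n \<in> N" for n using that C(1) by (auto simp: e_def N_def)
  have eC: "\<exists>n\<in>N. e n = s" if "s \<in> C" for s using that C(1) by (auto simp: e_def N_def intro!: bexI[of _ "to_nat_on C s"])
  have einj: "n = m" if "n \<in> N" "m \<in> N" "e n = e m" for n m using that C(1) by (auto simp: e_def N_def)
  define A where "A n = (if n \<in> N then ball (e n) (5 * r (e n)) else {})" for n
  define J where "J n = (if n \<in> N then {H (lo (e n))..<H (hi (e n))} else {})" for n
  have lomem: "e n \<in> B" if "n \<in> N" for n using eN[OF that] C(2) by blast
  define U where "U = (\<Union>n. A n)"
  have oU: "open U" unfolding U_def A_def by auto
  have BU: "B \<subseteq> U" using C(4) eC unfolding U_def A_def by fastforce
  have disjJ: "disjoint_family J"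
    unfolding disjoint_family_on_def
  proof (intro ballI impI)
    fix m n :: nat assume mn: "m ~= n"
    show "J m \<inter> J n = {}"
    proof (cases "m \<in> N \<and> n \<in> N")
      case True
      have "e m ~= e n" using einj[of m n] True mn by blast
      then consider "e m < e n" | "e n < e m" by linarith
      then have "H (hi (e m)) <= H (lo (e n)) \<or> H (hi (e n)) <= H (lo (e m))"
      proof cases
        case 1
        then have "hi (e m) <= lo (e n)" using sep[OF eN eN] True by simp
        then show ?thesis using mono[OF lohi(2)[OF lomem] lohi(1)[OF lomem]] True by simp
      next
        case 2
        then have "hi (e n) <= lo (e m)" using sep[OF eN eN] True by simp
        then show ?thesis using mono[OF lohi(2)[OF lomem] lohi(1)[OF lomem]] True by simp
      qed
      then show ?thesis by (auto simp: J_def)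
    qed (auto simp: J_def)
  qed
  have AJ: "emeasure lborel (A n) <= ennreal (10 / \<theta>) * emeasure lborel (J n)" for n
  proof (cases "n \<in> N")
    case True
    have rn: "0 < r (e n)" using r lomem[OF True] by blast
    have "emeasure lborel (A n) = ennreal (10 * r (e n))" using True rn by (simp add: A_def ball_eq_greaterThanLessThan)
    also have "... <= ennreal (10 / \<theta> * (H (hi (e n)) - H (lo (e n))))"
      using rH[OF lomem[OF True]] \<theta> by (intro ennreal_leI) (simp add: field_simps)
    also have "... = ennreal (10 / \<theta>) * ennreal (H (hi (e n)) - H (lo (e n)))"
      using \<theta> mono[OF lohi[OF lomem[OF True]]] by (intro ennreal_mult) auto
    also have "ennreal (H (hi (e n)) - H (lo (e n))) = emeasure lborel (J n)"
      using True mono[OF lohi[OF lomem[OF True]]] by (simp add: J_def)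
    finally show ?thesis .
  qed (simp add: A_def)
  have Am: "range A \<subseteq> sets lborel" by (auto simp: A_def)
  have Jm: "range J \<subseteq> sets lborel" by (auto simp: J_def)
  have "emeasure lborel U <= (\<Sum>n. emeasure lborel (A n))" unfolding U_def by (rule emeasure_subadditive_countably[OF Am])
  also have "... <= (\<Sum>n. ennreal (10 / \<theta>) * emeasure lborel (J n))" by (intro suminf_le AJ) auto
  also have "... = ennreal (10 / \<theta>) * (\<Sum>n. emeasure lborel (J n))" by simp
  also have "(\<Sum>n. emeasure lborel (J n)) = emeasure lborel (\<Union>n. J n)" by (rule suminf_emeasure[OF Jm disjJ])
  also have "... <= emeasure lborel {a..b}"
  proof (rule emeasure_mono)
    have "J n \<subseteq> {a..b}" for n
    proof (cases "n \<in> N")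
      case True
      then show ?thesis using rng[OF lohi(1)[OF lomem[OF True]]] rng[OF lohi(2)[OF lomem[OF True]]] by (auto simp: J_def)
    qed (simp add: J_def)
    then show "(\<Union>n. J n) \<subseteq> {a..b}" by blast
  qed simp
  also have "... = ennreal (b - a)" using ab by simp
  finally have "emeasure lborel U <= ennreal (10 / \<theta>) * ennreal (b - a)" by (simp add: mult_left_mono)
  also have "... = ennreal (10 * (b - a) / \<theta>)" using \<theta> ab by (simp add: ennreal_mult[symmetric])
  finally have "emeasure lborel U <= ennreal (10 * (b - a) / \<theta>)" .
  moreover have "\<bar>H t - H s\<bar> <= \<theta> * \<bar>t - s\<bar>" if "s \<in> K - U" "t \<in> K" for s t
    using that BU by (auto simp: B_def not_less[symmetric])
  ultimately show ?thesis using oU by blast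
qed

text \<open>A monotone \<open>1\<close>-Lipschitz \<open>F\<close> is the distribution function of a measure dominated by Lebesgue
  measure, so the claim reduces to Lebesgue's differentiation theorem for its density.\<close>

lemma AE_mono_lipschitz_differentiable:
  fixes F :: "real => real"
  assumes F: "\<And>s t. s <= t ==> 0 <= F t - F s" "\<And>s t. s <= t ==> F t - F s <= t - s"
  shows "AE t in lebesgue. \<exists>c. (F has_real_derivative c) (at t)"
proof -
  \<comment> \<open>\<open>F\<close> and \<open>G\<close> are both monotone, so each defines an
    interval measure. The two measures add up to Lebesgue measure, and therefore that of
    \<open>F\<close> is dominated by it.\<close>
  define G where "G t = t - F t" for t
  have mono: "F s <= F t" "G s <= G t" if "s <= t" for s t using F[OF that] by (simp_all add: G_def)
  have "\<bar>F s - F t\<bar> <= \<bar>s - t\<bar>" for s t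
    using F[of s t] F[of t s] by (cases "s <= t") (auto simp: abs_if)
  then have "1-lipschitz_on UNIV F" by (auto simp: lipschitz_on_def dist_real_def)
  then have cF: "continuous_on UNIV F" by (rule lipschitz_on_continuous_on)
  then have "continuous_on UNIV G" unfolding G_def by (intro continuous_intros)
  with cF have cr: "continuous (at_right a) F" "continuous (at_right a) G" for a
    by (auto intro: continuous_within_subset simp: continuous_on_eq_continuous_within)
  define N where "N = interval_measure F"
  obtain \<xi> where \<xi>: "sets \<xi> = sets N" "\<forall>A\<in>sets N. emeasure \<xi> A = emeasure N A + emeasure (interval_measure G) A"
    using sum_measure_exists[of N "interval_measure G"] unfolding N_def by auto
  have "\<xi> = lborel"
  proof (rule measure_eqI_generator_eq[where E = "range (\<lambda>(a, b). {a<..b::real})" and \<Omega> = UNIV and A = "\<lambda>i. {- real i<..real i}"])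
    show "Int_stable (range (\<lambda>(a, b). {a<..b::real}))"
      unfolding Int_stable_def by (auto simp: image_iff)
    show "sets \<xi> = sigma_sets UNIV (range (\<lambda>(a, b). {a<..b::real}))" "sets lborel = sigma_sets UNIV (range (\<lambda>(a, b). {a<..b::real}))"
      unfolding \<xi>(1) N_def sets_interval_measure sets_lborel by (subst borel_sigma_sets_Ioc, rule sets_measure_of, simp)+
    show em: "emeasure \<xi> X = emeasure lborel X" if X: "X \<in> range (\<lambda>(a, b). {a<..b::real})" for X
    proof -
      obtain a b where ab: "X = {a<..b}" using X by auto
      show ?thesis
      proof (cases "a <= b")
        case True
        have "emeasure \<xi> X = ennreal (F b - F a) + ennreal (G b - G a)"
          using \<xi>(2) emeasure_interval_measure_Ioc_eq[OF mono(1) cr(1), of a b] emeasure_interval_measure_Ioc_eq[OF mono(2) cr(2), of a b] True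
          by (simp add: ab N_def)
        also have "... = ennreal (b - a)" using mono[OF True] by (simp add: ennreal_plus[symmetric] G_def)
        finally show ?thesis using True by (simp add: ab)
      qed (use \<xi> in \<open>simp add: ab N_def\<close>)
    qed
    show "(\<Union>i. {- real i<..real i}) = UNIV"
    proof -
      have "\<exists>i. x \<in> {- real i<..real i}" for x :: real
      proof -
        obtain i where "\<bar>x\<bar> < real i" using reals_Archimedean2 by blast
        then show ?thesis by (intro exI[of _ i]) auto
      qed
      then show ?thesis by blast
    qed
    show "emeasure \<xi> {- real i<..real i} ~= \<infinity>" for i by (subst em) auto
  qed auto
  then have le: "emeasure N A <= emeasure lborel A" if "A \<in> sets borel" for A using \<xi>(2) that by (simp add: N_def)
  have ac: "absolutely_continuous lborel N"
    using le le_zero_eq unfolding absolutely_continuous_def null_sets_def N_def by fastforce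
  have sN: "sets N = sets lborel" by (simp add: N_def)
  define D where "D x = enn2real (RN_deriv lborel N x)" for x
  have Dm: "D \<in> borel_measurable borel" unfolding D_def by measurable
  have "AE x in lborel. RN_deriv lborel N x ~= \<infinity>"
    by (rule sigma_finite_measure.RN_deriv_finite[OF sigma_finite_lborel _ ac sN]) (simp add: N_def sigma_finite_interval_measure mono cr)
  then have "density lborel (RN_deriv lborel N) = density lborel (\<lambda>x. ennreal (D x))"
    by (intro density_cong) (auto simp: D_def less_top Dm[unfolded D_def])
  then have Nd: "N = density lborel (\<lambda>x. ennreal (D x))" using sigma_finite_measure.density_RN_deriv[OF sigma_finite_lborel ac sN] by simp
  have DF: "(D has_integral F b - F a) {a..b}" if "a <= b" for a b
  proof -
    have "(\<integral>\<^sup>+ x. ennreal (D x * indicator {a..b} x) \<partial>lborel) = emeasure N {a..b}"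
      unfolding Nd using Dm by (subst emeasure_density) (auto simp: ennreal_mult' ennreal_indicator intro!: nn_integral_cong split: split_indicator)
    also have "... = ennreal (F b - F a)"
      unfolding N_def using that mono(1) cF by (intro emeasure_interval_measure_Icc) auto
    finally have "((\<lambda>x. D x * indicator {a..b} x) has_integral F b - F a) UNIV"
      using Dm F(1)[OF that] by (intro nn_integral_has_integral) (auto simp: D_def)
    then show ?thesis
      by (subst has_integral_restrict_UNIV[symmetric]) (auto elim!: has_integral_eq[rotated] simp: indicator_def)
  qed
  \<comment> \<open>The differentiation theorem used here averages over intervals to the right of a
    point; reflecting the line supplies the left difference quotients.\<close>
  have DR: "((\<lambda>x. D (- x)) has_integral F (- a) - F (- b)) {a..b}" if "a <= b" for a b
    using DF[of "- b" "- a"] that has_integral_reflect_real[of D "F (- a) - F (- b)" "- a" "- b"] by simp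
  have int: "D integrable_on cbox a b" "(\<lambda>x. D (- x)) integrable_on cbox a b" for a b :: real
    using DF[of a b] DR[of a b] by (cases "a <= b"; auto)+
  obtain N1 where N1: "negligible N1" "\<And>x e. x \<notin> N1 ==> 0 < e ==> \<exists>d>0. \<forall>h. 0 < h \<and> h < d --> norm (integral (cbox x (x + h *\<^sub>R One)) D /\<^sub>R h ^ DIM(real) - D x) < e"
    using integrable_ccontinuous_explicit[OF int(1)] by blast
  obtain N2 where N2: "negligible N2" "\<And>x e. x \<notin> N2 ==> 0 < e ==> \<exists>d>0. \<forall>h. 0 < h \<and> h < d --> norm (integral (cbox x (x + h *\<^sub>R One)) (\<lambda>x. D (- x)) /\<^sub>R h ^ DIM(real) - D (- x)) < e"
    using integrable_ccontinuous_explicit[OF int(2)] by blast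
  have "negligible (N1 \<union> uminus ` N2)" using N1(1) N2(1)
    by (intro negligible_Un negligible_differentiable_image_negligible differentiable_on_minus differentiable_on_ident order_refl)
  then have "AE t in lebesgue. t \<notin> N1 \<union> uminus ` N2" unfolding negligible_iff_null_sets by (rule AE_not_in)
  then show ?thesis
  proof (rule eventually_mono)
    fix x assume "x \<notin> N1 \<union> uminus ` N2"
    then have x: "x \<notin> N1" "- x \<notin> N2" by (auto simp: image_iff)
    have "((\<lambda>y. (F y - F x) / (y - x)) \<longlongrightarrow> D x) (at x)"
    proof (rule tendstoI)
      fix e :: real assume e: "0 < e"
      obtain d1 where d1: "0 < d1" "\<And>h. 0 < h ==> h < d1 ==> \<bar>(F (x + h) - F x) / h - D x\<bar> < e"
        using N1(2)[OF x(1) e] DF[THEN integral_unique, of x] by (auto simp: divide_inverse_commute)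
      obtain d2 where d2: "0 < d2" "\<And>h. 0 < h ==> h < d2 ==> \<bar>(F x - F (x - h)) / h - D x\<bar> < e"
        using N2(2)[OF x(2) e] DR[THEN integral_unique, of "- x"] by (auto simp: divide_inverse_commute)
      have "dist ((F y - F x) / (y - x)) (D x) < e" if "y ~= x" "dist y x < min d1 d2" for y
      proof (cases "x < y")
        case True
        then show ?thesis using d1(2)[of "y - x"] that by (simp add: dist_real_def)
      next
        case False
        then show ?thesis using d2(2)[of "x - y"] that minus_divide_divide[of "F y - F x" "y - x"] by (simp add: dist_real_def)
      qed
      then show "\<forall>\<^sub>F y in at x. dist ((F y - F x) / (y - x)) (D x) < e"
        unfolding eventually_at using d1(1) d2(1) by (intro exI[of _ "min d1 d2"]) auto
    qed
    then show "\<exists>c. (F has_real_derivative c) (at x)" by (auto simp: has_field_derivative_iff)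
  qed
qed

text \<open>Rademacher's theorem on the line, relative to the domain \<open>K\<close>. The McShane
  extension becomes monotone after adding \<open>(L + 1) * t\<close>, and the factor
  \<open>c\<close> makes the result \<open>1\<close>-Lipschitz.\<close>

lemma AE_lipschitz_on_differentiable:
  fixes f :: "real => real"
  assumes f: "L-lipschitz_on K f"
  shows "AE t in lebesgue. t \<in> K --> (\<exists>c. (f has_real_derivative c) (at t within K))"
proof (cases "K = {}")
  case False
  have L: "0 <= L" using f by (rule lipschitz_on_nonneg)
  define g where "g s = (INF t\<in>K. f t + L * dist s t)" for s
  have fL: "f s <= f t + L * dist s t" if "s \<in> K" "t \<in> K" for s t
    using lipschitz_onD[OF f that] by (simp add: dist_real_def)
  have g1: "L-lipschitz_on UNIV g" unfolding g_def by (rule mcshane_extension(1)[OF False fL L])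
  have gK: "g s = f s" if s: "s \<in> K" for s unfolding g_def by (rule mcshane_extension(2)[OF False fL L s])
  have gle: "g s <= g t + L * \<bar>s - t\<bar>" for s t
    using lipschitz_onD[OF g1, of s t] by (simp add: dist_real_def)
  define c where "c = 1 / (2 * L + 1)"
  have c: "0 < c" "c * (2 * L + 1) = 1" using L by (simp_all add: c_def)
  define F where "F t = c * (g t + (L + 1) * t)" for t
  have "AE s in lebesgue. \<exists>c. (F has_real_derivative c) (at s)"
  proof (rule AE_mono_lipschitz_differentiable)
    fix s t :: real assume st: "s <= t"
    have d: "F t - F s = c * (g t - g s + (L + 1) * (t - s))" by (simp add: F_def algebra_simps)
    show "0 <= F t - F s" unfolding d using gle[of s t] st c(1) L by (intro mult_nonneg_nonneg) (auto simp: distrib_right)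
    have "F t - F s <= c * ((2 * L + 1) * (t - s))" unfolding d using gle[of t s] st c(1) by (intro mult_left_mono) (auto simp: algebra_simps)
    then show "F t - F s <= t - s" by (simp add: mult.assoc[symmetric] c(2))
  qed
  then show ?thesis
  proof (rule eventually_mono, intro impI)
    fix s assume ex: "\<exists>c. (F has_real_derivative c) (at s)" and s: "s \<in> K"
    obtain k where k: "(F has_real_derivative k) (at s)" using ex by (elim exE) (rule that)
    have "(2 * L + 1) * c = 1" using c(2) by (simp add: mult.commute)
    then have gF: "g = (\<lambda>t. (2 * L + 1) * F t - (L + 1) * t)" by (simp add: F_def mult.assoc[symmetric])
    have "(g has_real_derivative (2 * L + 1) * k - (L + 1) * 1) (at s within K)"
      unfolding gF by (rule has_field_derivative_at_within[OF DERIV_diff[OF DERIV_cmult[OF k] DERIV_cmult[OF DERIV_ident]]])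
    then have "(f has_real_derivative (2 * L + 1) * k - (L + 1) * 1) (at s within K)"
      unfolding has_field_derivative_def using s gK by (intro has_derivative_transform[of s K f g]) auto
    then show "\<exists>c. (f has_real_derivative c) (at s within K)" by blast
  qed
qed simp

lemma emeasure_lborel_eq_0_lipschitz_image:
  fixes f :: "real => real"
  assumes f: "\<And>s t. s \<in> A ==> t \<in> A ==> \<bar>f s - f t\<bar> <= B * \<bar>s - t\<bar>"
    and A: "A \<in> sets borel" "emeasure lborel A = 0" and fA: "f ` A \<in> sets borel"
  shows "emeasure lborel (f ` A) = 0"
proof -
  have "A \<in> null_sets lborel" using A by (simp add: null_sets_def)
  then have "negligible A" by (simp add: negligible_iff_null_sets null_sets_completionI)
  then have "negligible (f ` A)"
  proof (rule negligible_locally_Lipschitz_image[OF order_refl])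
    fix x assume x: "x \<in> A"
    show "\<exists>T B. open T \<and> x \<in> T \<and> (\<forall>y\<in>A \<inter> T. norm (f y - f x) <= B * norm (y - x))"
      using f x by (intro exI[of _ UNIV] exI[of _ B]) auto
  qed
  then show ?thesis using fA by (simp add: negligible_iff_emeasure0)
qed

section \<open>Variation of a curve and change of parameter\<close>

definition chain_sums :: "(real => 'a::metric_space) => real set => real => real set" where
  "chain_sums \<gamma> K t = {(\<Sum>i<m. dist (\<gamma> (\<tau> i)) (\<gamma> (\<tau> (Suc i)))) | m \<tau>.
     (\<forall>i\<le>m. \<tau> i \<in> K) \<and> (\<forall>i<m. \<tau> i <= \<tau> (Suc i)) \<and> \<tau> m = t}"

lemma chain_sumsI:
  assumes "\<forall>i\<le>m. \<tau> i \<in> K" "\<forall>i<m. \<tau> i <= \<tau> (Suc i)" "\<tau> m = t"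
  shows "(\<Sum>i<m. dist (\<gamma> (\<tau> i)) (\<gamma> (\<tau> (Suc i)))) \<in> chain_sums \<gamma> K t"
  unfolding chain_sums_def using assms by blast

lemma chain_sums_extend:
  assumes v: "v \<in> chain_sums \<gamma> K s" and st: "s <= t" "t \<in> K"
  shows "v + dist (\<gamma> s) (\<gamma> t) \<in> chain_sums \<gamma> K t"
proof -
  obtain m \<tau> where v: "v = (\<Sum>i<m. dist (\<gamma> (\<tau> i)) (\<gamma> (\<tau> (Suc i))))" "\<forall>i\<le>m. \<tau> i \<in> K" "\<forall>i<m. \<tau> i <= \<tau> (Suc i)" "\<tau> m = s"
    using v unfolding chain_sums_def by blast
  define \<sigma> where "\<sigma> i = (if i <= m then \<tau> i else t)" for i
  have "(\<Sum>i<Suc m. dist (\<gamma> (\<sigma> i)) (\<gamma> (\<sigma> (Suc i)))) \<in> chain_sums \<gamma> K t"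
    by (rule chain_sumsI) (use v st in \<open>auto simp: \<sigma>_def less_Suc_eq\<close>)
  also have "(\<Sum>i<Suc m. dist (\<gamma> (\<sigma> i)) (\<gamma> (\<sigma> (Suc i)))) = v + dist (\<gamma> s) (\<gamma> t)"
    using v by (simp add: \<sigma>_def)
  finally show ?thesis .
qed

text \<open>\<open>A\<close> is the variation along \<open>K\<close> up to time \<open>t\<close>;
  chains jump across the gaps of \<open>K\<close> and may start anywhere in it. Appending the
  segment from \<open>s\<close> to \<open>t\<close> to a chain shows that \<open>A\<close> grows at
  least as fast as the distance.\<close>

lemma variation_function:
  fixes \<gamma> :: "real => 'a::metric_space"
  assumes K: "compact K" and \<gamma>: "\<And>s t. s \<in> K ==> t \<in> K ==> s <= t ==> dist (\<gamma> s) (\<gamma> t) <= t - s"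
  defines "A \<equiv> \<lambda>t. Sup (chain_sums \<gamma> K t)"
  shows "\<And>t v. v \<in> chain_sums \<gamma> K t ==> v <= A t"
    and "\<And>s t. s \<in> K ==> t \<in> K ==> s <= t ==> dist (\<gamma> s) (\<gamma> t) <= A t - A s"
    and "\<And>s t. s \<in> K ==> t \<in> K ==> s <= t ==> A t - A s <= t - s"
    and "\<And>t e. t \<in> K ==> 0 < e ==> \<exists>v\<in>chain_sums \<gamma> K t. A t - e < v"
proof -
  obtain a where a: "\<And>x. x \<in> K ==> a <= x" using bounded_imp_bdd_below[OF compact_imp_bounded[OF K]] unfolding bdd_below_def by blast
  have sum_le: "(\<Sum>i<m. dist (\<gamma> (\<tau> i)) (\<gamma> (\<tau> (Suc i)))) <= \<tau> m - \<tau> 0"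
    if "\<forall>i\<le>m. \<tau> i \<in> K" "\<forall>i<m. \<tau> i <= \<tau> (Suc i)" for m and \<tau> :: "nat => real"
    using that
  proof (induction m)
    case (Suc m)
    have "dist (\<gamma> (\<tau> m)) (\<gamma> (\<tau> (Suc m))) <= \<tau> (Suc m) - \<tau> m" using Suc.prems by (intro \<gamma>) auto
    moreover have "(\<Sum>i<m. dist (\<gamma> (\<tau> i)) (\<gamma> (\<tau> (Suc i)))) <= \<tau> m - \<tau> 0" using Suc.prems by (intro Suc.IH) auto
    ultimately show ?case by simp
  qed simp
  have bdd: "bdd_above (chain_sums \<gamma> K t)" for t
  proof (rule bdd_aboveI)
    fix v assume "v \<in> chain_sums \<gamma> K t"
    then obtain m \<tau> where v: "v = (\<Sum>i<m. dist (\<gamma> (\<tau> i)) (\<gamma> (\<tau> (Suc i))))" "\<forall>i\<le>m. \<tau> i \<in> K" "\<forall>i<m. \<tau> i <= \<tau> (Suc i)" "\<tau> m = t"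
      unfolding chain_sums_def by blast
    have "v <= t - \<tau> 0" unfolding v(1) v(4)[symmetric] by (rule sum_le[OF v(2,3)])
    then show "v <= t - a" using a[of "\<tau> 0"] v(2) by simp
  qed
  show up: "v <= A t" if "v \<in> chain_sums \<gamma> K t" for t v
    unfolding A_def by (rule cSup_upper[OF that bdd])
  have zero: "0 \<in> chain_sums \<gamma> K t" if "t \<in> K" for t
    using chain_sumsI[of 0 "\<lambda>_. t" K t \<gamma>] that by simp
  show "\<exists>v\<in>chain_sums \<gamma> K t. A t - e < v" if "t \<in> K" "0 < e" for t e
    using less_cSup_iff[of "chain_sums \<gamma> K t" "A t - e"] bdd zero[OF that(1)] that(2) by (auto simp: A_def)
  show "dist (\<gamma> s) (\<gamma> t) <= A t - A s" if st: "s \<in> K" "t \<in> K" "s <= t" for s t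
  proof -
    have "A s <= A t - dist (\<gamma> s) (\<gamma> t)"
      unfolding A_def[of ]
    proof (rule cSup_least)
      show "chain_sums \<gamma> K s ~= {}" using zero[OF st(1)] by blast
      fix v assume "v \<in> chain_sums \<gamma> K s"
      then have "v + dist (\<gamma> s) (\<gamma> t) <= A t" using st by (intro up chain_sums_extend)
      then show "v <= Sup (chain_sums \<gamma> K t) - dist (\<gamma> s) (\<gamma> t)" by (simp add: A_def)
    qed
    then show ?thesis by simp
  qed
  show "A t - A s <= t - s" if st: "s \<in> K" "t \<in> K" "s <= t" for s t
  proof -
    \<comment> \<open>A chain that ends beyond \<open>s\<close> is cut at \<open>s\<close>: the
      first part is at most \<open>A s\<close>, the rest at most the elapsed time.\<close>
    have *: "(\<Sum>i<m. dist (\<gamma> (\<tau> i)) (\<gamma> (\<tau> (Suc i)))) <= A s + (\<tau> m - s)"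
      if "\<forall>i\<le>m. \<tau> i \<in> K" "\<forall>i<m. \<tau> i <= \<tau> (Suc i)" "s <= \<tau> m" for m and \<tau> :: "nat => real"
      using that
    proof (induction m)
      case 0
      then show ?case using up[OF zero[OF st(1)]] by simp
    next
      case (Suc m)
      show ?case
      proof (cases "s <= \<tau> m")
        case True
        then have "(\<Sum>i<m. dist (\<gamma> (\<tau> i)) (\<gamma> (\<tau> (Suc i)))) <= A s + (\<tau> m - s)" using Suc.prems by (intro Suc.IH) auto
        moreover have "dist (\<gamma> (\<tau> m)) (\<gamma> (\<tau> (Suc m))) <= \<tau> (Suc m) - \<tau> m" using Suc.prems by (intro \<gamma>) auto
        ultimately show ?thesis by simp
      next
        case False
        have "(\<Sum>i<m. dist (\<gamma> (\<tau> i)) (\<gamma> (\<tau> (Suc i)))) \<in> chain_sums \<gamma> K (\<tau> m)" using Suc.prems by (intro chain_sumsI) auto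
        then have "(\<Sum>i<m. dist (\<gamma> (\<tau> i)) (\<gamma> (\<tau> (Suc i)))) + dist (\<gamma> (\<tau> m)) (\<gamma> s) <= A s"
          using False st(1) by (intro up chain_sums_extend) auto
        moreover have "dist (\<gamma> (\<tau> m)) (\<gamma> (\<tau> (Suc m))) <= dist (\<gamma> (\<tau> m)) (\<gamma> s) + dist (\<gamma> s) (\<gamma> (\<tau> (Suc m)))" by (rule dist_triangle)
        moreover have "dist (\<gamma> s) (\<gamma> (\<tau> (Suc m))) <= \<tau> (Suc m) - s" using Suc.prems st(1) by (intro \<gamma>) auto
        ultimately show ?thesis by simp
      qed
    qed
    have "A t <= A s + (t - s)"
      unfolding A_def[of ]
    proof (rule cSup_least)
      show "chain_sums \<gamma> K t ~= {}" using zero[OF st(2)] by blast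
      fix v assume "v \<in> chain_sums \<gamma> K t"
      then obtain m \<tau> where v: "v = (\<Sum>i<m. dist (\<gamma> (\<tau> i)) (\<gamma> (\<tau> (Suc i))))" "\<forall>i\<le>m. \<tau> i \<in> K" "\<forall>i<m. \<tau> i <= \<tau> (Suc i)" "\<tau> m = t"
        unfolding chain_sums_def by blast
      then show "v <= Sup (chain_sums \<gamma> K s) + (t - s)" using *[OF v(2,3)] st(3) by (simp add: A_def)
    qed
    then show ?thesis by simp
  qed
qed

lemma step_cover:
  fixes \<tau> :: "nat => real"
  assumes "\<tau> 0 <= t" "t <= \<tau> m" "0 < m" shows "\<exists>i<m. \<tau> i <= t \<and> t <= \<tau> (Suc i)"
  using assms(2,3)
proof (induction m)
  case (Suc m)
  show ?case
  proof (cases "t <= \<tau> m \<and> 0 < m")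
    case True
    then show ?thesis using Suc.IH less_Suc_eq by blast
  next
    case False
    then show ?thesis using Suc.prems assms(1) by (intro exI[of _ m]) auto
  qed
qed simp

text \<open>The new parameter is the variation divided by \<open>1 + \<epsilon>\<close>. Variation
  dominates distance; the reverse estimate up to the factor \<open>1 + \<epsilon>\<close> needs a
  subset. On a piece of a nearly optimal chain the excess of variation over distance rises by little
  compared with the measure of the piece, so \<open>monotone_weak_type\<close> leaves a set of
  positive measure on which the excess is at most \<open>\<kappa> * \<epsilon>\<close> times the
  elapsed time. By \<open>lo\<close> this is at most \<open>\<epsilon>\<close> times the
  distance.\<close>

lemma reparametrize_almost_isometric:
  fixes \<gamma> :: "real => 'a::metric_space"
  assumes K: "compact K" "0 < emeasure lborel K" and K1: "K \<subseteq> {j..j+1}"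
    and up: "\<And>s t. s \<in> K ==> t \<in> K ==> s <= t ==> dist (\<gamma> s) (\<gamma> t) <= t - s"
    and lo: "\<And>s t. s \<in> K ==> t \<in> K ==> s <= t ==> \<kappa> * (t - s) <= dist (\<gamma> s) (\<gamma> t)"
    and \<kappa>: "0 < \<kappa>" and \<epsilon>: "0 < \<epsilon>"
  shows "\<exists>K' \<tau>. compact K' \<and> K' \<subseteq> K \<and> continuous_on K' \<tau> \<and> \<tau> ` K' \<subseteq> {0..1} \<and> 0 < emeasure lborel (\<tau> ` K') \<and>
    (\<forall>s\<in>K'. \<forall>t\<in>K'. s <= t --> 0 <= \<tau> t - \<tau> s \<and> \<tau> t - \<tau> s <= t - s \<and> \<tau> t - \<tau> s <= dist (\<gamma> s) (\<gamma> t) \<and> dist (\<gamma> s) (\<gamma> t) <= (1 + \<epsilon>) * (\<tau> t - \<tau> s))"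
proof -
  define A where "A t = Sup (chain_sums \<gamma> K t)" for t
  have A: "\<And>t v. v \<in> chain_sums \<gamma> K t ==> v <= A t"
    "\<And>s t. s \<in> K ==> t \<in> K ==> s <= t ==> dist (\<gamma> s) (\<gamma> t) <= A t - A s"
    "\<And>s t. s \<in> K ==> t \<in> K ==> s <= t ==> A t - A s <= t - s"
    "\<And>t e. t \<in> K ==> 0 < e ==> \<exists>v\<in>chain_sums \<gamma> K t. A t - e < v"
    unfolding A_def by (rule variation_function[OF K(1) up]; assumption)+
  have Kn: "K ~= {}" using K(2) by auto
  obtain lo' hi' where b: "lo' \<in> K" "hi' \<in> K" "\<And>x. x \<in> K ==> lo' <= x \<and> x <= hi'"
    using compact_attains_inf[OF K(1) Kn] compact_attains_sup[OF K(1) Kn] by blast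
  have Kfin: "emeasure lborel K < \<infinity>" by (rule emeasure_compact_finite[OF K(1)])
  define \<theta> where "\<theta> = \<kappa> * \<epsilon>"
  have \<theta>: "0 < \<theta>" using \<kappa> \<epsilon> by (simp add: \<theta>_def)
  \<comment> \<open>With this \<open>e\<close> the exceptional measures
    \<open>10 * def i / \<theta>\<close> of all pieces add up to at most half of the measure of
    \<open>K\<close>, so some piece has larger measure than its exceptional set.\<close>
  define e where "e = \<theta> * measure lborel K / 20"
  have mK: "0 < measure lborel K" using K(2) Kfin by (simp add: measure_def enn2real_positive_iff)
  have e: "0 < e" using \<theta> mK by (simp add: e_def)
  obtain v where v: "v \<in> chain_sums \<gamma> K hi'" "A hi' - e < v" using A(4)[OF b(2) e] by blast
  obtain m0 \<tau>0 where \<tau>0: "v = (\<Sum>i<m0. dist (\<gamma> (\<tau>0 i)) (\<gamma> (\<tau>0 (Suc i))))" "\<forall>i\<le>m0. \<tau>0 i \<in> K" "\<forall>i<m0. \<tau>0 i <= \<tau>0 (Suc i)" "\<tau>0 m0 = hi'"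
    using v(1) unfolding chain_sums_def by blast
  \<comment> \<open>Starting at the left end of \<open>K\<close> makes the pieces of the chain cover
    \<open>K\<close>.\<close>
  define \<tau> where "\<tau> i = (case i of 0 => lo' | Suc j => \<tau>0 j)" for i
  define m where "m = Suc m0"
  have \<tau>K: "\<tau> i \<in> K" if "i <= m" for i using that \<tau>0(2) b(1) by (cases i) (auto simp: \<tau>_def m_def)
  have \<tau>le: "\<tau> i <= \<tau> (Suc i)" if "i < m" for i
    using that \<tau>0(2,3) b(3) by (cases i) (auto simp: \<tau>_def m_def)
  have \<tau>end: "\<tau> 0 = lo'" "\<tau> m = hi'" using \<tau>0(4) by (simp_all add: \<tau>_def m_def)
  have "(\<Sum>i<m. dist (\<gamma> (\<tau> i)) (\<gamma> (\<tau> (Suc i)))) = dist (\<gamma> lo') (\<gamma> (\<tau>0 0)) + v"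
    unfolding m_def sum.lessThan_Suc_shift \<tau>0(1) by (simp add: \<tau>_def)
  then have vsum: "A hi' - e < (\<Sum>i<m. dist (\<gamma> (\<tau> i)) (\<gamma> (\<tau> (Suc i))))" using v(2) zero_le_dist[of "\<gamma> lo'" "\<gamma> (\<tau>0 0)"] by linarith
  define def where "def i = A (\<tau> (Suc i)) - A (\<tau> i) - dist (\<gamma> (\<tau> i)) (\<gamma> (\<tau> (Suc i)))" for i
  have def0: "0 <= def i" if "i < m" for i
    using A(2)[OF \<tau>K \<tau>K \<tau>le, of i] that by (simp add: def_def)
  have "(\<Sum>i<m. def i) = A hi' - A lo' - (\<Sum>i<m. dist (\<gamma> (\<tau> i)) (\<gamma> (\<tau> (Suc i))))"
    unfolding def_def sum_subtractf using sum_lessThan_telescope[of "\<lambda>i. A (\<tau> i)" m] by (simp add: \<tau>end sum_subtractf)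
  moreover have "0 <= A lo'" using A(1)[of 0 lo'] chain_sumsI[of 0 "\<lambda>_. lo'" K lo' \<gamma>] b(1) by simp
  ultimately have defsum: "(\<Sum>i<m. def i) < e" using vsum by linarith
  define P where "P i = K \<inter> {\<tau> i..\<tau> (Suc i)}" for i
  have Pc: "compact (P i)" for i unfolding P_def by (intro compact_Int K(1) compact_Icc)
  have Pb: "P i \<in> sets borel" for i using compact_imp_closed[OF Pc[of i]] by simp
  have KP: "K \<subseteq> (\<Union>i\<in>{..<m}. P i)"
  proof
    fix t assume t: "t \<in> K"
    have "\<exists>i<m. \<tau> i <= t \<and> t <= \<tau> (Suc i)" using b(3)[OF t] by (intro step_cover[of \<tau> t m]) (simp_all add: \<tau>end, simp add: m_def)
    then show "t \<in> (\<Union>i\<in>{..<m}. P i)" using t by (auto simp: P_def)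
  qed
  have "\<exists>i<m. ennreal (10 * def i / \<theta>) < emeasure lborel (P i)"
  proof (rule ccontr)
    assume "\<not> ?thesis"
    then have le: "emeasure lborel (P i) <= ennreal (10 * def i / \<theta>)" if "i < m" for i using that by (meson not_less)
    have "emeasure lborel K <= emeasure lborel (\<Union>i\<in>{..<m}. P i)" using KP Pb by (intro emeasure_mono) auto
    also have "... <= (\<Sum>i<m. emeasure lborel (P i))" using Pb by (intro emeasure_subadditive_finite) auto
    also have "... <= (\<Sum>i<m. ennreal (10 * def i / \<theta>))" by (intro sum_mono le) auto
    also have "... = ennreal (\<Sum>i<m. 10 * def i / \<theta>)" using def0 \<theta> by (intro sum_ennreal) auto
    also have "(\<Sum>i<m. 10 * def i / \<theta>) = 10 * (\<Sum>i<m. def i) / \<theta>" by (simp add: sum_distrib_left sum_divide_distrib)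
    also have "ennreal (10 * (\<Sum>i<m. def i) / \<theta>) <= ennreal (10 * e / \<theta>)" using defsum \<theta> by (intro ennreal_leI divide_right_mono) auto
    also have "10 * e / \<theta> = measure lborel K / 2" using \<theta> by (simp add: e_def)
    finally have "ennreal (measure lborel K) <= ennreal (measure lborel K / 2)"
      using Kfin by (simp add: emeasure_eq_ennreal_measure less_top)
    then show False using mK by (simp add: ennreal_le_iff)
  qed
  then obtain i where i: "i < m" "ennreal (10 * def i / \<theta>) < emeasure lborel (P i)" by blast
  \<comment> \<open>Variation minus the distance from the start of the piece: monotone by the
    triangle inequality, with total rise \<open>def i\<close>.\<close>
  define H where "H t = A t - dist (\<gamma> (\<tau> i)) (\<gamma> t)" for t
  have \<tau>i: "\<tau> i \<in> K" "\<tau> (Suc i) \<in> K" "\<tau> i <= \<tau> (Suc i)" using \<tau>K \<tau>le i(1) by auto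
  have Hmono: "H s <= H t" if "s \<in> P i" "t \<in> P i" "s <= t" for s t
    using A(2)[of s t] that dist_triangle[of "\<gamma> (\<tau> i)" "\<gamma> t" "\<gamma> s"] by (simp add: H_def P_def)
  have ends: "\<tau> i \<in> P i" "\<tau> (Suc i) \<in> P i" using \<tau>i by (auto simp: P_def)
  have Hrng: "H (\<tau> i) <= H s \<and> H s <= H (\<tau> (Suc i))" if s: "s \<in> P i" for s
    using Hmono[OF ends(1) s] Hmono[OF s ends(2)] s by (auto simp: P_def)
  have defH: "H (\<tau> (Suc i)) - H (\<tau> i) = def i" by (simp add: H_def def_def)
  obtain U where U: "open U" "emeasure lborel U <= ennreal (10 * (H (\<tau> (Suc i)) - H (\<tau> i)) / \<theta>)"
    "\<forall>s\<in>P i - U. \<forall>t\<in>P i. \<bar>H t - H s\<bar> <= \<theta> * \<bar>t - s\<bar>"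
    using monotone_weak_type[of "P i" H "H (\<tau> i)" "H (\<tau> (Suc i))" \<theta>, OF compact_imp_bounded[OF Pc] Hmono Hrng _ \<theta>] Hrng[OF ends(1)]
    by blast
  define K' where "K' = P i - U"
  have K': "compact K'" "K' \<subseteq> K" unfolding K'_def using compact_diff[OF Pc U(1)] by (auto simp: P_def)
  have Kpos: "0 < emeasure lborel K'"
  proof (rule ccontr)
    assume "\<not> ?thesis"
    then have z: "emeasure lborel K' = 0" by simp
    have meas: "K' \<in> sets lborel" "U \<in> sets lborel" using U(1) compact_imp_closed[OF K'(1)] by auto
    have "P i \<union> U \<in> sets lborel" using Pb[of i] U(1) by auto
    note meas = meas this
    have "emeasure lborel (P i) <= emeasure lborel (K' \<union> U)" using meas by (intro emeasure_mono) (auto simp: K'_def Un_commute)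
    also have "... <= emeasure lborel K' + emeasure lborel U" using meas by (intro emeasure_subadditive) auto
    also have "... <= ennreal (10 * def i / \<theta>)" using U(2) z defH by simp
    finally show False using i(2) by simp
  qed
  define q where "q = 1 + \<epsilon>"
  have q: "1 < q" using \<epsilon> by (simp add: q_def)
  have est: "A t - A s <= q * dist (\<gamma> s) (\<gamma> t)" if st: "s \<in> K'" "t \<in> K'" "s <= t" for s t
  proof -
    have sP: "s \<in> P i" "t \<in> P i" "s \<in> P i - U" using st by (auto simp: K'_def)
    have "\<bar>H t - H s\<bar> <= \<theta> * \<bar>t - s\<bar>" using U(3) sP by blast
    then have "A t - A s <= dist (\<gamma> (\<tau> i)) (\<gamma> t) - dist (\<gamma> (\<tau> i)) (\<gamma> s) + \<theta> * (t - s)" using st(3) by (simp add: H_def)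
    also have "... <= dist (\<gamma> s) (\<gamma> t) + \<theta> * (t - s)" using dist_triangle[of "\<gamma> (\<tau> i)" "\<gamma> t" "\<gamma> s"] by simp
    also have "\<theta> * (t - s) = \<epsilon> * (\<kappa> * (t - s))" by (simp add: \<theta>_def)
    also have "... <= \<epsilon> * dist (\<gamma> s) (\<gamma> t)" using lo[of s t] st K'(2) \<epsilon> by (intro mult_left_mono) auto
    finally show ?thesis by (simp add: q_def distrib_right)
  qed
  have Alip: "\<bar>A s - A t\<bar> <= 1 * \<bar>s - t\<bar>" if "s \<in> K" "t \<in> K" for s t
  proof (cases "s <= t")
    case True
    have "0 <= A t - A s" by (rule order_trans[OF zero_le_dist A(2)[OF that True]])
    then show ?thesis using A(3)[OF that True] True by simp
  next
    case False
    then have "t <= s" by simp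
    have "0 <= A s - A t" by (rule order_trans[OF zero_le_dist A(2)[OF that(2,1) \<open>t <= s\<close>]])
    then show ?thesis using A(3)[OF that(2,1) \<open>t <= s\<close>] \<open>t <= s\<close> by simp
  qed
  define \<sigma> where "\<sigma> t = (A t - A lo') / q" for t
  have "1-lipschitz_on K' A" using Alip K'(2) by (auto simp: lipschitz_on_def dist_real_def)
  then have \<sigma>c: "continuous_on K' \<sigma>" unfolding \<sigma>_def using q by (intro continuous_intros lipschitz_on_continuous_on) auto
  have \<sigma>d: "\<sigma> t - \<sigma> s = (A t - A s) / q" for s t by (simp add: \<sigma>_def diff_divide_distrib)
  have \<sigma>lo: "\<bar>s - t\<bar> <= q / \<kappa> * \<bar>\<sigma> s - \<sigma> t\<bar>" if "s \<in> K'" "t \<in> K'" for s t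
  proof -
    have "\<kappa> * \<bar>s - t\<bar> <= \<bar>A s - A t\<bar>"
      using lo[of s t] lo[of t s] A(2)[of s t] A(2)[of t s] that K'(2) by (cases "s <= t") (auto simp: subset_iff)
    then show ?thesis using q \<kappa> by (simp add: \<sigma>d pos_le_divide_eq mult.commute)
  qed
  have \<sigma>inj: "inj_on \<sigma> K'" using \<sigma>lo by (fastforce intro: inj_onI)
  have img: "compact (\<sigma> ` K')" by (rule compact_continuous_image[OF \<sigma>c K'(1)])
  have bk: "the_inv_into K' \<sigma> ` (\<sigma> ` K') = K'"
    using \<sigma>inj by (force simp: image_image the_inv_into_f_f)
  have "emeasure lborel (\<sigma> ` K') ~= 0"
  proof
    assume z: "emeasure lborel (\<sigma> ` K') = 0"
    have "emeasure lborel (the_inv_into K' \<sigma> ` (\<sigma> ` K')) = 0"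
    proof (rule emeasure_lborel_eq_0_lipschitz_image[where B = "q / \<kappa>"])
      fix x y assume "x \<in> \<sigma> ` K'" "y \<in> \<sigma> ` K'"
      then show "\<bar>the_inv_into K' \<sigma> x - the_inv_into K' \<sigma> y\<bar> <= q / \<kappa> * \<bar>x - y\<bar>"
        using \<sigma>inj \<sigma>lo by (auto simp: the_inv_into_f_f)
    qed (use z img K'(1) bk in \<open>auto intro: borel_closed compact_imp_closed\<close>)
    then show False using Kpos bk by simp
  qed
  then have pos: "0 < emeasure lborel (\<sigma> ` K')" by (simp add: zero_less_iff_neq_zero)
  have A1: "0 <= A t - A s" "dist (\<gamma> s) (\<gamma> t) <= A t - A s" "A t - A s <= t - s" "(A t - A s) / q <= A t - A s" if "s \<in> K" "t \<in> K" "s <= t" for s t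
  proof -
    show le: "dist (\<gamma> s) (\<gamma> t) <= A t - A s" "A t - A s <= t - s" by (rule A(2,3)[OF that])+
    then show A0: "0 <= A t - A s" using zero_le_dist order_trans by blast
    then show "(A t - A s) / q <= A t - A s" using q mult_left_mono[of 1 q "A t - A s"] by (simp add: divide_le_eq)
  qed
  have "\<sigma> ` K' \<subseteq> {0..1}"
  proof (intro image_subsetI)
    fix t assume "t \<in> K'"
    then have t: "t \<in> K" "lo' <= t" using K'(2) b(3) by auto
    have "t - lo' <= 1" using subsetD[OF K1 t(1)] subsetD[OF K1 b(1)] by simp
    then show "\<sigma> t \<in> {0..1}" using A1[OF b(1) t] q by (simp add: \<sigma>_def)
  qed
  moreover have "0 <= \<sigma> t - \<sigma> s \<and> \<sigma> t - \<sigma> s <= t - s \<and> \<sigma> t - \<sigma> s <= dist (\<gamma> s) (\<gamma> t) \<and> dist (\<gamma> s) (\<gamma> t) <= (1 + \<epsilon>) * (\<sigma> t - \<sigma> s)"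
    if st: "s \<in> K'" "t \<in> K'" "s <= t" for s t
  proof -
    have "s \<in> K" "t \<in> K" using st K'(2) by auto
    note A1 = A1[OF this st(3)]
    have "(A t - A s) / q <= dist (\<gamma> s) (\<gamma> t)" using est[OF st] q by (simp add: divide_le_eq mult.commute)
    then show ?thesis unfolding \<sigma>d q_def[symmetric] using A1 q by simp
  qed
  ultimately show ?thesis using K' \<sigma>c pos by (intro exI[of _ K'] exI[of _ \<sigma>]) blast
qed

text \<open>The cone condition contains a lower bound on the speed, since \<open>u\<close> is
  Lipschitz, so the change of parameter applies. It preserves the rate \<open>\<kappa>\<close>
  because the new parameter never runs faster than the old one. Cutting the times to a unit interval
  first brings the new parameters into \<open>{0..1}\<close>.\<close>

lemma refine_fragment:
  fixes p :: "'k::finite => 'a::metric_space => real"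
  assumes G: "compact G" "G \<subseteq> UNIV \<times> S" "0 < emeasure lborel (fst ` G)"
    and GR: "G \<times> G \<subseteq> cone_rel 0 1 \<kappa> C u p"
    and u: "u \<in> Lip" and \<kappa>: "0 < \<kappa>" and C: "0 <= C" and \<epsilon>: "0 < \<epsilon>"
  shows "\<exists>G2. compact G2 \<and> G2 ~= {} \<and> G2 \<subseteq> {0..1} \<times> S \<and> 0 < emeasure lborel (fst ` G2) \<and>
    G2 \<times> G2 \<subseteq> cone_rel 1 (1 + \<epsilon>) \<kappa> C u p"
proof -
  have Gc: "compact (fst ` G)" by (intro compact_continuous_image continuous_intros G(1))
  have "\<exists>j::int. emeasure lborel (fst ` G \<inter> {of_int j..of_int j+1}) ~= 0"
  proof (rule ccontr)
    assume "\<not> ?thesis"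
    then have "(\<Union>j::int. fst ` G \<inter> {of_int j..of_int j+1}) \<in> null_sets lborel"
      using Gc by (intro null_sets_UN) (auto simp: null_sets_def intro!: borel_closed compact_imp_closed)
    moreover have "\<exists>j::int. x \<in> {of_int j..of_int j+1}" for x :: real
      by (rule exI[of _ "\<lfloor>x\<rfloor>"]) (auto intro: order_less_imp_le)
    then have "(\<Union>j::int. fst ` G \<inter> {of_int j..of_int j+1}) = fst ` G" by blast
    ultimately show False using G(3) by (simp add: null_sets_def)
  qed
  then obtain j :: int where j: "emeasure lborel (fst ` G \<inter> {of_int j..of_int j+1}) ~= 0" by blast
  define K where "K = fst ` G \<inter> {of_int j..of_int j+1}"
  have K: "compact K" "0 < emeasure lborel K" "K \<subseteq> {of_int j..of_int j+1}"
    using Gc j by (auto simp: K_def zero_less_iff_neq_zero intro: compact_Int)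
  have "\<forall>t\<in>K. \<exists>x. (t, x) \<in> G" by (force simp: K_def)
  from bchoice[OF this] obtain \<gamma> where \<gamma>G: "\<forall>t\<in>K. (t, \<gamma> t) \<in> G" by (elim exE)
  have pair: "dist (\<gamma> s) (\<gamma> t) <= t - s" "\<kappa> * (t - s) <= cone_gap C u p (\<gamma> s) (\<gamma> t)" if st: "s \<in> K" "t \<in> K" "s <= t" for s t
  proof -
    have "(s, \<gamma> s) \<in> G" "(t, \<gamma> t) \<in> G" using \<gamma>G st by auto
    from graph_relD[OF GR this st(3)]
    show "dist (\<gamma> s) (\<gamma> t) <= t - s" "\<kappa> * (t - s) <= cone_gap C u p (\<gamma> s) (\<gamma> t)" by auto
  qed
  define Lu where "Lu = lip_const u + 1"
  have Lu: "0 < Lu" using lip_const_nonneg[OF u] by (simp add: Lu_def)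
  have uL: "u y - u x <= Lu * dist x y" for x y
  proof -
    have "\<bar>u y - u x\<bar> <= lip_const u * dist y x" by (rule Lip_abs_le[OF u])
    then have "u y - u x <= lip_const u * dist y x + dist y x" using zero_le_dist[of y x] by linarith
    then show ?thesis by (simp add: Lu_def distrib_right dist_commute)
  qed
  have lo: "\<kappa> / Lu * (t - s) <= dist (\<gamma> s) (\<gamma> t)" if st: "s \<in> K" "t \<in> K" "s <= t" for s t
  proof -
    have "0 <= C * (\<Sum>i\<in>UNIV. \<bar>p i (\<gamma> s) - p i (\<gamma> t)\<bar>)" using C by (simp add: sum_nonneg)
    then have "\<kappa> * (t - s) <= u (\<gamma> t) - u (\<gamma> s)" using pair(2)[OF st] unfolding cone_gap_def by linarith
    also have "... <= Lu * dist (\<gamma> s) (\<gamma> t)" by (rule uL)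
    finally show ?thesis using Lu by (simp add: divide_le_eq mult.commute)
  qed
  have \<kappa>L: "0 < \<kappa> / Lu" using \<kappa> Lu by simp
  have "\<exists>K' \<tau>. compact K' \<and> K' \<subseteq> K \<and> continuous_on K' \<tau> \<and> \<tau> ` K' \<subseteq> {0..1} \<and> 0 < emeasure lborel (\<tau> ` K') \<and>
    (\<forall>s\<in>K'. \<forall>t\<in>K'. s <= t --> 0 <= \<tau> t - \<tau> s \<and> \<tau> t - \<tau> s <= t - s \<and> \<tau> t - \<tau> s <= dist (\<gamma> s) (\<gamma> t) \<and> dist (\<gamma> s) (\<gamma> t) <= (1 + \<epsilon>) * (\<tau> t - \<tau> s))"
    by (rule reparametrize_almost_isometric[OF K pair(1) lo \<kappa>L \<epsilon>]; assumption)
  then obtain K' \<tau> where K': "compact K'" "K' \<subseteq> K" "continuous_on K' \<tau>" "\<tau> ` K' \<subseteq> {0..1}" "0 < emeasure lborel (\<tau> ` K')"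
    and \<tau>: "\<forall>s\<in>K'. \<forall>t\<in>K'. s <= t --> 0 <= \<tau> t - \<tau> s \<and> \<tau> t - \<tau> s <= t - s \<and> \<tau> t - \<tau> s <= dist (\<gamma> s) (\<gamma> t) \<and> dist (\<gamma> s) (\<gamma> t) <= (1 + \<epsilon>) * (\<tau> t - \<tau> s)"
    by (elim exE conjE) (rule that)
  define G2 where "G2 = (\<lambda>t. (\<tau> t, \<gamma> t)) ` K'"
  have f: "fst ` G2 = \<tau> ` K'" by (simp add: G2_def image_image)
  have "1-lipschitz_on K \<gamma>"
  proof (rule lipschitz_onI)
    fix s t assume st: "s \<in> K" "t \<in> K"
    show "dist (\<gamma> s) (\<gamma> t) <= 1 * dist s t"
      using pair(1)[OF st] pair(1)[OF st(2,1)] by (cases "s <= t") (auto simp: dist_real_def dist_commute)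
  qed simp
  then have \<gamma>c: "continuous_on K' \<gamma>" using K'(2) continuous_on_subset lipschitz_on_continuous_on by blast
  show ?thesis
  proof (intro exI[of _ G2] conjI subsetI)
    show "compact G2" unfolding G2_def by (intro compact_continuous_image continuous_on_Pair K'(1,3) \<gamma>c)
    show pos: "0 < emeasure lborel (fst ` G2)" unfolding f by (rule K'(5))
    then show "G2 ~= {}" by auto
    show "z \<in> {0..1} \<times> S" if "z \<in> G2" for z
    proof -
      from that obtain t where t: "t \<in> K'" "z = (\<tau> t, \<gamma> t)" by (auto simp: G2_def)
      then have "\<tau> t \<in> {0..1}" "\<gamma> t \<in> S" using K'(2,4) \<gamma>G G(2) by blast+
      then show ?thesis using t(2) by simp
    qed
    fix q assume "q \<in> G2 \<times> G2"
    then obtain s t where st: "s \<in> K'" "t \<in> K'" "q = ((\<tau> s, \<gamma> s), (\<tau> t, \<gamma> t))" by (auto simp: G2_def)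
    define Q where "Q s x t y \<longleftrightarrow> 1 * (t - s) <= dist x y \<and> dist x y <= (1 + \<epsilon>) * (t - s) \<and> \<kappa> * (t - s) <= cone_gap C u p x y" for s x t y
    have key: "\<tau> a <= \<tau> b \<and> Q (\<tau> a) (\<gamma> a) (\<tau> b) (\<gamma> b)" if ab: "a \<in> K'" "b \<in> K'" "a <= b" for a b
    proof -
      have t: "0 <= \<tau> b - \<tau> a" "\<tau> b - \<tau> a <= b - a" "\<tau> b - \<tau> a <= dist (\<gamma> a) (\<gamma> b)" "dist (\<gamma> a) (\<gamma> b) <= (1 + \<epsilon>) * (\<tau> b - \<tau> a)"
        using \<tau> ab by blast+
      have "\<kappa> * (\<tau> b - \<tau> a) <= \<kappa> * (b - a)" using t(2) \<kappa> by simp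
      also have "... <= cone_gap C u p (\<gamma> a) (\<gamma> b)" using ab K'(2) by (intro pair(2)) auto
      finally show ?thesis using t by (simp add: Q_def)
    qed
    have "q \<in> graph_rel Q"
    proof (cases "s <= t")
      case True
      then show ?thesis using key[OF st(1,2)] st(3) by (simp add: graph_rel_def)
    next
      case False
      then show ?thesis using key[OF st(2,1)] st(3) by (simp add: graph_rel_def)
    qed
    then show "q \<in> cone_rel 1 (1 + \<epsilon>) \<kappa> C u p"
      unfolding Q_def .
  qed
qed

section \<open>Measures on fragments\<close>

lemma fragment_of_graph:
  fixes G :: "(real \<times> 'a::metric_space) set"
  assumes G: "compact G" "G ~= {}" and L: "0 <= L"
    and lip: "\<And>s x t y. (s, x) \<in> G ==> (t, y) \<in> G ==> dist x y <= L * \<bar>s - t\<bar>"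
  shows "\<exists>\<gamma>. frag_graph \<gamma> = G"
proof -
  define K where "K = fst ` G"
  have "\<forall>t\<in>K. \<exists>x. (t, x) \<in> G" by (force simp: K_def)
  from bchoice[OF this] obtain g where g: "\<forall>t\<in>K. (t, g t) \<in> G" by (elim exE)
  have gu: "x = g t" if "(t, x) \<in> G" for t x
  proof -
    have "t \<in> K" using that by (force simp: K_def)
    then have "dist x (g t) <= L * \<bar>t - t\<bar>" using g that by (intro lip) auto
    then show ?thesis by simp
  qed
  define m where "m t = (if t \<in> K then Some (g t) else None)" for t
  have dm: "dom m = K" by (auto simp: m_def dom_def)
  have "compact (dom m)" unfolding dm K_def by (intro compact_continuous_image continuous_intros G(1))
  moreover have "dom m ~= {}" using G(2) by (simp add: dm K_def)
  moreover have "L-lipschitz_on (dom m) (\<lambda>t. the (m t))"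
    unfolding dm
  proof (rule lipschitz_onI)
    fix s t assume "s \<in> K" "t \<in> K"
    then show "dist (the (m s)) (the (m t)) <= L * dist s t" using g lip[of s "g s" t "g t"] by (simp add: m_def dist_real_def)
  qed (rule L)
  ultimately have fm: "frag_map (Fragment m) = m" by (intro Fragment_inverse) blast
  have "frag_graph (Fragment m) = (\<lambda>t. (t, g t)) ` K"
    unfolding frag_graph_def frag_dom_def frag_eval_def fm dm by (rule image_cong) (simp_all add: m_def)
  also have "... = G"
  proof
    show "(\<lambda>t. (t, g t)) ` K \<subseteq> G" using g by auto
    show "G \<subseteq> (\<lambda>t. (t, g t)) ` K"
    proof
      fix z assume z: "z \<in> G"
      then have "fst z \<in> K" "snd z = g (fst z)" using gu[of "fst z" "snd z"] by (auto simp: K_def)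
      then have "z = (fst z, g (fst z))" by (simp add: prod_eq_iff)
      then show "z \<in> (\<lambda>t. (t, g t)) ` K" using \<open>fst z \<in> K\<close> by (rule image_eqI)
    qed
  qed
  finally show ?thesis by blast
qed

definition frags_in :: "(real \<times> 'a::metric_space) set => ((real \<times> 'a) \<times> (real \<times> 'a)) set => 'a fragment set" where
  "frags_in Z R = {\<gamma>. frag_graph \<gamma> \<subseteq> Z \<and> frag_graph \<gamma> \<times> frag_graph \<gamma> \<subseteq> R}"

text \<open>Blaschke's theorem gives a limit set of the graphs, and the Lipschitz bound contained in
  \<open>R\<close> makes it the graph of a fragment again.\<close>

lemma compact_frags_in:
  fixes Z :: "(real \<times> 'a::metric_space) set"
  assumes Z: "compact Z" and R: "closed R" and L: "0 <= L"
    and RL: "\<And>s x t y. ((s, x), (t, y)) \<in> R ==> dist x y <= L * \<bar>s - t\<bar>"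
  shows "compact (frags_in Z R)"
  unfolding compact_eq_seq_compact_metric seq_compact_def
proof (intro allI impI)
  fix f :: "nat => 'a fragment" assume f: "\<forall>n. f n \<in> frags_in Z R"
  define G where "G n = frag_graph (f n)" for n
  have G: "compact (G n)" "G n ~= {}" "G n \<subseteq> Z" "G n \<times> G n \<subseteq> R" for n
    using spec[OF f, of n] by (simp_all add: G_def frags_in_def compact_frag_graph frag_graph_nonempty)
  obtain r G0 where r: "strict_mono (r :: nat => nat)" "compact G0" "G0 ~= {}" "G0 \<subseteq> Z" "(\<lambda>n. hausdorff_dist (G (r n)) G0) \<longlonglongrightarrow> 0"
    using hausdorff_sequentially_compact[OF Z, of G, OF G(1-3)] by (elim exE conjE) (rule that)
  have GR: "G0 \<times> G0 \<subseteq> R" by (rule hausdorff_limit_relation[OF G(1) G(2) r(2,3,5) R G(4)])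
  have "\<exists>\<gamma>. frag_graph \<gamma> = G0"
  proof (rule fragment_of_graph[OF r(2,3) L])
    fix s x t y assume "(s, x) \<in> G0" "(t, y) \<in> G0"
    then have "((s, x), (t, y)) \<in> R" using GR by (intro subsetD[OF GR] SigmaI)
    then show "dist x y <= L * \<bar>s - t\<bar>" by (rule RL)
  qed
  then obtain \<gamma> where \<gamma>: "frag_graph \<gamma> = G0" by (elim exE)
  have "\<gamma> \<in> frags_in Z R" using \<gamma> r(4) GR by (simp add: frags_in_def)
  moreover have "(f \<circ> r) \<longlonglongrightarrow> \<gamma>"
    by (rule tendsto_dist_iff[THEN iffD2]) (use r(5) in \<open>simp add: dist_fragment_def \<gamma> G_def\<close>)
  ultimately show "\<exists>l\<in>frags_in Z R. \<exists>r. strict_mono r \<and> (f \<circ> r) \<longlonglongrightarrow> l" using r(1) by (intro bexI[of _ \<gamma>] exI[of _ r] conjI)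
qed

text \<open>Placed on the graph and not only on the image, so that the time remains available; the
  slices over an interval of times in an Alberti representation are integrals over the
  graph.\<close>

definition graph_measure :: "'a::metric_space fragment => (real \<times> 'a) measure" where
  "graph_measure \<gamma> = distr (restrict_space lborel (frag_dom \<gamma>)) borel (\<lambda>t. (t, frag_eval \<gamma> t))"

lemma frag_dom_borel [measurable, simp]: "frag_dom \<gamma> \<in> sets borel"
  using compact_imp_closed[OF compact_frag_dom[of \<gamma>]] by simp

lemma sets_graph_measure [simp, measurable_cong]: "sets (graph_measure \<gamma>) = sets borel"
  and space_graph_measure [simp]: "space (graph_measure \<gamma>) = UNIV"
  by (simp_all add: graph_measure_def)

lemma continuous_on_frag_eval: "continuous_on (frag_dom \<gamma>) (frag_eval \<gamma>)"
  using lipschitz_frag_eval[of \<gamma>] lipschitz_on_continuous_on by blast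

lemma graph_map_measurable: "(\<lambda>t. (t, frag_eval \<gamma> t)) \<in> restrict_space lborel (frag_dom \<gamma>) \<rightarrow>\<^sub>M borel"
proof -
  have "(\<lambda>t. (t, frag_eval \<gamma> t)) \<in> restrict_space borel (frag_dom \<gamma>) \<rightarrow>\<^sub>M borel"
    by (intro borel_measurable_continuous_on_restrict continuous_intros continuous_on_frag_eval)
  moreover have "sets (restrict_space lborel (frag_dom \<gamma>)) = sets (restrict_space borel (frag_dom \<gamma>))"
    by (rule sets_restrict_space_cong) simp
  ultimately show ?thesis by (simp cong: measurable_cong_sets)
qed

lemma emeasure_graph_measure:
  assumes "A \<in> sets borel"
  shows "emeasure (graph_measure \<gamma>) A = emeasure lborel {t\<in>frag_dom \<gamma>. (t, frag_eval \<gamma> t) \<in> A}"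
proof -
  have "emeasure (graph_measure \<gamma>) A =
      emeasure (restrict_space lborel (frag_dom \<gamma>)) ((\<lambda>t. (t, frag_eval \<gamma> t)) -` A \<inter> space (restrict_space lborel (frag_dom \<gamma>)))"
    unfolding graph_measure_def by (rule emeasure_distr[OF graph_map_measurable assms])
  also have "(\<lambda>t. (t, frag_eval \<gamma> t)) -` A \<inter> space (restrict_space lborel (frag_dom \<gamma>)) = {t\<in>frag_dom \<gamma>. (t, frag_eval \<gamma> t) \<in> A}"
    by (auto simp: space_restrict_space)
  also have "emeasure (restrict_space lborel (frag_dom \<gamma>)) {t\<in>frag_dom \<gamma>. (t, frag_eval \<gamma> t) \<in> A} = emeasure lborel {t\<in>frag_dom \<gamma>. (t, frag_eval \<gamma> t) \<in> A}"
    by (rule emeasure_restrict_space) auto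
  finally show ?thesis .
qed

lemma emeasure_graph_measure_le:
  assumes "frag_dom \<gamma> \<subseteq> {0..1}" shows "emeasure (graph_measure \<gamma>) A <= 1"
proof (cases "A \<in> sets borel")
  case True
  have "emeasure (graph_measure \<gamma>) A <= emeasure lborel {0..1::real}"
    unfolding emeasure_graph_measure[OF True] using assms by (intro emeasure_mono) auto
  then show ?thesis by simp
qed (simp add: emeasure_notin_sets)

text \<open>The times at which a fragment is in \<open>F\<close> form a compact set, a small
  neighbourhood of which has hardly more measure and contains the corresponding times of all nearby
  fragments.\<close>

lemma graph_measure_usc:
  fixes F :: "(real \<times> 'a::metric_space) set"
  assumes F: "closed F"
  shows "open {\<gamma>. emeasure (graph_measure \<gamma>) F < y}"
  unfolding open_dist
proof (intro ballI)
  fix \<gamma>0 assume "\<gamma>0 \<in> {\<gamma>. emeasure (graph_measure \<gamma>) F < y}"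
  have Fb: "F \<in> sets borel" using F by simp
  have "{t\<in>frag_dom \<gamma>. (t, frag_eval \<gamma> t) \<in> F} = fst ` (frag_graph \<gamma> \<inter> F)" for \<gamma> :: "'a fragment"
    by (force simp: frag_graph_def)
  note em = emeasure_graph_measure[OF Fb, unfolded this]
  have "compact (fst ` (frag_graph \<gamma>0 \<inter> F))"
    by (intro compact_continuous_image continuous_intros compact_Int_closed compact_frag_graph F)
  moreover have "emeasure lborel (fst ` (frag_graph \<gamma>0 \<inter> F)) < y" using \<open>\<gamma>0 \<in> _\<close> by (simp add: em)
  ultimately obtain r where r: "0 < r" "emeasure lborel (\<Union>c\<in>fst ` (frag_graph \<gamma>0 \<inter> F). ball c r) < y"
    by (rule compact_nbhd_measure)
  obtain \<delta> where \<delta>: "\<delta> > 0" "\<forall>G. compact G \<and> G ~= {} \<and> hausdorff_dist G (frag_graph \<gamma>0) < \<delta> -->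
      fst ` (G \<inter> F) \<subseteq> (\<Union>c\<in>fst ` (frag_graph \<gamma>0 \<inter> F). ball c r)"
    using hausdorff_slice_usc[OF compact_frag_graph[of \<gamma>0] frag_graph_nonempty F r(1)] by (elim exE conjE) (rule that)
  show "\<exists>e>0. \<forall>\<gamma>. dist \<gamma> \<gamma>0 < e --> \<gamma> \<in> {\<gamma>. emeasure (graph_measure \<gamma>) F < y}"
  proof (intro exI[of _ \<delta>] conjI allI impI \<delta>(1))
    fix \<gamma> :: "'a fragment" assume "dist \<gamma> \<gamma>0 < \<delta>"
    then have "fst ` (frag_graph \<gamma> \<inter> F) \<subseteq> (\<Union>c\<in>fst ` (frag_graph \<gamma>0 \<inter> F). ball c r)"
      using \<delta>(2) compact_frag_graph frag_graph_nonempty by (auto simp: dist_fragment_def)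
    then have "emeasure lborel (fst ` (frag_graph \<gamma> \<inter> F)) <= emeasure lborel (\<Union>c\<in>fst ` (frag_graph \<gamma>0 \<inter> F). ball c r)"
      by (rule emeasure_mono) (simp, rule borel_open, auto)
    with r(2) show "\<gamma> \<in> {\<gamma>. emeasure (graph_measure \<gamma>) F < y}" by (simp add: em)
  qed
qed

text \<open>Closed sets generate the Borel sets and are stable under intersection, so semicontinuity
  on them already yields a measurable kernel. Domains inside \<open>{0..1}\<close> keep the masses
  at most 1.\<close>

lemma graph_measure_kernel:
  fixes \<Gamma> :: "'a::metric_space fragment set"
  assumes \<Gamma>: "\<Gamma> \<in> sets borel" and dom: "\<forall>\<gamma>\<in>\<Gamma>. frag_dom \<gamma> \<subseteq> {0..1}"
  shows "graph_measure \<in> restrict_space borel \<Gamma> \<rightarrow>\<^sub>M subprob_algebra borel"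
proof (rule measurable_subprob_algebra_generated[where \<Omega> = UNIV and G = "Collect closed"])
  show "sets (borel :: (real \<times> 'a) measure) = sigma_sets UNIV (Collect closed)"
    by (subst borel_eq_closed) (rule sets_measure_of, simp)
  show "Int_stable (Collect closed :: (real \<times> 'a) set set)" by (auto simp: Int_stable_def)
  show "subprob_space (graph_measure \<gamma>)" if "\<gamma> \<in> space (restrict_space borel \<Gamma>)" for \<gamma>
  proof (rule subprob_spaceI)
    have "\<gamma> \<in> \<Gamma>" using that by (simp add: space_restrict_space)
    then show "emeasure (graph_measure \<gamma>) (space (graph_measure \<gamma>)) <= 1" by (intro emeasure_graph_measure_le bspec[OF dom])
  qed simp
  have usc: "(\<lambda>\<gamma>. emeasure (graph_measure \<gamma>) F) \<in> borel_measurable (restrict_space borel \<Gamma>)" if F: "closed F" for F :: "(real \<times> 'a) set"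
  proof (rule borel_measurableI_less)
    fix y :: ennreal
    have "{\<gamma>. emeasure (graph_measure \<gamma>) F < y} \<in> sets borel" by (rule borel_open[OF graph_measure_usc[OF F]])
    then have "\<Gamma> \<inter> {\<gamma>. emeasure (graph_measure \<gamma>) F < y} \<in> sets (restrict_space borel \<Gamma>)"
      unfolding sets_restrict_space by (rule imageI)
    moreover have "{x \<in> space (restrict_space borel \<Gamma>). emeasure (graph_measure x) F < y} = \<Gamma> \<inter> {\<gamma>. emeasure (graph_measure \<gamma>) F < y}"
      by (auto simp: space_restrict_space)
    ultimately show "{x \<in> space (restrict_space borel \<Gamma>). emeasure (graph_measure x) F < y} \<in> sets (restrict_space borel \<Gamma>)" by simp
  qed
  show "(\<lambda>\<gamma>. emeasure (graph_measure \<gamma>) A) \<in> borel_measurable (restrict_space borel \<Gamma>)" if "A \<in> Collect closed" for A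
    using that by (intro usc) simp
  show "(\<lambda>\<gamma>. emeasure (graph_measure \<gamma>) UNIV) \<in> borel_measurable (restrict_space borel \<Gamma>)" by (rule usc) simp
qed simp_all

text \<open>Complements turn approximation by compact sets from inside into approximation by open
  sets from outside.\<close>

lemma regular_borel_probI:
  fixes P :: "'b::metric_space measure"
  assumes P: "prob_space P" "sets P = sets borel"
    and inner: "\<And>A e. A \<in> sets borel ==> 0 < e ==> \<exists>K. compact K \<and> K \<subseteq> A \<and> measure P A <= measure P K + e"
  shows "regular_borel_prob P"
proof -
  interpret prob_space P by (rule P(1))
  have sp: "space P = UNIV" using sets_eq_imp_space_eq[OF P(2)] by simp
  have in': "emeasure P A = (SUP K \<in> {K. compact K \<and> K \<subseteq> A}. emeasure P K)" if A: "A \<in> sets borel" for A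
  proof (rule antisym)
    show "emeasure P A <= (SUP K \<in> {K. compact K \<and> K \<subseteq> A}. emeasure P K)"
    proof (rule ennreal_le_epsilon)
      fix e :: real assume e: "0 < e"
      obtain K where K: "compact K" "K \<subseteq> A" "measure P A <= measure P K + e" using inner[OF A e] by blast
      have "emeasure P A = ennreal (measure P A)" by (rule emeasure_eq_measure)
      also have "... <= ennreal (measure P K + e)" by (rule ennreal_leI[OF K(3)])
      also have "... = emeasure P K + ennreal e" using e by (simp add: emeasure_eq_measure)
      also have "... <= (SUP K \<in> {K. compact K \<and> K \<subseteq> A}. emeasure P K) + ennreal e"
        using K by (intro add_right_mono SUP_upper) simp
      finally show "emeasure P A <= (SUP K \<in> {K. compact K \<and> K \<subseteq> A}. emeasure P K) + ennreal e" .
    qed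
    show "(SUP K \<in> {K. compact K \<and> K \<subseteq> A}. emeasure P K) <= emeasure P A"
      using A P(2) by (intro SUP_least emeasure_mono) auto
  qed
  have "emeasure P A = (INF U \<in> {U. open U \<and> A \<subseteq> U}. emeasure P U)" if A: "A \<in> sets borel" for A
  proof (rule antisym)
    show "emeasure P A <= (INF U \<in> {U. open U \<and> A \<subseteq> U}. emeasure P U)"
      using A P(2) by (intro INF_greatest emeasure_mono) auto
    show "(INF U \<in> {U. open U \<and> A \<subseteq> U}. emeasure P U) <= emeasure P A"
    proof (rule ennreal_le_epsilon)
      fix e :: real assume e: "0 < e"
      have cA: "- A \<in> sets borel" using A by auto
      obtain K where K: "compact K" "K \<subseteq> - A" "measure P (- A) <= measure P K + e" using inner[OF cA e] by blast
      have cl: "closed K" by (rule compact_imp_closed[OF K(1)])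
      have "measure P (- K) = 1 - measure P K" "measure P (- A) = 1 - measure P A"
        using prob_compl[of K] prob_compl[of A] A cl P(2) by (simp_all add: sp Compl_eq_Diff_UNIV)
      then have le: "measure P (- K) <= measure P A + e" using K(3) by simp
      have "(INF U \<in> {U. open U \<and> A \<subseteq> U}. emeasure P U) <= emeasure P (- K)"
        using K(2) cl by (intro INF_lower) auto
      also have "... = ennreal (measure P (- K))" by (rule emeasure_eq_measure)
      also have "... <= ennreal (measure P A + e)" by (rule ennreal_leI[OF le])
      also have "... = emeasure P A + ennreal e" using e by (simp add: emeasure_eq_measure)
      finally show "(INF U \<in> {U. open U \<and> A \<subseteq> U}. emeasure P U) <= emeasure P A + ennreal e" .
    qed
  qed
  then show ?thesis unfolding regular_borel_prob_def finite_radon_def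
    by (intro conjI P ballI finite_measure_axioms in')
qed

lemma finite_radon_inner:
  fixes \<mu> :: "'b::t2_space measure"
  assumes \<mu>: "finite_radon \<mu>" and A: "A \<in> sets borel" and e: "0 < e"
  shows "\<exists>K. compact K \<and> K \<subseteq> A \<and> measure \<mu> A <= measure \<mu> K + e"
proof -
  interpret finite_measure \<mu> using \<mu> by (simp add: finite_radon_def)
  have eq: "emeasure \<mu> A = (SUP K \<in> {K. compact K \<and> K \<subseteq> A}. emeasure \<mu> K)"
    using \<mu> A by (simp add: finite_radon_def)
  show ?thesis
  proof (cases "measure \<mu> A < e")
    case True
    then show ?thesis by (intro exI[of _ "{}"]) simp
  next
    case False
    have "emeasure \<mu> A - ennreal e < emeasure \<mu> A"
      using False e by (simp add: emeasure_eq_measure ennreal_minus ennreal_less_iff)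
    also note eq
    finally obtain K where K: "compact K" "K \<subseteq> A" "emeasure \<mu> A - ennreal e < emeasure \<mu> K"
      unfolding less_SUP_iff by auto
    have "measure \<mu> A - e < measure \<mu> K" using K(3) False e by (simp add: emeasure_eq_measure ennreal_minus ennreal_less_iff)
    then show ?thesis using K(1,2) by (intro exI[of _ K]) simp
  qed
qed

lemma measurable_continuous_on_If:
  fixes f :: "'a::topological_space => 'b::topological_space"
  assumes "E \<in> sets borel" "continuous_on E f" shows "(\<lambda>x. if x \<in> E then f x else c) \<in> borel_measurable borel"
proof -
  have "f \<in> restrict_space borel {x. x \<in> E} \<rightarrow>\<^sub>M borel" using borel_measurable_continuous_on_restrict[OF assms(2)] by simp
  then show ?thesis using assms(1) by (subst measurable_If_restrict_space_iff) auto
qed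

text \<open>Inner regularity is inherited from the line: a compact part of the preimage, taken
  within \<open>E\<close>, has a compact image.\<close>

lemma regular_borel_prob_continuous_image:
  fixes \<Psi> :: "real => 'b::metric_space"
  assumes M: "real_distribution M" "AE e in M. e \<in> E" and E: "compact E" "continuous_on E \<Psi>"
  shows "regular_borel_prob (distr M borel (\<lambda>e. if e \<in> E then \<Psi> e else c))"
proof -
  define P where "P = distr M borel (\<lambda>e. if e \<in> E then \<Psi> e else c)"
  interpret M: real_distribution M by (rule M(1))
  have sM: "sets M = sets borel" by simp
  have Eb: "E \<in> sets borel" using compact_imp_closed[OF E(1)] by simp
  define \<Psi>' where "\<Psi>' e = (if e \<in> E then \<Psi> e else c)" for e
  have m: "\<Psi>' \<in> M \<rightarrow>\<^sub>M borel"
    unfolding \<Psi>'_def measurable_cong_sets[OF sM refl] by (rule measurable_continuous_on_If[OF Eb E(2)])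
  have P: "P = distr M borel \<Psi>'" unfolding P_def \<Psi>'_def ..
  have spM: "space M = UNIV" by simp
  have mP: "measure P A = measure M (\<Psi>' -` A)" if "A \<in> sets borel" for A
    unfolding P using measure_distr[OF m that] by (simp add: spM)
  show ?thesis
    unfolding P_def[symmetric]
  proof (rule regular_borel_probI)
    show "prob_space P" unfolding P by (rule M.prob_space_distr[OF m])
    show "sets P = sets borel" by (simp add: P)
    fix A e assume A: "A \<in> sets (borel :: 'b measure)" and e: "0 < (e::real)"
    have pre: "\<Psi>' -` A \<in> sets M" using measurable_sets[OF m A] by (simp add: spM)
    define B where "B = \<Psi>' -` A \<inter> E"
    have B: "B \<in> sets borel" using pre Eb by (simp add: B_def sM)
    obtain C where C: "compact C" "C \<subseteq> B" "measure M B < measure M C + e"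
      by (rule finite_measure_compact_approx[OF sM M.finite_measure_axioms B e])
    have CE: "C \<subseteq> E" using C(2) by (simp add: B_def)
    define K where "K = \<Psi> ` C"
    have K: "compact K" unfolding K_def by (intro compact_continuous_image continuous_on_subset[OF E(2)] CE C(1))
    have Kb: "K \<in> sets borel" using compact_imp_closed[OF K] by simp
    have "K \<subseteq> A"
    proof
      fix x assume "x \<in> K"
      then obtain t where t: "t \<in> C" "x = \<Psi> t" by (auto simp: K_def)
      then have "t \<in> \<Psi>' -` A" "t \<in> E" using C(2) by (auto simp: B_def)
      then show "x \<in> A" using t by (simp add: \<Psi>'_def)
    qed
    moreover have "measure P A <= measure P K + e"
    proof -
      have "measure P A = measure M B"
        unfolding mP[OF A] using pre B M(2) by (intro M.finite_measure_eq_AE) (auto simp: B_def sM)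
      also have "... <= measure M C + e" using C(3) by simp
      also have "measure M C <= measure M (\<Psi>' -` K)"
        using measurable_sets[OF m Kb] CE by (intro M.finite_measure_mono) (auto simp: spM \<Psi>'_def K_def)
      also have "... = measure P K" by (rule mP[OF Kb, symmetric])
      finally show ?thesis by simp
    qed
    ultimately show "\<exists>K. compact K \<and> K \<subseteq> A \<and> measure P A <= measure P K + e" using K by blast
  qed
qed

section \<open>Occupation times and the minimax alternative for fragments\<close>

definition occupation :: "'a::metric_space fragment => 'a measure" where
  "occupation \<gamma> = distr (graph_measure \<gamma>) borel snd"

lemma sets_occupation [simp, measurable_cong]: "sets (occupation \<gamma>) = sets borel"
  and space_occupation [simp]: "space (occupation \<gamma>) = UNIV"
  by (simp_all add: occupation_def)

lemma emeasure_occupation: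
  assumes A: "A \<in> sets borel"
  shows "emeasure (occupation \<gamma>) A = emeasure (graph_measure \<gamma>) (UNIV \<times> A)"
    "emeasure (occupation \<gamma>) A = emeasure lborel {t\<in>frag_dom \<gamma>. frag_eval \<gamma> t \<in> A}"
proof -
  have m: "snd \<in> graph_measure \<gamma> \<rightarrow>\<^sub>M borel"
    unfolding measurable_cong_sets[OF sets_graph_measure refl] by (intro borel_measurable_continuous_onI continuous_intros)
  have U: "(UNIV :: real set) \<times> A = snd -` A" by auto
  have "emeasure (occupation \<gamma>) A = emeasure (graph_measure \<gamma>) (snd -` A \<inter> space (graph_measure \<gamma>))"
    unfolding occupation_def by (rule emeasure_distr[OF m A])
  then show 1: "emeasure (occupation \<gamma>) A = emeasure (graph_measure \<gamma>) (UNIV \<times> A)" by (simp add: U)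
  have "(UNIV :: real set) \<times> A \<in> sets borel" using measurable_sets[OF m A] by (simp add: U)
  then show "emeasure (occupation \<gamma>) A = emeasure lborel {t\<in>frag_dom \<gamma>. frag_eval \<gamma> t \<in> A}"
    unfolding 1 by (subst emeasure_graph_measure) simp_all
qed

lemma occupation_kernel:
  fixes \<Gamma> :: "'a::metric_space fragment set"
  assumes \<Gamma>: "\<Gamma> \<in> sets borel" and dom: "\<forall>\<gamma>\<in>\<Gamma>. frag_dom \<gamma> \<subseteq> {0..1}"
  shows "(\<lambda>\<gamma>. if \<gamma> \<in> \<Gamma> then occupation \<gamma> else null_measure borel) \<in> borel \<rightarrow>\<^sub>M subprob_algebra borel"
proof -
  have m: "(snd :: real \<times> 'a => 'a) \<in> borel \<rightarrow>\<^sub>M borel" by (intro borel_measurable_continuous_onI continuous_intros)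
  have "(\<lambda>\<gamma>. distr (graph_measure \<gamma>) borel snd) \<in> restrict_space borel \<Gamma> \<rightarrow>\<^sub>M subprob_algebra borel"
    by (rule measurable_compose[OF graph_measure_kernel[OF \<Gamma> dom] measurable_distr[OF m]])
  then have "occupation \<in> restrict_space borel {\<gamma>. \<gamma> \<in> \<Gamma>} \<rightarrow>\<^sub>M subprob_algebra borel"
    by (simp add: occupation_def[abs_def])
  moreover have "null_measure borel \<in> space (subprob_algebra (borel :: 'a measure))"
    by (auto simp: space_subprob_algebra intro!: subprob_spaceI)
  ultimately show ?thesis using \<Gamma> by (subst measurable_If_restrict_space_iff) auto
qed

lemma occupation_measurable:
  fixes \<Gamma> :: "'a::metric_space fragment set"
  assumes \<Gamma>: "\<Gamma> \<in> sets borel" and dom: "\<forall>\<gamma>\<in>\<Gamma>. frag_dom \<gamma> \<subseteq> {0..1}" and f: "f \<in> borel_measurable borel"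
  shows "(\<lambda>\<gamma>. if \<gamma> \<in> \<Gamma> then \<integral>\<^sup>+ z. f z \<partial>graph_measure \<gamma> else 0) \<in> borel_measurable borel"
proof -
  have "(\<lambda>\<gamma>. \<integral>\<^sup>+ z. f z \<partial>graph_measure \<gamma>) \<in> borel_measurable (restrict_space borel {\<gamma>. \<gamma> \<in> \<Gamma>})"
    using measurable_compose[OF graph_measure_kernel[OF \<Gamma> dom] nn_integral_measurable_subprob_algebra[OF f]] by simp
  then show ?thesis using \<Gamma> by (subst measurable_If_restrict_space_iff) auto
qed

text \<open>The payoffs are the times spent in the closed sets \<open>F n\<close>, upper
  semicontinuous in the fragment. Parametrizing \<open>\<Gamma>\<close> by a compact set of reals
  reduces the alternative to \<open>minimax_measure\<close>, and the law found there is pushed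
  forward to the fragments.\<close>

lemma minimax_fragments:
  fixes \<Gamma> :: "'a::metric_space fragment set"
  assumes \<Gamma>: "compact \<Gamma>" "\<Gamma> ~= {}" and dom: "\<forall>\<gamma>\<in>\<Gamma>. frag_dom \<gamma> \<subseteq> {0..1}"
    and F: "\<And>n::nat. closed (F n :: 'a set)"
  shows "(\<exists>P. regular_borel_prob P \<and> (AE \<gamma> in P. \<gamma> \<in> \<Gamma>) \<and> (\<forall>n. ennreal c <= (\<integral>\<^sup>+ \<gamma>. emeasure (occupation \<gamma>) (F n) \<partial>P))) \<or>
    (\<exists>N p. (\<forall>n. 0 <= p n) \<and> (\<Sum>n<N. p n) = 1 \<and> (\<forall>\<gamma>\<in>\<Gamma>. (\<Sum>n<N. p n * measure (occupation \<gamma>) (F n)) < c))"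
proof (cases "\<exists>N p. (\<forall>n. 0 <= p n) \<and> (\<Sum>n<N. p n) = 1 \<and> (\<forall>\<gamma>\<in>\<Gamma>. (\<Sum>n<N. p n * measure (occupation \<gamma>) (F n)) < c)")
  case False
  obtain E :: "real set" and \<Psi> where E: "compact E" "continuous_on E \<Psi>" "\<Psi> ` E = \<Gamma>"
    by (rule compact_is_continuous_image_of_real_compact[OF \<Gamma>(1)])
  have En: "E ~= {}" using E(3) \<Gamma>(2) by auto
  define J where "J n e = measure (occupation (\<Psi> e)) (F n)" for n e
  have cl: "closed (UNIV \<times> F n :: (real \<times> 'a) set)" for n by (intro closed_Times closed_UNIV F)
  have Fb: "F n \<in> sets borel" for n using F by simp
  have le1: "emeasure (occupation \<gamma>) A <= 1" if "\<gamma> \<in> \<Gamma>" for \<gamma> A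
  proof (cases "A \<in> sets borel")
    case True
    then show ?thesis unfolding emeasure_occupation(1)[OF True] by (intro emeasure_graph_measure_le bspec[OF dom that])
  qed (simp add: emeasure_notin_sets)
  have em: "emeasure (occupation \<gamma>) A = ennreal (measure (occupation \<gamma>) A)" if "\<gamma> \<in> \<Gamma>" for \<gamma> A
    using le1[OF that, of A] by (intro emeasure_eq_ennreal_measure) (auto simp: top_unique)
  have \<Psi>\<Gamma>: "\<Psi> e \<in> \<Gamma>" if "e \<in> E" for e using E(3) that by blast
  have "\<exists>M. real_distribution M \<and> (AE e in M. e \<in> E) \<and>
     (\<forall>n. (\<lambda>e. indicator E e * J n e) \<in> borel_measurable borel \<and> c <= (LINT e|M. indicator E e * J n e))"
  proof (rule minimax_measure[OF E(1) En])
    show "0 <= J n e \<and> J n e <= 1" if e: "e \<in> E" for n e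
      using le1[OF \<Psi>\<Gamma>[OF e], of "F n"] em[OF \<Psi>\<Gamma>[OF e], of "F n"] by (simp add: J_def)
    show "\<exists>e\<in>E. c <= (\<Sum>n<N. p n * J n e)" if p: "\<And>n. 0 <= p n" "(\<Sum>n<N. p n) = 1" for N p
    proof -
      have "\<not> (\<forall>\<gamma>\<in>\<Gamma>. (\<Sum>n<N. p n * measure (occupation \<gamma>) (F n)) < c)" using False p by blast
      then obtain \<gamma> where \<gamma>: "\<gamma> \<in> \<Gamma>" "c <= (\<Sum>n<N. p n * measure (occupation \<gamma>) (F n))" by (auto simp: not_less)
      then show ?thesis using E(3) by (auto simp: J_def)
    qed
    show "\<exists>\<delta>>0. \<forall>e'\<in>E. \<bar>e' - e\<bar> < \<delta> --> J n e' < J n e + \<eta>" if e: "e \<in> E" and \<eta>: "0 < \<eta>" for n e \<eta>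
    proof -
      have "emeasure (occupation (\<Psi> e)) (F n) < ennreal (J n e + \<eta>)"
        unfolding em[OF \<Psi>\<Gamma>[OF e]] using \<eta> by (simp add: J_def ennreal_less_iff)
      then obtain d where d: "d > 0" "\<forall>\<gamma>. dist \<gamma> (\<Psi> e) < d --> emeasure (occupation \<gamma>) (F n) < ennreal (J n e + \<eta>)"
        using graph_measure_usc[OF cl, of n "ennreal (J n e + \<eta>)"] unfolding emeasure_occupation(1)[OF Fb] open_dist by blast
      obtain \<delta> where \<delta>: "\<delta> > 0" "\<forall>e'\<in>E. dist e' e < \<delta> --> dist (\<Psi> e') (\<Psi> e) < d"
        using E(2) e d(1) unfolding continuous_on_iff by blast
      show ?thesis
      proof (intro exI[of _ \<delta>] conjI ballI impI)
        fix e' assume e': "e' \<in> E" "\<bar>e' - e\<bar> < \<delta>"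
        then have "dist (\<Psi> e') (\<Psi> e) < d" using \<delta>(2) by (simp add: dist_real_def)
        then have "emeasure (occupation (\<Psi> e')) (F n) < ennreal (J n e + \<eta>)" using d(2) by blast
        then have "ennreal (J n e') < ennreal (J n e + \<eta>)" unfolding em[OF \<Psi>\<Gamma>[OF e'(1)]] J_def .
        then show "J n e' < J n e + \<eta>" by (simp add: J_def ennreal_less_iff)
      qed (rule \<delta>(1))
    qed
  qed
  then obtain M where M: "real_distribution M" "AE e in M. e \<in> E"
    "\<And>n. (\<lambda>e. indicator E e * J n e) \<in> borel_measurable borel" "\<And>n. c <= (LINT e|M. indicator E e * J n e)" by blast
  interpret M: real_distribution M by (rule M(1))
  have sM: "sets M = sets borel" by simp
  obtain \<gamma>0 where \<gamma>0: "\<gamma>0 \<in> \<Gamma>" using \<Gamma>(2) by blast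
  define \<Psi>' where "\<Psi>' e = (if e \<in> E then \<Psi> e else \<gamma>0)" for e
  define P where "P = distr M borel \<Psi>'"
  have Eb: "E \<in> sets borel" using compact_imp_closed[OF E(1)] by simp
  have \<Gamma>b: "\<Gamma> \<in> sets borel" using compact_imp_closed[OF \<Gamma>(1)] by simp
  have m: "\<Psi>' \<in> M \<rightarrow>\<^sub>M borel"
    unfolding \<Psi>'_def measurable_cong_sets[OF sM refl] by (rule measurable_continuous_on_If[OF Eb E(2)])
  have "regular_borel_prob P" unfolding P_def \<Psi>'_def by (rule regular_borel_prob_continuous_image[OF M(1,2) E(1,2)])
  moreover have AEP: "AE \<gamma> in P. \<gamma> \<in> \<Gamma>"
    unfolding P_def using \<Psi>\<Gamma> \<gamma>0 \<Gamma>b by (subst AE_distr_iff[OF m]) (auto simp: \<Psi>'_def)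
  moreover have "ennreal c <= (\<integral>\<^sup>+ \<gamma>. emeasure (occupation \<gamma>) (F n) \<partial>P)" for n
  proof -
    have "ennreal c <= ennreal (LINT e|M. indicator E e * J n e)" by (rule ennreal_leI[OF M(4)])
    also have "... = (\<integral>\<^sup>+ e. ennreal (indicator E e * J n e) \<partial>M)"
    proof (rule nn_integral_eq_integral[symmetric])
      show "integrable M (\<lambda>e. indicator E e * J n e)"
      proof (rule M.integrable_const_bound[where B = 1])
        show "AE e in M. norm (indicator E e * J n e) <= 1"
          using le1 em \<Psi>\<Gamma> by (intro AE_I2) (auto simp: J_def indicator_def)
        show "(\<lambda>e. indicator E e * J n e) \<in> borel_measurable M" unfolding measurable_cong_sets[OF sM refl] by (rule M(3))
      qed
    qed (simp add: J_def)
    \<comment> \<open>Measurability of occupation times is available on \<open>\<Gamma>\<close>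
      only, so the integrand is set to 0 elsewhere before the integral is transported to
      \<open>P\<close>.\<close>
    also have "... = (\<integral>\<^sup>+ e. (if \<Psi>' e \<in> \<Gamma> then \<integral>\<^sup>+ z. indicator (UNIV \<times> F n) z \<partial>graph_measure (\<Psi>' e) else 0) \<partial>M)"
    proof (rule nn_integral_cong_AE)
      show "AE e in M. ennreal (indicator E e * J n e) = (if \<Psi>' e \<in> \<Gamma> then \<integral>\<^sup>+ z. indicator (UNIV \<times> F n) z \<partial>graph_measure (\<Psi>' e) else 0)"
        using M(2)
      proof eventually_elim
        case (elim e)
        have "UNIV \<times> F n \<in> sets (graph_measure (\<Psi> e))" using cl by simp
        then show ?case using elim \<Psi>\<Gamma>[OF elim] em[OF \<Psi>\<Gamma>[OF elim], of "F n"] by (simp add: \<Psi>'_def J_def emeasure_occupation(1)[OF Fb])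
      qed
    qed
    also have "... = (\<integral>\<^sup>+ \<gamma>. (if \<gamma> \<in> \<Gamma> then \<integral>\<^sup>+ z. indicator (UNIV \<times> F n) z \<partial>graph_measure \<gamma> else 0) \<partial>P)"
    proof -
      have "(\<lambda>\<gamma>. if \<gamma> \<in> \<Gamma> then \<integral>\<^sup>+ z. indicator (UNIV \<times> F n) z \<partial>graph_measure \<gamma> else 0) \<in> borel_measurable borel"
        using cl by (intro occupation_measurable[OF \<Gamma>b dom]) auto
      then show ?thesis unfolding P_def by (subst nn_integral_distr[OF m]) (simp_all cong: measurable_cong_sets)
    qed
    also have "... = (\<integral>\<^sup>+ \<gamma>. emeasure (occupation \<gamma>) (F n) \<partial>P)"
    proof (rule nn_integral_cong_AE)
      show "AE \<gamma> in P. (if \<gamma> \<in> \<Gamma> then \<integral>\<^sup>+ z. indicator (UNIV \<times> F n) z \<partial>graph_measure \<gamma> else 0) = emeasure (occupation \<gamma>) (F n)"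
        using AEP
      proof eventually_elim
        case (elim \<gamma>)
        have "UNIV \<times> F n \<in> sets (graph_measure \<gamma>)" using cl by simp
        then show ?case using elim by (simp add: emeasure_occupation(1)[OF Fb])
      qed
    qed
    finally show ?thesis .
  qed
  ultimately show ?thesis by blast
qed simp

section \<open>Alberti representations\<close>

text \<open>On \<open>A\<close> the measure \<open>\<mu>\<close> is absolutely continuous with
  respect to the \<open>P\<close>-mixture of the occupation measures. Densities are postponed until
  all pieces have been combined.\<close>

definition alberti_piece :: "'a::metric_space measure => 'a fragment set => 'a set => bool" where
  "alberti_piece \<mu> \<Gamma> A \<longleftrightarrow> (\<exists>P. regular_borel_prob P \<and> (AE \<gamma> in P. \<gamma> \<in> \<Gamma>) \<and>
     (\<forall>X\<in>sets borel. X \<subseteq> A --> (\<integral>\<^sup>+ \<gamma>. emeasure (occupation \<gamma>) X \<partial>P) = 0 --> emeasure \<mu> X = 0))"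

lemma finite_measure_occupation: "finite_measure (occupation \<gamma>)"
proof (rule finite_measureI)
  have "emeasure lborel (frag_dom \<gamma>) < \<infinity>" by (rule emeasure_compact_finite[OF compact_frag_dom])
  then show "emeasure (occupation \<gamma>) (space (occupation \<gamma>)) ~= \<infinity>" by (simp add: emeasure_occupation(2))
qed

lemma occupation_mixture:
  fixes P :: "'a::metric_space fragment measure"
  assumes \<Gamma>: "\<Gamma> \<in> sets borel" and dom: "\<forall>\<gamma>\<in>\<Gamma>. frag_dom \<gamma> \<subseteq> {0..1}"
    and P: "regular_borel_prob P" "AE \<gamma> in P. \<gamma> \<in> \<Gamma>"
  shows "\<exists>Q. finite_measure Q \<and> sets Q = sets borel \<and>
    (\<forall>h\<in>borel_measurable borel. (\<integral>\<^sup>+ x. h x \<partial>Q) = (\<integral>\<^sup>+ \<gamma>. (\<integral>\<^sup>+ x. h x \<partial>occupation \<gamma>) \<partial>P))"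
proof -
  have sP: "sets P = sets borel" using P(1) by (simp add: regular_borel_prob_def finite_radon_def)
  interpret P: prob_space P using P(1) by (simp add: regular_borel_prob_def)
  define \<theta> where "\<theta> \<gamma> = (if \<gamma> \<in> \<Gamma> then occupation \<gamma> else null_measure borel)" for \<gamma>
  have \<theta>m: "\<theta> \<in> P \<rightarrow>\<^sub>M subprob_algebra borel"
    unfolding \<theta>_def measurable_cong_sets[OF sP refl] by (rule occupation_kernel[OF \<Gamma> dom])
  have "subprob_space (P \<bind> \<theta>)" by (rule subprob_space_bind[OF _ \<theta>m]) unfold_locales
  moreover have "sets (P \<bind> \<theta>) = sets borel" by (rule sets_bind[OF _ P.not_empty]) (simp add: \<theta>_def)
  moreover have "(\<integral>\<^sup>+ x. h x \<partial>(P \<bind> \<theta>)) = (\<integral>\<^sup>+ \<gamma>. (\<integral>\<^sup>+ x. h x \<partial>occupation \<gamma>) \<partial>P)" if h: "h \<in> borel_measurable borel" for h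
    unfolding nn_integral_bind[OF h \<theta>m] using P(2) by (intro nn_integral_cong_AE) (auto simp: \<theta>_def)
  ultimately show ?thesis using subprob_space.axioms(1) by blast
qed

abbreviation rball :: "(nat => 'a::metric_space) => nat \<times> nat => 'a set" where
  "rball z p \<equiv> cball (z (fst p)) (1 / real (Suc (snd p)))"

text \<open>Finite unions of the balls \<open>rball z p\<close> form a countable family of closed
  sets that approximates every compact set from outside, so countably many payoffs suffice in the
  minimax argument.\<close>

lemma rational_ball_cover:
  fixes K :: "'a::polish_space set" and z :: "nat => 'a"
  assumes K: "compact K" and z: "\<forall>x e. 0 < e --> (\<exists>k. dist x (z k) < e)"
    and Q: "finite_measure Q" "sets Q = sets borel" and c: "emeasure Q K < c"
  shows "\<exists>l :: (nat \<times> nat) list. K \<subseteq> (\<Union>p\<in>set l. rball z p) \<and>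
    emeasure Q (\<Union>p\<in>set l. rball z p) < c"
proof -
  interpret finite_measure Q by (rule Q(1))
  have Kb: "K \<in> sets borel" using compact_imp_closed[OF K] by simp
  have "emeasure Q K = (INF U \<in> {U. K \<subseteq> U \<and> open U}. emeasure Q U)"
    by (rule outer_regular[OF Q(2) _ Kb]) simp
  then have "(INF U \<in> {U. K \<subseteq> U \<and> open U}. emeasure Q U) < c" using c by simp
  then obtain U where U: "K \<subseteq> U" "open U" "emeasure Q U < c" unfolding INF_less_iff by blast
  define I where "I = {p :: nat \<times> nat. rball z p \<subseteq> U}"
  have "K \<subseteq> (\<Union>p\<in>I. ball (z (fst p)) (1 / real (Suc (snd p))))"
  proof
    fix x assume x: "x \<in> K"
    then obtain e where e: "0 < e" "ball x e \<subseteq> U" using U open_contains_ball by blast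
    obtain j where j: "1 / real (Suc j) < e / 2" using reals_Archimedean[of "e / 2"] e(1) by (auto simp: inverse_eq_divide)
    obtain k where k: "dist x (z k) < 1 / real (Suc j)" using z by (metis of_nat_0_less_iff zero_less_Suc zero_less_divide_1_iff)
    have "cball (z k) (1 / real (Suc j)) \<subseteq> ball x e"
    proof
      fix y assume "y \<in> cball (z k) (1 / real (Suc j))"
      then have "dist x y < e" using dist_triangle[of x y "z k"] k j by simp
      then show "y \<in> ball x e" by simp
    qed
    then have "(k, j) \<in> I" using e(2) by (auto simp: I_def)
    moreover have "x \<in> ball (z k) (1 / real (Suc j))" using k by (simp add: dist_commute)
    ultimately show "x \<in> (\<Union>p\<in>I. ball (z (fst p)) (1 / real (Suc (snd p))))" by force
  qed
  then obtain J where J: "J \<subseteq> I" "finite J" "K \<subseteq> (\<Union>p\<in>J. ball (z (fst p)) (1 / real (Suc (snd p))))"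
    using compactE_image[OF K, of I "\<lambda>p. ball (z (fst p)) (1 / real (Suc (snd p)))"] by auto
  obtain l where l: "set l = J" using finite_list[OF J(2)] by blast
  have sub: "(\<Union>p\<in>set l. rball z p) \<subseteq> U" unfolding l using J(1) by (intro UN_least) (auto simp: I_def simp del: of_nat_Suc)
  have "(\<Union>p\<in>J. ball (z (fst p)) (1 / real (Suc (snd p)))) \<subseteq> (\<Union>p\<in>set l. rball z p)"
    unfolding l by (intro UN_mono order_refl ball_subset_cball)
  then have "K \<subseteq> (\<Union>p\<in>set l. rball z p)" using J(3) by (rule order_trans[rotated])
  moreover have "emeasure Q (\<Union>p\<in>set l. rball z p) <= emeasure Q U"
    using sub U(2) Q(2) by (intro emeasure_mono) auto
  ultimately show ?thesis using U(3) by (intro exI[of _ l]) auto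
qed

lemma measure_limsup_ge:
  assumes \<mu>: "finite_measure \<mu>" and L: "\<And>n::nat. L n \<in> sets \<mu>" and c: "\<And>n. c <= measure \<mu> (L n)"
  shows "c <= measure \<mu> (\<Inter>m. \<Union>i\<in>{m..}. L i)"
proof -
  interpret finite_measure \<mu> by (rule \<mu>)
  define U where "U m = (\<Union>i\<in>{m..}. L i)" for m
  have U: "range U \<subseteq> sets \<mu>" using L by (auto simp: U_def)
  have "decseq U" unfolding decseq_def U_def by (intro allI impI UN_mono) auto
  then have "(\<lambda>m. measure \<mu> (U m)) \<longlonglongrightarrow> measure \<mu> (\<Inter>m. U m)" using U by (intro finite_Lim_measure_decseq)
  moreover have "c <= measure \<mu> (U m)" for m
  proof -
    have "measure \<mu> (L m) <= measure \<mu> (U m)" using U by (intro finite_measure_mono) (auto simp: U_def)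
    then show ?thesis using c[of m] by simp
  qed
  ultimately have "c <= measure \<mu> (\<Inter>m. U m)" by (intro LIMSEQ_le_const) auto
  then show ?thesis by (simp add: U_def)
qed

text \<open>Markov's inequality for the weighted average of the indicators of \<open>F n\<close>. If
  every \<open>F n\<close> fills half of \<open>S\<close>, the average has integral at least half of
  the measure of \<open>S\<close>; it is at most 1 on \<open>L\<close> and at most
  \<open>1/4\<close> on the rest of \<open>S\<close>, so \<open>L\<close> retains a quarter.\<close>

lemma superlevel_measure:
  fixes p :: "nat => real"
  assumes m: "finite_measure m" and F: "\<And>n. F n \<in> sets m" and p: "\<And>n. 0 <= p n" "(\<Sum>n<N. p n) = 1" and S: "S \<in> sets m"
  defines "L \<equiv> {x\<in>S. 1/4 <= (\<Sum>n<N. p n * indicator (F n) x)}"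
  shows "L \<in> sets m" "measure m L <= 4 * (\<Sum>n<N. p n * measure m (F n))"
    "(\<And>n. measure m S / 2 <= measure m (F n \<inter> S)) ==> measure m S / 4 <= measure m L"
proof -
  interpret finite_measure m by (rule m)
  define f where "f x = (\<Sum>n<N. p n * indicator (F n) x)" for x
  have fm: "f \<in> borel_measurable m" unfolding f_def using F by measurable
  have Leq: "L = {x\<in>space m. 1/4 <= f x} \<inter> S" unfolding L_def f_def using sets.sets_into_space[OF S] by auto
  have "{x\<in>space m. 1/4 <= f x} \<in> sets m" using fm by measurable
  then show L: "L \<in> sets m" unfolding Leq using S by simp
  have ii: "integrable m (indicator A :: 'a => real)" if "A \<in> sets m" for A
    using that by (intro integrable_real_indicator) (auto simp: less_top[symmetric])
  have fS: "(LINT x|m. f x * indicator B x) = (\<Sum>n<N. p n * measure m (F n \<inter> B))" "integrable m (\<lambda>x. f x * indicator B x)" if B: "B \<in> sets m" for B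
  proof -
    have eq: "(\<lambda>x. f x * indicator B x) = (\<lambda>x. \<Sum>n<N. p n * indicator (F n \<inter> B) x)"
      by (rule ext) (auto simp: f_def sum_distrib_right indicator_def intro!: sum.cong)
    have i: "integrable m (\<lambda>x. p n * indicator (F n \<inter> B) x)" for n using ii[of "F n \<inter> B"] F B by simp
    show "integrable m (\<lambda>x. f x * indicator B x)" unfolding eq using i by (intro Bochner_Integration.integrable_sum)
    show "(LINT x|m. f x * indicator B x) = (\<Sum>n<N. p n * measure m (F n \<inter> B))"
      unfolding eq using i F B by (subst Bochner_Integration.integral_sum) (auto intro!: sum.cong simp: sets.sets_into_space Int_absorb2)
  qed
  have f0: "0 <= f x" "f x <= 1" for x
  proof -
    show "0 <= f x" unfolding f_def using p(1) by (intro sum_nonneg) auto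
    have "f x <= (\<Sum>n<N. p n * 1)" unfolding f_def using p(1) by (intro sum_mono mult_left_mono) (auto simp: indicator_def)
    then show "f x <= 1" using p(2) by simp
  qed
  have "1/4 * measure m L = (LINT x|m. 1/4 * indicat_real L x)" using L by (simp add: sets.sets_into_space Int_absorb2)
  also have "... <= (LINT x|m. f x * indicator (space m) x)"
  proof (rule integral_mono)
    show "integrable m (\<lambda>x. 1/4 * indicat_real L x)" using ii[OF L] by simp
    show "integrable m (\<lambda>x. f x * indicator (space m) x)" by (rule fS(2)) simp
    show "1/4 * indicat_real L x <= f x * indicator (space m) x" if "x \<in> space m" for x
      using that f0[of x] by (auto simp: indicator_def Leq)
  qed
  also have "... = (\<Sum>n<N. p n * measure m (F n))"
    using fS(1)[of "space m"] F by (simp add: sets.sets_into_space Int_absorb2)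
  finally show "measure m L <= 4 * (\<Sum>n<N. p n * measure m (F n))" by simp
  show "measure m S / 4 <= measure m L" if half: "\<And>n. measure m S / 2 <= measure m (F n \<inter> S)"
  proof -
    have "measure m S / 2 = (\<Sum>n<N. p n * (measure m S / 2))" unfolding sum_distrib_right[symmetric] p(2) by simp
    also have "... <= (\<Sum>n<N. p n * measure m (F n \<inter> S))" by (intro sum_mono mult_left_mono half p(1))
    also have "... = (LINT x|m. f x * indicator S x)" by (rule fS(1)[OF S, symmetric])
    also have "... <= (LINT x|m. indicator L x + 1/4 * indicat_real S x)"
    proof (rule integral_mono)
      show "integrable m (\<lambda>x. f x * indicator S x)" by (rule fS(2)[OF S])
      show "integrable m (\<lambda>x. indicator L x + 1/4 * indicat_real S x :: real)" using ii[OF L] ii[OF S] by simp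
      show "f x * indicator S x <= indicator L x + 1/4 * indicat_real S x" if "x \<in> space m" for x
        using that f0[of x] by (auto simp: indicator_def Leq)
    qed
    also have "... = measure m L + 1/4 * measure m S"
      using ii[OF L] ii[OF S] L S by (subst Bochner_Integration.integral_add) (auto simp: sets.sets_into_space Int_absorb2)
    finally show ?thesis by simp
  qed
qed

text \<open>The \<open>F n\<close> enumerate finite unions of balls that fill half of \<open>S\<close>. If no law on some \<open>\<Gamma> i\<close> charges all of
  them, the minimax alternative yields sets \<open>L i\<close> of large measure which fragments in \<open>\<Gamma> i\<close> hardly visit,
  and by Borel-Cantelli no fragment charges their upper limit.\<close>

lemma fragment_piece:
  fixes \<mu> :: "'a::polish_space measure" and \<Gamma> :: "nat => 'a fragment set"
  assumes \<mu>: "sets \<mu> = sets borel" "finite_measure \<mu>" and S: "compact S" "0 < measure \<mu> S"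
    and \<Gamma>: "\<And>i. compact (\<Gamma> i)" "\<And>i j. i <= j ==> \<Gamma> i \<subseteq> \<Gamma> j" and dom: "\<And>i. \<forall>\<gamma>\<in>\<Gamma> i. frag_dom \<gamma> \<subseteq> {0..1}"
    and H: "\<And>K. compact K ==> K \<subseteq> S ==> 0 < measure \<mu> K ==> \<exists>i. \<exists>\<gamma>\<in>\<Gamma> i. 0 < emeasure (occupation \<gamma>) K"
  shows "\<exists>S1\<in>sets borel. S1 \<subseteq> S \<and> 0 < measure \<mu> S1 \<and> (\<exists>i. alberti_piece \<mu> (\<Gamma> i) S1)"
proof -
  interpret \<mu>: finite_measure \<mu> by (rule \<mu>(2))
  have Sb: "S \<in> sets borel" using compact_imp_closed[OF S(1)] by simp
  obtain z :: "nat => 'a" where z: "\<forall>x e. 0 < e --> (\<exists>k. dist x (z k) < e)" using dense_sequence by blast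
  define F0 where "F0 n = (\<Union>p\<in>set (from_nat n :: (nat \<times> nat) list). rball z p)" for n
  \<comment> \<open>Unions that fill less than half of \<open>S\<close> are replaced by the whole
    space, so that the bound \<open>Fhalf\<close> holds for all \<open>n\<close>.\<close>
  define F where "F n = (if measure \<mu> S / 2 <= measure \<mu> (F0 n \<inter> S) then F0 n else UNIV)" for n
  have Fc: "closed (F n)" for n unfolding F_def F0_def by auto
  have Fb: "F n \<in> sets borel" for n using Fc by simp
  have Fhalf: "measure \<mu> S / 2 <= measure \<mu> (F n \<inter> S)" for n unfolding F_def by auto
  \<comment> \<open>After the factor 4 from Markov's inequality this leaves \<open>(1/2)^i\<close>,
    which is summable as Borel-Cantelli requires.\<close>
  define c :: "nat => real" where "c i = (1/4) * (1/2)^i" for i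
  have c: "0 < c i" for i by (simp add: c_def)
  have "\<exists>i P. regular_borel_prob P \<and> (AE \<gamma> in P. \<gamma> \<in> \<Gamma> i) \<and> (\<forall>n. ennreal (c i) <= (\<integral>\<^sup>+ \<gamma>. emeasure (occupation \<gamma>) (F n) \<partial>P))"
  proof (rule ccontr)
    assume no: "\<not> ?thesis"
    have "\<forall>i. \<exists>N p. (\<forall>n. 0 <= p n) \<and> (\<Sum>n<N. p n) = (1::real) \<and> (\<forall>\<gamma>\<in>\<Gamma> i. (\<Sum>n<N. p n * measure (occupation \<gamma>) (F n)) < c i)"
    proof
      fix i show "\<exists>N p. (\<forall>n. 0 <= p n) \<and> (\<Sum>n<N. p n) = (1::real) \<and> (\<forall>\<gamma>\<in>\<Gamma> i. (\<Sum>n<N. p n * measure (occupation \<gamma>) (F n)) < c i)"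
      proof (cases "\<Gamma> i = {}")
        case True
        then show ?thesis by (intro exI[of _ 1] exI[of _ "\<lambda>_. 1"]) simp
      next
        case False
        from minimax_fragments[OF \<Gamma>(1) False dom Fc, where c = "c i"] show ?thesis by (rule disjE) (rule notE[OF no], rule exI[of _ i])
      qed
    qed
    from this[unfolded choice_iff] obtain N p where q: "\<forall>i. (\<forall>n. 0 <= p i n) \<and> (\<Sum>n<N i. p i n) = (1::real) \<and> (\<forall>\<gamma>\<in>\<Gamma> i. (\<Sum>n<N i. p i n * measure (occupation \<gamma>) (F n)) < c i)"
      by (elim exE) (rule that)
    have p: "\<And>i n. 0 <= p i n" "\<And>i. (\<Sum>n<N i. p i n) = 1" and pc: "\<And>i \<gamma>. \<gamma> \<in> \<Gamma> i ==> (\<Sum>n<N i. p i n * measure (occupation \<gamma>) (F n)) < c i"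
      using q by blast+
    define L where "L i = {x\<in>S. 1/4 <= (\<Sum>n<N i. p i n * indicator (F n) x)}" for i
    have Lb: "L i \<in> sets borel" "measure \<mu> S / 4 <= measure \<mu> (L i)" for i
    proof -
      have Fm: "F n \<in> sets \<mu>" for n using Fb \<mu>(1) by simp
      have Sm: "S \<in> sets \<mu>" using Sb \<mu>(1) by simp
      show "L i \<in> sets borel" unfolding L_def \<mu>(1)[symmetric] by (rule superlevel_measure(1)[OF \<mu>(2) Fm p Sm])
      show "measure \<mu> S / 4 <= measure \<mu> (L i)" unfolding L_def by (rule superlevel_measure(3)[OF \<mu>(2) Fm p Sm Fhalf])
    qed
    have L\<theta>: "measure (occupation \<gamma>) (L i) <= (1/2)^i" if g: "\<gamma> \<in> \<Gamma> (i)" for i \<gamma>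
    proof -
      have "measure (occupation \<gamma>) (L i) <= 4 * (\<Sum>n<N i. p i n * measure (occupation \<gamma>) (F n))"
        unfolding L_def
      proof (rule superlevel_measure(2)[OF finite_measure_occupation])
        show "F n \<in> sets (occupation \<gamma>)" for n using Fb by simp
        show "S \<in> sets (occupation \<gamma>)" using Sb by simp
      qed (rule p)+
      also have "... <= 4 * c i" using pc[OF g] by simp
      finally show ?thesis by (simp add: c_def)
    qed
    define Li where "Li = (\<Inter>m. \<Union>i\<in>{m..}. L i)"
    have Lib: "Li \<in> sets borel" unfolding Li_def using Lb(1) by (intro sets.countable_INT) auto
    have "measure \<mu> S / 4 <= measure \<mu> Li"
      unfolding Li_def by (rule measure_limsup_ge[OF \<mu>(2) _ Lb(2)]) (simp add: Lb(1) \<mu>(1))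
    then have Lpos: "0 < measure \<mu> Li" using S(2) by simp
    obtain K where K: "compact K" "K \<subseteq> Li" "measure \<mu> Li < measure \<mu> K + measure \<mu> Li"
      by (rule finite_measure_compact_approx[OF \<mu> Lib Lpos])
    have "K \<subseteq> S" using K(2) by (auto simp: Li_def L_def)
    then obtain i \<gamma> where g: "\<gamma> \<in> \<Gamma> i" "0 < emeasure (occupation \<gamma>) K" using H[OF K(1)] K(3) by auto
    have "emeasure (occupation \<gamma>) K <= ennreal e" if e: "0 < e" for e
    proof -
      obtain m0 where m0: "(1/2::real)^m0 < e / 2" using real_arch_pow_inv[of "e / 2" "1/2"] e by auto
      \<comment> \<open>From index \<open>m\<close> on, \<open>\<gamma>\<close> lies in all the sets
        \<open>\<Gamma> j\<close>, since these increase, and the tail of the geometric series is at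
        most \<open>e\<close>.\<close>
      define m where "m = max m0 i"
      have "(1/2::real)^m <= (1/2)^m0" unfolding m_def by (rule power_decreasing) auto
      then have m: "2 * (1/2::real)^m <= e" using m0 by linarith
      have im: "i <= m" by (simp add: m_def)
      have geo: "(\<lambda>j. (1/2::real)^m * (1/2)^j) sums ((1/2)^m * 2)"
        using geometric_sums[of "1/2::real"] by (intro sums_mult) simp
      have "emeasure (occupation \<gamma>) K <= emeasure (occupation \<gamma>) (\<Union>j. L (m + j))"
      proof (rule emeasure_mono)
        show "K \<subseteq> (\<Union>j. L (m + j))"
        proof
          fix x assume "x \<in> K"
          then have "x \<in> (\<Union>i\<in>{m..}. L i)" using K(2) unfolding Li_def by blast
          then obtain i where "m <= i" "x \<in> L i" by auto
          then have "x \<in> L (m + (i - m))" by simp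
          then show "x \<in> (\<Union>j. L (m + j))" by (rule UN_I[OF UNIV_I])
        qed
      qed (use Lb(1) in auto)
      also have "... <= (\<Sum>j. emeasure (occupation \<gamma>) (L (m + j)))" using Lb(1) by (intro emeasure_subadditive_countably) auto
      also have "... <= (\<Sum>j. ennreal ((1/2)^m * (1/2)^j))"
      proof (intro suminf_le)
        fix j
        have "\<gamma> \<in> \<Gamma> ((m + j))" using g(1) \<Gamma>(2)[of i "(m + j)"] im by auto
        then have "measure (occupation \<gamma>) (L (m + j)) <= (1/2)^m * (1/2)^j" using L\<theta> by (simp add: power_add[symmetric])
        then show "emeasure (occupation \<gamma>) (L (m + j)) <= ennreal ((1/2)^m * (1/2)^j)"
          unfolding finite_measure.emeasure_eq_measure[OF finite_measure_occupation] by (rule ennreal_leI)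
      qed simp_all
      also have "... = ennreal ((1/2)^m * 2)" by (rule suminf_ennreal_eq[OF _ geo]) simp
      also have "... <= ennreal e" using m by (intro ennreal_leI) simp
      finally show ?thesis .
    qed
    then have "emeasure (occupation \<gamma>) K <= 0" by (intro ennreal_le_epsilon[where x = "emeasure (occupation \<gamma>) K" and y = 0]) simp_all
    then show False using g(2) by simp
  qed
  then obtain i P where P: "regular_borel_prob P" "AE \<gamma> in P. \<gamma> \<in> \<Gamma> i" "\<And>n. ennreal (c i) <= (\<integral>\<^sup>+ \<gamma>. emeasure (occupation \<gamma>) (F n) \<partial>P)"
    by blast
  have \<Gamma>b: "\<Gamma> i \<in> sets borel" using compact_imp_closed[OF \<Gamma>(1)] by simp
  obtain Q where Q: "finite_measure Q" "sets Q = sets borel"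
    "\<And>h. h \<in> borel_measurable borel ==> (\<integral>\<^sup>+ x. h x \<partial>Q) = (\<integral>\<^sup>+ \<gamma>. (\<integral>\<^sup>+ x. h x \<partial>occupation \<gamma>) \<partial>P)"
    using occupation_mixture[OF \<Gamma>b dom P(1,2)] by blast
  have Qem: "emeasure Q X = (\<integral>\<^sup>+ \<gamma>. emeasure (occupation \<gamma>) X \<partial>P)" if "X \<in> sets borel" for X
    using Q(3)[of "indicator X"] that by (simp add: Q(2))
  \<comment> \<open>A \<open>Q\<close>-null set cannot exhaust \<open>S\<close>: a compact part of
    it with most of the measure of \<open>S\<close> would be covered by some \<open>F n\<close> of
    \<open>Q\<close>-measure below \<open>c i\<close>.\<close>
  have ns: "0 < measure \<mu> (S - Z)" if Zb: "Z \<in> sets borel" and Z: "emeasure Q Z = 0" for Z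
  proof (rule ccontr)
    assume "\<not> ?thesis"
    then have "measure \<mu> (S - Z) = 0" using measure_nonneg[of \<mu> "S - Z"] by linarith
    then have mSZ: "measure \<mu> (S \<inter> Z) = measure \<mu> S"
      using \<mu>.finite_measure_Union[of "S \<inter> Z" "S - Z"] Sb Zb \<mu>(1) by (simp add: Int_Diff_Un Int_Diff_disjoint)
    have "S \<inter> Z \<in> sets borel" "0 < measure \<mu> S / 4" using Sb Zb S(2) by auto
    from finite_measure_compact_approx[OF \<mu> this]
    obtain K where K: "compact K" "K \<subseteq> S \<inter> Z" "measure \<mu> (S \<inter> Z) < measure \<mu> K + measure \<mu> S / 4" by blast
    have "emeasure Q K <= emeasure Q Z" using K(2) Zb Q(2) by (intro emeasure_mono) auto
    then have "emeasure Q K < ennreal (c i)" using Z c[of i] by simp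
    from rational_ball_cover[OF K(1) z Q(1,2) this]
    obtain l :: "(nat \<times> nat) list" where l: "K \<subseteq> (\<Union>p\<in>set l. rball z p)"
      "emeasure Q (\<Union>p\<in>set l. rball z p) < ennreal (c i)" by (elim exE conjE) (rule that)
    define n where "n = to_nat l"
    have F0n: "F0 n = (\<Union>p\<in>set l. rball z p)" unfolding F0_def n_def from_nat_to_nat ..
    have F0b: "F0 n \<in> sets borel" unfolding F0_def by (intro borel_closed closed_UN) auto
    have "K \<subseteq> F0 n \<inter> S" using l(1) K(2) unfolding F0n by blast
    then have "measure \<mu> K <= measure \<mu> (F0 n \<inter> S)" using F0b Sb \<mu>(1) by (intro \<mu>.finite_measure_mono) auto
    then have "F n = F0 n" using K(3) mSZ S(2) by (simp add: F_def)
    then show False using l(2) P(3)[of n] Qem[OF Fb, of n] F0n by simp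
  qed
  \<comment> \<open>A \<open>Q\<close>-null set of maximal \<open>\<mu>\<close>-measure is removed;
    on what remains every \<open>Q\<close>-null set is \<open>\<mu>\<close>-null.\<close>
  let ?N = "{Z\<in>sets borel. emeasure Q Z = 0}"
  have "{} \<in> ?N" by simp
  then have "?N ~= {}" by blast
  from ennreal_SUP_countable_SUP[OF this, of "emeasure \<mu>"] obtain f :: "nat => ennreal"
    where f: "range f \<subseteq> emeasure \<mu> ` ?N" "(SUP Z\<in>?N. emeasure \<mu> Z) = (SUP n. f n)" by auto
  then have "\<forall>n. \<exists>Z. Z \<in> ?N \<and> f n = emeasure \<mu> Z" by blast
  from choice[OF this] obtain Y where Y: "\<And>n. Y n \<in> ?N" "\<And>n. f n = emeasure \<mu> (Y n)" by blast
  define Z where "Z = (\<Union>n. Y n)"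
  have ZQ: "Z \<in> null_sets Q" unfolding Z_def using Y(1) Q(2) by (intro null_sets_UN) (auto simp: null_sets_def)
  then have Z: "Z \<in> sets borel" "emeasure Q Z = 0" using Q(2) by (auto simp: null_sets_def)
  have max: "emeasure \<mu> W <= emeasure \<mu> Z" if "W \<in> null_sets Q" for W
  proof -
    have "emeasure \<mu> W <= (SUP n. f n)" unfolding f(2)[symmetric] using that Q(2) by (intro SUP_upper) (auto simp: null_sets_def)
    also have "... <= emeasure \<mu> Z" using Y(2) Z(1) \<mu>(1) by (intro SUP_least) (auto simp: Z_def intro!: emeasure_mono)
    finally show ?thesis .
  qed
  have "alberti_piece \<mu> (\<Gamma> i) (S - Z)"
    unfolding alberti_piece_def
  proof (intro exI[of _ P] conjI P(1,2) ballI impI)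
    fix X assume X: "X \<in> sets borel" "X \<subseteq> S - Z" "(\<integral>\<^sup>+ \<gamma>. emeasure (occupation \<gamma>) X \<partial>P) = 0"
    then have "X \<in> null_sets Q" using Qem Q(2) by (auto simp: null_sets_def)
    then have "emeasure \<mu> (Z \<union> X) <= emeasure \<mu> Z" by (intro max null_sets.Un ZQ)
    moreover have "measure \<mu> (Z \<union> X) = measure \<mu> Z + measure \<mu> X"
      using X Z(1) \<mu>(1) by (intro \<mu>.finite_measure_Union) auto
    ultimately show "emeasure \<mu> X = 0" by (simp add: \<mu>.emeasure_eq_measure measure_le_0_iff)
  qed
  then show ?thesis using ns[OF Z] Z(1) Sb by (intro bexI[of _ "S - Z"] conjI exI[of _ i]) auto
qed

text \<open>A fragment that does not contract distances spends its visits to a set of diameter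
  \<open>d\<close> within a time interval of length \<open>d\<close>, so a cover of the image yields
  a cover of the times. The lower biLipschitz constant 1 enters here.\<close>

lemma occupation_null_if_hausdorff1_null:
  fixes \<gamma> :: "'a::metric_space fragment"
  assumes \<gamma>: "\<And>s t. s \<in> frag_dom \<gamma> ==> t \<in> frag_dom \<gamma> ==> \<bar>s - t\<bar> <= dist (frag_eval \<gamma> s) (frag_eval \<gamma> t)"
    and A: "A \<in> sets borel" "hausdorff1 (A \<inter> frag_eval \<gamma> ` frag_dom \<gamma>) = 0"
  shows "emeasure (occupation \<gamma>) A = 0"
proof -
  define X where "X = A \<inter> frag_eval \<gamma> ` frag_dom \<gamma>"
  have "emeasure (occupation \<gamma>) A <= ennreal e" if e: "0 < e" for e
  proof -
    have "(INF E \<in> {E :: nat => 'a set. X \<subseteq> (\<Union>n. E n) \<and> (\<forall>n. bounded (E n) \<and> diameter (E n) <= 1)}. \<Sum>n. ennreal (diameter (E n))) <= hausdorff1 X"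
      unfolding hausdorff1_def by (rule SUP_upper) simp
    also have "... < ennreal e" using A(2) e by (simp add: X_def)
    finally obtain E :: "nat => 'a set" where E: "X \<subseteq> (\<Union>n. E n)" "\<And>n. bounded (E n)" "(\<Sum>n. ennreal (diameter (E n))) < ennreal e"
      unfolding INF_less_iff by blast
    define T where "T n = {t\<in>frag_dom \<gamma>. frag_eval \<gamma> t \<in> E n}" for n
    define J where "J n = (if T n = {} then {} else {Inf (T n)..Sup (T n)})" for n
    have bT: "bdd_above (T n)" "bdd_below (T n)" for n
      using bounded_subset[OF compact_imp_bounded[OF compact_frag_dom[of \<gamma>]], of "T n"] bounded_imp_bdd_above bounded_imp_bdd_below by (auto simp: T_def)
    have TJ: "T n \<subseteq> J n" for n using bT[of n] by (auto simp: J_def intro: cInf_lower cSup_upper)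
    have Jm: "emeasure lborel (J n) <= ennreal (diameter (E n))" for n
    proof (cases "T n = {}")
      case False
      have st: "t <= s + diameter (E n)" if "s \<in> T n" "t \<in> T n" for s t
      proof -
        have "\<bar>s - t\<bar> <= dist (frag_eval \<gamma> s) (frag_eval \<gamma> t)" using that by (intro \<gamma>) (auto simp: T_def)
        also have "... <= diameter (E n)" using that E(2) by (intro diameter_bounded_bound) (auto simp: T_def)
        finally show ?thesis by linarith
      qed
      have "Sup (T n) - diameter (E n) <= Inf (T n)"
      proof (rule cInf_greatest[OF False])
        fix s assume "s \<in> T n"
        then have "Sup (T n) <= s + diameter (E n)" using False st by (intro cSup_least) auto
        then show "Sup (T n) - diameter (E n) <= s" by simp
      qed
      moreover have "Inf (T n) <= Sup (T n)" by (rule cInf_le_cSup[OF False bT])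
      ultimately show ?thesis using False by (simp add: J_def ennreal_leI)
    qed (simp add: J_def)
    have Jb: "J n \<in> sets borel" for n by (simp add: J_def)
    have "emeasure (occupation \<gamma>) A <= emeasure lborel (\<Union>n. J n)"
      unfolding emeasure_occupation(2)[OF A(1)]
    proof (rule emeasure_mono)
      show "{t \<in> frag_dom \<gamma>. frag_eval \<gamma> t \<in> A} \<subseteq> (\<Union>n. J n)"
      proof
        fix t assume t: "t \<in> {t \<in> frag_dom \<gamma>. frag_eval \<gamma> t \<in> A}"
        then have "frag_eval \<gamma> t \<in> X" by (simp add: X_def)
        then obtain n where "frag_eval \<gamma> t \<in> E n" using E(1) by blast
        then have "t \<in> T n" using t by (simp add: T_def)
        then show "t \<in> (\<Union>n. J n)" using TJ by blast
      qed
      show "(\<Union>n. J n) \<in> sets lborel" unfolding sets_lborel by (intro sets.countable_UN image_subsetI Jb)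
    qed
    also have "... <= (\<Sum>n. emeasure lborel (J n))" using Jb by (intro emeasure_subadditive_countably image_subsetI) simp
    also have "... <= (\<Sum>n. ennreal (diameter (E n)))" by (intro suminf_le Jm) auto
    also have "... <= ennreal e" using E(3) by simp
    finally show ?thesis .
  qed
  then have "emeasure (occupation \<gamma>) A <= 0" by (intro ennreal_le_epsilon[where x = "emeasure (occupation \<gamma>) A" and y = 0]) simp_all
  then show ?thesis by simp
qed

section \<open>Densities and gluing of the pieces\<close>

lemma nn_integral_occupation:
  assumes "h \<in> borel_measurable borel"
  shows "(\<integral>\<^sup>+ x. h x \<partial>occupation \<gamma>) = (\<integral>\<^sup>+ z. h (snd z) \<partial>graph_measure \<gamma>)"
proof -
  have m: "snd \<in> graph_measure \<gamma> \<rightarrow>\<^sub>M borel"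
    unfolding measurable_cong_sets[OF sets_graph_measure refl] by (intro borel_measurable_continuous_onI continuous_intros)
  show ?thesis unfolding occupation_def using assms by (subst nn_integral_distr[OF m]) simp_all
qed

lemma nn_integral_graph_measure_cong:
  assumes "f \<in> borel_measurable borel" "g \<in> borel_measurable borel"
    and "\<And>t. t \<in> frag_dom \<gamma> ==> f (t, frag_eval \<gamma> t) = g (t, frag_eval \<gamma> t)"
  shows "(\<integral>\<^sup>+ z. f z \<partial>graph_measure \<gamma>) = (\<integral>\<^sup>+ z. g z \<partial>graph_measure \<gamma>)"
  unfolding graph_measure_def using assms
  by (subst (1 2) nn_integral_distr[OF graph_map_measurable]) (auto intro!: nn_integral_cong simp: space_restrict_space)

lemma borel_measurable_comp_snd:
  assumes "f \<in> borel_measurable borel"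
  shows "(\<lambda>z :: 'b::topological_space \<times> 'a::topological_space. f (snd z)) \<in> borel_measurable borel"
  by (rule measurable_compose[OF borel_measurable_continuous_onI[OF continuous_on_snd[OF continuous_on_id]] assms])

lemma borel_measurable_comp_fst:
  assumes "f \<in> borel_measurable borel"
  shows "(\<lambda>z :: 'b::topological_space \<times> 'a::topological_space. f (fst z)) \<in> borel_measurable borel"
  by (rule measurable_compose[OF borel_measurable_continuous_onI[OF continuous_on_fst[OF continuous_on_id]] assms])

text \<open>Integrals of the countably many functions \<open>\<phi> l\<close> determine the topology, because a nonnegative
  continuous function is the increasing limit of those below it.\<close>

lemma radon_borel_measurableI:
  fixes \<nu> :: "'b::topological_space => 'a::polish_space measure"
  assumes rad: "\<And>\<gamma>. finite_radon (\<nu> \<gamma>)"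
    and meas: "\<And>h. h \<in> borel_measurable borel ==> (\<lambda>\<gamma>. \<integral>\<^sup>+ x. h x \<partial>\<nu> \<gamma>) \<in> borel_measurable borel"
  shows "\<nu> \<in> borel \<rightarrow>\<^sub>M radon_borel"
proof -
  obtain z :: "nat => 'a" where z: "\<forall>x e. 0 < e --> (\<exists>k. dist x (z k) < e)" using dense_sequence by blast
  \<comment> \<open>Finite maxima of 0 and of cones with apex in the dense sequence, integer slope
    and rational height.\<close>
  define \<phi> :: "(nat \<times> nat \<times> rat) list => 'a => real" where
    "\<phi> l x = foldr (\<lambda>(k, j, q) m. max (of_rat q - real j * dist x (z k)) m) l 0" for l x
  have \<phi>_simps: "\<phi> [] x = 0" "\<phi> ((k, j, q) # l) x = max (of_rat q - real j * dist x (z k)) (\<phi> l x)" for k j q l x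
    by (simp_all add: \<phi>_def)
  have \<phi>0: "0 <= \<phi> l x" for l x by (induction l) (auto simp: \<phi>_simps)
  have \<phi>_app: "\<phi> (l @ l') x = max (\<phi> l x) (\<phi> l' x)" for l l' x
    by (induction l) (auto simp: \<phi>_simps \<phi>0)
  have \<phi>c: "continuous_on UNIV (\<phi> l)" for l
  proof (induction l)
    case (Cons a l)
    then show ?case by (cases a) (auto simp: \<phi>_simps[abs_def] intro!: continuous_intros)
  qed (simp add: \<phi>_simps[abs_def])
  have approx: "\<exists>l. (\<forall>x. \<phi> l x <= g x) \<and> (LINT x|M. g x) - e < (LINT x|M. \<phi> l x)"
    if g: "continuous_on UNIV g" "\<And>x. 0 <= g x" and M: "sets M = sets borel" and ig: "integrable M g" and e: "0 < e" for g M and e :: real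
  proof -
    define p where "p n = (let l = from_nat n in if \<forall>x. \<phi> l x <= g x then l else [])" for n
    define L where "L n = concat (map p [0..<n])" for n
    have pg: "\<phi> (p n) x <= g x" for n x using g(2) by (auto simp: p_def Let_def \<phi>_simps)
    have LS: "\<phi> (L (Suc n)) x = max (\<phi> (L n) x) (\<phi> (p n) x)" for n x by (simp add: L_def \<phi>_app)
    have Lg: "\<phi> (L n) x <= g x" for n x
      by (induction n) (auto simp: LS pg, simp add: L_def \<phi>_simps g(2))
    have mono: "\<phi> (L m) x <= \<phi> (L n) x" if "m <= n" for m n x
      by (rule lift_Suc_mono_le[of "\<lambda>n. \<phi> (L n) x", OF _ that]) (simp add: LS)
    have lim: "(\<lambda>n. \<phi> (L n) x) \<longlonglongrightarrow> g x" for x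
    proof (rule LIMSEQ_I)
      fix r :: real assume r: "0 < r"
      obtain q where q: "g x - r < of_rat q" "of_rat q < g x - r / 2" using of_rat_dense[of "g x - r" "g x - r / 2"] r by auto
      obtain d where d: "0 < d" "\<And>y. dist y x < d ==> dist (g y) (g x) < r / 2"
        using g(1) r unfolding continuous_on_iff by (metis UNIV_I half_gt_zero)
      obtain j :: nat where j: "2 * g x / d < real j" using reals_Archimedean2 by blast
      define r' where "r' = (of_rat q - (g x - r)) / (real j + 1)"
      have r': "0 < r'" "real j * r' < of_rat q - (g x - r)" using q(1) by (simp_all add: r'_def field_simps)
      obtain k where k: "dist x (z k) < min r' (d / 2)" using z r'(1) d(1) by (metis half_gt_zero min_less_iff_conj)
      have "of_rat q - real j * dist y (z k) <= g y" for y
      proof (cases "dist y x < d")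
        case True
        then have "of_rat q <= g y" using d(2)[OF True] q(2) unfolding dist_real_def by linarith
        then show ?thesis using mult_nonneg_nonneg[of "real j" "dist y (z k)"] zero_le_dist[of y "z k"] by linarith
      next
        case False
        then have "d / 2 <= dist y (z k)" using k dist_triangle[of y x "z k"] by (simp add: dist_commute)
        then have "real j * (d / 2) <= real j * dist y (z k)" by (rule mult_left_mono) simp
        moreover have "g x < real j * (d / 2)" using j d(1) by (simp add: field_simps)
        ultimately show ?thesis using q(2) r g(2)[of y] by linarith
      qed
      then have "\<forall>y. \<phi> [(k, j, q)] y <= g y" using g(2) by (simp add: \<phi>_simps)
      then have "p (to_nat [(k, j, q)]) = [(k, j, q)]" by (simp add: p_def)
      then have "of_rat q - real j * dist x (z k) <= \<phi> (L (Suc (to_nat [(k, j, q)]))) x" by (simp add: LS \<phi>_simps)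
      moreover have "real j * dist x (z k) <= real j * r'" using k by (intro mult_left_mono) auto
      ultimately have "g x - r < \<phi> (L (Suc (to_nat [(k, j, q)]))) x" using r'(2) by linarith
      then have "norm (\<phi> (L n) x - g x) < r" if "Suc (to_nat [(k, j, q)]) <= n" for n
        using mono[OF that, of x] Lg[of n x] by simp
      then show "\<exists>no. \<forall>n\<ge>no. norm (\<phi> (L n) x - g x) < r" by blast
    qed
    have m: "f \<in> borel_measurable M" if "continuous_on UNIV f" for f :: "'a => real"
      unfolding measurable_cong_sets[OF M refl] by (rule borel_measurable_continuous_onI[OF that])
    have "(\<lambda>n. LINT x|M. \<phi> (L n) x) \<longlonglongrightarrow> (LINT x|M. g x)"
      by (rule integral_dominated_convergence[OF m[OF g(1)] m[OF \<phi>c] ig]) (auto simp: lim Lg \<phi>0)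
    then have "\<forall>\<^sub>F n in sequentially. (LINT x|M. g x) - e < (LINT x|M. \<phi> (L n) x)"
      by (rule order_tendstoD) (use e in simp)
    then show ?thesis using Lg eventually_happens'[OF sequentially_bot] by blast
  qed
  have s\<nu>: "sets (\<nu> \<gamma>) = sets borel" and fin: "finite_measure (\<nu> \<gamma>)" for \<gamma> using rad[of \<gamma>] by (auto simp: finite_radon_def)
  define h where "h \<gamma> l = (LINT x|\<nu> \<gamma>. \<phi> l x)" for \<gamma> l
  have hm: "h \<in> borel_measurable borel"
  proof (rule measurable_coordinatewise_then_product)
    fix l
    have "\<phi> l \<in> borel_measurable borel" by (rule borel_measurable_continuous_onI[OF \<phi>c])
    then have "h \<gamma> l = enn2real (\<integral>\<^sup>+ x. ennreal (\<phi> l x) \<partial>\<nu> \<gamma>)" for \<gamma>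
      unfolding h_def by (intro integral_eq_nn_integral) (simp_all add: \<phi>0 measurable_cong_sets[OF s\<nu> refl])
    then show "(\<lambda>\<gamma>. h \<gamma> l) \<in> borel_measurable borel"
      using \<open>\<phi> l \<in> _\<close> by (simp add: borel_measurable_enn2real meas)
  qed
  define \<S> where "\<S> = {{\<mu>. finite_radon \<mu> \<and> (LINT x|\<mu>. g x) \<in> U} | (g :: 'a => real) U. continuous_on UNIV g \<and> bounded (range g) \<and> open U}"
  \<comment> \<open>Open sets are arbitrary unions of finite intersections of generators, so
    measurable preimages of generators would not be enough. Writing all preimages as preimages under
    \<open>h\<close> of open sets survives arbitrary unions, because \<open>h\<close> has values in
    a countable product of lines.\<close>
  have pull: "\<exists>V. open V \<and> \<nu> -` W = h -` V" if "generate_topology_on \<S> W" for W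
    using that
  proof induction
    case Empty
    show ?case by (rule exI[of _ "{}"]) simp
  next
    case (Int W1 W2)
    then show ?case by (metis open_Int vimage_Int)
  next
    case (UN K)
    then have "\<forall>k\<in>K. \<exists>V. open V \<and> \<nu> -` k = h -` V" by blast
    from bchoice[OF this] obtain f where "\<forall>k\<in>K. open (f k) \<and> \<nu> -` k = h -` f k" by blast
    then show ?case by (intro exI[of _ "\<Union>k\<in>K. f k"]) (auto simp: vimage_Union vimage_UN)
  next
    case (Basis W)
    then obtain g :: "'a => real" and U :: "real set" where W: "W = {\<mu>. finite_radon \<mu> \<and> (LINT x|\<mu>. g x) \<in> U}" "continuous_on UNIV g" "bounded (range g)" "open U"
      unfolding \<S>_def by blast
    obtain b where b: "\<And>x. \<bar>g x\<bar> <= b" using W(3) unfolding bounded_real by blast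
    have "\<exists>V. open V \<and> h \<gamma> \<in> V \<and> h -` V \<subseteq> \<nu> -` W" if \<gamma>: "\<nu> \<gamma> \<in> W" for \<gamma>
    proof -
      define I where "I = (LINT x|\<nu> \<gamma>. g x)"
      have "I \<in> U" using \<gamma> by (simp add: W(1) I_def)
      then obtain e where e: "0 < e" "\<And>y. dist y I < e ==> y \<in> U" using W(4) unfolding open_dist by blast
      let ?one = "[(0, 0, 1)] :: (nat \<times> nat \<times> rat) list"
      have int: "integrable (\<nu> \<gamma>') f" if "continuous_on UNIV f" "\<And>x. \<bar>f x\<bar> <= c" for f :: "'a => real" and \<gamma>' c
      proof -
        have "f \<in> borel_measurable (\<nu> \<gamma>')"
          unfolding measurable_cong_sets[OF s\<nu> refl] by (rule borel_measurable_continuous_onI[OF that(1)])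
        then show ?thesis using that(2) by (intro finite_measure.integrable_const_bound[OF fin, of _ c]) auto
      qed
      \<comment> \<open>Both \<open>g + b\<close> and \<open>b - g\<close> are nonnegative.
        Approximating them from below bounds the integral of \<open>g\<close> from both sides; the
        total mass is the integral of the function coded by \<open>?one\<close>.\<close>
      have gb: "\<bar>g x + b\<bar> <= 2 * b" "\<bar>b - g x\<bar> <= 2 * b" "0 <= g x + b" "0 <= b - g x" for x using b[of x] by auto
      have c: "continuous_on UNIV (\<lambda>x. g x + b)" "continuous_on UNIV (\<lambda>x. b - g x)" by (intro continuous_intros W(2))+
      have one: "h \<gamma>' ?one = measure (\<nu> \<gamma>') UNIV" for \<gamma>'
        using sets_eq_imp_space_eq[OF s\<nu>[of \<gamma>']] by (simp add: h_def \<phi>_simps)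
      have eq: "(LINT x|\<nu> \<gamma>'. g x + b) = (LINT x|\<nu> \<gamma>'. g x) + b * h \<gamma>' ?one" "(LINT x|\<nu> \<gamma>'. b - g x) = b * h \<gamma>' ?one - (LINT x|\<nu> \<gamma>'. g x)" for \<gamma>'
        using int[OF W(2) b, of \<gamma>'] finite_measure.integrable_const[OF fin, of \<gamma>' b] sets_eq_imp_space_eq[OF s\<nu>[of \<gamma>']] by (simp_all add: one)
      obtain l1 where l1: "\<And>x. \<phi> l1 x <= g x + b" "(LINT x|\<nu> \<gamma>. g x + b) - e < h \<gamma> l1"
        using approx[OF c(1) gb(3) s\<nu> int[OF c(1) gb(1)] e(1), of \<gamma>] unfolding h_def by blast
      obtain l2 where l2: "\<And>x. \<phi> l2 x <= b - g x" "(LINT x|\<nu> \<gamma>. b - g x) - e < h \<gamma> l2"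
        using approx[OF c(2) gb(4) s\<nu> int[OF c(2) gb(2)] e(1), of \<gamma>] unfolding h_def by blast
      have up: "h \<gamma>' l1 <= (LINT x|\<nu> \<gamma>'. g x + b)" "h \<gamma>' l2 <= (LINT x|\<nu> \<gamma>'. b - g x)" for \<gamma>'
      proof -
        have "\<bar>\<phi> l1 x\<bar> <= 2 * b" "\<bar>\<phi> l2 x\<bar> <= 2 * b" for x using l1(1)[of x] l2(1)[of x] \<phi>0[of _ x] gb(1,2)[of x] by (smt (verit))+
        then show "h \<gamma>' l1 <= (LINT x|\<nu> \<gamma>'. g x + b)" "h \<gamma>' l2 <= (LINT x|\<nu> \<gamma>'. b - g x)"
          unfolding h_def by - (rule integral_mono[OF int[OF \<phi>c] int[OF c(1) gb(1)] l1(1)], assumption, rule integral_mono[OF int[OF \<phi>c] int[OF c(2) gb(2)] l2(1)])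
      qed
      show ?thesis
      proof (intro exI[of _ "{y. I - e < y l1 - b * y ?one} \<inter> {y. b * y ?one - y l2 < I + e}"] conjI subsetI)
        show "open ({y. I - e < y l1 - b * y ?one} \<inter> {y. b * y ?one - y l2 < I + e})"
          by (intro open_Int open_Collect_less continuous_intros continuous_on_product_coordinates)
        show "h \<gamma> \<in> {y. I - e < y l1 - b * y ?one} \<inter> {y. b * y ?one - y l2 < I + e}"
          using l1(2) l2(2) unfolding eq I_def by auto
        fix \<gamma>' assume "\<gamma>' \<in> h -` ({y. I - e < y l1 - b * y ?one} \<inter> {y. b * y ?one - y l2 < I + e})"
        then have "dist (LINT x|\<nu> \<gamma>'. g x) I < e" using up[of \<gamma>'] unfolding eq by (auto simp: dist_real_def abs_less_iff)
        then show "\<gamma>' \<in> \<nu> -` W" using rad e(2) by (simp add: W(1))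
      qed
    qed
    then have "\<forall>\<gamma>\<in>\<nu> -` W. \<exists>V. open V \<and> h \<gamma> \<in> V \<and> h -` V \<subseteq> \<nu> -` W" by blast
    from bchoice[OF this] obtain f where "\<forall>\<gamma>\<in>\<nu> -` W. open (f \<gamma>) \<and> h \<gamma> \<in> f \<gamma> \<and> h -` f \<gamma> \<subseteq> \<nu> -` W" by blast
    then show ?case by (intro exI[of _ "\<Union>\<gamma>\<in>\<nu> -` W. f \<gamma>"]) (auto simp: vimage_UN)
  qed
  have rt: "radon_topology = topology_generated_by \<S>" by (simp add: radon_topology_def \<S>_def)
  show ?thesis
    unfolding radon_borel_def
  proof (rule measurable_measure_of)
    have "topspace radon_topology \<subseteq> {\<mu> :: 'a measure. finite_radon \<mu>}" unfolding rt topology_generated_by_topspace by (auto simp: \<S>_def)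
    then show "{W. openin radon_topology (W :: 'a measure set)} \<subseteq> Pow {\<mu>. finite_radon \<mu>}" using openin_subset by blast
    show "\<nu> \<in> space borel \<rightarrow> {\<mu>. finite_radon \<mu>}" using rad by simp
    fix W assume "W \<in> {W. openin radon_topology (W :: 'a measure set)}"
    then obtain V where "open V" "\<nu> -` W = h -` V" using pull[of W] by (auto simp: rt openin_topology_generated_by_iff)
    then show "\<nu> -` W \<inter> space borel \<in> sets borel" using measurable_sets[OF hm borel_open[of V]] by simp
  qed
qed

text \<open>All weights \<open>(1/2)^(i+1)\<close> are positive, so the mixture has exactly the
  common null sets. Inner regularity follows because finitely many components carry the mixture up
  to a small error, and a finite union of compact sets is compact.\<close>

lemma regular_borel_prob_mixture:
  fixes P :: "nat => 'b::metric_space measure"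
  assumes P: "\<And>i. regular_borel_prob (P i)"
  shows "\<exists>P'. regular_borel_prob P' \<and> (\<forall>f\<in>borel_measurable borel. (\<integral>\<^sup>+ x. f x \<partial>P') = 0 \<longleftrightarrow> (\<forall>i. (\<integral>\<^sup>+ x. f x \<partial>P i) = 0))"
proof -
  define w where "w i = ((1 / 2) ^ Suc i :: real)" for i :: nat
  define g :: "nat pmf" where "g = geometric_pmf (1 / 2)"
  have gw: "pmf g i = w i" for i by (simp add: g_def w_def)
  have sP: "sets (P i) = sets borel" and pP: "prob_space (P i)" and rP: "finite_radon (P i)" for i
    using P[of i] by (simp_all add: regular_borel_prob_def finite_radon_def)
  have k: "P \<in> measure_pmf g \<rightarrow>\<^sub>M subprob_algebra borel"
    using pP sP by (auto simp: space_subprob_algebra intro: prob_space_imp_subprob_space)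
  define P' where "P' = measure_pmf g \<bind> P"
  have sP': "sets P' = sets borel" unfolding P'_def by (rule sets_bind) (simp_all add: sP)
  have int: "(\<integral>\<^sup>+ x. f x \<partial>P') = (\<Sum>i. ennreal (w i) * (\<integral>\<^sup>+ x. f x \<partial>P i))" if f: "f \<in> borel_measurable borel" for f
    unfolding P'_def by (subst nn_integral_bind[OF f k]) (simp add: nn_integral_measure_pmf nn_integral_count_space_nat gw)
  have pr: "prob_space P'" unfolding P'_def by (rule measure_pmf.prob_space_bind[OF _ k]) (simp add: pP)
  interpret P': prob_space P' by (rule pr)
  have w0: "0 <= w i" for i by (simp add: w_def)
  have wsum: "summable w" "(\<Sum>i. w i) = 1"
    using power_half_series unfolding w_def sums_iff by auto
  have ms: "(\<lambda>i. w i * measure (P i) A) sums measure P' A" if A: "A \<in> sets borel" for A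
  proof -
    have le: "w i * measure (P i) A <= w i" for i
      using prob_space.prob_le_1[OF pP] w0 by (simp add: mult_left_le)
    have s: "summable (\<lambda>i. w i * measure (P i) A)"
      by (rule summable_comparison_test[OF _ wsum(1)]) (use le w0 in auto)
    have "emeasure P' A = (\<Sum>i. ennreal (w i) * emeasure (P i) A)"
      using int[of "indicator A"] A by (simp add: sP sP')
    also have "... = (\<Sum>i. ennreal (w i * measure (P i) A))"
      using finite_measure.emeasure_eq_measure[OF prob_space.finite_measure[OF pP]] w0 by (simp add: ennreal_mult)
    also have "... = ennreal (\<Sum>i. w i * measure (P i) A)" using w0 s by (intro suminf_ennreal2) auto
    finally have "measure P' A = (\<Sum>i. w i * measure (P i) A)"
      using w0 s by (simp add: measure_def suminf_nonneg)
    then show ?thesis using s by (simp add: sums_iff)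
  qed
  have "regular_borel_prob P'"
  proof (rule regular_borel_probI[OF pr sP'])
    fix A e assume A: "A \<in> sets (borel :: 'b measure)" and e: "0 < (e::real)"
    have "\<forall>i. \<exists>C. compact C \<and> C \<subseteq> A \<and> measure (P i) A <= measure (P i) C + e / 2"
      using finite_radon_inner[OF rP A, of "e / 2"] e by simp
    from choice[OF this] obtain C where C: "\<forall>i. compact (C i) \<and> C i \<subseteq> A \<and> measure (P i) A <= measure (P i) (C i) + e / 2" by (elim exE)
    have "(\<lambda>n. \<Sum>i<n. w i * measure (P i) A) \<longlonglongrightarrow> measure P' A" using ms[OF A] by (simp add: sums_def)
    then have "\<forall>\<^sub>F n in sequentially. measure P' A - e / 2 < (\<Sum>i<n. w i * measure (P i) A)"
      by (rule order_tendstoD) (use e in simp)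
    then obtain n where n: "measure P' A - e / 2 < (\<Sum>i<n. w i * measure (P i) A)" by (auto simp: eventually_sequentially)
    define K where "K = (\<Union>i<n. C i)"
    have K: "compact K" "K \<subseteq> A" using C by (auto simp: K_def intro!: compact_UN)
    have Kb: "K \<in> sets borel" using compact_imp_closed[OF K(1)] by simp
    have "(\<Sum>i<n. w i * measure (P i) A) <= (\<Sum>i<n. w i * measure (P i) K + w i * (e / 2))"
    proof (rule sum_mono)
      fix i assume i: "i \<in> {..<n}"
      have "measure (P i) (C i) <= measure (P i) K"
        using i Kb sP by (intro finite_measure.finite_measure_mono[OF prob_space.finite_measure[OF pP]]) (auto simp: K_def)
      then have "measure (P i) A <= measure (P i) K + e / 2" using spec[OF C, of i] by simp
      then have "w i * measure (P i) A <= w i * (measure (P i) K + e / 2)" using w0 by (rule mult_left_mono)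
      then show "w i * measure (P i) A <= w i * measure (P i) K + w i * (e / 2)" by (simp add: distrib_left)
    qed
    also have "... = (\<Sum>i<n. w i * measure (P i) K) + (\<Sum>i<n. w i) * (e / 2)" by (simp add: sum.distrib sum_distrib_right)
    also have "... <= measure P' K + 1 * (e / 2)"
    proof (intro add_mono mult_right_mono)
      show "(\<Sum>i<n. w i * measure (P i) K) <= measure P' K"
        using sum_le_suminf[of "\<lambda>i. w i * measure (P i) K" "{..<n}"] ms[OF Kb] w0 by (simp add: sums_iff)
      show "(\<Sum>i<n. w i) <= 1" using sum_le_suminf[of w "{..<n}"] wsum w0 by simp
    qed (use e in simp)
    finally have "measure P' A <= measure P' K + e" using n by simp
    then show "\<exists>K. compact K \<and> K \<subseteq> A \<and> measure P' A <= measure P' K + e" using K by blast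
  qed
  moreover have "ennreal (w i) ~= 0" for i by (simp add: w_def)
  ultimately show ?thesis using int by (intro exI[of _ P']) (simp add: suminf_eq_zero_iff)
qed

text \<open>The laws of all pieces are mixed into one law \<open>P\<close>. The resulting mixture
  \<open>Q\<close> of occupation measures dominates \<open>\<mu>\<close>, and the density
  \<open>\<rho>\<close> of \<open>\<mu>\<close> with respect to \<open>Q\<close> is at the same time
  the density of each \<open>\<nu> \<gamma>\<close> with respect to the occupation measure of
  \<open>\<gamma>\<close>.\<close>

lemma alberti_glue:
  fixes \<mu> :: "'a::polish_space measure" and \<Gamma> :: "nat => 'a fragment set"
  assumes \<mu>: "sets \<mu> = sets borel" "finite_measure \<mu>" and piece: "\<And>i. alberti_piece \<mu> (\<Gamma> i) (A i)" and \<Gamma>: "\<And>i. compact (\<Gamma> i)"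
    and dom: "\<And>i. \<forall>\<gamma>\<in>\<Gamma> i. frag_dom \<gamma> \<subseteq> {0..1}"
    and expand: "\<And>i \<gamma> s t. \<gamma> \<in> \<Gamma> i ==> s \<in> frag_dom \<gamma> ==> t \<in> frag_dom \<gamma> ==> \<bar>s - t\<bar> <= dist (frag_eval \<gamma> s) (frag_eval \<gamma> t)"
    and A: "\<And>i. A i \<in> sets borel" "emeasure \<mu> (UNIV - (\<Union>i. A i)) = 0"
  shows "\<exists>P \<nu>. alberti_representation \<mu> P \<nu> \<and> (AE \<gamma> in P. \<gamma> \<in> (\<Union>i. \<Gamma> i))"
proof -
  have "\<forall>i. alberti_piece \<mu> (\<Gamma> i) (A i)" using piece by blast
  then obtain P0 where P0: "\<And>i. regular_borel_prob (P0 i)" "\<And>i. AE \<gamma> in P0 i. \<gamma> \<in> \<Gamma> i"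
    "\<And>i X. X \<in> sets borel ==> X \<subseteq> A i ==> (\<integral>\<^sup>+ \<gamma>. emeasure (occupation \<gamma>) X \<partial>P0 i) = 0 ==> emeasure \<mu> X = 0"
    unfolding alberti_piece_def by metis
  define U where "U = (\<Union>i. \<Gamma> i)"
  have Ub: "U \<in> sets borel" using compact_imp_closed[OF \<Gamma>] unfolding U_def by (intro sets.countable_UN) auto
  have Ud: "\<forall>\<gamma>\<in>U. frag_dom \<gamma> \<subseteq> {0..1}" using dom by (auto simp: U_def)
  have P0U: "AE \<gamma> in P0 i. \<gamma> \<in> U" for i using P0(2)[of i] by (rule eventually_mono) (auto simp: U_def)
  obtain P where P: "regular_borel_prob P" "\<And>f. f \<in> borel_measurable borel ==> (\<integral>\<^sup>+ x. f x \<partial>P) = 0 \<longleftrightarrow> (\<forall>i. (\<integral>\<^sup>+ x. f x \<partial>P0 i) = 0)"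
    using regular_borel_prob_mixture[of P0, OF P0(1)] by blast
  have sP: "sets P = sets borel" using P(1) by (simp add: regular_borel_prob_def finite_radon_def)
  have "(\<integral>\<^sup>+ \<gamma>. indicator (- U) \<gamma> \<partial>P0 i) = (\<integral>\<^sup>+ \<gamma>. 0 \<partial>P0 i)" for i
    using P0U[of i] by (intro nn_integral_cong_AE) (auto elim!: eventually_mono)
  then have "(\<integral>\<^sup>+ \<gamma>. indicator (- U) \<gamma> \<partial>P) = 0" using P(2)[of "indicator (- U)"] Ub by simp
  then have "- U \<in> null_sets P" using Ub sP by (simp add: null_sets_def)
  then have PU: "AE \<gamma> in P. \<gamma> \<in> U" by (rule eventually_mono[OF AE_not_in]) simp
  obtain Q where Q: "finite_measure Q" "sets Q = sets borel"
    "\<And>h. h \<in> borel_measurable borel ==> (\<integral>\<^sup>+ x. h x \<partial>Q) = (\<integral>\<^sup>+ \<gamma>. (\<integral>\<^sup>+ x. h x \<partial>occupation \<gamma>) \<partial>P)"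
    using occupation_mixture[OF Ub Ud P(1) PU] by blast
  define J where "J h \<gamma> = (if \<gamma> \<in> U then \<integral>\<^sup>+ z. h z \<partial>graph_measure \<gamma> else 0)" for h and \<gamma> :: "'a fragment"
  have Jm: "J h \<in> borel_measurable borel" if "h \<in> borel_measurable borel" for h
    unfolding J_def[abs_def] by (rule occupation_measurable[OF Ub Ud that])
  have Jocc: "J (\<lambda>z. h (snd z)) \<gamma> = (\<integral>\<^sup>+ x. h x \<partial>occupation \<gamma>)" if "h \<in> borel_measurable borel" "\<gamma> \<in> U" for h \<gamma>
    using that by (simp add: J_def nn_integral_occupation)
  have JQ: "(\<integral>\<^sup>+ \<gamma>. J (\<lambda>z. h (snd z)) \<gamma> \<partial>P) = (\<integral>\<^sup>+ x. h x \<partial>Q)" if "h \<in> borel_measurable borel" for h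
    unfolding Q(3)[OF that] using PU by (intro nn_integral_cong_AE) (auto simp: Jocc[OF that] elim!: eventually_mono)
  have "absolutely_continuous Q \<mu>"
    unfolding absolutely_continuous_def
  proof
    fix X assume X: "X \<in> null_sets Q"
    then have Xb: "X \<in> sets borel" using Q(2) by auto
    have Xi: "emeasure \<mu> (X \<inter> A i) = 0" for i
    proof (rule P0(3)[of _ i])
      have XA: "X \<inter> A i \<in> sets borel" using Xb A(1) by auto
      then show "X \<inter> A i \<in> sets borel" .
      have ind: "indicator (X \<inter> A i) \<in> borel_measurable borel" using XA by simp
      have "X \<inter> A i \<in> null_sets Q" using X A(1) Q(2) by (intro null_set_Int2) auto
      then have "(\<integral>\<^sup>+ x. indicator (X \<inter> A i) x \<partial>Q) = 0" by (simp add: null_sets_def)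
      then have "(\<integral>\<^sup>+ \<gamma>. J (\<lambda>z. indicator (X \<inter> A i) (snd z)) \<gamma> \<partial>P) = 0" by (simp add: JQ[OF ind])
      then have "(\<integral>\<^sup>+ \<gamma>. J (\<lambda>z. indicator (X \<inter> A i) (snd z)) \<gamma> \<partial>P0 i) = 0"
        using P(2)[OF Jm[OF borel_measurable_comp_snd[OF ind]]] by blast
      moreover have "(\<integral>\<^sup>+ \<gamma>. J (\<lambda>z. indicator (X \<inter> A i) (snd z)) \<gamma> \<partial>P0 i) = (\<integral>\<^sup>+ \<gamma>. emeasure (occupation \<gamma>) (X \<inter> A i) \<partial>P0 i)"
        using P0U[of i] XA by (intro nn_integral_cong_AE) (auto simp: Jocc[OF ind] elim!: eventually_mono)
      ultimately show "(\<integral>\<^sup>+ \<gamma>. emeasure (occupation \<gamma>) (X \<inter> A i) \<partial>P0 i) = 0" by simp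
    qed simp
    have "(\<Union>i. X \<inter> A i) \<union> (UNIV - (\<Union>i. A i)) \<in> null_sets \<mu>"
      using Xi Xb A \<mu>(1) by (intro null_sets.Un null_sets_UN) (auto simp: null_sets_def)
    then show "X \<in> null_sets \<mu>" using Xb \<mu>(1) by (elim null_sets_subset) auto
  qed
  then have RN0: "density Q (RN_deriv Q \<mu>) = \<mu>"
    using finite_measure.sigma_finite_measure[OF Q(1)] \<mu>(1) Q(2) by (intro sigma_finite_measure.density_RN_deriv) auto
  define \<rho> where "\<rho> = RN_deriv Q \<mu>"
  have RN: "density Q \<rho> = \<mu>" unfolding \<rho>_def by (rule RN0)
  have \<rho>: "\<rho> \<in> borel_measurable borel"
    unfolding \<rho>_def measurable_cong_sets[OF Q(2)[symmetric] refl] by (rule borel_measurable_RN_deriv)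
  have \<mu>int: "(\<integral>\<^sup>+ x. \<rho> x * h x \<partial>Q) = (\<integral>\<^sup>+ x. h x \<partial>\<mu>)" if "h \<in> borel_measurable borel" for h
    using \<rho> that unfolding RN[symmetric] by (subst nn_integral_density) (simp_all add: measurable_cong_sets[OF Q(2) refl])
  have \<rho>s: "(\<lambda>z :: real \<times> 'a. \<rho> (snd z)) \<in> borel_measurable borel" by (rule borel_measurable_comp_snd[OF \<rho>])
  \<comment> \<open>\<open>\<nu> \<gamma>\<close> has to be a finite measure for every fragment.
    Those with an infinite integral of \<open>\<rho>\<close> form a \<open>P\<close>-null set and
    receive the zero measure.\<close>
  define G where "G = U \<inter> {\<gamma>\<in>space borel. J (\<lambda>z. \<rho> (snd z)) \<gamma> < \<infinity>}"
  have Gb: "G \<in> sets borel" unfolding G_def using Ub Jm[OF \<rho>s] by measurable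
  have PG: "AE \<gamma> in P. \<gamma> \<in> G"
  proof -
    have "(\<integral>\<^sup>+ \<gamma>. J (\<lambda>z. \<rho> (snd z)) \<gamma> \<partial>P) = emeasure \<mu> (space \<mu>)" using \<mu>int[of "\<lambda>_. 1"] by (simp add: JQ[OF \<rho>])
    then have "(\<integral>\<^sup>+ \<gamma>. J (\<lambda>z. \<rho> (snd z)) \<gamma> \<partial>P) ~= \<infinity>" using finite_measure.emeasure_finite[OF \<mu>(2)] by simp
    then have "AE \<gamma> in P. J (\<lambda>z. \<rho> (snd z)) \<gamma> ~= \<infinity>"
      using Jm[OF \<rho>s] by (intro nn_integral_PInf_AE) (simp_all add: measurable_cong_sets[OF sP refl])
    with PU show ?thesis by eventually_elim (simp add: G_def less_top)
  qed
  define \<nu> where "\<nu> \<gamma> = density (occupation \<gamma>) (\<lambda>x. indicator G \<gamma> * \<rho> x)" for \<gamma>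
  have s\<nu>: "sets (\<nu> \<gamma>) = sets borel" for \<gamma> by (simp add: \<nu>_def)
  have nn\<nu>: "(\<integral>\<^sup>+ x. h x \<partial>\<nu> \<gamma>) = indicator G \<gamma> * J (\<lambda>z. \<rho> (snd z) * h (snd z)) \<gamma>" if h: "h \<in> borel_measurable borel" for h \<gamma>
  proof -
    have "(\<integral>\<^sup>+ x. h x \<partial>\<nu> \<gamma>) = (\<integral>\<^sup>+ x. indicator G \<gamma> * \<rho> x * h x \<partial>occupation \<gamma>)"
      unfolding \<nu>_def using \<rho> h by (intro nn_integral_density) (auto cong: measurable_cong_sets)
    then show ?thesis using Jocc[of "\<lambda>x. \<rho> x * h x" \<gamma>] \<rho> h by (cases "\<gamma> \<in> G") (simp_all add: G_def)
  qed
  have em\<nu>: "emeasure (\<nu> \<gamma>) X = indicator G \<gamma> * J (\<lambda>z. \<rho> (snd z) * indicator X (snd z)) \<gamma>" if "X \<in> sets borel" for X \<gamma>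
    using nn\<nu>[of "indicator X" \<gamma>] that by (simp add: s\<nu>)
  have fin: "finite_measure (\<nu> \<gamma>)" for \<gamma>
    using em\<nu>[of UNIV \<gamma>] sets_eq_imp_space_eq[OF s\<nu>[of \<gamma>]] by (intro finite_measureI) (auto simp: G_def indicator_def)
  have meas: "(\<lambda>\<gamma>. indicator G \<gamma> * J (\<lambda>z. \<rho> (snd z) * h z) \<gamma>) \<in> borel_measurable borel" if h: "h \<in> borel_measurable borel" for h
    using Gb Jm[OF borel_measurable_times_ennreal[OF \<rho>s h]] by measurable
  have radon: "\<nu> \<in> borel \<rightarrow>\<^sub>M radon_borel"
    by (intro radon_borel_measurableI finite_radonI s\<nu> fin) (simp add: nn\<nu> meas borel_measurable_comp_snd)
  have ac: "emeasure (\<nu> \<gamma>) X = 0" if X: "X \<in> sets borel" "hausdorff1 (X \<inter> frag_eval \<gamma> ` frag_dom \<gamma>) = 0" for \<gamma> X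
  proof (cases "\<gamma> \<in> G")
    case True
    then obtain i where i: "\<gamma> \<in> \<Gamma> i" by (auto simp: G_def U_def)
    have "emeasure (occupation \<gamma>) X = 0" by (rule occupation_null_if_hausdorff1_null[OF expand[OF i] X])
    then have "X \<in> null_sets (occupation \<gamma>)" using X(1) by (simp add: null_sets_def)
    then have "X \<in> null_sets (\<nu> \<gamma>)" unfolding \<nu>_def using \<rho> by (subst null_sets_density_iff) (auto cong: measurable_cong_sets dest: AE_not_in elim!: eventually_mono)
    then show ?thesis by auto
  qed (simp add: em\<nu>[OF X(1)])
  have repr: "emeasure \<mu> X = (\<integral>\<^sup>+ \<gamma>. emeasure (\<nu> \<gamma>) X \<partial>P)" if X: "X \<in> sets borel" for X
  proof -
    have m: "(\<lambda>x. \<rho> x * indicator X x) \<in> borel_measurable borel" using \<rho> X by measurable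
    have "(\<integral>\<^sup>+ \<gamma>. emeasure (\<nu> \<gamma>) X \<partial>P) = (\<integral>\<^sup>+ \<gamma>. J (\<lambda>z. \<rho> (snd z) * indicator X (snd z)) \<gamma> \<partial>P)"
      using PG by (intro nn_integral_cong_AE) (auto simp: em\<nu>[OF X] elim!: eventually_mono)
    also have "... = emeasure \<mu> X" unfolding JQ[OF m] using X \<mu>(1) by (subst \<mu>int) simp_all
    finally show ?thesis ..
  qed
  have slice: "(\<lambda>\<gamma>. emeasure (\<nu> \<gamma>) (X \<inter> frag_eval \<gamma> ` (frag_dom \<gamma> \<inter> {a..b}))) \<in> borel_measurable borel" if X: "X \<in> sets borel" for X a b
  proof -
    \<comment> \<open>A fragment in \<open>U\<close> is injective, so a point lies in the image of
      the times in \<open>{a..b}\<close> exactly if its own time does. The slice thereby becomes an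
      integral over the graph.\<close>
    define h :: "real \<times> 'a => ennreal" where "h z = indicator {a..b} (fst z) * indicator X (snd z)" for z
    have hm: "h \<in> borel_measurable borel"
      unfolding h_def using borel_measurable_comp_snd[OF borel_measurable_indicator[OF X]] borel_measurable_comp_fst[OF borel_measurable_indicator[of "{a..b}"]]
      by measurable
    have "emeasure (\<nu> \<gamma>) (X \<inter> frag_eval \<gamma> ` (frag_dom \<gamma> \<inter> {a..b})) = indicator G \<gamma> * J (\<lambda>z. \<rho> (snd z) * h z) \<gamma>" for \<gamma>
    proof -
      let ?Y = "X \<inter> frag_eval \<gamma> ` (frag_dom \<gamma> \<inter> {a..b})"
      have "compact (frag_eval \<gamma> ` (frag_dom \<gamma> \<inter> {a..b}))"
        by (intro compact_continuous_image compact_Int compact_frag_dom compact_Icc continuous_on_subset[OF continuous_on_frag_eval]) auto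
      then have Y: "?Y \<in> sets borel" by (intro sets.Int X borel_closed compact_imp_closed)
      have "J (\<lambda>z. \<rho> (snd z) * indicator ?Y (snd z)) \<gamma> = J (\<lambda>z. \<rho> (snd z) * h z) \<gamma>" if \<gamma>: "\<gamma> \<in> U"
      proof -
        have "(\<integral>\<^sup>+ z. \<rho> (snd z) * indicator ?Y (snd z) \<partial>graph_measure \<gamma>) = (\<integral>\<^sup>+ z. \<rho> (snd z) * h z \<partial>graph_measure \<gamma>)"
        proof (intro nn_integral_graph_measure_cong borel_measurable_times_ennreal \<rho>s hm borel_measurable_comp_snd[OF borel_measurable_indicator[OF Y]])
          fix t assume t: "t \<in> frag_dom \<gamma>"
          have inj: "s = t" if "s \<in> frag_dom \<gamma>" "frag_eval \<gamma> s = frag_eval \<gamma> t" for s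
            using \<gamma> expand[OF _ that(1) t] that(2) by (auto simp: U_def)
          have "frag_eval \<gamma> t \<in> frag_eval \<gamma> ` (frag_dom \<gamma> \<inter> {a..b}) \<longleftrightarrow> t \<in> {a..b}"
          proof
            assume "frag_eval \<gamma> t \<in> frag_eval \<gamma> ` (frag_dom \<gamma> \<inter> {a..b})"
            then obtain s where "s \<in> frag_dom \<gamma>" "s \<in> {a..b}" "frag_eval \<gamma> s = frag_eval \<gamma> t" by force
            then show "t \<in> {a..b}" using inj[of s] by simp
          qed (use t in auto)
          then show "\<rho> (snd (t, frag_eval \<gamma> t)) * indicator ?Y (snd (t, frag_eval \<gamma> t)) = \<rho> (snd (t, frag_eval \<gamma> t)) * h (t, frag_eval \<gamma> t)"
            by (auto simp: h_def indicator_def)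
        qed
        then show ?thesis by (simp add: J_def)
      qed
      then show ?thesis by (cases "\<gamma> \<in> G") (simp_all add: em\<nu>[OF Y] G_def)
    qed
    then show ?thesis using meas[OF hm] by simp
  qed
  have "alberti_representation \<mu> P \<nu>"
    unfolding alberti_representation_def by (intro conjI P(1) radon ballI allI impI ac repr slice)
  then show ?thesis using PU unfolding U_def by blast
qed

text \<open>All errors are measured in units of \<open>a = w \<bullet> v\<close>. The part of
  \<open>v\<close> off \<open>w\<close> is at most \<open>a / C\<close>, replacing \<open>w\<close>
  by \<open>w'\<close> adds \<open>a / C\<close> and \<open>2 * a / C\<close>, and
  \<open>w' \<bullet> v\<close> is still at least \<open>a * (1 - 2 / C)\<close>. The last
  hypothesis compares these two totals.\<close>

lemma open_cone_perturb:
  fixes v w w' :: "'v::euclidean_space"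
  assumes a: "0 < w \<bullet> v" and gap: "C * norm (v - (w \<bullet> v) *\<^sub>R w) <= w \<bullet> v" and C: "1 <= C"
    and w: "norm w = 1" "norm w' = 1" "norm (w' - w) <= 1 / C" and \<alpha>: "0 < tan \<alpha>" "4 / C < tan \<alpha> * (1 - 2 / C)"
  shows "v \<in> open_cone w' \<alpha>"
proof -
  define a where "a = w \<bullet> v"
  have a0: "0 < a" using assms(1) by (simp add: a_def)
  have r: "norm (v - a *\<^sub>R w) <= a / C" using gap C by (simp add: a_def pos_le_divide_eq mult.commute)
  have "norm v <= norm (v - a *\<^sub>R w) + norm (a *\<^sub>R w)" using norm_triangle_ineq[of "v - a *\<^sub>R w" "a *\<^sub>R w"] by simp
  moreover have "norm (a *\<^sub>R w) = a" using a0 w(1) by simp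
  moreover have "a * 1 <= a * C" using a0 C by (intro mult_left_mono) auto
  then have "a / C <= a" using C by (simp add: divide_le_eq)
  ultimately have nv: "norm v <= 2 * a" using r by simp
  have "\<bar>(w - w') \<bullet> v\<bar> <= norm (w - w') * norm v" by (rule Cauchy_Schwarz_ineq2)
  also have "... <= 1 / C * (2 * a)" using w(3) nv C by (intro mult_mono) (auto simp: norm_minus_commute)
  finally have d: "\<bar>a - w' \<bullet> v\<bar> <= 2 * a / C" by (simp add: a_def inner_diff_left)
  have "norm (v - (w' \<bullet> v) *\<^sub>R w') <= norm (v - a *\<^sub>R w) + norm (a *\<^sub>R (w - w')) + norm ((a - w' \<bullet> v) *\<^sub>R w')"
  proof -
    have "v - (w' \<bullet> v) *\<^sub>R w' = (v - a *\<^sub>R w) + a *\<^sub>R (w - w') + (a - w' \<bullet> v) *\<^sub>R w'" by (simp add: algebra_simps)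
    then have "norm (v - (w' \<bullet> v) *\<^sub>R w') <= norm ((v - a *\<^sub>R w) + a *\<^sub>R (w - w')) + norm ((a - w' \<bullet> v) *\<^sub>R w')"
      by (metis norm_triangle_ineq)
    also have "... <= norm (v - a *\<^sub>R w) + norm (a *\<^sub>R (w - w')) + norm ((a - w' \<bullet> v) *\<^sub>R w')"
      by (intro add_right_mono norm_triangle_ineq)
    finally show ?thesis .
  qed
  also have "norm (a *\<^sub>R (w - w')) <= a / C"
    using mult_left_mono[OF w(3), of a] a0 by (simp add: norm_minus_commute)
  also have "norm ((a - w' \<bullet> v) *\<^sub>R w') <= 2 * a / C" using d w(2) by simp
  finally have "norm (v - (w' \<bullet> v) *\<^sub>R w') <= a / C + a / C + 2 * a / C" using r by linarith
  also have "... = a * (4 / C)" using C by (simp add: field_simps)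
  also have "... < a * (tan \<alpha> * (1 - 2 / C))" using \<alpha>(2) a0 by (intro mult_strict_left_mono)
  also have "... = tan \<alpha> * (a - 2 * a / C)" by (simp add: algebra_simps)
  also have "... <= tan \<alpha> * (w' \<bullet> v)" using d \<alpha>(1) by (intro mult_left_mono) auto
  finally show ?thesis by (simp add: open_cone_def)
qed

lemma has_vector_derivative_vec:
  fixes f :: "'k::finite => real => real"
  assumes "\<And>i. (f i has_real_derivative c i) (at t within K)"
  shows "((\<lambda>s. \<chi> i. f i s) has_vector_derivative (\<chi> i. c i)) (at t within K)"
  unfolding has_vector_derivative_def
proof (subst has_derivative_componentwise_within, intro ballI)
  fix b :: "real ^ 'k" assume "b \<in> Basis"
  then obtain i where b: "b = axis i 1" by (auto simp: Basis_vec_def)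
  have "(f i has_derivative (\<lambda>x. x * c i)) (at t within K)"
    using assms[of i] by (simp add: has_field_derivative_def mult_commute_abs)
  then show "((\<lambda>s. (\<chi> i. f i s) \<bullet> b) has_derivative (\<lambda>x. x *\<^sub>R (\<chi> i. c i) \<bullet> b)) (at t within K)"
    unfolding b by (simp add: inner_axis)
qed

section \<open>Assembling the charts\<close>

abbreviation along :: "real ^ 'k => ('k::finite => 'b => real) => 'b => real" where
  "along w f x \<equiv> \<Sum>m\<in>UNIV. w $ m * f m x"

abbreviation across :: "real ^ 'k => ('k::finite => 'b => real) => 'k => 'b => real" where
  "across w f i x \<equiv> f i x - w $ i * along w f x"

definition cone_fragment :: "real => real => ('k::finite => 'a::metric_space => real) => real ^ 'k => real => 'a set => 'a fragment => bool" where
  "cone_fragment \<epsilon> C \<pi> w \<kappa> S \<gamma> \<longleftrightarrow> frag_graph \<gamma> \<subseteq> UNIV \<times> S \<and> frag_graph \<gamma> \<times> frag_graph \<gamma> \<subseteq>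
     graph_rel (\<lambda>s x t y. 1 * (t - s) <= dist x y \<and> dist x y <= (1 + \<epsilon>) * (t - s) \<and>
       \<kappa> * (t - s) <= cone_gap C (along w \<pi>) (across w \<pi>) x y)"

lemma frag_graph_iff: "(t, x) \<in> frag_graph \<gamma> \<longleftrightarrow> t \<in> frag_dom \<gamma> \<and> frag_eval \<gamma> t = x"
  by (auto simp: frag_graph_def)

lemma cone_fragment_pairs:
  assumes \<gamma>: "cone_fragment \<epsilon> C \<pi> w \<kappa> S \<gamma>" and st: "s \<in> frag_dom \<gamma>" "t \<in> frag_dom \<gamma>" "s <= t"
  defines "x \<equiv> frag_eval \<gamma> s" and "y \<equiv> frag_eval \<gamma> t"
  shows "t - s <= dist x y \<and> dist x y <= (1 + \<epsilon>) * (t - s) \<and>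
    \<kappa> * (t - s) <= cone_gap C (along w \<pi>) (across w \<pi>) x y"
proof -
  have mem: "(s, x) \<in> frag_graph \<gamma>" "(t, y) \<in> frag_graph \<gamma>" using st by (simp_all add: frag_graph_iff x_def y_def)
  have R: "frag_graph \<gamma> \<times> frag_graph \<gamma> \<subseteq>
     graph_rel (\<lambda>s x t y. 1 * (t - s) <= dist x y \<and> dist x y <= (1 + \<epsilon>) * (t - s) \<and>
       \<kappa> * (t - s) <= cone_gap C (along w \<pi>) (across w \<pi>) x y)"
    using \<gamma> by (simp only: cone_fragment_def)
  from graph_relD[OF R mem st(3)] show ?thesis
  proof (elim disjE conjE)
    assume "s = t"
    then have "x = y" by (simp add: x_def y_def)
    then show ?thesis using \<open>s = t\<close> by (simp add: cone_gap_def)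
  qed simp
qed

lemma cone_fragment_bilipschitz:
  assumes \<gamma>: "cone_fragment \<epsilon> C \<pi> w \<kappa> S \<gamma>" and st: "s \<in> frag_dom \<gamma>" "t \<in> frag_dom \<gamma>"
  shows "1 * \<bar>s - t\<bar> <= dist (frag_eval \<gamma> s) (frag_eval \<gamma> t) \<and> dist (frag_eval \<gamma> s) (frag_eval \<gamma> t) <= (1 + \<epsilon>) * \<bar>s - t\<bar>"
  using cone_fragment_pairs[OF \<gamma> st] cone_fragment_pairs[OF \<gamma> st(2,1)]
  by (cases "s <= t") (auto simp: dist_commute)

text \<open>Dividing the cone inequality by the elapsed time and passing to the limit gives the same
  inequality for the derivative. The rate \<open>\<kappa>\<close> survives the limit and makes the
  component along \<open>w\<close> strictly positive.\<close>

lemma cone_fragment_direction: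
  fixes \<pi> :: "'k::finite => 'a::metric_space => real"
  assumes \<gamma>: "cone_fragment \<epsilon> C \<pi> w \<kappa> S \<gamma>" and \<pi>: "\<And>i. \<pi> i \<in> Lip" and \<kappa>: "0 < \<kappa>" and C: "1 <= C" and w: "norm w = 1"
    and S: "\<And>x. x \<in> S ==> norm (w' x) = 1 \<and> norm (w' x - w) <= 1 / C \<and> 0 < tan (\<alpha> x) \<and> 4 / C < tan (\<alpha> x) * (1 - 2 / C)"
  shows "AE t in lebesgue. t \<in> frag_dom \<gamma> --> (\<exists>v. (((\<lambda>x. \<chi> i. \<pi> i x) \<circ> frag_eval \<gamma>) has_vector_derivative v) (at t within frag_dom \<gamma>) \<and>
    v \<in> open_cone (w' (frag_eval \<gamma> t)) (\<alpha> (frag_eval \<gamma> t)))"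
proof -
  define K where "K = frag_dom \<gamma>"
  define f where "f i s = \<pi> i (frag_eval \<gamma> s)" for i s
  obtain L where L: "L-lipschitz_on K (frag_eval \<gamma>)" unfolding K_def using lipschitz_frag_eval by blast
  have fL: "(lip_const (\<pi> i) * L)-lipschitz_on K (f i)" for i
  proof (rule lipschitz_onI)
    fix s t assume st: "s \<in> K" "t \<in> K"
    have "dist (f i s) (f i t) <= lip_const (\<pi> i) * dist (frag_eval \<gamma> s) (frag_eval \<gamma> t)"
      using Lip_abs_le[OF \<pi>] by (simp add: f_def dist_real_def)
    also have "... <= lip_const (\<pi> i) * (L * dist s t)" by (intro mult_left_mono lipschitz_onD[OF L st] lip_const_nonneg \<pi>)
    finally show "dist (f i s) (f i t) <= lip_const (\<pi> i) * L * dist s t" by (simp add: mult.assoc)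
  qed (intro mult_nonneg_nonneg lip_const_nonneg \<pi> lipschitz_on_nonneg[OF L])
  have "AE t in lebesgue. \<forall>i\<in>UNIV. t \<in> K --> (\<exists>c. (f i has_real_derivative c) (at t within K))"
    by (subst AE_finite_all) (simp_all add: AE_lipschitz_on_differentiable[OF fL])
  then show ?thesis
  proof (rule eventually_mono, intro impI)
    fix t assume ex: "\<forall>i\<in>UNIV. t \<in> K --> (\<exists>c. (f i has_real_derivative c) (at t within K))" and "t \<in> frag_dom \<gamma>"
    then have t: "t \<in> K" by (simp add: K_def)
    define x where "x = frag_eval \<gamma> t"
    have "(t, x) \<in> frag_graph \<gamma>" using t by (simp add: frag_graph_iff x_def K_def)
    then have "x \<in> S" using \<gamma> by (auto simp: cone_fragment_def)
    note Sx = S[OF this]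
    have comp: "((\<lambda>x. \<chi> i. \<pi> i x) \<circ> frag_eval \<gamma>) = (\<lambda>s. \<chi> i. f i s)" by (simp add: f_def comp_def)
    show "\<exists>v. (((\<lambda>x. \<chi> i. \<pi> i x) \<circ> frag_eval \<gamma>) has_vector_derivative v) (at t within frag_dom \<gamma>) \<and>
      v \<in> open_cone (w' (frag_eval \<gamma> t)) (\<alpha> (frag_eval \<gamma> t))"
    proof (cases "at t within K = bot")
      \<comment> \<open>At an isolated time every vector is a derivative, so the axis of the cone
        can be taken.\<close>
      case True
      have "w' x \<in> open_cone (w' x) (\<alpha> x)"
        using Sx by (simp add: open_cone_def dot_square_norm)
      moreover have "(((\<lambda>x. \<chi> i. \<pi> i x) \<circ> frag_eval \<gamma>) has_vector_derivative w' x) (at t within frag_dom \<gamma>)"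
        using True by (simp add: has_vector_derivative_def has_derivative_def K_def bounded_linear_scaleR_left)
      ultimately show ?thesis by (auto simp: x_def)
    next
      case False
      have "\<forall>i. \<exists>c. (f i has_real_derivative c) (at t within K)" using ex t by blast
      from choice[OF this] obtain c where c: "\<forall>i. (f i has_real_derivative c i) (at t within K)" by (elim exE)
      define v where "v = (\<chi> i. c i)"
      have vd: "((\<lambda>s. \<chi> i. f i s) has_vector_derivative v) (at t within K)"
        unfolding v_def by (rule has_vector_derivative_vec) (use c in blast)
      define q where "q i s = (f i s - f i t) / (s - t)" for i s
      have qlim: "(q i \<longlongrightarrow> c i) (at t within K)" for i
        using c unfolding has_field_derivative_iff q_def by blast
      have diff: "\<kappa> + C * (\<Sum>i\<in>UNIV. \<bar>across w q i s\<bar>) <= along w q s"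
        if s: "s \<in> K" "s ~= t" for s
      proof -
        \<comment> \<open>The difference quotient may be taken from either side, while the cone
          inequality is stated from the earlier to the later time.\<close>
        define a b where "a = min s t" and "b = max s t"
        have ab: "a \<in> K" "b \<in> K" "a < b" using s t by (auto simp: a_def b_def min_def max_def)
        have qab: "q i s = (f i b - f i a) / (b - a)" for i
          using s by (auto simp: q_def a_def b_def min_def max_def divide_simps) (simp add: algebra_simps)
        have ba: "0 < b - a" using ab by simp
        have u: "along w q s = (along w f b - along w f a) / (b - a)"
          by (simp add: qab sum_subtractf[symmetric] sum_divide_distrib right_diff_distrib)
        have p: "\<bar>across w q i s\<bar> =
            \<bar>across w f i a - across w f i b\<bar> / (b - a)" for i
        proof -
          have alg: "(X - Y) / e - z * ((U - W) / e) = - ((Y - z * W) - (X - z * U)) / e" for X Y U W z e :: real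
            by (cases "e = 0") (simp_all add: field_simps)
          have "across w q i s =
            - (across w f i a - across w f i b) / (b - a)"
            unfolding u unfolding qab by (rule alg)
          then show ?thesis using ba by (simp add: abs_divide)
        qed
        have "\<kappa> * (b - a) <= cone_gap C (along w \<pi>) (across w \<pi>) (frag_eval \<gamma> a) (frag_eval \<gamma> b)"
          using cone_fragment_pairs[OF \<gamma>, of a b] ab by (auto simp: K_def)
        also have "... = along w f b - along w f a -
            C * (\<Sum>i\<in>UNIV. \<bar>across w f i a - across w f i b\<bar>)"
          by (simp add: cone_gap_def f_def)
        finally have "\<kappa> <= (along w f b - along w f a -
            C * (\<Sum>i\<in>UNIV. \<bar>across w f i a - across w f i b\<bar>)) / (b - a)"
          using ba by (simp add: pos_le_divide_eq)
        also have "... = along w q s - C * (\<Sum>i\<in>UNIV. \<bar>across w q i s\<bar>)"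
          unfolding p unfolding u diff_divide_distrib sum_divide_distrib[symmetric] by simp
        finally show ?thesis by simp
      qed
      have "\<kappa> + C * (\<Sum>i\<in>UNIV. \<bar>c i - w $ i * (\<Sum>m\<in>UNIV. w $ m * c m)\<bar>) <= (\<Sum>m\<in>UNIV. w $ m * c m)"
      proof (rule tendsto_le[OF False])
        show "((along w q) \<longlongrightarrow> (\<Sum>m\<in>UNIV. w $ m * c m)) (at t within K)"
          by (intro tendsto_intros qlim)
        show "((\<lambda>s. \<kappa> + C * (\<Sum>i\<in>UNIV. \<bar>across w q i s\<bar>)) \<longlongrightarrow>
           \<kappa> + C * (\<Sum>i\<in>UNIV. \<bar>c i - w $ i * (\<Sum>m\<in>UNIV. w $ m * c m)\<bar>)) (at t within K)"
          by (intro tendsto_intros qlim)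
        show "\<forall>\<^sub>F s in at t within K. \<kappa> + C * (\<Sum>i\<in>UNIV. \<bar>across w q i s\<bar>) <= along w q s"
          unfolding eventually_at_filter by (rule always_eventually) (use diff in blast)
      qed
      moreover have wv: "w \<bullet> v = (\<Sum>m\<in>UNIV. w $ m * c m)" by (simp add: inner_vec_def v_def)
      ultimately have main: "\<kappa> + C * (\<Sum>i\<in>UNIV. \<bar>c i - w $ i * (w \<bullet> v)\<bar>) <= w \<bullet> v" by simp
      have "norm (v - (w \<bullet> v) *\<^sub>R w) <= (\<Sum>i\<in>UNIV. \<bar>c i - w $ i * (w \<bullet> v)\<bar>)"
        using norm_le_l1_cart[of "v - (w \<bullet> v) *\<^sub>R w"] by (simp add: v_def mult.commute)
      then have "C * norm (v - (w \<bullet> v) *\<^sub>R w) <= C * (\<Sum>i\<in>UNIV. \<bar>c i - w $ i * (w \<bullet> v)\<bar>)" using C by (intro mult_left_mono) auto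
      then have gap: "C * norm (v - (w \<bullet> v) *\<^sub>R w) <= w \<bullet> v" using main \<kappa> by linarith
      have "0 <= C * (\<Sum>i\<in>UNIV. \<bar>c i - w $ i * (w \<bullet> v)\<bar>)" using C by (intro mult_nonneg_nonneg sum_nonneg) auto
      then have pos: "0 < w \<bullet> v" using main \<kappa> by linarith
      have "v \<in> open_cone (w' x) (\<alpha> x)" using Sx by (intro open_cone_perturb[OF pos gap C w]) auto
      then show ?thesis using vd unfolding comp K_def x_def by blast
    qed
  qed
qed

text \<open>\<open>D i\<close> acts on the coordinates like \<open>l\<close> times the partial
  derivative in direction \<open>i\<close>, so \<open>N\<close> acts like
  \<open>\<sigma> * l\<close> times the derivative in direction \<open>w\<close>. It annihilates the
  components orthogonal to \<open>w\<close> because \<open>w\<close> has length 1. The sign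
  \<open>\<sigma>\<close> serves to make \<open>\<sigma> * l\<close> positive.\<close>

lemma chart_direction_operator:
  fixes \<pi> :: "'k::finite => 'a::metric_space => real" and w :: "real ^ 'k" and \<sigma> :: real
  assumes \<pi>: "\<And>i. \<pi> i \<in> Lip" and D: "\<And>i. lip_operator \<mu> 1 (D i)"
    and Dl: "\<And>i m. AE x in \<mu>. D i (\<pi> m) x = (if i = m then l x else 0)" and w: "norm w = 1"
  defines "N \<equiv> \<lambda>f x. \<Sum>i\<in>UNIV. (\<sigma> * w $ i) * D i f x" and "u \<equiv> \<lambda>x. \<Sum>m\<in>UNIV. w $ m * \<pi> m x"
  shows "u \<in> Lip" and "AE x in \<mu>. N u x = \<sigma> * l x" and "\<And>i. AE x in \<mu>. N (\<lambda>x. \<pi> i x - w $ i * u x) x = 0"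
proof -
  have wL: "(\<lambda>x. w $ m * \<pi> m x) \<in> Lip" for m using Lip_linear(1)[OF \<pi> \<pi>, of "w $ m" m 0 m] by simp
  have sq: "(\<Sum>m\<in>UNIV. w $ m * w $ m) = 1"
    using w by (simp add: norm_eq_1 inner_vec_def)
  have usum: "u \<in> Lip \<and> (AE x in \<mu>. D i u x = (\<Sum>m\<in>UNIV. D i (\<lambda>x. w $ m * \<pi> m x) x))" for i
    unfolding u_def by (rule lip_operator_sum[OF D finite wL])
  then show uL: "u \<in> Lip" by blast
  have D1: "AE x in \<mu>. D i (\<lambda>x. w $ m * \<pi> m x) x = w $ m * D i (\<pi> m) x" for i m
    using lip_operatorD(3)[OF D \<pi> \<pi>, of i "w $ m" m 0 m] by simp
  have Du: "AE x in \<mu>. D i u x = w $ i * l x" for i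
  proof -
    have "AE x in \<mu>. \<forall>m\<in>UNIV. D i (\<lambda>x. w $ m * \<pi> m x) x = w $ m * D i (\<pi> m) x \<and> D i (\<pi> m) x = (if i = m then l x else 0)"
      using D1[of i] Dl[of i] by (subst AE_finite_all) auto
    with usum[THEN conjunct2, of i] show ?thesis
    proof eventually_elim
      case (elim x)
      have "D i u x = (\<Sum>m\<in>UNIV. w $ m * (if i = m then l x else 0))" using elim by simp
      also have "... = (\<Sum>m\<in>UNIV. if i = m then w $ i * l x else 0)" by (intro sum.cong) auto
      finally show ?case by simp
    qed
  qed
  have Duall: "AE x in \<mu>. \<forall>i\<in>UNIV. D i u x = w $ i * l x" using Du by (subst AE_finite_all) auto
  then show "AE x in \<mu>. N u x = \<sigma> * l x"
  proof (rule eventually_mono)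
    fix x assume *: "\<forall>i\<in>UNIV. D i u x = w $ i * l x"
    have "N u x = (\<Sum>i\<in>UNIV. \<sigma> * l x * (w $ i * w $ i))" unfolding N_def using * by (intro sum.cong) auto
    also have "... = \<sigma> * l x" by (simp only: sum_distrib_left[symmetric] sq mult_1_right)
    finally show "N u x = \<sigma> * l x" .
  qed
  show "AE x in \<mu>. N (\<lambda>x. \<pi> i x - w $ i * u x) x = 0" for i
  proof -
    have "AE x in \<mu>. \<forall>m\<in>UNIV. D m (\<lambda>x. \<pi> i x - w $ i * u x) x = D m (\<pi> i) x - w $ i * D m u x \<and> D m (\<pi> i) x = (if m = i then l x else 0)"
    proof (subst AE_finite_all, simp, intro ballI)
      fix m
      have "AE x in \<mu>. D m (\<lambda>x. \<pi> i x - w $ i * u x) x = D m (\<pi> i) x - w $ i * D m u x"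
        using lip_operatorD(3)[OF D \<pi> uL, of m 1 i "- (w $ i)"] by simp
      then show "AE x in \<mu>. D m (\<lambda>x. \<pi> i x - w $ i * u x) x = D m (\<pi> i) x - w $ i * D m u x \<and> D m (\<pi> i) x = (if m = i then l x else 0)"
        using Dl[of m i] by (rule eventually_conj)
    qed
    with Duall show ?thesis
    proof eventually_elim
      case (elim x)
      have "N (\<lambda>x. \<pi> i x - w $ i * u x) x = (\<Sum>m\<in>UNIV. (if m = i then \<sigma> * w $ i * l x else 0) - \<sigma> * w $ i * l x * (w $ m * w $ m))"
      proof -
        have dm: "D m (\<lambda>x. \<pi> i x - w $ i * u x) x = (if m = i then l x else 0) - w $ i * (w $ m * l x)" for m using elim by simp
        show ?thesis unfolding N_def dm by (intro sum.cong) (auto simp: algebra_simps)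
      qed
      also have "... = \<sigma> * w $ i * l x - \<sigma> * w $ i * l x * (\<Sum>m\<in>UNIV. w $ m * w $ m)"
        by (simp add: sum_subtractf sum_distrib_left)
      also have "... = 0" by (simp add: sq)
      finally show ?case .
    qed
  qed
qed

text \<open>The points at which a thin cone around the constant direction \<open>w\<close> lies
  inside the cone with axis \<open>w'\<close> and angle \<open>\<alpha>\<close>; the conditions are
  those of \<open>open_cone_perturb\<close>.\<close>

definition near_cone :: "('a => real ^ 'k) => ('a => real) => real => real ^ 'k => 'a set" where
  "near_cone w' \<alpha> C w = {x. norm (w' x) = 1 \<and> norm (w' x - w) <= 1 / C \<and> 0 < tan (\<alpha> x) \<and> 4 / C < tan (\<alpha> x) * (1 - 2 / C)}"

lemma near_cone_borel:
  fixes w' :: "'a::topological_space => real ^ 'k::finite"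
  assumes "w' \<in> borel_measurable borel" "\<alpha> \<in> borel_measurable borel"
  shows "near_cone w' \<alpha> C w \<in> sets borel"
proof -
  note [measurable] = assms
  have s: "(sin :: real => real) \<in> borel_measurable borel" "(cos :: real => real) \<in> borel_measurable borel"
    by (intro borel_measurable_continuous_onI continuous_intros)+
  have [measurable]: "(\<lambda>x. tan (\<alpha> x)) \<in> borel_measurable borel"
    unfolding tan_def using measurable_compose[OF assms(2) s(1)] measurable_compose[OF assms(2) s(2)] by measurable
  show ?thesis unfolding near_cone_def by measurable
qed

lemma near_cone_exists:
  assumes T: "sphere 0 1 \<subseteq> closure T" and w': "norm (w' x :: real ^ 'k::finite) = 1" and \<alpha>: "0 < \<alpha> x" "\<alpha> x < pi / 2"
  shows "\<exists>w\<in>T. \<exists>n::nat. x \<in> near_cone w' \<alpha> (real (Suc n)) w"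
proof -
  have tan: "0 < tan (\<alpha> x)" using \<alpha> by (rule tan_gt_zero)
  have l: "(\<lambda>n. 1 / real (Suc n)) \<longlonglongrightarrow> 0" using LIMSEQ_inverse_real_of_nat by (simp add: inverse_eq_divide)
  have "(\<lambda>n. tan (\<alpha> x) * (1 - 2 * (1 / real (Suc n))) - 4 * (1 / real (Suc n))) \<longlonglongrightarrow> tan (\<alpha> x) * (1 - 2 * 0) - 4 * 0"
    by (intro tendsto_intros l)
  then have "\<forall>\<^sub>F n in sequentially. 0 < tan (\<alpha> x) * (1 - 2 * (1 / real (Suc n))) - 4 * (1 / real (Suc n))"
    by (rule order_tendstoD) (use tan in simp)
  then obtain n where n: "0 < tan (\<alpha> x) * (1 - 2 * (1 / real (Suc n))) - 4 * (1 / real (Suc n))" by (auto simp: eventually_sequentially)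
  have "w' x \<in> closure T" using T w' by (auto simp: sphere_def dist_norm)
  moreover have "0 < 1 / real (Suc n)" by simp
  ultimately obtain w where w: "w \<in> T" "dist w (w' x) < 1 / real (Suc n)" unfolding closure_approachable by blast
  have "norm (w' x - w) <= 1 / real (Suc n)" using w(2) by (simp add: dist_norm norm_minus_commute del: of_nat_Suc)
  moreover have "4 / real (Suc n) < tan (\<alpha> x) * (1 - 2 / real (Suc n))" using n by (simp del: of_nat_Suc)
  ultimately have "x \<in> near_cone w' \<alpha> (real (Suc n)) w" unfolding near_cone_def using w' tan by blast
  then show ?thesis using w(1) by blast
qed

text \<open>The constants vary from piece to piece; the existential quantifier hides them, so that a
  single predicate serves all pieces of a chart.\<close>

definition chart_fragment :: "real => ('k::finite => 'a::metric_space => real) => ('a => real ^ 'k) => ('a => real) => 'a set => 'a fragment => bool" where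
  "chart_fragment \<epsilon> \<pi> w' \<alpha> V \<gamma> \<longleftrightarrow> (\<exists>C w \<kappa> S. 1 <= C \<and> norm w = 1 \<and> 0 < \<kappa> \<and> S \<subseteq> V \<inter> near_cone w' \<alpha> C w \<and> cone_fragment \<epsilon> C \<pi> w \<kappa> S \<gamma>)"

definition chart_piece :: "'a::metric_space measure => real => ('k::finite => 'a => real) => ('a => real ^ 'k) => ('a => real) => 'a set => 'a set => bool" where
  "chart_piece \<mu> \<epsilon> \<pi> w' \<alpha> V A \<longleftrightarrow> (\<exists>\<Gamma>. compact \<Gamma> \<and> (\<forall>\<gamma>\<in>\<Gamma>. frag_dom \<gamma> \<subseteq> {0..1} \<and> chart_fragment \<epsilon> \<pi> w' \<alpha> V \<gamma>) \<and> alberti_piece \<mu> \<Gamma> A)"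

lemma Lip_continuous: "f \<in> Lip ==> continuous_on UNIV f"
  by (rule lipschitz_on_continuous_on[OF lipschitz_on_lip_const])

text \<open>On \<open>S\<close> the operator satisfies \<open>N u > c\<close> almost everywhere,
  while \<open>\<delta>\<close> is chosen with \<open>\<delta> * BN <= c\<close>; hence
  \<open>fragment_exists\<close> applies to every compact part of positive measure. The fragments
  with rate \<open>1 / (i + 1)\<close> form compact sets that increase with \<open>i\<close>, and
  every positive rate is reached.\<close>

lemma piece_in_near_cone:
  fixes \<mu> :: "'a::polish_space measure" and \<pi> :: "'k::finite => 'a => real"
  assumes \<mu>: "sets \<mu> = sets borel" "finite_measure \<mu>" and \<pi>: "\<And>i. \<pi> i \<in> Lip" and D: "\<And>i. lip_operator \<mu> 1 (D i)"
    and Dl: "\<And>i m. AE x in \<mu>. D i (\<pi> m) x = (if i = m then l x else 0)" and w: "norm w = 1" and C: "1 <= C" and \<epsilon>: "0 < \<epsilon>"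
    and S: "compact S" "S \<subseteq> V \<inter> near_cone w' \<alpha> C w" "0 < measure \<mu> S" and c: "0 < c" and lS: "AE x in \<mu>. x \<in> S --> c < \<sigma> * l x"
  shows "\<exists>S1\<in>sets borel. S1 \<subseteq> S \<and> 0 < measure \<mu> S1 \<and> chart_piece \<mu> \<epsilon> \<pi> w' \<alpha> V S1"
proof -
  interpret \<mu>: finite_measure \<mu> by (rule \<mu>(2))
  define u where "u x = (\<Sum>m\<in>UNIV. w $ m * \<pi> m x)" for x
  define p where "p i x = \<pi> i x - w $ i * u x" for i x
  define N where "N f x = (\<Sum>i\<in>UNIV. (\<sigma> * w $ i) * D i f x)" for f x
  have uL: "u \<in> Lip" and Nu: "AE x in \<mu>. N u x = \<sigma> * l x" and Np: "AE x in \<mu>. N (p i) x = 0" for i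
    unfolding u_def[abs_def] N_def p_def[abs_def] by (rule chart_direction_operator[OF \<pi> D Dl w])+
  have pL: "p i \<in> Lip" for i unfolding p_def[abs_def] using Lip_linear(1)[OF \<pi> uL, of 1 i "- (w $ i)"] by simp
  define BN where "BN = (\<Sum>i\<in>UNIV. \<bar>\<sigma> * w $ i\<bar>) * 1"
  have NL: "lip_operator \<mu> BN N" unfolding BN_def N_def[abs_def] by (rule lip_operator_lincomb[OF \<mu> D])
  have BN: "0 <= BN" by (simp add: BN_def sum_nonneg)
  define \<delta> where "\<delta> = c / (BN + 1)"
  have \<delta>: "0 < \<delta>" "\<delta> * BN <= c" using c BN by (simp_all add: \<delta>_def divide_le_eq mult.commute distrib_left)
  define R where "R \<kappa> = cone_rel 1 (1 + \<epsilon>) \<kappa> C u p" for \<kappa>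
  define Z where "Z = {0..1::real} \<times> S"
  have Z: "compact Z" unfolding Z_def by (intro compact_Times compact_Icc S(1))
  define \<Gamma> where "\<Gamma> i = frags_in Z (R (1 / real (Suc i)))" for i
  have \<Gamma>c: "compact (\<Gamma> i)" for i
    unfolding \<Gamma>_def
  proof (rule compact_frags_in[OF Z])
    show "closed (R (1 / real (Suc i)))" unfolding R_def by (rule closed_graph_rel_gap[OF Lip_continuous[OF uL] Lip_continuous[OF pL]])
    show "0 <= 1 + \<epsilon>" using \<epsilon> by simp
    show "dist x y <= (1 + \<epsilon>) * \<bar>s - t\<bar>" if "((s, x), (t, y)) \<in> R (1 / real (Suc i))" for s x t y
      using that by (auto simp: R_def graph_rel_def dist_commute)
  qed
  have Rmono: "R \<kappa> \<subseteq> R \<kappa>'" if "\<kappa>' <= \<kappa>" for \<kappa> \<kappa>'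
  proof -
    have "\<kappa>' * (t - s) <= \<kappa> * (t - s)" if "s <= t" for s t :: real using that \<open>\<kappa>' <= \<kappa>\<close> by (intro mult_right_mono) auto
    then show ?thesis unfolding R_def graph_rel_def by (auto intro: order_trans)
  qed
  have \<Gamma>mono: "\<Gamma> i \<subseteq> \<Gamma> j" if "i <= j" for i j
  proof -
    have "1 / real (Suc j) <= 1 / real (Suc i)" using that by (simp add: frac_le)
    then show ?thesis using Rmono unfolding \<Gamma>_def frags_in_def by blast
  qed
  have dom: "\<forall>\<gamma>\<in>\<Gamma> i. frag_dom \<gamma> \<subseteq> {0..1}" for i
    by (auto simp: \<Gamma>_def frags_in_def Z_def frag_graph_def)
  have H: "\<exists>i. \<exists>\<gamma>\<in>\<Gamma> i. 0 < emeasure (occupation \<gamma>) K" if K: "compact K" "K \<subseteq> S" "0 < measure \<mu> K" for K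
  proof -
    have Kb: "K \<in> sets borel" using compact_imp_closed[OF K(1)] by simp
    have nle: "\<not> (AE x in \<mu>. x \<in> K --> N u x <= \<delta> * BN)"
    proof
      assume "AE x in \<mu>. x \<in> K --> N u x <= \<delta> * BN"
      with lS Nu have "AE x in \<mu>. x \<notin> K"
      proof eventually_elim
        case (elim x)
        then show ?case using K(2) \<delta>(2) by auto
      qed
      then have "K \<in> null_sets \<mu>" using Kb \<mu>(1) by (subst (asm) AE_iff_null_sets[symmetric]) auto
      then show False using K(3) by (simp add: measure_eq_0_null_sets)
    qed
    have Dp: "AE x in \<mu>. x \<in> K --> N (p i) x = 0" for i using Np[of i] by (rule eventually_mono) simp
    have C0: "0 <= C" using C by simp
    have "\<exists>\<kappa>>0. \<exists>b G. compact G \<and> G ~= {} \<and> G \<subseteq> {0..b} \<times> K \<and> 0 < emeasure lborel (fst ` G) \<and>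
      G \<times> G \<subseteq> cone_rel 0 1 \<kappa> C u p"
      by (rule fragment_exists[OF \<mu> NL BN K(1) uL pL Dp \<delta>(1) C0 nle])
    then obtain \<kappa> b G where \<kappa>: "0 < \<kappa>" and G: "compact G" "G \<subseteq> {0..b} \<times> K" "0 < emeasure lborel (fst ` G)"
      "G \<times> G \<subseteq> cone_rel 0 1 \<kappa> C u p"
      by (elim exE conjE) (rule that)
    have "G \<subseteq> UNIV \<times> K" using G(2) by blast
    from refine_fragment[OF G(1) this G(3,4) uL \<kappa> C0 \<epsilon>, folded R_def]
    obtain G2 where G2: "compact G2" "G2 ~= {}" "G2 \<subseteq> {0..1} \<times> K" "0 < emeasure lborel (fst ` G2)" "G2 \<times> G2 \<subseteq> R \<kappa>"
      by (elim exE conjE) (rule that)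
    have "\<exists>\<gamma>. frag_graph \<gamma> = G2"
    proof (rule fragment_of_graph[OF G2(1,2), of "1 + \<epsilon>"])
      show "0 <= 1 + \<epsilon>" using \<epsilon> by simp
      fix s x t y assume "(s, x) \<in> G2" "(t, y) \<in> G2"
      then have "((s, x), (t, y)) \<in> R \<kappa>" by (intro subsetD[OF G2(5)] SigmaI)
      then show "dist x y <= (1 + \<epsilon>) * \<bar>s - t\<bar>" by (auto simp: R_def graph_rel_def dist_commute)
    qed
    then obtain \<gamma> where \<gamma>: "frag_graph \<gamma> = G2" by (elim exE)
    obtain i where i: "1 / real (Suc i) < \<kappa>" using reals_Archimedean[OF \<kappa>] by (auto simp: inverse_eq_divide)
    have "G2 \<subseteq> Z" using G2(3) K(2) unfolding Z_def by blast
    then have "\<gamma> \<in> \<Gamma> i" using G2(5) Rmono[of "1 / real (Suc i)" \<kappa>] i by (auto simp: \<Gamma>_def frags_in_def \<gamma> simp del: of_nat_Suc)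
    moreover have "{t\<in>frag_dom \<gamma>. frag_eval \<gamma> t \<in> K} = fst ` G2"
      using G2(3) unfolding \<gamma>[symmetric] by (force simp: frag_graph_def)
    then have "0 < emeasure (occupation \<gamma>) K" using G2(4) by (simp add: emeasure_occupation(2)[OF Kb])
    ultimately show ?thesis by blast
  qed
  have "\<exists>S1\<in>sets borel. S1 \<subseteq> S \<and> 0 < measure \<mu> S1 \<and> (\<exists>i. alberti_piece \<mu> (\<Gamma> i) S1)"
    by (rule fragment_piece[OF \<mu> S(1,3) \<Gamma>c \<Gamma>mono dom H])
  then obtain S1 i where S1: "S1 \<in> sets borel" "S1 \<subseteq> S" "0 < measure \<mu> S1" "alberti_piece \<mu> (\<Gamma> i) S1" by blast
  have chart: "chart_fragment \<epsilon> \<pi> w' \<alpha> V \<gamma>" if "\<gamma> \<in> \<Gamma> i" for \<gamma>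
    unfolding chart_fragment_def
  proof (rule exI[of _ C], rule exI[of _ w], rule exI[of _ "1 / real (Suc i)"], rule exI[of _ S], intro conjI)
    have "frag_graph \<gamma> \<subseteq> UNIV \<times> S" "frag_graph \<gamma> \<times> frag_graph \<gamma> \<subseteq> R (1 / real (Suc i))"
      using that unfolding \<Gamma>_def frags_in_def Z_def by blast+
    then show "cone_fragment \<epsilon> C \<pi> w (1 / real (Suc i)) S \<gamma>" unfolding cone_fragment_def R_def u_def[abs_def] p_def[abs_def] by (rule conjI)
  qed (use C w S in auto)
  then have "chart_piece \<mu> \<epsilon> \<pi> w' \<alpha> V S1"
    unfolding chart_piece_def using \<Gamma>c dom S1(4) by (intro exI[of _ "\<Gamma> i"]) simp
  then show ?thesis using S1(1-3) by blast
qed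

text \<open>Countably many directions, widths, signs of \<open>l\<close> and positive lower bounds
  for \<open>\<bar>l\<bar>\<close> cover \<open>B\<close> up to a null set, so one combination has
  positive measure.\<close>

lemma piece_in_chart:
  fixes \<mu> :: "'a::polish_space measure" and \<pi> :: "'k::finite => 'a => real"
  assumes \<mu>: "sets \<mu> = sets borel" "finite_measure \<mu>" and \<pi>: "\<And>i. \<pi> i \<in> Lip" and D: "\<And>i. lip_operator \<mu> 1 (D i)"
    and Dl: "\<And>i m. AE x in \<mu>. D i (\<pi> m) x = (if i = m then l x else 0)" and l: "\<And>x. x \<in> V ==> l x ~= 0" and \<epsilon>: "0 < \<epsilon>"
    and w': "w' \<in> borel_measurable borel" "\<And>x. norm (w' x) = 1" and \<alpha>: "\<alpha> \<in> borel_measurable borel" "\<And>x. 0 < \<alpha> x" "\<And>x. \<alpha> x < pi / 2"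
    and B: "B \<in> sets borel" "B \<subseteq> V" "0 < measure \<mu> B"
  shows "\<exists>S1\<in>sets borel. S1 \<subseteq> B \<and> 0 < measure \<mu> S1 \<and> chart_piece \<mu> \<epsilon> \<pi> w' \<alpha> V S1"
proof -
  interpret \<mu>: finite_measure \<mu> by (rule \<mu>(2))
  define i0 :: 'k where "i0 = undefined"
  \<comment> \<open>A Borel function that agrees with \<open>l\<close> almost everywhere; it makes
    the sets \<open>A q\<close> Borel.\<close>
  define l' where "l' = D i0 (\<pi> i0)"
  have l'm: "l' \<in> borel_measurable borel" unfolding l'_def by (rule lip_operatorD(1)[OF D \<pi>])
  have l'l: "AE x in \<mu>. l' x = l x" using Dl[of i0 i0] by (simp add: l'_def)
  obtain T :: "(real ^ 'k) set" where T: "countable T" "T \<subseteq> sphere 0 1" "sphere 0 1 \<subseteq> closure T" by (rule separable)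
  define I where "I = T \<times> (UNIV :: nat set) \<times> {1, -1 :: real} \<times> (UNIV :: nat set)"
  have cI: "countable I" unfolding I_def using T(1) by auto
  define A where "A q = B \<inter> near_cone w' \<alpha> (real (Suc (fst (snd q)))) (fst q) \<inter> {x. 1 / real (Suc (snd (snd (snd q)))) < fst (snd (snd q)) * l' x}" for q :: "(real ^ 'k) \<times> nat \<times> real \<times> nat"
  have Ab: "A q \<in> sets borel" for q
  proof -
    have "{x. 1 / real (Suc (snd (snd (snd q)))) < fst (snd (snd q)) * l' x} \<in> sets borel" using l'm by measurable
    then show ?thesis unfolding A_def using B(1) near_cone_borel[OF w'(1) \<alpha>(1)] by auto
  qed
  have cov: "x \<in> (\<Union>q\<in>I. A q)" if x: "x \<in> B" "l' x = l x" for x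
  proof -
    obtain w n where wn: "w \<in> T" "x \<in> near_cone w' \<alpha> (real (Suc n)) w" using near_cone_exists[of T w' x \<alpha>, OF T(3) w'(2) \<alpha>(2,3)] by blast
    have "l' x ~= 0" using l x B(2) by auto
    then obtain \<sigma> where \<sigma>: "\<sigma> \<in> {1, -1 :: real}" "0 < \<sigma> * l' x" using that[of 1] that[of "-1"] by (cases "0 < l' x") auto
    obtain m where m: "1 / real (Suc m) < \<sigma> * l' x" using reals_Archimedean[OF \<sigma>(2)] by (auto simp: inverse_eq_divide)
    have "x \<in> A (w, n, \<sigma>, m)" unfolding A_def fst_conv snd_conv using x(1) wn(2) m by blast
    moreover have "(w, n, \<sigma>, m) \<in> I" using wn(1) \<sigma>(1) by (auto simp: I_def)
    ultimately show ?thesis by blast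
  qed
  have "\<exists>q\<in>I. 0 < measure \<mu> (A q)"
  proof (rule ccontr)
    assume "\<not> ?thesis"
    then have "measure \<mu> (A q) = 0" if "q \<in> I" for q using that measure_nonneg[of \<mu> "A q"] by (metis less_eq_real_def)
    then have "A q \<in> null_sets \<mu>" if "q \<in> I" for q using that Ab \<mu>(1) by (simp add: null_sets_def \<mu>.emeasure_eq_measure)
    then have "(\<Union>q\<in>I. A q) \<in> null_sets \<mu>" by (rule null_sets_UN'[OF cI])
    then have "AE x in \<mu>. x \<notin> (\<Union>q\<in>I. A q)" by (rule AE_not_in)
    with l'l have "AE x in \<mu>. x \<notin> B" by eventually_elim (use cov in blast)
    then have "B \<in> null_sets \<mu>" using B(1) \<mu>(1) by (subst (asm) AE_iff_null_sets[symmetric]) auto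
    then show False using B(3) by (simp add: measure_eq_0_null_sets)
  qed
  then obtain w n \<sigma> m where q: "(w, n, \<sigma>, m) \<in> I" "0 < measure \<mu> (A (w, n, \<sigma>, m))" by (metis prod_cases4)
  have w1: "norm w = 1" using q(1) T(2) by (auto simp: I_def dist_norm)
  obtain S where S: "compact S" "S \<subseteq> A (w, n, \<sigma>, m)" "measure \<mu> (A (w, n, \<sigma>, m)) < measure \<mu> S + measure \<mu> (A (w, n, \<sigma>, m))"
    by (rule finite_measure_compact_approx[OF \<mu> Ab q(2)])
  have SV: "S \<subseteq> V \<inter> near_cone w' \<alpha> (real (Suc n)) w" using S(2) B(2) by (auto simp: A_def)
  have lS: "AE x in \<mu>. x \<in> S --> 1 / real (Suc m) < \<sigma> * l x"
    using l'l by (rule eventually_mono) (use S(2) in \<open>auto simp: A_def\<close>)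
  have "\<exists>S1\<in>sets borel. S1 \<subseteq> S \<and> 0 < measure \<mu> S1 \<and> chart_piece \<mu> \<epsilon> \<pi> w' \<alpha> V S1"
    by (rule piece_in_near_cone[OF \<mu> \<pi> D Dl w1 _ \<epsilon> S(1) SV _ _ lS]) (use S(3) in auto)
  moreover have "S \<subseteq> B" using S(2) by (auto simp: A_def)
  ultimately show ?thesis by blast
qed

lemma chart_fragment_bilipschitz:
  assumes "chart_fragment \<epsilon> \<pi> w' \<alpha> V \<gamma>" "s \<in> frag_dom \<gamma>" "t \<in> frag_dom \<gamma>"
  shows "1 * \<bar>s - t\<bar> <= dist (frag_eval \<gamma> s) (frag_eval \<gamma> t) \<and> dist (frag_eval \<gamma> s) (frag_eval \<gamma> t) <= (1 + \<epsilon>) * \<bar>s - t\<bar>"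
  using assms cone_fragment_bilipschitz unfolding chart_fragment_def by blast

lemma chart_fragment_direction:
  assumes \<gamma>: "chart_fragment \<epsilon> \<pi> w' \<alpha> V \<gamma>" and \<pi>: "\<And>i. \<pi> i \<in> Lip"
  shows "frag_eval \<gamma> ` frag_dom \<gamma> \<subseteq> V"
    and "AE t in lebesgue. t \<in> frag_dom \<gamma> --> (\<exists>v. (((\<lambda>x. \<chi> i. \<pi> i x) \<circ> frag_eval \<gamma>) has_vector_derivative v) (at t within frag_dom \<gamma>) \<and>
      v \<in> open_cone (w' (frag_eval \<gamma> t)) (\<alpha> (frag_eval \<gamma> t)))"
proof -
  obtain C w \<kappa> S where *: "1 <= C" "norm w = 1" "0 < \<kappa>" "S \<subseteq> V \<inter> near_cone w' \<alpha> C w" "cone_fragment \<epsilon> C \<pi> w \<kappa> S \<gamma>"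
    using \<gamma> unfolding chart_fragment_def by (elim exE conjE) (rule that)
  show "frag_eval \<gamma> ` frag_dom \<gamma> \<subseteq> V" using *(4,5) by (auto simp: cone_fragment_def frag_graph_def)
  show "AE t in lebesgue. t \<in> frag_dom \<gamma> --> (\<exists>v. (((\<lambda>x. \<chi> i. \<pi> i x) \<circ> frag_eval \<gamma>) has_vector_derivative v) (at t within frag_dom \<gamma>) \<and>
      v \<in> open_cone (w' (frag_eval \<gamma> t)) (\<alpha> (frag_eval \<gamma> t)))"
    by (rule cone_fragment_direction[OF *(5) \<pi> *(3,1,2)]) (use *(4) in \<open>auto simp: near_cone_def\<close>)
qed

theorem theorem1p3:
  fixes T :: "('a::polish_space \<Rightarrow> real) \<Rightarrow> ('k::finite \<Rightarrow> 'a \<Rightarrow> real) \<Rightarrow> real"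
  assumes "metric_current T" and "nonzero_current T"
  shows "(\<exists>(V :: nat \<Rightarrow> 'a set) (\<pi> :: nat \<Rightarrow> 'a \<Rightarrow> real ^ 'k).
            disjoint_family V \<and> (\<forall>j. V j \<in> sets borel) \<and>
            (\<forall>j x y. infnorm (\<pi> j x - \<pi> j y) \<le> dist x y) \<and>
            emeasure (mass T) (UNIV - (\<Union>j. V j)) = 0 \<and>
            (\<forall>\<epsilon>>0. \<forall>C :: 'a \<Rightarrow> (real ^ 'k) set. cone_field C \<longrightarrow>
               (\<exists>P \<nu>. alberti_representation (mass T) P \<nu> \<and>
                      bilipschitz_representation 1 (1 + \<epsilon>) P \<and>
                      (\<forall>j. in_direction_on (V j) P (\<pi> j) C)))) \<and>
         (\<exists>D :: 'k \<Rightarrow> ('a \<Rightarrow> real) \<Rightarrow> 'a \<Rightarrow> real.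
            (\<forall>i. weaver_derivation (mass T) (D i)) \<and> independent_derivations (mass T) D)"
proof (rule conjI[OF _ current_derivations[OF assms(1)]])
  define \<mu> where "\<mu> = mass T"
  interpret current_with_mass T \<mu> unfolding \<mu>_def by (rule mass_properties(1)[OF assms(1)])
  interpret \<mu>: finite_measure \<mu> by (rule finite_mu)
  have sp: "space \<mu> = UNIV" using sets_eq_imp_space_eq[OF sets_mu] by simp
  \<comment> \<open>Empty members of the exhaustion also need a law on some compact set of
    fragments, and a piece of positive measure provides one. This is where \<open>T\<close> being
    nonzero enters.\<close>
  have pos: "0 < measure \<mu> (space \<mu>)"
  proof (rule ccontr)
    assume "\<not> ?thesis"
    then have "measure \<mu> UNIV = 0" by (simp add: sp zero_less_measure_iff)
    then have z: "(LINT x|\<mu>. \<bar>f x\<bar>) = 0" for f :: "'a => real"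
      by (intro integral_eq_zero_AE AE_I'[of UNIV]) (simp_all add: null_sets_def \<mu>.emeasure_eq_measure sets_mu)
    obtain f \<pi> where "f \<in> Lipb" "Lips \<pi>" "T f \<pi> ~= 0" using assms(2) by (auto simp: nonzero_current_def forms_iff)
    then show False using mass_boundD[of f \<pi>] z[of f] by simp
  qed
  obtain V and \<pi> :: "nat => 'k => 'a => real" and D l where charts: "operator_charts \<mu> V \<pi> D l"
    using current_operators[OF assms(1), folded \<mu>_def] by (elim exE) (rule that)
  note ch = charts[unfolded operator_charts_def]
  have V: "disjoint_family V" "\<And>j. V j \<in> sets borel" "emeasure \<mu> (UNIV - (\<Union>j. V j)) = 0"
    using ch by (elim conjE; simp)+
  have \<pi>: "\<pi> j i \<in> Lip" "lip_const (\<pi> j i) <= 1" for j i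
    using ch by (elim conjE; simp)+
  have l: "l j x ~= 0" if "x \<in> V j" for j x
    using ch that by (elim conjE) simp
  have D: "lip_operator \<mu> 1 (D j i)" "AE x in \<mu>. D j i (\<pi> j m) x = (if i = m then l j x else 0)" for j i m
    using ch by (elim conjE; blast)+
  define \<Phi> :: "nat => 'a => real ^ 'k" where "\<Phi> j x = (\<chi> i. \<pi> j i x)" for j x
  have "infnorm (\<Phi> j x - \<Phi> j y) <= dist x y" for j x y
    unfolding infnorm_cart
  proof (rule cSup_least)
    fix v assume "v \<in> {\<bar>(\<Phi> j x - \<Phi> j y) $ i\<bar> |i. i \<in> UNIV}"
    then obtain i where i: "v = \<bar>\<pi> j i x - \<pi> j i y\<bar>" by (auto simp: \<Phi>_def)
    have "v <= lip_const (\<pi> j i) * dist x y" unfolding i by (rule Lip_abs_le[OF \<pi>(1)])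
    also have "... <= 1 * dist x y" by (intro mult_right_mono \<pi>(2)) simp
    finally show "v <= dist x y" by simp
  qed auto
  moreover have "\<exists>P \<nu>. alberti_representation \<mu> P \<nu> \<and> bilipschitz_representation 1 (1 + \<epsilon>) P \<and> (\<forall>j. in_direction_on (V j) P (\<Phi> j) C)"
    if \<epsilon>: "0 < \<epsilon>" and C: "cone_field C" for \<epsilon> and C :: "'a => (real ^ 'k) set"
  proof -
    obtain w' \<alpha> where w': "w' \<in> borel_measurable borel" "\<And>x. norm (w' x) = 1" and \<alpha>: "\<alpha> \<in> borel_measurable borel" "\<And>x. 0 < \<alpha> x" "\<And>x. \<alpha> x < pi / 2"
      and Cw: "\<And>x. C x = open_cone (w' x) (\<alpha> x)"
      using C unfolding cone_field_def by blast
    define G where "G B \<longleftrightarrow> (\<exists>j. chart_piece \<mu> \<epsilon> (\<pi> j) w' \<alpha> (V j) B)" for B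
    have ex: "\<exists>S\<in>sets \<mu>. S \<subseteq> B \<and> 0 < measure \<mu> S \<and> G S" if B: "B \<in> sets \<mu>" "0 < measure \<mu> B" for B
    proof -
      have Bb: "B \<in> sets borel" using B(1) sets_mu by simp
      have "\<exists>j. 0 < measure \<mu> (B \<inter> V j)"
      proof (rule ccontr)
        assume "\<not> ?thesis"
        then have "measure \<mu> (B \<inter> V j) = 0" for j using measure_nonneg[of \<mu> "B \<inter> V j"] by (metis less_eq_real_def)
        then have "(\<Union>j. B \<inter> V j) \<in> null_sets \<mu>"
          using Bb V(2) by (intro null_sets_UN) (auto simp: null_sets_def \<mu>.emeasure_eq_measure sets_mu)
        moreover have "UNIV - (\<Union>j. V j) \<in> null_sets \<mu>" using V by (simp add: null_sets_def sets_mu)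
        ultimately have "(\<Union>j. B \<inter> V j) \<union> (UNIV - (\<Union>j. V j)) \<in> null_sets \<mu>" by (rule null_sets.Un)
        then have "B \<in> null_sets \<mu>" using B(1) by (rule null_sets_subset) blast
        then show False using B(2) by (simp add: measure_eq_0_null_sets)
      qed
      then obtain j where j: "0 < measure \<mu> (B \<inter> V j)" by blast
      have "\<exists>S1\<in>sets borel. S1 \<subseteq> B \<inter> V j \<and> 0 < measure \<mu> S1 \<and> chart_piece \<mu> \<epsilon> (\<pi> j) w' \<alpha> (V j) S1"
        by (rule piece_in_chart[OF sets_mu finite_mu \<pi>(1) D l \<epsilon> w' \<alpha>]) (use Bb V(2) j in auto)
      then show ?thesis unfolding G_def sets_mu by blast
    qed
    obtain A :: "nat => 'a set" where A: "\<And>i. A i \<in> sets \<mu>" "\<And>i. A i = {} \<or> G (A i)" "emeasure \<mu> (space \<mu> - (\<Union>i. A i)) = 0"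
      by (rule exhaustion[where G = G, OF finite_mu ex]; (rule that)?; assumption)
    have "alberti_piece \<mu> \<Gamma> {}" if "alberti_piece \<mu> \<Gamma> S" for \<Gamma> S
      using that unfolding alberti_piece_def by auto
    then have "G {}" using ex[OF sets.top pos] unfolding G_def chart_piece_def by blast
    then have "\<forall>i. \<exists>j \<Gamma>. compact \<Gamma> \<and> (\<forall>\<gamma>\<in>\<Gamma>. frag_dom \<gamma> \<subseteq> {0..1} \<and> chart_fragment \<epsilon> (\<pi> j) w' \<alpha> (V j) \<gamma>) \<and> alberti_piece \<mu> \<Gamma> (A i)"
      using A(2) unfolding G_def chart_piece_def by metis
    from this[unfolded choice_iff] obtain J \<Gamma> where \<Gamma>: "\<And>i. compact (\<Gamma> i)" "\<And>i. \<forall>\<gamma>\<in>\<Gamma> i. frag_dom \<gamma> \<subseteq> {0..1}" "\<And>i. alberti_piece \<mu> (\<Gamma> i) (A i)"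
      and chart: "\<And>i \<gamma>. \<gamma> \<in> \<Gamma> i ==> chart_fragment \<epsilon> (\<pi> (J i)) w' \<alpha> (V (J i)) \<gamma>" by blast
    have bi: "1 * \<bar>s - t\<bar> <= dist (frag_eval \<gamma> s) (frag_eval \<gamma> t) \<and> dist (frag_eval \<gamma> s) (frag_eval \<gamma> t) <= (1 + \<epsilon>) * \<bar>s - t\<bar>"
      if "\<gamma> \<in> \<Gamma> i" "s \<in> frag_dom \<gamma>" "t \<in> frag_dom \<gamma>" for \<gamma> i s t by (rule chart_fragment_bilipschitz[OF chart[OF that(1)] that(2,3)])
    have "\<exists>P \<nu>. alberti_representation \<mu> P \<nu> \<and> (AE \<gamma> in P. \<gamma> \<in> (\<Union>i. \<Gamma> i))"
    proof (rule alberti_glue[OF sets_mu finite_mu \<Gamma>(3,1,2)])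
      show "A i \<in> sets borel" for i using A(1) sets_mu by simp
      show "emeasure \<mu> (UNIV - (\<Union>i. A i)) = 0" using A(3) by (simp add: sp)
      show "\<bar>s - t\<bar> <= dist (frag_eval \<gamma> s) (frag_eval \<gamma> t)" if "\<gamma> \<in> \<Gamma> i" "s \<in> frag_dom \<gamma>" "t \<in> frag_dom \<gamma>" for \<gamma> i s t
        using bi[OF that] by simp
    qed
    then obtain P \<nu> where P: "alberti_representation \<mu> P \<nu>" "AE \<gamma> in P. \<gamma> \<in> (\<Union>i. \<Gamma> i)" by blast
    have "bilipschitz_representation 1 (1 + \<epsilon>) P"
      unfolding bilipschitz_representation_def using P(2) by (rule eventually_mono) (use bi in blast)
    moreover have "in_direction_on (V j) P (\<Phi> j) C" for j
      unfolding in_direction_on_def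
      using P(2)
    proof (rule eventually_mono)
      fix \<gamma> assume "\<gamma> \<in> (\<Union>i. \<Gamma> i)"
      then obtain i where i: "\<gamma> \<in> \<Gamma> i" by blast
      note dir = chart_fragment_direction[OF chart[OF i] \<pi>(1)]
      show "AE t in lebesgue. t \<in> frag_dom \<gamma> \<and> frag_eval \<gamma> t \<in> V j -->
        (\<exists>u. ((\<Phi> j \<circ> frag_eval \<gamma>) has_vector_derivative u) (at t within frag_dom \<gamma>) \<and> u \<in> C (frag_eval \<gamma> t))"
        using dir(2)
      proof (rule eventually_mono, intro impI)
        fix t
        assume ex: "t \<in> frag_dom \<gamma> --> (\<exists>v. (((\<lambda>x. \<chi> m. \<pi> (J i) m x) \<circ> frag_eval \<gamma>) has_vector_derivative v) (at t within frag_dom \<gamma>) \<and>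
            v \<in> open_cone (w' (frag_eval \<gamma> t)) (\<alpha> (frag_eval \<gamma> t)))" and t: "t \<in> frag_dom \<gamma> \<and> frag_eval \<gamma> t \<in> V j"
        \<comment> \<open>A fragment runs inside the chart it was built for, so meeting
          \<open>V j\<close> identifies its coordinates as \<open>\<pi> j\<close>.\<close>
        have "frag_eval \<gamma> t \<in> V (J i)" using dir(1) t by blast
        then have "J i = j" using V(1) t by (auto simp: disjoint_family_on_def)
        then show "\<exists>u. ((\<Phi> j \<circ> frag_eval \<gamma>) has_vector_derivative u) (at t within frag_dom \<gamma>) \<and> u \<in> C (frag_eval \<gamma> t)"
          using ex t by (simp add: Cw \<Phi>_def[abs_def])
      qed
    qed
    ultimately show ?thesis using P(1) by blast
  qed
  ultimately show "\<exists>(V :: nat => 'a set) (\<pi> :: nat => 'a => real ^ 'k).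
            disjoint_family V \<and> (\<forall>j. V j \<in> sets borel) \<and>
            (\<forall>j x y. infnorm (\<pi> j x - \<pi> j y) <= dist x y) \<and>
            emeasure (mass T) (UNIV - (\<Union>j. V j)) = 0 \<and>
            (\<forall>\<epsilon>>0. \<forall>C :: 'a => (real ^ 'k) set. cone_field C -->
               (\<exists>P \<nu>. alberti_representation (mass T) P \<nu> \<and>
                      bilipschitz_representation 1 (1 + \<epsilon>) P \<and>
                      (\<forall>j. in_direction_on (V j) P (\<pi> j) C)))"
    using V unfolding \<mu>_def[symmetric] by (intro exI[of _ V] exI[of _ \<Phi>] conjI allI impI) simp_all
qed

end
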